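(* (Classification of the non-periodic tilings of $\mathbb{Z}_{144}$.) All subsets of $\mathbb{Z}_{144}$ are counted up to translation. There are collections of non-periodic subsets of $\mathbb{Z}_{144}$ as described in (I)–(IV) below, such that the non-periodic tilings $\mathbb{Z}_{144}=A\oplus B$ (up to translating $A$ and $B$ independently and interchanging $A$ and $B$) are exactly the pairs listed in (I)–(IV). (I) Pairs $(A,B)$ with $A\in T_1$, $B\in T_2$, where $T_1$ consists of 36 sets of cardinality 24, $T_2$ consists of 6 sets of cardinality 6; every $A\in T_1$ has $\mathrm{Cyc}(A)$ equal to $\{2,8,9,16,18,24,72,144\}$ or $\{2,8,9,16,18,72,144\}$, both occurring; every $B\in T_2$ has $\mathrm{Cyc}(B)=\{3,4,6,12,24,36,48\}$. Moreover $\{0,17,20,23,28,29,40,48,53,59,65,68,76,88,89,95,96,101,116,124,125,131,136,137\}\in T_1$ and $\{0,32,58,90,112,122\}\in T_2$. (II) Pairs $(A,B)$ with $A\in T_1'$, $B\in T_2'$, where $T_1'$ consists of 6 sets of cardinality 12, $T_2'$ consists of 324 sets of cardinality 12; every $A\in T_1'$ has $\mathrm{Cyc}(A)=\{4,9,16,18,36,144\}$; every $B\in T_2'$ has $\mathrm{Cyc}(B)$ equal to $\{2,3,6,8,12,18,24,48,72\}$ or $\{2,3,6,8,12,24,48,72\}$, both occurring. Moreover $\{0,34,40,46,48,58,88,96,106,118,130,136\}\in T_1'$ and $\{0,16,29,44,57,73,80,93,108,109,124,137\}\in T_2'$. (III) Pairs $(A,B)$ with $A\in T_1''$, $B\in T_2''$,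 where $T_1''$ consists of 8640 sets of cardinality 24, $T_2''$ consists of 3 sets of cardinality 6; every $A\in T_1''$ has $\mathrm{Cyc}(A)$ equal to $\{2,4,9,12,16,18,36,144\}$, $\{2,4,6,9,16,18,36,144\}$ or $\{2,4,9,16,18,36,144\}$, all three occurring; every $B\in T_2''$ has $\mathrm{Cyc}(B)=\{3,6,8,12,24,48,72\}$. Moreover $\{0,9,17,26,27,34,39,40,48,51,57,65,74,82,88,96,99,105,111,113,122,123,130,136\}\in T_1''$ and $\{0,36,64,80,100,116\}\in T_2''$. (IV) Pairs $(A,B)$ with either $A\in T_1'''$ and $B\in T_2'''\cup S_2$, or $A\in S_1$ and $B\in T_2'''$ (no set in $S_1$ tiles with a set in $S_2$), where all sets have cardinality 12; $T_1'''$ consists of 6 sets with $\mathrm{Cyc}=\{3,4,6,8,12,24,36,48,72\}$; $S_1$ consists of 156 sets with $\mathrm{Cyc}=\{3,4,6,8,12,24,48,72\}$; $T_2'''$ consists of 12 sets with $\mathrm{Cyc}=\{2,9,16,18,36,144\}$; $S_2$ consists of 48 sets with $\mathrm{Cyc}=\{2,9,16,18,144\}$. Moreover $\{0,18,28,44,54,64,80,82,98,108,118,134\}\in T_1'''$, $\{0,16,30,44,58,74,80,94,108,110,124,138\}\in S_1$, $\{0,33,40,45,48,57,88,96,105,117,129,136\}\in T_2'''$, and $\{0,27,30,35,60,72,75,83,102,123,131,132\}\in S_2$.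
   Context: $\mathbb{Z}_{144}=\mathbb{Z}/144\mathbb{Z}$, with elements represented by $0,1,\dots,143$. $\mathbb{Z}_{144}=A\oplus B$ (a tiling) means that every $g\in\mathbb{Z}_{144}$ has a unique representation $g=a+b$ with $a\in A$, $b\in B$; one says that $A$ and $B$ tile with each other. A set $A\subseteq\mathbb{Z}_{144}$ is periodic if $A+g=A$ for some nonzero $g\in\mathbb{Z}_{144}$, and non-periodic otherwise; a tiling $\mathbb{Z}_{144}=A\oplus B$ is non-periodic if both $A$ and $B$ are non-periodic. For $A\subseteq\mathbb{Z}_{144}$, with elements represented in $\{0,\dots,143\}$, put $A(X)=\sum_{a\in A}X^a$ and let $\mathrm{Cyc}(A)$ be the set of divisors $d>1$ of $144$ such that the cyclotomic polynomial $\Phi_d(X)$ divides $A(X)$; this depends only on the translation class of $A$. Counting up to translation means that a set and all its translates are regarded as one set (so "$T$ consists of $n$ sets" means $n$ translation classes, and "the set $E$ belongs to $T$" means that its translation class does). *)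

theory Defs
  imports Complex_Main "HOL-Computational_Algebra.Polynomial" "HOL-Number_Theory.Totient"
begin

text \<open>
  Elements of the cyclic group of order 144 are represented by the residues 0, ..., 143,
  with addition modulo 144.
\<close>

definition Z144 :: "nat set" where
  "Z144 = {0..<144}"

definition translate :: "nat \<Rightarrow> nat set \<Rightarrow> nat set" where
  "translate g A = (\<lambda>a. (a + g) mod 144) ` A"

definition tiling :: "nat set \<Rightarrow> nat set \<Rightarrow> bool" where
  "tiling A B \<longleftrightarrow> A \<subseteq> Z144 \<and> B \<subseteq> Z144 \<and>
     (\<forall>g\<in>Z144. \<exists>!p. p \<in> A \<times> B \<and> g = (fst p + snd p) mod 144)"

definition periodic :: "nat set \<Rightarrow> bool" where
  "periodic A \<longleftrightarrow> (\<exists>g\<in>Z144. g \<noteq> 0 \<and> translate g A = A)"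

definition nonperiodic_tiling :: "nat set \<Rightarrow> nat set \<Rightarrow> bool" where
  "nonperiodic_tiling A B \<longleftrightarrow> tiling A B \<and> \<not> periodic A \<and> \<not> periodic B"

text \<open>
  The \<open>d\<close>-th cyclotomic polynomial, as the product of \<open>X - \<zeta>\<close> over the primitive \<open>d\<close>-th roots of
  unity \<open>\<zeta>\<close>. It is monic with integer coefficients, so it divides an integer polynomial over the
  complex numbers iff it does so over the integers.
\<close>

definition cyclotomic :: "nat \<Rightarrow> complex poly" where
  "cyclotomic d = (\<Prod>k\<in>totatives d. [:- cis (2 * pi * real k / real d), 1:])"

definition mask_poly :: "nat set \<Rightarrow> complex poly" where
  "mask_poly A = (\<Sum>a\<in>A. monom 1 a)"

definition Cyc :: "nat set \<Rightarrow> nat set" where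
  "Cyc A = {d. d dvd 144 \<and> d > 1 \<and> cyclotomic d dvd mask_poly A}"

definition tclass :: "nat set \<Rightarrow> nat set set" where
  "tclass A = {translate g A |g. g \<in> Z144}"

text \<open>
  \<open>T\<close> is a collection of \<open>n\<close> non-periodic sets up to translation (that is, of \<open>n\<close> translation
  classes), all of cardinality \<open>m\<close>, and \<open>K\<close> is the set of the values of \<open>Cyc\<close> on \<open>T\<close>:
  every value lies in \<open>K\<close>, and every member of \<open>K\<close> occurs.
\<close>

definition collection :: "nat set set set \<Rightarrow> nat \<Rightarrow> nat \<Rightarrow> nat set set \<Rightarrow> bool" where
  "collection T n m K \<longleftrightarrow>
     T \<subseteq> tclass ` {A. A \<subseteq> Z144 \<and> \<not> periodic A} \<and> finite T \<and> card T = n \<and>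
     (\<forall>C\<in>T. \<forall>A\<in>C. card A = m \<and> Cyc A \<in> K) \<and>
     (\<forall>D\<in>K. \<exists>C\<in>T. \<exists>A\<in>C. Cyc A = D)"

end

theory Submission
  imports Defs "HOL-Number_Theory.Cong" "HOL-Computational_Algebra.Primes" "HOL-Library.FuncSet"
begin

text \<open>
  Call the pair of levels of \<open>a - b\<close> at the primes 2 and 3 its difference class. Counting the
  representations in a product of mask polynomials and raising one of them to a prime power modulo the prime
  (Tijdeman) shows that \<open>A\<close> may be replaced by \<open>tA\<close> for every \<open>t\<close> prime to \<open>|A|\<close>; hence
  \<open>A\<close> and \<open>B\<close> tile iff \<open>|A| |B| = 144\<close> and no nonzero difference of \<open>A\<close> has the class of a
  difference of \<open>B\<close>. For each divisor \<open>d > 1\<close> of 144 the polynomial \<open>\<Phi>\<^sub>d\<close> divides one of the two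
  mask polynomials, and \<open>\<Phi>\<^sub>d\<close> with \<open>6 | d\<close> divides that of \<open>A\<close> iff the number \<open>c n\<close> of elements of \<open>A\<close>
  congruent to \<open>n\<close> modulo \<open>d\<close> satisfies \<open>c n + c (n + d/2 + d/3) = c (n + d/2) + c (n + d/3)\<close>. In
  a non-periodic tiling these relations force 6 to divide both cardinalities, one factor to be of
  one parity, and then one of them to be a grid (relation \<open>RG M W\<close>) or a union of two grids, while
  the other satisfies the complementary relation \<open>RC M W\<close>. Both kinds of sets can be counted
  residue class by residue class, and their values of \<open>Cyc\<close> follow from the relations above.
\<close>

section \<open>Cyclotomic divisors and residue counts\<close>

text \<open>One family has 1244160 members, so the structure has to be derived and the counts
  obtained as products; explicit computation is confined to samples and residue checks.
  Non-periodicity enters in one form only: every nonzero subgroup contains 48 or 72, so a set is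
  non-periodic iff neither shift preserves it. If \<Phi>_144 divides a mask polynomial, the 0-1
  values at n, n + 48, n + 72, n + 120 split the set into a part invariant under 72 and a part
  invariant under 48; adding order 48 or 72 gives splittings with larger cosets. The sets met here
  have 6 or 12 elements, and equations such as 2x + 3y = 6, 2x + 9y = 12 or 4x + 3y = 12 then leave
  one part only. So the proof turns on which factor receives the orders 144, 48 and 72, and finally
  9; a factor of one parity is what allows the other one to be cut into halves of this size. The
  two-fold nature of (IV) arises because two grids in the classes modulo 4 of one parity may or may
  not have the same residues modulo 9, which is visible in \<Phi>_36.\<close>

definition mem :: "nat set \<Rightarrow> nat \<Rightarrow> bool" where
  "mem A n \<longleftrightarrow> n mod 144 \<in> A"

text \<open>Only one inclusion is asked for: on a finite set closure under adding g already gives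
  invariance, see \<open>translate_closed\<close>. Residues enter through \<open>mem\<close>, so
  shifts can be written without reduction modulo 144.\<close>

definition stable :: "nat \<Rightarrow> nat set \<Rightarrow> bool" where
  "stable g A \<longleftrightarrow> (\<forall>n. mem A n \<longrightarrow> mem A (n + g))"

definition cnt :: "nat set \<Rightarrow> nat \<Rightarrow> nat \<Rightarrow> nat" where
  "cnt A d n = card {a\<in>A. a mod d = n mod d}"

definition hat :: "nat set \<Rightarrow> complex \<Rightarrow> complex" where
  "hat A z = (\<Sum>a\<in>A. z ^ a)"

text \<open>For d > 0 this says that z has multiplicative order exactly d;
  \<open>prim_iff_cis\<close> links it to the roots in the product defining
  \<open>cyclotomic\<close>.\<close>

definition prim :: "nat \<Rightarrow> complex \<Rightarrow> bool" where
  "prim d z \<longleftrightarrow> z ^ d = 1 \<and> (\<forall>k. z ^ k = 1 \<longrightarrow> d dvd k)"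

lemma prod_linear_dvd_iff:
  fixes f :: "'a \<Rightarrow> complex"
  assumes "finite K" "inj_on f K"
  shows "(\<Prod>k\<in>K. [:- f k, 1:]) dvd p \<longleftrightarrow> (\<forall>k\<in>K. poly p (f k) = 0)"
  using assms
proof (induction K arbitrary: p rule: finite_induct)
  case empty
  then show ?case by simp
next
  case (insert k K)
  have inj: "inj_on f K" and neq: "\<And>j. j \<in> K \<Longrightarrow> f j \<noteq> f k"
    using insert.prems insert.hyps by (auto simp: image_iff)
  show ?case
  proof (cases "poly p (f k) = 0")
    case False
    then have "\<not> [:- f k, 1:] dvd p" by (simp add: poly_eq_0_iff_dvd)
    then show ?thesis using False insert.hyps by (auto dest: dvd_mult_left)
  next
    case True
    then obtain q where p: "p = [:- f k, 1:] * q"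
      by (auto simp: poly_eq_0_iff_dvd)
    have "(\<Prod>k\<in>insert k K. [:- f k, 1:]) dvd p \<longleftrightarrow> (\<Prod>k\<in>K. [:- f k, 1:]) dvd q"
      unfolding p prod.insert[OF insert.hyps] by (rule dvd_mult_cancel_left[THEN trans]) simp
    also have "\<dots> \<longleftrightarrow> (\<forall>j\<in>K. poly q (f j) = 0)"
      using insert.IH[OF inj] .
    also have "\<dots> \<longleftrightarrow> (\<forall>j\<in>insert k K. poly p (f j) = 0)"
      using neq by (auto simp: p)
    finally show ?thesis .
  qed
qed

lemma cis_mod:
  assumes "d > 0"
  shows "cis (2 * pi * real (a mod d) / real d) = cis (2 * pi * real a / real d)"
proof -
  have "real a = real d * real (a div d) + real (a mod d)"
    by (metis mult_div_mod_eq of_nat_add of_nat_mult)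
  then have "2 * pi * real a / real d = 2 * pi * real (a div d) + 2 * pi * real (a mod d) / real d"
    using assms by (simp add: field_simps)
  then show ?thesis by (simp add: cis_mult[symmetric])
qed

lemma cis_eq_1_iff:
  assumes "d > 0"
  shows "cis (2 * pi * real a / real d) = 1 \<longleftrightarrow> d dvd a"
proof -
  have "inj_on (\<lambda>k. cis (2 * pi * real k / real d)) {..<d}"
    using bij_betw_roots_unity[OF assms] by (auto simp: bij_betw_def)
  then have "cis (2 * pi * real (a mod d) / real d) = cis (2 * pi * real 0 / real d) \<longleftrightarrow> a mod d = 0"
    using assms by (subst inj_on_eq_iff) auto
  then show ?thesis using cis_mod[OF assms, of a] by (simp add: dvd_eq_mod_eq_0)
qed

lemma prim_iff_cis:
  assumes "d > 1"
  shows "prim d z \<longleftrightarrow> (\<exists>k\<in>totatives d. z = cis (2 * pi * real k / real d))"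
proof
  assume p: "prim d z"
  then have "z ^ d = 1" by (simp add: prim_def)
  then have "z \<in> (\<lambda>k. cis (2 * pi * real k / real d)) ` {..<d}"
    using bij_betw_roots_unity[of d] assms by (auto simp: bij_betw_def)
  then obtain k where k: "k < d" "z = cis (2 * pi * real k / real d)" by auto
  have pow: "z ^ m = cis (2 * pi * real (k * m) / real d)" for m
    by (simp add: k DeMoivre mult_ac)
  define g where "g = gcd k d"
  have g: "g > 0" using assms by (simp add: g_def)
  have "d dvd k * (d div g)"
    by (metis div_mult_swap dvd_div_mult dvd_triv_right g_def gcd_dvd1 gcd_dvd2 mult.commute)
  then have "z ^ (d div g) = 1"
    unfolding pow using cis_eq_1_iff[of d "k * (d div g)"] assms by simp
  then have "d dvd d div g" using p by (simp add: prim_def)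
  then have "g = 1" using g assms
    by (metis One_nat_def dvd_div_eq_0_iff dvd_imp_le g_def gcd_dvd2 div_less_dividend
        le_less_trans less_irrefl nat_less_le not_less_eq Suc_lessI bot_nat_0.not_eq_extremum less_nat_zero_code)
  then have "coprime k d" by (simp add: g_def coprime_iff_gcd_eq_1)
  moreover have "k > 0" using \<open>coprime k d\<close> assms by (cases k) auto
  ultimately show "\<exists>k\<in>totatives d. z = cis (2 * pi * real k / real d)"
    using k by (auto simp: totatives_def)
next
  assume "\<exists>k\<in>totatives d. z = cis (2 * pi * real k / real d)"
  then obtain k where k: "coprime k d" "z = cis (2 * pi * real k / real d)"
    by (auto simp: totatives_def)
  have pow: "z ^ m = cis (2 * pi * real (k * m) / real d)" for m
    by (simp add: k DeMoivre mult_ac)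
  have "z ^ m = 1 \<longleftrightarrow> d dvd m" for m
    unfolding pow using cis_eq_1_iff[of d "k * m"] assms k
    by (simp add: coprime_commute coprime_dvd_mult_right_iff)
  then show "prim d z" by (simp add: prim_def)
qed

text \<open>The roots of \<open>cyclotomic d\<close> are simple, so divisibility amounts to
  vanishing at each of them; from here on polynomials are replaced by the values
  \<open>hat A z\<close>.\<close>

lemma Cyc_iff: "d \<in> Cyc A \<longleftrightarrow> d dvd 144 \<and> d > 1 \<and> (\<forall>z. prim d z \<longrightarrow> hat A z = 0)"
proof (cases "d > 1")
  case True
  have "inj_on (\<lambda>k. cis (2 * pi * real k / real d)) (totatives d)"
  proof (rule inj_on_subset)
    show "inj_on (\<lambda>k. cis (2 * pi * real k / real d)) {..<d}"
      using bij_betw_roots_unity[of d] True by (auto simp: bij_betw_def)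
    show "totatives d \<subseteq> {..<d}"
      using True totatives_less by auto
  qed
  then have "cyclotomic d dvd mask_poly A \<longleftrightarrow>
      (\<forall>k\<in>totatives d. poly (mask_poly A) (cis (2 * pi * real k / real d)) = 0)"
    unfolding cyclotomic_def by (intro prod_linear_dvd_iff) auto
  moreover have "poly (mask_poly A) z = hat A z" for z
    by (simp add: mask_poly_def hat_def poly_sum poly_monom)
  ultimately show ?thesis using prim_iff_cis[OF True] True
    by (auto simp: Cyc_def)
qed (auto simp: Cyc_def)

lemma ex_prim:
  fixes z :: complex
  assumes "z ^ m = 1" "m > 0"
  obtains d where "d dvd m" "d > 0" "prim d z"
proof -
  define d where "d = (LEAST k. k > 0 \<and> z ^ k = 1)"
  have d: "d > 0 \<and> z ^ d = 1"
    unfolding d_def by (rule LeastI[of _ m]) (use assms in auto)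
  have "d dvd k" if "z ^ k = 1" for k
  proof (rule ccontr)
    assume nd: "\<not> d dvd k"
    have "z ^ k = (z ^ d) ^ (k div d) * z ^ (k mod d)"
      by (metis mult_div_mod_eq power_add power_mult)
    then have "z ^ (k mod d) = 1" using that d by simp
    moreover have "0 < k mod d" using nd by (simp add: dvd_eq_mod_eq_0)
    ultimately have "d \<le> k mod d"
      unfolding d_def by (intro Least_le) auto
    then show False using d by (meson mod_less_divisor not_less)
  qed
  then have "prim d z" using d by (simp add: prim_def)
  then show ?thesis using that d assms by (auto simp: prim_def)
qed

lemma prim_power_iff: "prim d z \<Longrightarrow> z ^ k = 1 \<longleftrightarrow> d dvd k"
  by (auto simp: prim_def power_mult dvd_def)

text \<open>The powers of z with exponent below d are d distinct d-th roots of unity, hence all of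
  them; comparing orders then makes the exponent prime to d.\<close>

lemma prim_ex_power:
  assumes z: "prim d z" and w: "prim d w" and d: "d > 0"
  obtains t where "coprime t d" "w = z ^ t"
proof -
  have z0: "z \<noteq> 0" using z d by (auto simp: prim_def power_0_left)
  have "inj_on (\<lambda>i. z ^ i) {..<d}"
  proof (rule linorder_inj_onI)
    fix i j assume ij: "i < j" "i \<in> {..<d}" "j \<in> {..<d}"
    show "z ^ i \<noteq> z ^ j"
    proof
      assume "z ^ i = z ^ j"
      then have "z ^ i * z ^ (j - i) = z ^ i * 1" using ij
        by (metis le_add_diff_inverse less_imp_le mult_1_right power_add)
      then have "z ^ (j - i) = 1" using z0 by auto
      then have "d dvd j - i" using z by (simp add: prim_def)
      then show False using ij by (auto dest: dvd_imp_le)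
    qed
  qed auto
  then have "card ((\<lambda>i. z ^ i) ` {..<d}) = card {w::complex. w ^ d = 1}"
    using card_roots_unity_eq[OF d] by (simp add: card_image)
  moreover have "(\<lambda>i. z ^ i) ` {..<d} \<subseteq> {w. w ^ d = 1}"
    using z by (auto simp: prim_def power_mult[symmetric] mult.commute[of _ d])
      (simp add: power_mult)
  ultimately have "(\<lambda>i. z ^ i) ` {..<d} = {w. w ^ d = 1}"
    using finite_roots_unity[of d] d by (intro card_subset_eq) auto
  moreover have "w ^ d = 1" using w by (simp add: prim_def)
  ultimately obtain t where t: "w = z ^ t" by blast
  define g where "g = gcd t d"
  have g: "g > 0" "g dvd t" "g dvd d" using d by (auto simp: g_def)
  have "d dvd t * (d div g)"
    using g by (metis div_mult_swap dvd_div_mult dvd_triv_right mult.commute)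
  then have "w ^ (d div g) = 1"
    unfolding t power_mult[symmetric] prim_power_iff[OF z] .
  then have "d dvd d div g" using w by (simp add: prim_def)
  then have "d \<le> d div g" using d g by (intro dvd_imp_le) (auto elim: dvdE)
  then have "g \<le> 1"
    by (metis d div_less_dividend not_le)
  then have "g = 1" using g by simp
  then have "coprime t d" by (simp add: g_def coprime_iff_gcd_eq_1)
  then show ?thesis using t that by blast
qed

lemma power_mod_cong:
  fixes z :: complex
  assumes "z ^ d = 1"
  shows "z ^ (n mod d) = z ^ n"
  by (metis assms mod_mult_div_eq mult_1_right power_add power_mult power_one)

text \<open>A polynomial of degree less than \<open>d\<close> that vanishes at all \<open>d\<close>-th roots of unity is zero;
  this replaces Fourier inversion.\<close>

lemma coeffs_zero_of_roots_unity:
  fixes g :: "nat \<Rightarrow> complex"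
  assumes d: "d > 0" and z: "\<And>z. z ^ d = 1 \<Longrightarrow> (\<Sum>n<d. g n * z ^ n) = 0" and n: "n < d"
  shows "g n = 0"
proof -
  define p where "p = (\<Sum>n<d. monom (g n) n)"
  have ev: "poly p z = (\<Sum>n<d. g n * z ^ n)" for z
    by (simp add: p_def poly_sum poly_monom)
  have co: "coeff p n = g n" if "n < d" for n
    using that by (simp add: p_def coeff_sum)
  have deg: "degree p < d"
  proof (cases "p = 0")
    case False
    have "\<And>n. n \<ge> d \<Longrightarrow> coeff p n = 0" by (simp add: p_def coeff_sum)
    then show ?thesis using False by (metis leading_coeff_neq_0 not_le)
  qed (use d in simp)
  have "p = 0"
  proof (rule ccontr)
    assume p: "p \<noteq> 0"
    have "card {z::complex. z ^ d = 1} \<le> card {z. poly p z = 0}"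
      by (rule card_mono[OF poly_roots_finite[OF p]]) (use z in \<open>auto simp: ev\<close>)
    also have "\<dots> \<le> degree p" using p by (rule card_poly_roots_bound)
    finally show False using deg card_roots_unity_eq[OF d] by simp
  qed
  then show ?thesis using co[OF n] by simp
qed

section \<open>Residue counts and their mixed differences\<close>

lemma sum_shift_periodic:
  fixes g :: "nat \<Rightarrow> complex"
  assumes "\<And>n. g (n mod d) = g n" "z ^ d = 1" "d > 0"
  shows "(\<Sum>n<d. g (n + s) * z ^ n) * z ^ s = (\<Sum>n<d. g n * z ^ n)"
proof -
  have "(\<Sum>n<d. g (n + s) * z ^ n) * z ^ s = (\<Sum>n<d. g (n + s) * z ^ (n + s))"
    by (simp add: sum_distrib_right power_add mult.assoc)
  also have "\<dots> = (\<Sum>n<d. g ((n + s) mod d) * z ^ ((n + s) mod d))"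
    using assms power_mod_cong[OF assms(2)] by simp
  also have "\<dots> = (\<Sum>n<d. g n * z ^ n)"
  proof (rule sum.reindex_bij_betw[of "\<lambda>n. (n + s) mod d" "{..<d}" "{..<d}" "\<lambda>n. g n * z ^ n"])
    have inj: "inj_on (\<lambda>n. (n + s) mod d) {..<d}"
    proof (rule inj_onI)
      fix x y assume "x \<in> {..<d}" "y \<in> {..<d}" "(x + s) mod d = (y + s) mod d"
      then show "x = y"
        using cong_add_rcancel_nat[of x s y d] by (simp add: cong_def)
    qed
    moreover have "(\<lambda>n. (n + s) mod d) ` {..<d} \<subseteq> {..<d}" using assms by auto
    ultimately show "bij_betw (\<lambda>n. (n + s) mod d) {..<d} {..<d}"
      by (simp add: bij_betw_def endo_inj_surj)
  qed
  finally show ?thesis .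
qed

lemma hat_eq_cnt:
  assumes "finite A" "z ^ d = 1" "d > 0"
  shows "hat A z = (\<Sum>n<d. of_nat (cnt A d n) * z ^ n)"
proof -
  have "hat A z = (\<Sum>n<d. \<Sum>a\<in>{a\<in>A. a mod d = n}. z ^ a)"
    unfolding hat_def using assms by (subst sum.group[where T="{..<d}"]) auto
  also have "\<dots> = (\<Sum>n<d. \<Sum>a\<in>{a\<in>A. a mod d = n}. z ^ n)"
    using power_mod_cong[OF assms(2)] by (intro sum.cong) auto
  also have "\<dots> = (\<Sum>n<d. of_nat (cnt A d n) * z ^ n)"
    by (intro sum.cong) (auto simp: cnt_def)
  finally show ?thesis .
qed

text \<open>A mixed second difference of residue counts with steps s and t. Its transform carries
  the factor (z^s - 1)(z^t - 1), so the steps decide at which roots anything has to be known about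
  A.\<close>

definition dd :: "nat set \<Rightarrow> nat \<Rightarrow> nat \<Rightarrow> nat \<Rightarrow> nat \<Rightarrow> int" where
  "dd A m s t n = int (cnt A m n) - int (cnt A m (n + s)) - int (cnt A m (n + t))
     + int (cnt A m (n + s + t))"

lemma cnt_mod [simp]: "cnt A m (n mod m) = cnt A m n"
  by (simp add: cnt_def)

lemma cnt_mod_add: "cnt A m (n mod m + s) = cnt A m (n + s)"
  by (simp add: cnt_def mod_add_left_eq)

lemma dd_mod: "dd A m s t (n mod m) = dd A m s t n"
  unfolding dd_def by (simp add: cnt_mod_add add.assoc)

text \<open>The factor z^(s + t) on the left makes up for the shifts in \<open>dd\<close> going
  forward.\<close>

lemma hat_dd:
  assumes "finite A" "z ^ m = 1" "m > 0"
  shows "(\<Sum>n<m. of_int (dd A m s t n) * z ^ n) * z ^ (s + t) = (z ^ s - 1) * (z ^ t - 1) * hat A z"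
proof -
  define c where "c = (\<lambda>n. complex_of_nat (cnt A m n))"
  define S where "S = (\<lambda>k. \<Sum>n<m. c (n + k) * z ^ n)"
  have per: "\<And>n. c (n mod m) = c n" by (simp add: c_def)
  have S: "S k * z ^ k = hat A z" for k
    unfolding S_def hat_eq_cnt[OF assms] using sum_shift_periodic[of c, OF per assms(2,3)] by (simp add: c_def)
  have "(\<Sum>n<m. of_int (dd A m s t n) * z ^ n) = S 0 - S s - S t + S (s + t)"
    by (simp add: S_def dd_def c_def algebra_simps sum.distrib sum_subtractf)
  then have "(\<Sum>n<m. of_int (dd A m s t n) * z ^ n) * z ^ (s + t)
      = S 0 * z ^ 0 * z ^ (s + t) - (S s * z ^ s) * z ^ t - (S t * z ^ t) * z ^ s + S (s + t) * z ^ (s + t)"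
    by (simp only:) (simp add: algebra_simps power_add)
  then show ?thesis unfolding S by (simp add: algebra_simps power_add)
qed

text \<open>At a root of order d either d divides a step, and z^s - 1 or z^t - 1 vanishes, or
  \<open>hat A\<close> does. So the transform of the difference vanishes at all m-th roots of
  unity.\<close>

lemma dd_eq_0:
  assumes A: "finite A" and m: "m dvd 144"
    and Cyc: "\<And>d. d dvd m \<Longrightarrow> \<not> d dvd s \<Longrightarrow> \<not> d dvd t \<Longrightarrow> d \<in> Cyc A"
  shows "dd A m s t n = 0"
proof -
  have m0: "m > 0" using m by (auto intro: Nat.gr0I)
  have *: "(\<Sum>n<m. of_int (dd A m s t n) * z ^ n) = 0" if z: "z ^ m = 1" for z :: complex
  proof -
    have z0: "z \<noteq> 0" using z m0 by (auto simp: power_0_left)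
    obtain d where d: "d dvd m" "d > 0" "prim d z" using ex_prim[OF z m0] by blast
    have "(z ^ s - 1) * (z ^ t - 1) * hat A z = 0"
    proof (cases "d dvd s \<or> d dvd t")
      case True
      then show ?thesis using prim_power_iff[OF d(3)] by auto
    next
      case False
      then have "d \<in> Cyc A" using Cyc d by blast
      then show ?thesis using d by (simp add: Cyc_iff)
    qed
    then show ?thesis using hat_dd[OF A z m0, of s t] z0
      by (metis divisors_zero power_not_zero)
  qed
  have "complex_of_int (dd A m s t (n mod m)) = 0"
    using coeffs_zero_of_roots_unity[of m "\<lambda>n. of_int (dd A m s t n)" "n mod m", OF m0 *] m0 by simp
  then show ?thesis by (simp add: dd_mod)
qed

lemma Cyc_dd:
  assumes "finite A" "d \<in> Cyc A" "\<And>k. k dvd d \<Longrightarrow> \<not> k dvd s \<Longrightarrow> \<not> k dvd t \<Longrightarrow> k = d"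
  shows "dd A d s t n = 0"
  using assms by (intro dd_eq_0) (auto simp: Cyc_iff)

text \<open>The converse at a single order: neither of the two step factors vanishes at a primitive
  d-th root, so \<open>hat A\<close> must.\<close>

lemma dd_Cyc:
  assumes "finite A" "d dvd 144" "d > 1" "\<not> d dvd s" "\<not> d dvd t" "\<And>n. n < d \<Longrightarrow> dd A d s t n = 0"
  shows "d \<in> Cyc A"
proof -
  have "hat A z = 0" if z: "prim d z" for z
  proof -
    have zd: "z ^ d = 1" using z by (simp add: prim_def)
    have "(z ^ s - 1) * (z ^ t - 1) * hat A z = 0"
      using hat_dd[OF assms(1) zd, of s t] assms by simp
    then show ?thesis using prim_power_iff[OF z] assms by simp
  qed
  then show ?thesis using assms by (simp add: Cyc_iff)
qed

section \<open>Tilings and multiplication\<close>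

lemma tiling_subset: "tiling A B \<Longrightarrow> A \<subseteq> Z144 \<and> B \<subseteq> Z144"
  by (simp add: tiling_def)

lemma finite_Z144 [simp]: "finite Z144" by (simp add: Z144_def)

lemma finite_sub_Z144: "A \<subseteq> Z144 \<Longrightarrow> finite A"
  using finite_subset[OF _ finite_Z144] .

lemma tiling_finite: "tiling A B \<Longrightarrow> finite A \<and> finite B"
  by (simp add: tiling_def finite_sub_Z144)

lemma tiling_bij:
  "tiling A B \<longleftrightarrow> A \<subseteq> Z144 \<and> B \<subseteq> Z144 \<and> bij_betw (\<lambda>p. (fst p + snd p) mod 144) (A \<times> B) Z144"
proof -
  let ?f = "\<lambda>p. (fst p + snd p) mod 144 :: nat"
  have sub: "?f p \<in> Z144" for p by (simp add: Z144_def)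
  have "(\<forall>g\<in>Z144. \<exists>!p. p \<in> A \<times> B \<and> g = ?f p) \<longleftrightarrow> inj_on ?f (A \<times> B) \<and> ?f ` (A \<times> B) = Z144"
  proof
    assume *: "\<forall>g\<in>Z144. \<exists>!p. p \<in> A \<times> B \<and> g = ?f p"
    have "inj_on ?f (A \<times> B)"
    proof (rule inj_onI)
      fix p q assume pq: "p \<in> A \<times> B" "q \<in> A \<times> B" "?f p = ?f q"
      have "\<exists>!r. r \<in> A \<times> B \<and> ?f p = ?f r" using * sub[of p] by (rule bspec)
      then show "p = q" using pq by blast
    qed
    moreover have "?f ` (A \<times> B) = Z144"
    proof
      show "?f ` (A \<times> B) \<subseteq> Z144" using sub by (rule image_subsetI)
      show "Z144 \<subseteq> ?f ` (A \<times> B)"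
      proof
        fix g assume "g \<in> Z144"
        then obtain p where "p \<in> A \<times> B" "g = ?f p" using * by (meson ex1_implies_ex)
        then show "g \<in> ?f ` (A \<times> B)" by (rule rev_image_eqI)
      qed
    qed
    ultimately show "inj_on ?f (A \<times> B) \<and> ?f ` (A \<times> B) = Z144" ..
  next
    assume *: "inj_on ?f (A \<times> B) \<and> ?f ` (A \<times> B) = Z144"
    show "\<forall>g\<in>Z144. \<exists>!p. p \<in> A \<times> B \<and> g = ?f p"
    proof
      fix g assume "g \<in> Z144"
      then have "g \<in> ?f ` (A \<times> B)" using * by simp
      then obtain p where p: "p \<in> A \<times> B" "g = ?f p" by (rule imageE)
      show "\<exists>!p. p \<in> A \<times> B \<and> g = ?f p"
      proof (rule ex1I[of _ p])
        fix q assume "q \<in> A \<times> B \<and> g = ?f q"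
        then show "q = p" using * p inj_onD[of ?f "A \<times> B" q p] by metis
      qed (use p in simp)
    qed
  qed
  then show ?thesis by (simp add: tiling_def bij_betw_def)
qed

lemma tiling_inj:
  assumes "tiling A B" "a \<in> A" "a' \<in> A" "b \<in> B" "b' \<in> B" "(a + b) mod 144 = (a' + b') mod 144"
  shows "a = a' \<and> b = b'"
proof -
  have "inj_on (\<lambda>p. (fst p + snd p) mod 144) (A \<times> B)"
    using assms(1) by (simp add: tiling_bij bij_betw_def)
  from inj_onD[OF this, of "(a, b)" "(a', b')"] show ?thesis using assms by simp
qed

lemma tiling_surj:
  assumes "tiling A B"
  obtains a b where "a \<in> A" "b \<in> B" "g mod 144 = (a + b) mod 144"
proof -
  have "g mod 144 \<in> Z144" by (simp add: Z144_def)
  then have "\<exists>p. p \<in> A \<times> B \<and> g mod 144 = (fst p + snd p) mod 144"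
    using assms unfolding tiling_def by (meson ex1_implies_ex)
  then show ?thesis using that by auto
qed

lemma tiling_card: "tiling A B \<Longrightarrow> card A * card B = 144"
  unfolding tiling_bij by (auto dest!: bij_betw_same_card simp: card_cartesian_product Z144_def)

lemma tilingI_card:
  assumes "A \<subseteq> Z144" "B \<subseteq> Z144" "card A * card B = 144"
    and "\<And>a a' b b'. a \<in> A \<Longrightarrow> a' \<in> A \<Longrightarrow> b \<in> B \<Longrightarrow> b' \<in> B \<Longrightarrow> (a + b) mod 144 = (a' + b') mod 144 \<Longrightarrow> a = a' \<and> b = b'"
  shows "tiling A B"
proof -
  let ?f = "\<lambda>p. (fst p + snd p) mod 144 :: nat"
  have inj: "inj_on ?f (A \<times> B)"
    unfolding inj_on_def using assms(4) by (metis mem_Times_iff prod.collapse)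
  have "?f ` (A \<times> B) \<subseteq> Z144" by (auto simp: Z144_def)
  moreover have "card (?f ` (A \<times> B)) = card Z144"
    using assms(3) by (simp add: card_image[OF inj] card_cartesian_product Z144_def)
  ultimately have "?f ` (A \<times> B) = Z144" by (intro card_subset_eq) auto
  then show ?thesis using assms inj by (simp add: tiling_bij bij_betw_def)
qed

lemma tilingI_surj:
  assumes "A \<subseteq> Z144" "B \<subseteq> Z144" "card A * card B = 144"
    and "\<And>g. g < 144 \<Longrightarrow> \<exists>a\<in>A. \<exists>b\<in>B. (a + b) mod 144 = g"
  shows "tiling A B"
proof -
  let ?f = "\<lambda>p. (fst p + snd p) mod 144 :: nat"
  have fin: "finite (A \<times> B)" using assms finite_sub_Z144 by blast
  have im: "?f ` (A \<times> B) = Z144"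
    using assms(4) by (fastforce simp: Z144_def image_iff)
  then have "inj_on ?f (A \<times> B)"
    using assms(3) fin by (intro eq_card_imp_inj_on) (auto simp: card_cartesian_product Z144_def)
  then show ?thesis using assms im by (simp add: tiling_bij bij_betw_def)
qed

lemma tilingI:
  assumes "A \<subseteq> Z144" "B \<subseteq> Z144"
    and inj: "\<And>a a' b b'. a \<in> A \<Longrightarrow> a' \<in> A \<Longrightarrow> b \<in> B \<Longrightarrow> b' \<in> B \<Longrightarrow> (a + b) mod 144 = (a' + b') mod 144 \<Longrightarrow> a = a' \<and> b = b'"
    and surj: "\<And>g. g < 144 \<Longrightarrow> \<exists>a\<in>A. \<exists>b\<in>B. (a + b) mod 144 = g"
  shows "tiling A B"
proof -
  let ?f = "\<lambda>p. (fst p + snd p) mod 144 :: nat"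
  have "inj_on ?f (A \<times> B)"
    unfolding inj_on_def using inj by (metis mem_Times_iff prod.collapse)
  moreover have "?f ` (A \<times> B) = Z144"
    using surj by (fastforce simp: Z144_def image_iff)
  ultimately show ?thesis using assms by (simp add: tiling_bij bij_betw_def)
qed

lemma tiling_commute: "tiling A B \<longleftrightarrow> tiling B A"
proof -
  have "tiling B A" if "tiling A B" for A B
  proof (rule tilingI)
    show "B \<subseteq> Z144" "A \<subseteq> Z144" using that tiling_subset by auto
    show "a = a' \<and> b = b'" if "a \<in> B" "a' \<in> B" "b \<in> A" "b' \<in> A" "(a + b) mod 144 = (a' + b') mod 144" for a a' b b'
      using tiling_inj[OF \<open>tiling A B\<close>, of b b' a a'] that by (simp add: add.commute)
    show "\<exists>a\<in>B. \<exists>b\<in>A. (a + b) mod 144 = g" if "g < 144" for g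
      using tiling_surj[OF \<open>tiling A B\<close>, of g] that by (metis add.commute mod_less)
  qed
  then show ?thesis by blast
qed

section \<open>Replacing one factor by a multiple\<close>

lemma hat_tiling:
  assumes "tiling A B" "z ^ 144 = 1" "z \<noteq> 1"
  shows "hat A z * hat B z = 0"
proof -
  have "hat A z * hat B z = (\<Sum>p\<in>A\<times>B. z ^ (fst p + snd p))"
    by (simp add: hat_def sum_product sum.cartesian_product power_add split_def)
  also have "\<dots> = (\<Sum>p\<in>A\<times>B. z ^ ((fst p + snd p) mod 144))"
    by (simp add: power_mod_cong[OF assms(2)])
  also have "\<dots> = (\<Sum>n\<in>Z144. z ^ n)"
    using assms(1) unfolding tiling_bij by (auto intro: sum.reindex_bij_betw)
  also have "\<dots> = (z ^ 144 - 1) / (z - 1)"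
    using geometric_sum[OF assms(3), of 144] by (simp add: Z144_def lessThan_atLeast0)
  finally show ?thesis using assms by simp
qed

text \<open>Functions given on the 144-th roots of unity by integer combinations of powers: the ring
  \<open>\<int>[X]/(X\<^sup>144 - 1)\<close> seen through its evaluations.\<close>

definition iperiodic :: "(complex \<Rightarrow> complex) \<Rightarrow> bool" where
  "iperiodic f \<longleftrightarrow> (\<exists>c :: nat \<Rightarrow> int. \<forall>z. z ^ 144 = 1 \<longrightarrow> f z = (\<Sum>n<144. of_int (c n) * z ^ n))"

lemma iperiodic_power: "iperiodic (\<lambda>z. z ^ k)"
proof -
  have "z ^ k = (\<Sum>n<144. of_int (if n = k mod 144 then 1 else 0) * z ^ n)" if "z ^ 144 = 1" for z :: complex
  proof -
    have "(\<Sum>n<144. of_int (if n = k mod 144 then 1 else 0) * z ^ n) = (\<Sum>n<144. if n = k mod 144 then z ^ n else 0)"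
      by (intro sum.cong) auto
    also have "\<dots> = z ^ (k mod 144)" by (subst sum.delta) auto
    finally show ?thesis using power_mod_cong[OF that] by simp
  qed
  then show ?thesis unfolding iperiodic_def
    by (intro exI[of _ "\<lambda>n. if n = k mod 144 then 1 else 0"]) simp
qed

lemma iperiodic_add: "iperiodic f \<Longrightarrow> iperiodic g \<Longrightarrow> iperiodic (\<lambda>z. f z + g z)"
  unfolding iperiodic_def
proof (elim exE)
  fix c d :: "nat \<Rightarrow> int"
  assume "\<forall>z. z ^ 144 = 1 \<longrightarrow> f z = (\<Sum>n<144. of_int (c n) * z ^ n)"
    "\<forall>z. z ^ 144 = 1 \<longrightarrow> g z = (\<Sum>n<144. of_int (d n) * z ^ n)"
  then show "\<exists>c :: nat \<Rightarrow> int. \<forall>z. z ^ 144 = 1 \<longrightarrow> f z + g z = (\<Sum>n<144. of_int (c n) * z ^ n)"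
    by (intro exI[of _ "\<lambda>n. c n + d n"]) (simp add: algebra_simps sum.distrib)
qed

lemma iperiodic_scale: "iperiodic f \<Longrightarrow> iperiodic (\<lambda>z. of_int m * f z)"
  unfolding iperiodic_def
proof (elim exE)
  fix c :: "nat \<Rightarrow> int"
  assume "\<forall>z. z ^ 144 = 1 \<longrightarrow> f z = (\<Sum>n<144. of_int (c n) * z ^ n)"
  then show "\<exists>c :: nat \<Rightarrow> int. \<forall>z. z ^ 144 = 1 \<longrightarrow> of_int m * f z = (\<Sum>n<144. of_int (c n) * z ^ n)"
    by (intro exI[of _ "\<lambda>n. m * c n"]) (simp add: sum_distrib_left mult.assoc)
qed

lemma iperiodic_0: "iperiodic (\<lambda>z. 0)"
  using iperiodic_scale[OF iperiodic_power, of 0] by simp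

lemma iperiodic_sum: "(\<And>i. i \<in> I \<Longrightarrow> iperiodic (f i)) \<Longrightarrow> iperiodic (\<lambda>z. \<Sum>i\<in>I. f i z)"
  by (induction I rule: infinite_finite_induct) (auto simp: iperiodic_0 intro: iperiodic_add)

lemma iperiodic_cong: "iperiodic f \<Longrightarrow> (\<And>z. z ^ 144 = 1 \<Longrightarrow> f z = g z) \<Longrightarrow> iperiodic g"
  unfolding iperiodic_def by metis

lemma iperiodic_mult:
  assumes "iperiodic f" "iperiodic g"
  shows "iperiodic (\<lambda>z. f z * g z)"
proof -
  obtain c d :: "nat \<Rightarrow> int" where
    c: "\<And>z. z ^ 144 = 1 \<Longrightarrow> f z = (\<Sum>n<144. of_int (c n) * z ^ n)" and
    d: "\<And>z. z ^ 144 = 1 \<Longrightarrow> g z = (\<Sum>n<144. of_int (d n) * z ^ n)"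
    using assms unfolding iperiodic_def by blast
  have "iperiodic (\<lambda>z. \<Sum>i<144. \<Sum>j<144. of_int (c i * d j) * z ^ (i + j))"
    by (intro iperiodic_sum iperiodic_scale iperiodic_power)
  then show ?thesis
    by (rule iperiodic_cong) (simp add: c d sum_product power_add mult_ac)
qed

lemma iperiodic_pow: "iperiodic f \<Longrightarrow> iperiodic (\<lambda>z. f z ^ k)"
  by (induction k) (use iperiodic_power[of 0] in \<open>auto intro: iperiodic_mult\<close>)

lemma iperiodic_hat: "iperiodic (\<lambda>z. hat A z)"
  unfolding hat_def by (intro iperiodic_sum iperiodic_power)

text \<open>The inner binomial coefficients are multiples of p; dividing p out leaves integer
  combinations of powers, so the remainder k is again \<open>iperiodic\<close>.\<close>

lemma frobenius_add:
  assumes "iperiodic f" "iperiodic g" "prime p"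
  shows "\<exists>k. iperiodic k \<and> (\<forall>z. (f z + g z) ^ p = f z ^ p + g z ^ p + of_nat p * k z)"
proof (intro exI conjI allI)
  let ?k = "\<lambda>z. \<Sum>i\<in>{1..<p}. of_int (int ((p choose i) div p)) * (f z ^ i * g z ^ (p - i))"
  show "iperiodic ?k"
    by (intro iperiodic_sum iperiodic_scale iperiodic_mult iperiodic_pow assms)
  fix z
  have p: "p > 0" using assms prime_gt_0_nat by blast
  have "(f z + g z) ^ p = (\<Sum>i\<le>p. of_nat (p choose i) * f z ^ i * g z ^ (p - i))"
    by (rule binomial_ring)
  also have "{..p} = insert 0 (insert p {1..<p})" using p by auto
  also have "(\<Sum>i\<in>\<dots>. of_nat (p choose i) * f z ^ i * g z ^ (p - i))
      = g z ^ p + f z ^ p + (\<Sum>i\<in>{1..<p}. of_nat (p choose i) * f z ^ i * g z ^ (p - i))"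
    using p by (simp add: add.assoc)
  also have "(\<Sum>i\<in>{1..<p}. of_nat (p choose i) * f z ^ i * g z ^ (p - i)) = of_nat p * ?k z"
    unfolding sum_distrib_left
  proof (intro sum.cong refl)
    fix i assume "i \<in> {1..<p}"
    then have "p dvd (p choose i)" using assms by (intro dvd_choose_prime) auto
    then have "(p choose i) = p * ((p choose i) div p)" by simp
    then have "(of_nat (p choose i) :: complex) = of_nat p * of_nat ((p choose i) div p)"
      by (metis of_nat_mult)
    then show "of_nat (p choose i) * f z ^ i * g z ^ (p - i)
        = of_nat p * (of_int (int ((p choose i) div p)) * (f z ^ i * g z ^ (p - i)))"
      by (simp add: mult.assoc)
  qed
  finally show "(f z + g z) ^ p = f z ^ p + g z ^ p + of_nat p * ?k z" by simp
qed

lemma frobenius_hat: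
  assumes "prime p" "finite A"
  shows "\<exists>k. iperiodic k \<and> (\<forall>z. hat A z ^ p = hat A (z ^ p) + of_nat p * k z)"
  using assms(2)
proof (induction A rule: finite_induct)
  case empty
  have "p > 0" using assms prime_gt_0_nat by blast
  then show ?case using iperiodic_0 by (intro exI[of _ "\<lambda>z. 0"]) (simp add: hat_def)
next
  case (insert a A)
  then obtain k where k: "iperiodic k" "\<And>z. hat A z ^ p = hat A (z ^ p) + of_nat p * k z" by blast
  obtain l where l: "iperiodic l" "\<And>z. (z ^ a + hat A z) ^ p = (z ^ a) ^ p + hat A z ^ p + of_nat p * l z"
    using frobenius_add[OF iperiodic_power iperiodic_hat assms(1), of a A] by blast
  have "hat (insert a A) z ^ p = hat (insert a A) (z ^ p) + of_nat p * (k z + l z)" for z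
    using insert.hyps l(2)[of z] k(2)[of z]
    by (simp add: hat_def algebra_simps flip: power_mult)
  then show ?case using iperiodic_add[OF k(1) l(1)] by blast
qed

definition mul :: "nat \<Rightarrow> nat set \<Rightarrow> nat set" where
  "mul t A = (\<lambda>a. t * a mod 144) ` A"

lemma mul_subset: "mul t A \<subseteq> Z144"
  by (auto simp: mul_def Z144_def)

text \<open>Tijdeman's argument. Let r n count the representations n = pa + b. Modulo p the
  polynomials A(X)^p and A(X^p) agree, and A^p B = A^(p-1) (AB) is |A|^(p-1) times the sum of all
  powers, so every r n is congruent to |A|^(p-1) modulo p. This is not 0, hence each n is
  represented, and at most 144 pairs have to produce 144 sums.\<close>

lemma tiling_mul_prime:
  assumes t: "tiling A B" and p: "prime p" "\<not> p dvd card A"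
  shows "tiling (mul p A) B"
proof (rule tilingI_surj)
  have fin: "finite A" "finite B" using t tiling_finite by auto
  define r where "r = (\<lambda>n. card {q\<in>A\<times>B. (p * fst q + snd q) mod 144 = n})"
  obtain k where k: "iperiodic k" "\<And>z. hat A z ^ p = hat A (z ^ p) + of_nat p * k z"
    using frobenius_hat[OF p(1) fin(1)] by blast
  obtain H :: "nat \<Rightarrow> int" where
    H: "\<And>z. z ^ 144 = 1 \<Longrightarrow> k z * hat B z = (\<Sum>n<144. of_int (H n) * z ^ n)"
    using iperiodic_mult[OF k(1) iperiodic_hat[of B]] unfolding iperiodic_def by blast
  have p0: "p > 0" using p prime_gt_0_nat by blast
  have sumr: "(\<Sum>n<144. of_nat (r n) * z ^ n) = hat A (z ^ p) * hat B z" if z: "z ^ 144 = 1" for z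
  proof -
    have "hat A (z ^ p) * hat B z = (\<Sum>q\<in>A\<times>B. z ^ (p * fst q + snd q))"
      by (simp add: hat_def sum_product sum.cartesian_product power_add power_mult split_def)
    also have "\<dots> = (\<Sum>n<144. \<Sum>q\<in>{q\<in>A\<times>B. (p * fst q + snd q) mod 144 = n}. z ^ (p * fst q + snd q))"
      using fin by (subst sum.group[where T="{..<144}"]) auto
    also have "\<dots> = (\<Sum>n<144. \<Sum>q\<in>{q\<in>A\<times>B. (p * fst q + snd q) mod 144 = n}. z ^ n)"
      using power_mod_cong[OF z] by (intro sum.cong) auto
    finally show ?thesis by (simp add: r_def)
  qed
  \<comment> \<open>At z = 1 the values are cardinalities with |A| |B| = 144; elsewhere both sides
    vanish.\<close>
  have sum1: "hat A z ^ p * hat B z = of_nat (card A ^ (p - 1)) * (\<Sum>n<144. z ^ n)" if z: "z ^ 144 = 1" for z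
  proof (cases "z = 1")
    case True
    have "hat A 1 ^ p * hat B 1 = of_nat (card A ^ p * card B)" by (simp add: hat_def)
    also have "card A ^ p * card B = card A ^ (p - 1) * (card A * card B)"
      using p0 by (metis Suc_diff_1 mult.assoc power_Suc2)
    finally show ?thesis using True tiling_card[OF t] by simp
  next
    case False
    have "hat A z ^ p * hat B z = hat A z ^ (p - 1) * (hat A z * hat B z)"
      using p0 by (metis Suc_diff_1 mult.assoc power_Suc2)
    moreover have "(\<Sum>n<144. z ^ n) = 0" using geometric_sum[OF False, of 144] z by simp
    ultimately show ?thesis using hat_tiling[OF t z False] by simp
  qed
  have eq: "int (r n) = int (card A ^ (p - 1)) - int p * H n" if n: "n < 144" for n
  proof -
    have "(of_int (int (r n) - int (card A ^ (p - 1)) + int p * H n) :: complex) = 0"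
    proof (rule coeffs_zero_of_roots_unity[of 144 "\<lambda>n. of_int (int (r n) - int (card A ^ (p - 1)) + int p * H n)"])
      fix z :: complex assume z: "z ^ 144 = 1"
      have "(\<Sum>n<144. of_int (int (r n) - int (card A ^ (p - 1)) + int p * H n) * z ^ n)
         = (\<Sum>n<144. of_nat (r n) * z ^ n) - of_nat (card A ^ (p - 1)) * (\<Sum>n<144. z ^ n)
           + of_nat p * (\<Sum>n<144. of_int (H n) * z ^ n)"
        by (simp add: algebra_simps sum.distrib sum_subtractf sum_distrib_left)
      also have "\<dots> = 0"
        unfolding sumr[OF z] sum1[OF z, symmetric] H[OF z, symmetric] k(2) by (simp add: algebra_simps)
      finally show "(\<Sum>n<144. of_int (int (r n) - int (card A ^ (p - 1)) + int p * H n) * z ^ n) = 0" .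
    qed (use n in auto)
    then show ?thesis by (simp only: of_int_eq_0_iff)
  qed
  have surj: "\<exists>q\<in>A\<times>B. (p * fst q + snd q) mod 144 = n" if n: "n < 144" for n
  proof (rule ccontr)
    assume "\<not> ?thesis"
    then have "{q \<in> A \<times> B. (p * fst q + snd q) mod 144 = n} = {}" by blast
    then have "r n = 0" unfolding r_def by (simp only: card.empty)
    then have "int p dvd int (card A ^ (p - 1))" using eq[OF n] by simp
    then have "p dvd card A ^ (p - 1)" by (simp only: int_dvd_int_iff)
    then show False using p prime_dvd_power by blast
  qed
  show sj: "\<exists>a\<in>mul p A. \<exists>b\<in>B. (a + b) mod 144 = g" if "g < 144" for g
    using surj[OF that] by (auto simp: mul_def mod_add_left_eq)
  show "mul p A \<subseteq> Z144" "B \<subseteq> Z144" using mul_subset t tiling_subset by auto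
  have finm: "finite (mul p A)" using fin by (simp add: mul_def)
  have "Z144 \<subseteq> (\<lambda>q. (fst q + snd q) mod 144) ` (mul p A \<times> B)"
    using sj by (fastforce simp: Z144_def image_iff)
  then have "card Z144 \<le> card (mul p A \<times> B)"
    using fin finm by (meson card_image_le card_mono finite_SigmaI finite_imageI le_trans)
  then have "144 \<le> card (mul p A) * card B" by (simp add: Z144_def card_cartesian_product)
  moreover have "card (mul p A) * card B \<le> card A * card B"
    unfolding mul_def using card_image_le[OF fin(1)] by (intro mult_right_mono) auto
  ultimately show "card (mul p A) * card B = 144" using tiling_card[OF t] by simp
qed

text \<open>One prime factor of t is used at a time. The cardinality is preserved along the way, and
  so is coprimality.\<close>

theorem tiling_mul:
  assumes "tiling A B" "coprime t (card A)" "t > 0"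
  shows "tiling (mul t A) B"
  using assms
proof (induction t arbitrary: A rule: less_induct)
  case (less t)
  show ?case
  proof (cases "t = 1")
    case True
    have "a mod 144 = a" if "a \<in> A" for a using that less.prems tiling_subset[of A B] by (auto simp: Z144_def)
    then have "mul 1 A = A" by (auto simp: mul_def image_iff)
    then show ?thesis using True less.prems by simp
  next
    case False
    then obtain p where p: "prime p" "p dvd t" using prime_factor_nat by blast
    then obtain s where s: "t = p * s" by blast
    have s0: "s > 0" "s < t" using s less.prems p prime_gt_1_nat by auto
    have "\<not> p dvd card A"
      using less.prems(2) p by (metis coprime_common_divisor not_prime_unit)
    then have tp: "tiling (mul p A) B" using tiling_mul_prime less.prems p by blast
    have "card (mul p A) * card B = card A * card B"
      using tiling_card[OF tp] tiling_card[OF less.prems(1)] by simp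
    moreover have "card B \<noteq> 0"
      using tiling_card[OF less.prems(1)] by (metis mult_0_right zero_neq_numeral)
    ultimately have "card (mul p A) = card A" by simp
    then have "tiling (mul s (mul p A)) B"
      using less.IH[OF s0(2) tp] less.prems(2) s0 s by simp
    moreover have "mul s (mul p A) = mul t A"
      by (auto simp: mul_def image_image s mod_mult_right_eq mult_ac)
    ultimately show ?thesis by simp
  qed
qed

lemma tiling_mul_inj:
  assumes "tiling A B" "tiling (mul t A) B"
  shows "inj_on (\<lambda>a. t * a mod 144) A"
proof -
  have "card (mul t A) * card B = card A * card B" "card B \<noteq> 0"
    using tiling_card[OF assms(1)] tiling_card[OF assms(2)] by (simp, metis mult_0_right zero_neq_numeral)
  then have "card (mul t A) = card A" by simp
  then show ?thesis
    unfolding mul_def using tiling_finite[OF assms(1)] by (simp add: eq_card_imp_inj_on)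
qed

lemma hat_mul:
  assumes "inj_on (\<lambda>a. t * a mod 144) A" "z ^ 144 = 1"
  shows "hat (mul t A) z = hat A (z ^ t)"
  unfolding hat_def mul_def using assms
  by (simp add: sum.reindex power_mod_cong[OF assms(2)] power_mult)

lemma coprime_144_iff: "coprime t (144::nat) \<longleftrightarrow> odd t \<and> \<not> 3 dvd t"
proof -
  have "(144::nat) = 2 ^ 4 * 3 ^ 2" by simp
  then have "coprime t (144::nat) \<longleftrightarrow> coprime t 2 \<and> coprime t 3"
    by (simp only: coprime_mult_right_iff coprime_power_right_iff) simp
  also have "\<dots> \<longleftrightarrow> odd t \<and> \<not> 3 dvd t"
    using prime_imp_coprime[of 3 t] by (auto simp: coprime_commute dest: coprime_common_divisor[of t 3 3])
  finally show ?thesis .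
qed

text \<open>Each primitive d-th root is a zero of one of the two transforms; that the same transform
  serves all of them holds because any other such root is z^u with u prime to 144, and uA tiles with
  B as well.\<close>

theorem Cyc_tiling:
  assumes t: "tiling A B" and d: "d dvd 144" "d > 1"
  shows "d \<in> Cyc A \<or> d \<in> Cyc B"
proof (rule ccontr)
  assume *: "\<not> ?thesis"
  then obtain z w where z: "prim d z" "hat B z \<noteq> 0" and w: "prim d w" "hat A w \<noteq> 0"
    using d by (auto simp: Cyc_iff)
  have z144: "z ^ 144 = 1" using z(1) d by (simp add: prim_power_iff)
  obtain s where s: "coprime s d" "w = z ^ s" using prim_ex_power[OF z(1) w(1)] d by auto
  have "\<exists>u. coprime u 144 \<and> w = z ^ u"
  proof (cases "coprime s 144")
    \<comment> \<open>The exponent s is only prime to d. As d is divisible by 2 or 3 and s is prime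
      to d, the exponent s + d, which gives the same power, is prime to both whenever s is
      not.\<close>
    case False
    have "w = z ^ (s + d)" using s z(1) by (simp add: prim_def power_add)
    moreover have "\<not> (even s \<and> even d)" "\<not> (3 dvd s \<and> 3 dvd d)"
      using s(1) by (auto dest: coprime_common_divisor)
    moreover have "coprime (s + d) 144"
    proof -
      have "even d \<or> 3 dvd d"
      proof (rule ccontr)
        assume "\<not> ?thesis"
        then have "coprime d 144" by (simp add: coprime_144_iff)
        then show False using d coprime_absorb_left[of d 144] by simp
      qed
      then show ?thesis
        using False calculation(2,3) unfolding coprime_144_iff by presburger
    qed
    ultimately show ?thesis by blast
  qed (use s in auto)
  then obtain u where u: "coprime u 144" "w = z ^ u" by blast
  have "u > 0" using u by (cases u) auto
  moreover have "card A dvd 144" using tiling_card[OF t] by (metis dvd_triv_left)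
  then have "coprime u (card A)" using u by (metis coprime_divisors dvd_refl)
  ultimately have tm: "tiling (mul u A) B" using tiling_mul t by blast
  have "z \<noteq> 1" using z(1) d prim_power_iff[OF z(1), of 1] by auto
  then have "hat A w * hat B z = 0"
    using hat_tiling[OF tm z144] hat_mul[OF tiling_mul_inj[OF t tm] z144] u by simp
  then show False using z w by simp
qed

section \<open>Difference classes and tilings\<close>

definition sim :: "nat \<Rightarrow> nat \<Rightarrow> nat \<Rightarrow> nat \<Rightarrow> bool" where
  "sim a a' b b' \<longleftrightarrow> (\<forall>m\<in>{2,4,8,16,3,9}. (a mod m = a' mod m) \<longleftrightarrow> (b mod m = b' mod m))"

text \<open>Only a = a' is demanded: if a = a', then \<open>sim\<close> makes b and b' agree modulo
  16 and 9, so they are equal in \<open>Z144\<close> too.\<close>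

definition disjoint_diffs :: "nat set \<Rightarrow> nat set \<Rightarrow> bool" where
  "disjoint_diffs A B \<longleftrightarrow> (\<forall>a\<in>A. \<forall>a'\<in>A. \<forall>b\<in>B. \<forall>b'\<in>B. sim a a' b b' \<longrightarrow> a = a')"

lemma disjoint_diffsD:
  "disjoint_diffs A B \<Longrightarrow> a \<in> A \<Longrightarrow> a' \<in> A \<Longrightarrow> b \<in> B \<Longrightarrow> b' \<in> B \<Longrightarrow> sim a a' b b' \<Longrightarrow> a = a'"
  unfolding disjoint_diffs_def by blast

lemma crt_eq:
  assumes "a < 144" "b < 144" "a mod 16 = b mod 16" "a mod 9 = b mod (9::nat)"
  shows "a = b"
proof -
  have "[a = b] (mod 16 * 9)"
    using assms by (intro coprime_cong_mult_nat) (auto simp: cong_def coprime_iff_gcd_eq_1 gcd_non_0_nat)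
  then show ?thesis using assms by (simp add: cong_def)
qed

lemma crt_mod:
  assumes "a mod 16 = b mod 16" "a mod 9 = b mod (9::nat)"
  shows "a mod 144 = b mod 144"
  by (rule crt_eq) (use assms in \<open>auto simp: mod_mod_cancel\<close>)

text \<open>Residues modulo 16 of the same 2-adic level are odd multiples of one another; this is
  checked for all pairs of residues.\<close>

lemma ex_unit_16:
  assumes "u < 16" "v < 16" "\<And>m. m \<in> {2,4,8} \<Longrightarrow> u mod m = 0 \<longleftrightarrow> v mod m = (0::nat)" "u = 0 \<longleftrightarrow> v = 0"
  shows "\<exists>t. odd t \<and> t * u mod 16 = v"
proof -
  have all: "\<forall>u\<in>set [0..<16]. \<forall>v\<in>set [0..<16]. (u mod 2 = 0 \<longleftrightarrow> v mod 2 = 0) \<longrightarrow> (u mod 4 = 0 \<longleftrightarrow> v mod 4 = 0)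
     \<longrightarrow> (u mod 8 = 0 \<longleftrightarrow> v mod 8 = 0) \<longrightarrow> (u = 0 \<longleftrightarrow> v = 0) \<longrightarrow>
     list_ex (\<lambda>t. t * u mod 16 = v) [1,3,5,7,9,11,13,15::nat]" by code_simp
  have "list_ex (\<lambda>t. t * u mod 16 = v) [1,3,5,7,9,11,13,15]"
    by (rule all[rule_format]) (use assms(1,2,4) in \<open>simp_all add: assms(3)\<close>)
  then obtain t where t: "t \<in> set [1,3,5,7,9,11,13,15]" "t * u mod 16 = v" unfolding list_ex_iff by blast
  have "odd t" using t(1) by auto
  then show ?thesis using t(2) by blast
qed

lemma ex_unit_9:
  assumes "u < 9" "v < 9" "u mod 3 = 0 \<longleftrightarrow> v mod 3 = (0::nat)" "u = 0 \<longleftrightarrow> v = 0"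
  shows "\<exists>t. \<not> 3 dvd t \<and> t * u mod 9 = v"
proof -
  have all: "\<forall>u\<in>set [0..<9]. \<forall>v\<in>set [0..<9]. (u mod 3 = 0 \<longleftrightarrow> v mod 3 = 0) \<longrightarrow> (u = 0 \<longleftrightarrow> v = 0) \<longrightarrow>
     list_ex (\<lambda>t. t mod 3 \<noteq> 0 \<and> t * u mod 9 = v) [1,2,4,5,7,8::nat]" by code_simp
  have "list_ex (\<lambda>t. t mod 3 \<noteq> 0 \<and> t * u mod 9 = v) [1,2,4,5,7,8]"
    by (rule all[rule_format]) (use assms(1,2,4) in \<open>simp_all add: assms(3)\<close>)
  then obtain t where "t \<in> set [1,2,4,5,7,8]" "t mod 3 \<noteq> 0 \<and> t * u mod 9 = v" unfolding list_ex_iff by blast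
  then show ?thesis unfolding dvd_eq_mod_eq_0 by blast
qed

text \<open>143 stands for -1 modulo 144, so the expression is a - a' without negative
  numbers.\<close>

lemma diff_mod_eq_0_iff: fixes a a' m :: nat assumes "m dvd 144" 
  shows "((a + 143 * a') mod 144) mod m = 0 \<longleftrightarrow> a mod m = a' mod m"
proof -
  have "((a + 143 * a') mod 144) mod m = (a + 143 * a') mod m" using assms by (simp add: mod_mod_cancel)
  moreover have "(a + 143 * a') mod m = 0 \<longleftrightarrow> [(a + 143 * a') = 0] (mod m)" by (simp add: cong_def)
  moreover have "\<dots> \<longleftrightarrow> [(a + 143 * a') + a' = 0 + a'] (mod m)" by (rule cong_add_rcancel_nat[symmetric])
  moreover have "(a + 143 * a') + a' = a + 144 * a'" by simp
  moreover have "[a + 144 * a' = a + 0] (mod m)" using assms by (intro cong_add) (auto simp: cong_0_iff)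
  ultimately show ?thesis unfolding cong_def by simp
qed

text \<open>Differences with the same greatest common divisor with 144 are unit multiples of each other,
  and a tiling survives multiplication of one side by a unit.\<close>

theorem tiling_disjoint_diffs:
  assumes t: "tiling A B"
  shows "disjoint_diffs A B"
  unfolding disjoint_diffs_def
proof (intro ballI impI)
  fix a a' b b' assume in': "a \<in> A" "a' \<in> A" "b \<in> B" "b' \<in> B" and s: "sim a a' b b'"
  define u v where "u = (a + 143 * a') mod 144" and "v = (b + 143 * b') mod 144"
  note um = diff_mod_eq_0_iff[of _ a a', folded u_def] and vm = diff_mod_eq_0_iff[of _ b b', folded v_def]
  have "\<exists>t. odd t \<and> t * (u mod 16) mod 16 = v mod 16"
  proof (rule ex_unit_16)
    show "u mod 16 mod m = 0 \<longleftrightarrow> v mod 16 mod m = 0" if "m \<in> {2,4,8}" for m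
    proof -
      have "m dvd 16" "m dvd 144" using that by auto
      moreover have "(a mod m = a' mod m) = (b mod m = b' mod m)"
        using s that unfolding sim_def by blast
      ultimately show ?thesis by (simp only: mod_mod_cancel um vm)
    qed
    show "u mod 16 = 0 \<longleftrightarrow> v mod 16 = 0"
      using s um[of 16] vm[of 16] by (simp add: sim_def)
  qed simp_all
  then obtain t1 where t1: "odd t1" "t1 * u mod 16 = v mod 16" by (auto simp: mod_mult_right_eq)
  have "\<exists>t. \<not> 3 dvd t \<and> t * (u mod 9) mod 9 = v mod 9"
  proof (rule ex_unit_9)
    show "u mod 9 mod 3 = 0 \<longleftrightarrow> v mod 9 mod 3 = 0"
      using s um[of 3] vm[of 3] by (simp add: sim_def mod_mod_cancel)
    show "u mod 9 = 0 \<longleftrightarrow> v mod 9 = 0"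
      using s um[of 9] vm[of 9] by (simp add: sim_def)
  qed simp_all
  then obtain t2 where t2: "\<not> 3 dvd t2" "t2 * u mod 9 = v mod 9" by (auto simp: mod_mult_right_eq)
  \<comment> \<open>Chinese remainders: 81 is 1 modulo 16 and 0 modulo 9, while 64 is 0 modulo 16
    and 1 modulo 9.\<close>
  define t where "t = 81 * t1 + 64 * t2"
  have "t = 3 * (27 * t1 + 21 * t2) + t2" by (simp add: t_def)
  then have "3 dvd t \<longleftrightarrow> 3 dvd t2" by (metis dvd_add_right_iff dvd_triv_left)
  moreover have "odd t" using t1(1) by (simp add: t_def)
  ultimately have "coprime t 144" using t2(1) by (simp add: coprime_144_iff)
  have "t = t1 + 16 * (5 * t1 + 4 * t2)" "t = t2 + 9 * (9 * t1 + 7 * t2)" by (simp_all add: t_def)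
  then have tm: "t mod 16 = t1 mod 16" "t mod 9 = t2 mod 9" by (metis mod_mult_self2)+
  have tu: "t * u mod 144 = v mod 144"
    by (rule crt_mod) (metis tm t1 t2 mod_mult_left_eq)+
  have "t > 0" using t1 by (auto simp: t_def intro: Nat.gr0I)
  moreover have "card A dvd 144" using tiling_card[OF \<open>tiling A B\<close>] by (metis dvd_triv_left)
  then have "coprime t (card A)" using \<open>coprime t 144\<close> by (metis coprime_divisors dvd_refl)
  ultimately have tt: "tiling (mul t A) B" using tiling_mul \<open>tiling A B\<close> by blast
  \<comment> \<open>Since t(a - a') = b - b', one element of the group has two representations by tA
    and B.\<close>
  have "(t * a + b') mod 144 = (t * a' + b) mod 144"
  proof -
    have "[t * (a + 143 * a') = b + 143 * b'] (mod 144)"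
      using tu by (simp add: u_def v_def cong_def mod_mult_right_eq)
    then have "[t * (a + 143 * a') + t * a' + b' = b + 143 * b' + t * a' + b'] (mod 144)"
      by (intro cong_add) auto
    moreover have "t * (a + 143 * a') + t * a' + b' = t * a + b' + 144 * (t * a')"
      "b + 143 * b' + t * a' + b' = t * a' + b + 144 * b'" by (simp_all add: algebra_simps)
    ultimately show ?thesis by (simp add: cong_def)
  qed
  then have "t * a mod 144 = t * a' mod 144"
    using tiling_inj[OF tt, of "t * a mod 144" "t * a' mod 144" b' b] in'
    by (simp add: mul_def mod_add_left_eq)
  then show "a = a'" using tiling_mul_inj[OF \<open>tiling A B\<close> tt] in' by (auto dest: inj_onD)
qed

lemma mod_eq_dvd:
  fixes x y m k :: nat
  assumes "x mod k = y mod k" "m dvd k"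
  shows "x mod m = y mod m"
proof -
  have "x mod k mod m = y mod k mod m" using assms by simp
  then show ?thesis unfolding mod_mod_cancel[OF assms(2)] .
qed

text \<open>Two equal sums give a - a' = b' - b, and opposite differences have the same class. So
  the sums are distinct, and the cardinalities do the rest.\<close>

theorem disjoint_diffs_tiling:
  assumes A: "A \<subseteq> Z144" and B: "B \<subseteq> Z144" and card: "card A * card B = 144" and dis: "disjoint_diffs A B"
  shows "tiling A B"
proof (rule tilingI_card[OF A B card])
  fix a a' b b' assume ab: "a \<in> A" "a' \<in> A" "b \<in> B" "b' \<in> B" and eq: "(a + b) mod 144 = (a' + b') mod 144"
  have *: "a mod m = a' mod m \<longleftrightarrow> b mod m = b' mod m" if "m dvd 144" for m
  proof -
    have e: "(a + b) mod m = (a' + b') mod m" using eq that by (rule mod_eq_dvd)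
    have "a mod m = a' mod m" if "b mod m = b' mod m"
    proof -
      have "(a' + b') mod m = (a' + b) mod m" using that by (intro mod_add_cong) auto
      then show ?thesis using e cong_add_rcancel_nat[of a b a' m] by (simp add: cong_def)
    qed
    moreover have "b mod m = b' mod m" if "a mod m = a' mod m"
    proof -
      have "(a' + b') mod m = (a + b') mod m" using that by (intro mod_add_cong) auto
      then show ?thesis using e cong_add_lcancel_nat[of a b b' m] by (simp add: cong_def)
    qed
    ultimately show ?thesis by blast
  qed
  have "sim a a' b b'" unfolding sim_def using * by auto
  then have "a = a'" using dis ab by (auto dest: disjoint_diffsD)
  moreover have "b < 144" "b' < 144" using ab B by (auto simp: Z144_def)
  ultimately show "a = a' \<and> b = b'" using *[of 144] by simp
qed

section \<open>Translates, stability and periods\<close>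

lemma mem_mod [simp]: "mem A (n mod 144) = mem A n"
  by (simp add: mem_def)

lemma mem_add_mod: "mem A (n mod 144 + k) = mem A (n + k)"
  by (simp add: mem_def mod_add_left_eq)

lemma mem_add_144 [simp]: "mem A (n + 144) = mem A n"
  by (simp add: mem_def)

lemma in_mem: "A \<subseteq> Z144 \<Longrightarrow> a \<in> A \<Longrightarrow> mem A a"
  by (auto simp: mem_def Z144_def)

lemma mod_add_cong_iff: "(a + g) mod m = (b + g) mod m \<longleftrightarrow> a mod m = b mod (m::nat)"
  using cong_add_rcancel_nat[of a g b m] by (simp add: cong_def)

lemma inj_translate: "A \<subseteq> Z144 \<Longrightarrow> inj_on (\<lambda>a. (a + g) mod 144) A"
proof (rule inj_onI)
  fix x y assume A: "A \<subseteq> Z144" and xy: "x \<in> A" "y \<in> A" "(x + g) mod 144 = (y + g) mod 144"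
  have "x < 144" "y < 144" using A xy by (auto simp: Z144_def)
  then show "x = y" using xy by (simp add: mod_add_cong_iff)
qed

lemma card_translate: "A \<subseteq> Z144 \<Longrightarrow> card (translate g A) = card A"
  unfolding translate_def by (rule card_image[OF inj_translate])

lemma translate_subset: "translate g A \<subseteq> Z144"
  by (auto simp: translate_def Z144_def)

lemma closed_mult:
  assumes "stable g A" "mem A n"
  shows "mem A (n + g * k)"
proof (induction k)
  case (Suc k)
  then have "mem A (n + g * k + g)" using assms by (simp add: stable_def)
  then show ?case by (simp add: algebra_simps)
qed (use assms in simp)

lemma translate_closed:
  assumes A: "A \<subseteq> Z144" and cl: "stable g A"
  shows "translate g A = A"
proof (rule card_subset_eq)
  show "finite A" using A finite_sub_Z144 by blast
  show "translate g A \<subseteq> A"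
    using cl A by (auto simp: translate_def stable_def mem_def Z144_def)
  show "card (translate g A) = card A" using card_translate[OF A] .
qed

lemma closed_translate:
  assumes "translate g A = A"
  shows "stable g A"
  unfolding stable_def
proof (intro allI impI)
  fix n assume "mem A n"
  then have "(n mod 144 + g) mod 144 \<in> translate g A" by (auto simp: mem_def translate_def)
  then show "mem A (n + g)" using assms by (simp add: mem_def mod_add_left_eq)
qed

text \<open>A nonzero g generates a subgroup containing the one of order 2 or the one of order 3. If
  16 does not divide g, some multiple is 8 modulo 16, and 9 times it is 72; otherwise some multiple
  is 3 modulo 9, and 16 times it is 48.\<close>

lemma ex_multiple_48_72:
  assumes "g < 144" "g \<noteq> (0::nat)"
  shows "\<exists>k. g * k mod 144 = 48 \<or> g * k mod 144 = 72"
proof (cases "g mod 16 = 0")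
  case False
  have all: "\<forall>u\<in>set [1..<16]. list_ex (\<lambda>k. u * k mod 16 = 8) [1,2,4,8::nat]" by code_simp
  have "list_ex (\<lambda>k. (g mod 16) * k mod 16 = 8) [1,2,4,8]"
    by (rule all[rule_format]) (use False in simp)
  then obtain k where "(g mod 16) * k mod 16 = 8" unfolding list_ex_iff by blast
  then have "9 * (g * k mod 16) = 72" by (simp add: mod_mult_left_eq)
  then have "g * (9 * k) mod 144 = 72"
    using mult_mod_right[of 9 "g * k" 16] by (simp add: mult_ac)
  then show ?thesis by blast
next
  case True
  then have "g mod 9 \<noteq> 0" using crt_eq[of g 0] assms by auto
  have all: "\<forall>u\<in>set [1..<9]. list_ex (\<lambda>k. u * k mod 9 = 3) [1,2,3,4,5,6,7,8::nat]" by code_simp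
  have "list_ex (\<lambda>k. (g mod 9) * k mod 9 = 3) [1,2,3,4,5,6,7,8]"
    by (rule all[rule_format]) (use \<open>g mod 9 \<noteq> 0\<close> in simp)
  then obtain k where "(g mod 9) * k mod 9 = 3" unfolding list_ex_iff by blast
  then have "16 * (g * k mod 9) = 48" by (simp add: mod_mult_left_eq)
  then have "g * (16 * k) mod 144 = 48"
    using mult_mod_right[of 16 "g * k" 9] by (simp add: mult_ac)
  then show ?thesis by blast
qed

lemma periodic_iff:
  assumes A: "A \<subseteq> Z144"
  shows "periodic A \<longleftrightarrow> stable 48 A \<or> stable 72 A"
proof
  assume "periodic A"
  then obtain g where g: "g < 144" "g \<noteq> 0" "stable g A"
    unfolding periodic_def using closed_translate by (auto simp: Z144_def)
  obtain k where k: "g * k mod 144 = 48 \<or> g * k mod 144 = 72" using ex_multiple_48_72 g by blast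
  have "mem A (n + (g * k) mod 144)" if "mem A n" for n
    using closed_mult[OF g(3) that, of k] by (simp add: mem_def mod_add_right_eq)
  then have "stable (g * k mod 144) A" by (simp add: stable_def)
  then show "stable 48 A \<or> stable 72 A" using k by auto
next
  assume "stable 48 A \<or> stable 72 A"
  then show "periodic A"
    unfolding periodic_def using translate_closed[OF A] by (auto simp: Z144_def intro: bexI[of _ 48] bexI[of _ 72])
qed

lemma card_residue_class:
  assumes "g dvd N" "c < g"
  shows "card {n. n < N \<and> n mod g = c} = N div g"
proof -
  have g: "g > 0" using assms by simp
  have bd: "N = g * (N div g)" using assms by simp
  have "{n. n < N \<and> n mod g = c} = (\<lambda>k. c + g * k) ` {..<N div g}"
  proof (intro equalityI subsetI)
    fix n assume "n \<in> {n. n < N \<and> n mod g = c}"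
    then have n: "n < N" "n mod g = c" by auto
    have "n = c + g * (n div g)" using n(2) by (metis mod_mult_div_eq)
    moreover have "n div g < N div g"
      using n(1) bd g by (metis less_mult_imp_div_less mult.commute)
    ultimately show "n \<in> (\<lambda>k. c + g * k) ` {..<N div g}" by blast
  next
    fix n assume "n \<in> (\<lambda>k. c + g * k) ` {..<N div g}"
    then obtain k where k: "n = c + g * k" "k < N div g" by auto
    have "g * Suc k \<le> g * (N div g)" using k by (intro mult_le_mono2) simp
    then have "n < N" using k assms bd by simp
    then show "n \<in> {n. n < N \<and> n mod g = c}" using k assms by simp
  qed
  moreover have "inj_on (\<lambda>k. c + g * k) {..<N div g}" using g by (auto simp: inj_on_def)
  ultimately show ?thesis by (simp add: card_image)
qed

lemma closed_fill:
  assumes "stable g A" "g dvd 144" "mem A a" "n mod g = a mod g" "a < 144"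
  shows "mem A n"
proof -
  have "n + 144 \<ge> a" using assms by simp
  moreover have "(n + 144) mod g = a mod g" using assms
    by (metis dvd_def mod_mult_self2)
  ultimately have "g dvd n + 144 - a" using mod_eq_dvd_iff_nat by blast
  then obtain k where "n + 144 - a = g * k" by blast
  then have "n + 144 = a + g * k" using \<open>n + 144 \<ge> a\<close> by simp
  then show ?thesis using closed_mult[OF assms(1,3), of k] by (metis mem_add_144)
qed

text \<open>A set stable under g is a union of cosets of the subgroup generated by g, each of 144 /
  g elements.\<close>

lemma closed_dvd_card:
  assumes A: "A \<subseteq> Z144" and cl: "stable g A" and g: "g dvd 144"
  shows "144 div g dvd card A"
proof -
  have fin: "finite A" using A finite_sub_Z144 by blast
  have g0: "g > 0" using g by (auto intro: Nat.gr0I)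
  have "card A = (\<Sum>c<g. card {a\<in>A. a mod g = c})"
    using fin g0 by (subst card_eq_sum, subst sum.group[where T="{..<g}" and g="\<lambda>a. a mod g", symmetric]) auto
  moreover have "144 div g dvd card {a\<in>A. a mod g = c}" if c: "c < g" for c
  proof (cases "{a\<in>A. a mod g = c} = {}")
    case False
    then obtain a where a: "a \<in> A" "a mod g = c" by blast
    have "{a\<in>A. a mod g = c} = {n. n < 144 \<and> n mod g = c}"
    proof (intro equalityI subsetI)
      fix n assume n: "n \<in> {n. n < 144 \<and> n mod g = c}"
      have "mem A n" using closed_fill[OF cl g in_mem[OF A a(1)]] a n A by (auto simp: Z144_def)
      then show "n \<in> {a\<in>A. a mod g = c}" using n by (simp add: mem_def)
    qed (use A in \<open>auto simp: Z144_def\<close>)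
    then show ?thesis using card_residue_class[OF g c] by simp
  next
    case True
    then show ?thesis by (metis card.empty dvd_0_right)
  qed
  ultimately show ?thesis by (metis (no_types, lifting) dvd_sum lessThan_iff)
qed

text \<open>As B lies in one class modulo m, the sums of B with the slice of A in class i run
  through a single class modulo m, each element once; the shifts k < m carry this class over all the
  others. So every slice of A is itself a tile.\<close>

lemma tiling_split:
  assumes t: "tiling A B" and m: "m dvd 144" and r: "\<And>b. b \<in> B \<Longrightarrow> b mod m = r" and i: "i < m"
  shows "tiling {a\<in>A. a mod m = i} (\<Union>k<m. translate k B)"
proof (rule tilingI)
  have AB: "A \<subseteq> Z144" "B \<subseteq> Z144" using t tiling_subset by auto
  show "{a\<in>A. a mod m = i} \<subseteq> Z144" using AB by auto
  show "(\<Union>k<m. translate k B) \<subseteq> Z144" using translate_subset by auto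
next
  fix a a' c c' assume a: "a \<in> {a\<in>A. a mod m = i}" "a' \<in> {a\<in>A. a mod m = i}"
    and c: "c \<in> (\<Union>k<m. translate k B)" "c' \<in> (\<Union>k<m. translate k B)" and eq: "(a + c) mod 144 = (a' + c') mod 144"
  obtain k b where k: "k < m" "b \<in> B" "c = (b + k) mod 144" using c by (auto simp: translate_def)
  obtain k' b' where k': "k' < m" "b' \<in> B" "c' = (b' + k') mod 144" using c by (auto simp: translate_def)
  have eq': "(a + b + k) mod 144 = (a' + b' + k') mod 144"
    using eq k k' by (simp add: mod_add_right_eq add.assoc)
  then have e: "(a + b + k) mod m = (a' + b' + k') mod m" using m by (rule mod_eq_dvd)
  have "a mod m = a' mod m" "b mod m = b' mod m" using a r[OF k(2)] r[OF k'(2)] by auto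
  then have "(a + b) mod m = (a' + b') mod m" by (rule mod_add_cong)
  then have "(a + b + k') mod m = (a' + b' + k') mod m" by (simp only: mod_add_cong_iff)
  then have "k mod m = k' mod m"
    using e cong_add_lcancel_nat[of "a + b" k k' m] by (simp add: cong_def)
  then have kk: "k = k'" using k k' by simp
  then have "(a + b) mod 144 = (a' + b') mod 144" using eq' by (simp add: mod_add_cong_iff)
  then show "a = a' \<and> c = c'" using tiling_inj[OF t, of a a' b b'] a k k' kk by simp
next
  fix g :: nat assume g: "g < 144"
  have m0: "m > 0" using i by simp
  define k where "k = (g + (m - (i + r) mod m)) mod m"
  have k: "k < m" using m0 by (simp add: k_def)
  have km: "(i + r + k) mod m = g mod m"
  proof -
    have "(i + r) mod m \<le> m" using m0 by (simp add: less_imp_le)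
    then have "(i + r) mod m + (g + (m - (i + r) mod m)) = g + m" by simp
    then have "((i + r) mod m + (g + (m - (i + r) mod m))) mod m = g mod m" by simp
    then show ?thesis by (simp add: k_def mod_add_left_eq mod_add_right_eq)
  qed
  have "m \<le> 144" using m by (simp add: dvd_imp_le)
  then have kg: "k \<le> g + 144" using k by simp
  obtain a b where ab: "a \<in> A" "b \<in> B" "(g + 144 - k) mod 144 = (a + b) mod 144"
    using tiling_surj[OF t] by metis
  have g': "(a + b + k) mod 144 = g"
  proof -
    have "(a + b + k) mod 144 = (g + 144 - k + k) mod 144" using ab(3) by (metis mod_add_left_eq)
    then show ?thesis using kg g by simp
  qed
  have "(a + b + k) mod 144 = g mod 144" using g' g by simp
  then have "(a + b + k) mod m = g mod m" using m by (rule mod_eq_dvd)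
  then have "(a + b + k) mod m = (i + r + k) mod m" using km by simp
  then have "(a + b) mod m = (i + r) mod m" by (simp add: mod_add_cong_iff)
  moreover have "(a + b) mod m = (a + r) mod m" using r[OF ab(2)] by (metis mod_add_right_eq mod_mod_trivial)
  ultimately have "a mod m = i mod m" by (simp add: mod_add_cong_iff)
  then have "a \<in> {a\<in>A. a mod m = i}" using ab i by simp
  moreover have "(b + k) mod 144 \<in> (\<Union>k<m. translate k B)" using ab k by (auto simp: translate_def)
  moreover have "(a + (b + k) mod 144) mod 144 = g" using g' by (simp add: mod_add_right_eq add.assoc)
  ultimately show "\<exists>a\<in>{a\<in>A. a mod m = i}. \<exists>c\<in>(\<Union>k<m. translate k B). (a + c) mod 144 = g" by blast
qed

text \<open>The residue modulo m tells which \<open>translate k B\<close> an element comes from, and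
  a shift by a multiple of m does not change it; so elements with k = 0 stay there.\<close>

lemma closed_split:
  assumes cl: "stable g (\<Union>k<m. translate k B)" and m: "m dvd 144" "m dvd g" and B: "B \<subseteq> Z144"
    and r: "\<And>b. b \<in> B \<Longrightarrow> b mod m = r"
  shows "stable g B"
  unfolding stable_def
proof (intro allI impI)
  fix n assume n: "mem B n"
  have m0: "m > 0" using m(1) by (auto intro: Nat.gr0I)
  have "n mod 144 \<in> B" using n by (simp add: mem_def)
  then have "mem (\<Union>k<m. translate k B) n"
    using m0 by (auto simp: mem_def translate_def intro!: bexI[of _ 0] rev_image_eqI[of "n mod 144"])
  then have "mem (\<Union>k<m. translate k B) (n + g)" using cl by (simp add: stable_def)
  then obtain k b where k: "k < m" "b \<in> B" "(n + g) mod 144 = (b + k) mod 144"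
    by (auto simp: mem_def translate_def)
  have "(n + g) mod m = n mod m" using m(2) by (auto elim!: dvdE)
  then have "(n + g) mod m = n mod 144 mod m" unfolding mod_mod_cancel[OF m(1)] .
  then have "(n + g) mod m = r" using r[OF \<open>n mod 144 \<in> B\<close>] by simp
  moreover have "(n + g) mod m = (b + k) mod m" using k(3) m(1) by (rule mod_eq_dvd)
  moreover have "(b + 0) mod m = r" using r[OF k(2)] by simp
  ultimately have "k mod m = 0 mod m"
    using cong_add_lcancel_nat[of b k 0 m] by (simp add: cong_def)
  then have "k = 0" using k(1) by simp
  moreover have "b < 144" using k B by (auto simp: Z144_def)
  ultimately show "mem B (n + g)" using k by (simp add: mem_def)
qed

lemma hat_translate: "B \<subseteq> Z144 \<Longrightarrow> z ^ 144 = 1 \<Longrightarrow> hat (translate g B) z = z ^ g * hat B z"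
  unfolding hat_def translate_def
  by (simp add: sum.reindex[OF inj_translate] power_mod_cong power_add sum_distrib_left mult.commute)

text \<open>The union of the two shifts of B has the transform (1 + z) B(z), and 1 + z vanishes only
  at the root of order 2; hence the bound d > 2.\<close>

lemma Cyc_half:
  assumes t: "tiling A B" and r: "\<And>b. b \<in> B \<Longrightarrow> b mod 2 = r" and i: "i < 2" and d: "d dvd 144" "d > 2"
  shows "d \<in> Cyc {a\<in>A. a mod 2 = i} \<or> d \<in> Cyc B"
proof -
  have B: "B \<subseteq> Z144" "finite B" using t tiling_subset tiling_finite by auto
  let ?B = "\<Union>k<2. translate k B"
  have un: "?B = translate 0 B \<union> translate 1 B" by (auto simp: lessThan_nat_numeral lessThan_Suc numeral_2_eq_2)
  have "d \<in> Cyc {a\<in>A. a mod 2 = i} \<or> d \<in> Cyc ?B"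
    using Cyc_tiling[OF tiling_split[OF t _ r i]] d by simp
  moreover have "d \<in> Cyc B" if "d \<in> Cyc ?B"
  proof -
    have "hat B z = 0" if z: "prim d z" for z
    proof -
      have z144: "z ^ 144 = 1" using z d by (simp add: prim_power_iff)
      have "z ^ 2 \<noteq> 1" using z d by (auto simp: prim_power_iff dest: dvd_imp_le)
      then have "1 + z \<noteq> 0" by (metis add.commute add_eq_0_iff power2_minus power_one)
      have "translate 0 B \<inter> translate 1 B = {}"
      proof -
        have "(b + 0) mod 144 \<noteq> (c + 1) mod 144" if bc: "b \<in> B" "c \<in> B" for b c
        proof
          assume "(b + 0) mod 144 = (c + 1) mod 144"
          then have "(b + 0) mod 2 = (c + 1) mod 2" by (rule mod_eq_dvd) simp
          moreover have "b mod 2 = c mod 2" using r[OF bc(1)] r[OF bc(2)] by simp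
          ultimately show False by presburger
        qed
        then show ?thesis by (fastforce simp: translate_def)
      qed
      then have "hat ?B z = hat (translate 0 B) z + hat (translate 1 B) z"
        unfolding un hat_def using B by (intro sum.union_disjoint) (auto simp: translate_def)
      also have "\<dots> = (1 + z) * hat B z"
        using hat_translate[OF B(1) z144, of 0] hat_translate[OF B(1) z144, of 1] by (simp add: algebra_simps)
      finally show ?thesis using that \<open>d \<in> Cyc ?B\<close> \<open>1 + z \<noteq> 0\<close> z by (simp add: Cyc_iff)
    qed
    then show ?thesis using that by (simp add: Cyc_iff)
  qed
  ultimately show ?thesis by blast
qed

text \<open>The mixed difference with second step 1 vanishes, so the difference D with step s is
  constant. Going round by m steps of length s returns to the same residue, whence m D = 0.\<close>

lemma Cyc_shift_invariant:
  assumes A: "finite A" and m: "m dvd 144" "m > 0" and Cyc: "\<And>d. d dvd m \<Longrightarrow> \<not> d dvd s \<Longrightarrow> d \<in> Cyc A"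
  shows "cnt A m (n + s) = cnt A m n"
proof -
  define D where "D = (\<lambda>n. int (cnt A m n) - int (cnt A m (n + s)))"
  have "D n = D (n + 1)" for n
    using dd_eq_0[OF A m(1) Cyc, of s 1 n] by (simp add: dd_def D_def add.commute add.left_commute)
  then have D: "D n = D 0" for n by (induction n) auto
  have "int (cnt A m (s * k)) = int (cnt A m 0) - int k * D 0" for k
  proof (induction k)
    case (Suc k)
    then show ?case using D[of "s * k"] by (simp add: D_def algebra_simps)
  qed simp
  from this[of m] have "int m * D 0 = 0" using cnt_mod[of A m "s * m"] cnt_mod[of A m 0] by simp
  then show ?thesis using m D[of n] by (simp add: D_def)
qed

lemma cnt_144: "A \<subseteq> Z144 \<Longrightarrow> cnt A 144 n = (if mem A n then 1 else 0)"
proof -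
  assume A: "A \<subseteq> Z144"
  have "{a\<in>A. a mod 144 = n mod 144} = (if mem A n then {n mod 144} else {})"
    using A by (auto simp: mem_def Z144_def)
  then show ?thesis by (simp add: cnt_def)
qed

lemma cnt_eq_0_iff: "finite A \<Longrightarrow> cnt A d n = 0 \<longleftrightarrow> (\<forall>a\<in>A. a mod d \<noteq> n mod d)"
  by (auto simp: cnt_def)

lemma cnt_posE:
  assumes "cnt A d n \<noteq> 0"
  obtains a where "a \<in> A" "a mod d = n mod d"
  using assms unfolding cnt_def by (metis (mono_tags, lifting) Collect_empty_eq card.empty)

lemma divisors_144:
  "d dvd 144 \<longleftrightarrow> d \<in> {1,2,3,4,6,8,9,12,16,18,24,36,48,72,144::nat}"
proof
  assume d: "d dvd 144"
  have "list_all (\<lambda>d. d dvd 144 \<longrightarrow> d \<in> set [0,1,2,3,4,6,8,9,12,16,18,24,36,48,72,144]) [0..<145]"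
    by code_simp
  moreover have "d \<le> 144" using d by (simp add: dvd_imp_le)
  ultimately have "d \<in> set [0,1,2,3,4,6,8,9,12,16,18,24,36,48,72,144]"
    using d unfolding list_all_iff by (metis atLeastLessThan_iff atLeastLessThan_upt le_imp_less_Suc
        Suc_numeral semiring_norm(5) semiring_norm(8) zero_le numeral_plus_one Suc_eq_plus1 le0)
  then show "d \<in> {1,2,3,4,6,8,9,12,16,18,24,36,48,72,144}" using d by auto
qed auto

lemma stable_if_Cyc:
  assumes "A \<subseteq> Z144" "\<And>d. d dvd 144 \<Longrightarrow> \<not> d dvd s \<Longrightarrow> d \<in> Cyc A"
  shows "stable s A"
  unfolding stable_def
proof (intro allI impI)
  fix n assume n: "mem A n"
  have "cnt A 144 (n + s) = cnt A 144 n"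
    using assms finite_sub_Z144[of A] by (intro Cyc_shift_invariant) auto
  then show "mem A (n + s)" using n by (simp add: cnt_144[OF assms(1)] split: if_splits)
qed

text \<open>The condition on s says that d is its only divisor not dividing s; it runs over the list
  of divisors so that it can be decided by evaluation.\<close>

lemma Cyc_shift:
  assumes A: "finite A" and d: "d \<in> Cyc A"
    and s: "\<forall>k\<in>{1,2,3,4,6,8,9,12,16,18,24,36,48,72,144}. k dvd d \<longrightarrow> \<not> k dvd s \<longrightarrow> k = d"
  shows "cnt A d (n + s) = cnt A d n"
proof (rule Cyc_shift_invariant[OF A])
  show "d dvd 144" "d > 0" using d by (auto simp: Cyc_iff)
  show "k \<in> Cyc A" if "k dvd d" "\<not> k dvd s" for k
    using that s d dvd_trans[OF that(1) \<open>d dvd 144\<close>] by (metis divisors_144)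
qed

text \<open>The only divisor of d that divides neither d/2 nor d/3 is d itself, so the mixed
  difference with these two steps needs nothing but order d.\<close>

lemma Cyc_six:
  assumes A: "finite A" and d: "d \<in> Cyc A" "6 dvd d"
  shows "cnt A d n + cnt A d (n + d div 2 + d div 3) = cnt A d (n + d div 2) + cnt A d (n + d div 3)"
proof -
  have d144: "d dvd 144" using d by (simp add: Cyc_iff)
  have *: "\<forall>d\<in>{1,2,3,4,6,8,9,12,16,18,24,36,48,72,144::nat}. 6 dvd d \<longrightarrow>
     (\<forall>k\<in>{1,2,3,4,6,8,9,12,16,18,24,36,48,72,144}. k dvd d \<longrightarrow> \<not> k dvd d div 2 \<longrightarrow> \<not> k dvd d div 3 \<longrightarrow> k = d)"
    by simp
  have "dd A d (d div 2) (d div 3) n = 0"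
  proof (rule Cyc_dd[OF A d(1)])
    fix k assume k: "k dvd d" "\<not> k dvd d div 2" "\<not> k dvd d div 3"
    have "k dvd 144" using k d144 dvd_trans by blast
    then show "k = d" using * d144 d(2) k unfolding divisors_144 by blast
  qed
  then show ?thesis unfolding dd_def by linarith
qed

lemma mod_144_swap:
  assumes "x mod 144 = (y + k) mod (144::nat)"
  shows "(y + (n + k)) mod 144 = (x + n) mod 144"
proof -
  have "(x + n) mod 144 = (y + k + n) mod 144" by (rule mod_add_cong) (use assms in auto)
  then show ?thesis by (simp add: add_ac)
qed

text \<open>The counts are 0 or 1, so c(n) = 1 and c(n + 72) = 0 force c(n + 48) = 1 and c(n + 120)
  = 0. As 120 = 48 + 72, the same step applies at n + 48.\<close>

lemma Cyc_144_dichotomy: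
  assumes A: "A \<subseteq> Z144" and "144 \<in> Cyc A" "mem A n" "\<not> mem A (n + 72)"
  shows "mem A (n + 48) \<and> mem A (n + 96)"
proof -
  have eq: "cnt A 144 n + cnt A 144 (n + 120) = cnt A 144 (n + 72) + cnt A 144 (n + 48)" for n
    using Cyc_six[OF finite_sub_Z144[OF A] assms(2), of n] by (simp add: add.assoc)
  have 1: "mem A (n + 48)" "\<not> mem A (n + 120)"
    using eq[of n] assms by (auto simp: cnt_144[OF A] split: if_splits)
  moreover have "mem A (n + 48) \<longrightarrow> \<not> mem A (n + 48 + 72) \<longrightarrow> mem A (n + 48 + 48)"
    using eq[of "n + 48"] by (auto simp: cnt_144[OF A] split: if_splits)
  ultimately have "mem A (n + 96)" by (simp add: add.assoc)
  then show ?thesis using 1 by simp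
qed

lemma mem_tiling_inj:
  assumes "tiling A B" "mem A a" "mem A a'" "mem B b" "mem B b'" "(a + b) mod 144 = (a' + b') mod 144"
  shows "a mod 144 = a' mod 144 \<and> b mod 144 = b' mod 144"
  using assms tiling_inj[OF assms(1), of "a mod 144" "a' mod 144" "b mod 144" "b' mod 144"]
  by (simp add: mem_def mod_add_eq)

lemma mod_add_eqI: "j mod m = k mod (m::nat) \<Longrightarrow> (n + j) mod m = (n + k) mod m"
  by (rule mod_add_cong) simp_all

lemma mult_shift:
  assumes "144 dvd c * k"
  shows "c * (n mod 144) mod 144 = c * ((n + k) mod 144) mod (144::nat)"
proof -
  obtain j where "c * k = 144 * j" using assms by blast
  then have "c * (n + k) = c * n + 144 * j" by (simp add: algebra_simps)
  then have "c * (n + k) mod 144 = c * n mod 144" by simp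
  then show ?thesis by (simp only: mod_mult_right_eq)
qed

lemma shift_neq:
  assumes "0 < k" "k < m"
  shows "(n + k) mod m \<noteq> n mod (m::nat)" "n mod m \<noteq> (n + k) mod m"
  using cong_add_lcancel_nat[of n k 0 m] assms by (auto simp: cong_def)

lemma cnt_eq_0I:
  assumes "\<And>a. a \<in> A \<Longrightarrow> a mod m = r" "m dvd d" "q mod m \<noteq> r"
  shows "cnt A d q = 0"
proof -
  have "a mod d \<noteq> q mod d" if "a \<in> A" for a
    using assms that mod_eq_dvd[of a d q m] by metis
  then have "{a\<in>A. a mod d = q mod d} = {}" by blast
  then show ?thesis unfolding cnt_def by (simp only: card.empty)
qed

section \<open>Periodicity when a cardinality is prime to 2 or 3\<close>

lemma dichotomy_no_72:
  assumes "A \<subseteq> Z144" "144 \<in> Cyc A" "\<And>n. mem A n \<Longrightarrow> \<not> mem A (n + 72)"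
  shows "stable 48 A"
  unfolding stable_def using Cyc_144_dichotomy[OF assms(1,2)] assms(3) by blast

lemma dichotomy_no_48:
  assumes "A \<subseteq> Z144" "144 \<in> Cyc A" "\<And>n. mem A n \<Longrightarrow> \<not> mem A (n + 48)"
  shows "stable 72 A"
  unfolding stable_def using Cyc_144_dichotomy[OF assms(1,2)] assms(3) by blast

text \<open>If 3 does not divide \<open>|A|\<close>, then \<open>9A\<close> tiles with \<open>B\<close> as well; as it lies in the subgroup
  of multiples of 9, a zero of order 16, 48 or 144 forces the difference 72 into it.\<close>

lemma periodic_if_not_3_dvd:
  assumes t: "tiling A B" and n3: "\<not> 3 dvd card A"
  shows "stable 72 B \<or> stable 48 B \<or> stable 72 A"
\<comment> \<open>16, 48 and 144 are the divisors of 144 that do not divide 72.\<close>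
proof (cases "{16, 48, 144} \<subseteq> Cyc B")
  case True
  have "stable 72 B"
    by (rule stable_if_Cyc) (use True t tiling_subset in \<open>auto simp: divisors_144\<close>)
  then show ?thesis by simp
next
  case False
  have sub: "A \<subseteq> Z144" "B \<subseteq> Z144" and fin: "finite A" "finite B"
    using t tiling_subset tiling_finite by auto
  let ?A = "mul 9 A"
  have "coprime (3 ^ 2) (card A)"
    using prime_imp_coprime[of 3 "card A"] n3 by (simp only: coprime_power_left_iff) simp
  then have t9: "tiling ?A B" using tiling_mul[OF t, of 9] by simp
  have fin9: "finite ?A" using t9 tiling_finite by auto
  obtain d where d: "d \<in> {16, 48, 144}" "d \<in> Cyc ?A"
    using False Cyc_tiling[OF t9, of 16] Cyc_tiling[OF t9, of 48] Cyc_tiling[OF t9, of 144] by auto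
  have m9: "p mod 9 = 0" if "p \<in> ?A" for p
    using that by (auto simp: mul_def mod_mod_cancel)
  have "A \<noteq> {}" using tiling_card[OF t] by auto
  then obtain p where p: "p \<in> ?A" by (auto simp: mul_def)
  then have cp: "cnt ?A k p \<noteq> 0" for k using cnt_eq_0_iff[OF fin9] by blast
  \<comment> \<open>All elements of \<open>?A\<close> are multiples of 9, so a shift that is not a
    multiple of 3 or of 9 leaves the set. The relation of the chosen order then forces a shift that
    is 8 modulo 16.\<close>
  have "\<exists>q\<in>?A. q mod 16 = (p + 8) mod 16"
  proof -
    consider "d = 16" | "d = 48" | "d = 144" using d by blast
    then show ?thesis
    proof cases
      case 1
      have "cnt ?A 16 (p + 8) = cnt ?A 16 p"
        by (rule Cyc_shift[OF fin9]) (use 1 d in simp_all)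
      then show ?thesis using cp[of 16] by (metis cnt_posE)
    next
      case 2
      have m3: "q mod 3 = 0" if "q \<in> ?A" for q using m9[OF that] by presburger
      have "cnt ?A 48 (p + 16) = 0"
        by (rule cnt_eq_0I[of _ 3 0, OF m3]) (use m3[OF p] in presburger)+
      then have "cnt ?A 48 (p + 24) \<noteq> 0"
        using Cyc_six[OF fin9 d(2), of p] cp[of d] 2 by simp
      then obtain q where "q \<in> ?A" "q mod 48 = (p + 24) mod 48" by (rule cnt_posE)
      then have "q \<in> ?A" "q mod 16 = (p + 24) mod 16" using mod_eq_dvd[of q 48 "p + 24" 16] by auto
      moreover have "(p + 24) mod 16 = (p + 8) mod 16" by (rule mod_add_eqI) simp
      ultimately show ?thesis by auto
    next
      case 3
      have "cnt ?A 144 (p + 48) = 0"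
        by (rule cnt_eq_0I[of _ 9 0, OF m9]) (use m9[OF p] in presburger)+
      then have "cnt ?A 144 (p + 72) \<noteq> 0"
        using Cyc_six[OF fin9 d(2), of p] cp[of d] 3 by simp
      then obtain q where "q \<in> ?A" "q mod 144 = (p + 72) mod 144" by (rule cnt_posE)
      then have "q \<in> ?A" "q mod 16 = (p + 72) mod 16" using mod_eq_dvd[of q 144 "p + 72" 16] by auto
      moreover have "(p + 72) mod 16 = (p + 8) mod 16" by (rule mod_add_eqI) simp
      ultimately show ?thesis by auto
    qed
  qed
  then obtain q where q: "q \<in> ?A" "q mod 16 = (p + 8) mod 16" by blast
  have q72: "q mod 144 = (p + 72) mod 144"
  proof (rule crt_mod)
    have "(p + 72) mod 16 = (p + 8) mod 16" by (rule mod_add_eqI) simp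
    then show "q mod 16 = (p + 72) mod 16" using q(2) by simp
    have "(p + 72) mod 9 = 0" using m9[OF p] by presburger
    then show "q mod 9 = (p + 72) mod 9" using m9[OF q(1)] by simp
  qed
  have B72: "\<not> mem B (n + 72)" if n: "mem B n" for n
  proof
    assume n72: "mem B (n + 72)"
    have "mem ?A p" "mem ?A q" using p q in_mem[OF mul_subset] by auto
    moreover have "(p + (n + 72)) mod 144 = (q + n) mod 144"
      by (rule mod_144_swap[OF q72])
    ultimately have "(n + 72) mod 144 = n mod 144"
      using mem_tiling_inj[OF t9 _ _ n72 n] by blast
    then show False using shift_neq(1)[of 72 144] by simp
  qed
  \<comment> \<open>9 * 48 is 0 modulo 144, whereas multiplication by 9 is injective on A.\<close>
  have A48: "\<not> mem A (n + 48)" if n: "mem A n" for n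
  proof
    assume "mem A (n + 48)"
    moreover have "9 * (n mod 144) mod 144 = 9 * ((n + 48) mod 144) mod 144"
      by (rule mult_shift) simp
    ultimately have "n mod 144 = (n + 48) mod 144"
      using inj_onD[OF tiling_mul_inj[OF t t9], of "n mod 144" "(n + 48) mod 144"] n
      unfolding mem_def by blast
    then show False using shift_neq(2)[of _ 144] by simp
  qed
  show ?thesis
    using Cyc_tiling[OF t, of 144] dichotomy_no_72[OF sub(2) _ B72] dichotomy_no_48[OF sub(1) _ A48] by auto
qed

text \<open>The counterpart for the prime 2. The set 16A consists of multiples of 16, and each of
  the orders 9, 18, 36, 72, 144, the divisors that do not divide 48, forces the difference 48 or -48
  into it, so B has no difference 48. As 16 * 72 = 0, A has no difference 72. Order 144 then
  decides.\<close>

lemma periodic_if_not_2_dvd: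
  assumes t: "tiling A B" and n2: "odd (card A)"
  shows "stable 72 B \<or> stable 48 B \<or> stable 48 A"
proof (cases "{9, 18, 36, 72, 144} \<subseteq> Cyc B")
  case True
  have "stable 48 B"
    by (rule stable_if_Cyc) (use True t tiling_subset in \<open>auto simp: divisors_144\<close>)
  then show ?thesis by simp
next
  case False
  have sub: "A \<subseteq> Z144" "B \<subseteq> Z144" and fin: "finite A" "finite B"
    using t tiling_subset tiling_finite by auto
  let ?A = "mul 16 A"
  have "coprime (2 ^ 4) (card A)"
    using n2 by (simp only: coprime_power_left_iff) simp
  then have t16: "tiling ?A B" using tiling_mul[OF t, of 16] by simp
  have fin16: "finite ?A" using t16 tiling_finite by auto
  obtain d where d: "d \<in> {9, 18, 36, 72, 144}" "d \<in> Cyc ?A"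
    using False Cyc_tiling[OF t16, of 9] Cyc_tiling[OF t16, of 18] Cyc_tiling[OF t16, of 36]
      Cyc_tiling[OF t16, of 72] Cyc_tiling[OF t16, of 144] by auto
  have m16: "p mod 16 = 0" if "p \<in> ?A" for p
    using that by (auto simp: mul_def mod_mod_cancel)
  have "A \<noteq> {}" using tiling_card[OF t] by auto
  then obtain p where p: "p \<in> ?A" by (auto simp: mul_def)
  then have cp: "cnt ?A k p \<noteq> 0" for k using cnt_eq_0_iff[OF fin16] by blast
  \<comment> \<open>m will be the full power of 2 in d. The shift by d/2 leaves the multiples of m,
    so the relation of order d forces the shift by d/3.\<close>
  have even_case: "\<exists>q\<in>?A. q mod 9 = (p + d div 3) mod 9"
    if "m dvd d" "m dvd 16" "m dvd p" "\<not> m dvd d div 2" "6 dvd d" "9 dvd d" for m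
  proof -
    have m0: "a mod m = 0" if "a \<in> ?A" for a
      using m16[OF that] \<open>m dvd 16\<close> by (meson dvd_eq_mod_eq_0 dvd_trans)
    have "(p + d div 2) mod m \<noteq> 0" using that by (metis dvd_add_right_iff mod_eq_0_iff_dvd)
    then have "cnt ?A d (p + d div 2) = 0" using cnt_eq_0I[of ?A m 0, OF m0 \<open>m dvd d\<close>] by blast
    then have "cnt ?A d (p + d div 3) \<noteq> 0"
      using Cyc_six[OF fin16 d(2) \<open>6 dvd d\<close>, of p] cp[of d] by simp
    then obtain q where "q \<in> ?A" "q mod d = (p + d div 3) mod d" by (rule cnt_posE)
    then show ?thesis using mod_eq_dvd[of q d "p + d div 3" 9] \<open>9 dvd d\<close> by blast
  qed
  have p16: "2 dvd p" "4 dvd p" "8 dvd p" "16 dvd p"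
    using m16[OF p] by presburger+
  have "\<exists>q\<in>?A. q mod 9 = (p + 3) mod 9 \<or> q mod 9 = (p + 6) mod 9"
  proof -
    consider "d = 9" | "d = 18" | "d = 36" | "d = 72" | "d = 144" using d by blast
    then show ?thesis
    proof cases
      case 1
      have "cnt ?A 9 (p + 3) = cnt ?A 9 p"
        by (rule Cyc_shift[OF fin16]) (use 1 d in simp_all)
      then show ?thesis using cp[of 9] by (metis cnt_posE)
    next
      case 2
      then show ?thesis using even_case[of 2] p16 by auto
    next
      case 3
      have "\<exists>q\<in>?A. q mod 9 = (p + 12) mod 9" using even_case[of 4] p16 3 by simp
      moreover have "(p + 12) mod 9 = (p + 3) mod 9" by (rule mod_add_eqI) simp
      ultimately show ?thesis by auto
    next
      case 4
      have "\<exists>q\<in>?A. q mod 9 = (p + 24) mod 9" using even_case[of 8] p16 4 by simp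
      moreover have "(p + 24) mod 9 = (p + 6) mod 9" by (rule mod_add_eqI) simp
      ultimately show ?thesis by auto
    next
      case 5
      have "\<exists>q\<in>?A. q mod 9 = (p + 48) mod 9" using even_case[of 16] p16 5 by simp
      moreover have "(p + 48) mod 9 = (p + 3) mod 9" by (rule mod_add_eqI) simp
      ultimately show ?thesis by auto
    qed
  qed
  then obtain q where q: "q \<in> ?A" "q mod 9 = (p + 3) mod 9 \<or> q mod 9 = (p + 6) mod 9" by blast
  have q48: "q mod 144 = (p + 48) mod 144 \<or> p mod 144 = (q + 48) mod 144"
    using q(2)
  proof
    assume "q mod 9 = (p + 3) mod 9"
    moreover have "(p + 48) mod 9 = (p + 3) mod 9" by (rule mod_add_eqI) simp
    ultimately have "q mod 9 = (p + 48) mod 9" by simp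
    moreover have "(p + 48) mod 16 = 0" using m16[OF p] m16[OF q(1)] by presburger
    then have "q mod 16 = (p + 48) mod 16" using m16[OF p] m16[OF q(1)] by simp
    ultimately have "q mod 144 = (p + 48) mod 144" by (intro crt_mod)
    then show ?thesis ..
  next
    assume "q mod 9 = (p + 6) mod 9"
    then have "(q + 48) mod 9 = (p + 6 + 48) mod 9" by (rule mod_add_cong) simp
    moreover have "(p + 6 + 48) mod 9 = p mod 9"
      using mod_add_eqI[of 54 9 0 p] by (simp add: add.assoc)
    ultimately have "p mod 9 = (q + 48) mod 9" by simp
    moreover have "(q + 48) mod 16 = 0" using m16[OF p] m16[OF q(1)] by presburger
    then have "p mod 16 = (q + 48) mod 16" using m16[OF p] m16[OF q(1)] by simp
    ultimately have "p mod 144 = (q + 48) mod 144" by (intro crt_mod)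
    then show ?thesis ..
  qed
  have B48: "\<not> mem B (n + 48)" if n: "mem B n" for n
  proof
    assume n48: "mem B (n + 48)"
    have "mem ?A p" "mem ?A q" using p q in_mem[OF mul_subset] by auto
    moreover have "(p + (n + 48)) mod 144 = (q + n) mod 144 \<or> (q + (n + 48)) mod 144 = (p + n) mod 144"
      using q48 mod_144_swap[of q p 48 n] mod_144_swap[of p q 48 n] by blast
    ultimately have "(n + 48) mod 144 = n mod 144"
      using mem_tiling_inj[OF t16 _ _ n48 n] by blast
    then show False using shift_neq(1)[of 48 144] by simp
  qed
  have A72: "\<not> mem A (n + 72)" if n: "mem A n" for n
  proof
    assume "mem A (n + 72)"
    moreover have "16 * (n mod 144) mod 144 = 16 * ((n + 72) mod 144) mod 144"
      by (rule mult_shift) simp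
    ultimately have "n mod 144 = (n + 72) mod 144"
      using inj_onD[OF tiling_mul_inj[OF t t16], of "n mod 144" "(n + 72) mod 144"] n
      unfolding mem_def by blast
    then show False using shift_neq(2)[of _ 144] by simp
  qed
  show ?thesis
    using Cyc_tiling[OF t, of 144] dichotomy_no_48[OF sub(2) _ B48] dichotomy_no_72[OF sub(1) _ A72] by auto
qed

section \<open>Non-periodic tilings\<close>

lemma card_by_residue:
  assumes "finite A" "m > 0"
  shows "card A = (\<Sum>i<m. card {a\<in>A. a mod m = (i::nat)})"
proof -
  have "(\<Sum>i<m. \<Sum>a\<in>{a\<in>A. a mod m = i}. 1) = (\<Sum>a\<in>A. 1::nat)"
    using assms by (intro sum.group) auto
  then show ?thesis by simp
qed

lemma stable_by_residue:
  assumes A: "A \<subseteq> Z144" and st: "\<And>i. i < m \<Longrightarrow> stable g {a\<in>A. a mod m = i}" and m: "m > 0"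
  shows "stable g A"
  unfolding stable_def
proof (intro allI impI)
  fix n assume n: "mem A n"
  let ?i = "n mod 144 mod m"
  have "mem {a\<in>A. a mod m = ?i} n" using n by (simp add: mem_def)
  then have "mem {a\<in>A. a mod m = ?i} (n + g)" using st[of ?i] m by (simp add: stable_def)
  then show "mem A (n + g)" by (simp add: mem_def)
qed

lemma nonperiodic_tilingD:
  assumes "nonperiodic_tiling A B"
  shows "tiling A B" "A \<subseteq> Z144" "B \<subseteq> Z144" "\<not> stable 48 A" "\<not> stable 72 A" "\<not> stable 48 B" "\<not> stable 72 B"
    "card A * card B = 144"
  using assms tiling_subset[of A B] periodic_iff[of A] periodic_iff[of B] tiling_card
  unfolding nonperiodic_tiling_def by auto

lemma nonperiodic_tiling_commute: "nonperiodic_tiling A B \<longleftrightarrow> nonperiodic_tiling B A"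
  unfolding nonperiodic_tiling_def using tiling_commute by blast

lemma six_dvd_card:
  assumes np: "nonperiodic_tiling A B"
  shows "2 dvd card A" "3 dvd card A"
  using nonperiodic_tilingD[OF np] periodic_if_not_3_dvd[of A B] periodic_if_not_2_dvd[of A B] by blast+

lemma card_parts:
  assumes t: "tiling A B" and m: "m dvd 144" "m > 0" and r: "\<And>b. b \<in> B \<Longrightarrow> b mod m = r" and i: "i < m"
  shows "card A = m * card {a\<in>A. a mod m = i}" "m * card {a\<in>A. a mod m = i} * card B = 144"
proof -
  let ?U = "\<Union>k<m. translate k B"
  have *: "card {a\<in>A. a mod m = j} * card ?U = 144" if "j < m" for j
    using tiling_card[OF tiling_split[OF t m(1) r that]] .
  have "card ?U \<noteq> 0" using *[OF i] by (metis mult_0_right zero_neq_numeral)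
  then have "card {a\<in>A. a mod m = j} = card {a\<in>A. a mod m = i}" if "j < m" for j
    using *[OF that] *[OF i] by (metis mult_right_cancel)
  then have "(\<Sum>j<m. card {a\<in>A. a mod m = j}) = m * card {a\<in>A. a mod m = i}" by simp
  then show "card A = m * card {a\<in>A. a mod m = i}"
    using card_by_residue[of A m] tiling_finite[OF t] m by simp
  then show "m * card {a\<in>A. a mod m = i} * card B = 144" using tiling_card[OF t] by simp
qed

text \<open>A slice P of A modulo 3 satisfies 3 |P| |B| = 144 with 3 dividing |B|; since 27 does not
  divide 144, |P| is prime to 3. So P is stable under 72, as a period of the enlarged second factor
  would descend to B, and A would be periodic.\<close>

lemma not_one_class_mod_3:
  assumes np: "nonperiodic_tiling A B" and r: "\<And>b. b \<in> B \<Longrightarrow> b mod 3 = r"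
  shows False
proof -
  note D = nonperiodic_tilingD[OF np]
  have "3 dvd card B" using six_dvd_card np nonperiodic_tiling_commute by blast
  have "stable 72 {a\<in>A. a mod 3 = i}" if i: "i < 3" for i
  proof -
    let ?A = "{a\<in>A. a mod 3 = i}" and ?U = "\<Union>k<3. translate k B"
    have t: "tiling ?A ?U" by (rule tiling_split[OF D(1) _ r i]) simp
    have "\<not> 3 dvd card ?A"
    proof
      assume "3 dvd card ?A"
      then obtain x where x: "card ?A = 3 * x" by blast
      obtain y where y: "card B = 3 * y" using \<open>3 dvd card B\<close> by blast
      have "3 * card ?A * card B = 144" using card_parts(2)[OF D(1) _ _ r i] by simp
      then have "27 * (x * y) = 144" unfolding x y by simp
      then show False by presburger
    qed
    moreover have "stable g B" if "stable g ?U" "3 dvd g" for g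
      by (rule closed_split[OF that(1) _ that(2) D(3) r]) auto
    ultimately show ?thesis using periodic_if_not_3_dvd[OF t] D by auto
  qed
  then have "stable 72 A" by (rule stable_by_residue[OF D(2)]) auto
  then show False using D by simp
qed

text \<open>Elements that differ modulo 2 and modulo 3 have the lowest level at both primes, so such
  a pair cannot occur in both factors. A set without such a pair lies in one class modulo 2 or in
  one class modulo 3, and the latter is excluded.\<close>

lemma one_class_mod_2:
  assumes np: "nonperiodic_tiling A B"
  shows "(\<exists>r. \<forall>b\<in>B. b mod 2 = r) \<or> (\<exists>r. \<forall>a\<in>A. a mod 2 = r)"
proof -
  note D = nonperiodic_tilingD[OF np]
  have line: "\<exists>r. \<forall>b\<in>B. b mod 2 = r"
    if B: "nonperiodic_tiling A B" and nu: "\<And>b b'. b \<in> B \<Longrightarrow> b' \<in> B \<Longrightarrow> b mod 2 = b' mod 2 \<or> b mod 3 = b' mod 3" for A B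
  proof (rule ccontr)
    assume *: "\<not> ?thesis"
    then obtain b1 where b1: "b1 \<in> B" by blast
    obtain b2 where b2: "b2 \<in> B" "b2 mod 2 \<noteq> b1 mod 2" using * by blast
    have "b mod 3 = b1 mod 3" if "b \<in> B" for b
    proof -
      have "b mod 2 \<noteq> b1 mod 2 \<or> b mod 2 \<noteq> b2 mod 2" using b2 by auto
      then show ?thesis using nu[OF that b1] nu[OF that b2(1)] nu[OF b2(1) b1] b2(2) by auto
    qed
    then show False using not_one_class_mod_3[OF B] by blast
  qed
  show ?thesis
  proof (rule ccontr)
    assume *: "\<not> ?thesis"
    obtain b b' where b: "b \<in> B" "b' \<in> B" "b mod 2 \<noteq> b' mod 2" "b mod 3 \<noteq> b' mod 3"
      using line[OF np] * by blast
    obtain a a' where a: "a \<in> A" "a' \<in> A" "a mod 2 \<noteq> a' mod 2" "a mod 3 \<noteq> a' mod 3"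
      using line[of B A] np nonperiodic_tiling_commute * by blast
    have far: "x mod m \<noteq> y mod m" if "x mod 2 \<noteq> y mod 2" "x mod 3 \<noteq> y mod 3" "m \<in> {2,4,8,16,3,9}" for x y m :: nat
      using that mod_eq_dvd[of x m y 2] mod_eq_dvd[of x m y 3] by auto
    have "sim a a' b b'" unfolding sim_def using far[OF a(3,4)] far[OF b(3,4)] by blast
    then have "a = a'" using tiling_disjoint_diffs[OF D(1)] a b by (auto dest: disjoint_diffsD)
    then show False using a by simp
  qed
qed

text \<open>Put |B| = 6y and let a half of A have 3x elements; then xy = 4. With x = 1 the halves
  would have 3 elements, an odd number, and both would be stable under 48.\<close>

lemma card_half:
  assumes np: "nonperiodic_tiling A B" and r: "\<And>b. b \<in> B \<Longrightarrow> b mod 2 = r" and i: "i < 2"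
  shows "card B = 6 \<and> card {a\<in>A. a mod 2 = i} = 12 \<or> card B = 12 \<and> card {a\<in>A. a mod 2 = i} = 6"
proof -
  note D = nonperiodic_tilingD[OF np]
  have parts: "card A = 2 * card {a\<in>A. a mod 2 = j}" "2 * card {a\<in>A. a mod 2 = j} * card B = 144" if "j < 2" for j
    using card_parts[OF D(1) _ _ r that] by auto
  have "2 dvd card B" "3 dvd card B" using six_dvd_card np nonperiodic_tiling_commute by blast+
  then have "6 dvd card B" by presburger
  then obtain y where y: "card B = 6 * y" by blast
  have "3 dvd card A" using six_dvd_card[OF np] by simp
  then have "3 dvd card {a\<in>A. a mod 2 = i}" using parts(1)[OF i] by presburger
  then obtain x where x: "card {a\<in>A. a mod 2 = i} = 3 * x" by blast
  have xy: "x * y = 4" using parts(2)[OF i] x y by simp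
  then have "x dvd 4" by (metis dvd_triv_left)
  then have "x \<le> 4" by (simp add: dvd_imp_le)
  moreover have "x \<noteq> 1"
  proof
    assume x1: "x = 1"
    have "stable 48 {a\<in>A. a mod 2 = j}" if j: "j < 2" for j
    proof -
      let ?A = "{a\<in>A. a mod 2 = j}" and ?U = "\<Union>k<2. translate k B"
      have t: "tiling ?A ?U" by (rule tiling_split[OF D(1) _ r j]) simp
      have "card ?A = 3" using parts(1)[OF i] parts(1)[OF j] x x1 by simp
      moreover have "stable g B" if "stable g ?U" "2 dvd g" for g
        by (rule closed_split[OF that(1) _ that(2) D(3) r]) auto
      ultimately show ?thesis using periodic_if_not_2_dvd[OF t] D by auto
    qed
    then have "stable 48 A" by (rule stable_by_residue[OF D(2)]) auto
    then show False using D by simp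
  qed
  moreover have "x \<noteq> 3"
  proof
    assume "x = 3"
    then have "3 * y = 4" using xy by simp
    then show False by presburger
  qed
  ultimately have "x = 2 \<or> x = 4" using xy by (cases "x = 0") (auto simp: le_Suc_eq numeral_eq_Suc)
  then show ?thesis using xy x y by auto
qed

text \<open>The elements whose shift by g stays in A form a set stable under g, since 2g = 0; the
  others are stable under h by hypothesis. Both sizes are multiples of coset sizes, which for small
  |A| leaves only one kind.\<close>

lemma dichotomy_split:
  assumes A: "A \<subseteq> Z144" and sp: "\<And>n. mem A n \<Longrightarrow> \<not> mem A (n + g) \<Longrightarrow> mem A (n + h) \<and> \<not> mem A (n + h + g)"
    and g: "g dvd 144" and h: "h dvd 144" and gg: "2 * g mod 144 = 0"
  shows "\<exists>x y. card A = (144 div g) * x + (144 div h) * y \<and> (x = 0 \<longrightarrow> stable h A) \<and> (y = 0 \<longrightarrow> stable g A)"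
proof -
  let ?P = "{n\<in>A. mem A (n + g)}" and ?R = "{n\<in>A. \<not> mem A (n + g)}"
  have fin: "finite A" using A finite_sub_Z144 by blast
  have mP: "mem ?P n \<longleftrightarrow> mem A n \<and> mem A (n + g)" for n
    by (simp add: mem_def mod_add_left_eq)
  have mR: "mem ?R n \<longleftrightarrow> mem A n \<and> \<not> mem A (n + g)" for n
    by (simp add: mem_def mod_add_left_eq)
  have sP: "stable g ?P"
  proof -
    have "mem A (n + g + g) = mem A n" for n
    proof -
      have "(n + g + g) mod 144 = (n + 2 * g mod 144) mod 144" by (simp add: mod_add_right_eq mult_2 add.assoc)
      then show ?thesis using gg by (simp add: mem_def)
    qed
    then show ?thesis unfolding stable_def mP by blast
  qed
  have sR: "stable h ?R" unfolding stable_def mR using sp by blast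
  have dP: "144 div g dvd card ?P" by (rule closed_dvd_card[OF _ sP g]) (use A in auto)
  have dR: "144 div h dvd card ?R" by (rule closed_dvd_card[OF _ sR h]) (use A in auto)
  obtain x where x: "card ?P = (144 div g) * x" using dP by blast
  obtain y where y: "card ?R = (144 div h) * y" using dR by blast
  have "A = ?P \<union> ?R" by blast
  then have "card A = card ?P + card ?R" using fin card_Un_disjoint[of ?P ?R] by auto
  moreover have "stable h A" if "x = 0"
  proof -
    have "?P = {}" using x that fin by simp
    then have "?R = A" by blast
    then show ?thesis using sR by metis
  qed
  moreover have "stable g A" if "y = 0"
  proof -
    have "?R = {}" using y that fin by simp
    then have "?P = A" by blast
    then show ?thesis using sP by metis
  qed
  ultimately show ?thesis using x y by (intro exI[of _ x] exI[of _ y]) auto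
qed

text \<open>2x + 3y = 6 forces x = 0 or y = 0.\<close>

lemma Cyc_144_card_6:
  assumes P: "P \<subseteq> Z144" "card P = 6" and "144 \<in> Cyc P"
  shows "stable 48 P \<or> stable 72 P"
proof -
  have eq: "cnt P 144 n + cnt P 144 (n + 120) = cnt P 144 (n + 72) + cnt P 144 (n + 48)" for n
    using Cyc_six[OF finite_sub_Z144[OF P(1)] assms(3), of n] by (simp add: add.assoc)
  have *: "mem P (n + 48) \<and> \<not> mem P (n + 48 + 72)" if "mem P n" "\<not> mem P (n + 72)" for n
    using eq[of n] that by (auto simp: cnt_144[OF P(1)] add.assoc split: if_splits)
  obtain x y where xy: "card P = 2 * x + 3 * y" "x = 0 \<longrightarrow> stable 48 P" "y = 0 \<longrightarrow> stable 72 P"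
    using dichotomy_split[OF P(1) *] by auto
  have "x = 0 \<or> y = 0" using xy(1) P by presburger
  then show ?thesis using xy by blast
qed

text \<open>48 and 144 are the divisors of 144 that divide neither 72 nor 16, so the mixed
  difference with these steps vanishes. Then 2x + 9y = 6 or 12 forces y = 0.\<close>

lemma Cyc_48_144_stable:
  assumes P: "P \<subseteq> Z144" "card P = 6 \<or> card P = 12" and C: "48 \<in> Cyc P" "144 \<in> Cyc P"
  shows "stable 72 P"
proof -
  have dd: "dd P 144 72 16 n = 0" for n
    by (rule dd_eq_0[OF finite_sub_Z144[OF P(1)]]) (use C in \<open>auto simp: divisors_144\<close>)
  have *: "mem P (n + 16) \<and> \<not> mem P (n + 16 + 72)" if "mem P n" "\<not> mem P (n + 72)" for n
    using that dd[of n] by (auto simp: dd_def cnt_144[OF P(1)] add.assoc add.commute[of _ n] split: if_splits)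
  obtain x y where xy: "card P = 2 * x + 9 * y" "y = 0 \<longrightarrow> stable 72 P"
    using dichotomy_split[OF P(1) *] by auto
  have "y = 0" using xy(1) P by presburger
  then show ?thesis using xy by blast
qed

text \<open>72 and 144 are the divisors that divide neither 36 nor 48. The full cosets of the
  subgroup of order 4 contribute 4u elements, the remaining elements are stable under 48 and number
  3v; 4u + 3v = 6 or 12 leaves one kind.\<close>

lemma Cyc_72_144_stable:
  assumes P: "P \<subseteq> Z144" "card P = 6 \<or> card P = 12" and C: "72 \<in> Cyc P" "144 \<in> Cyc P"
  shows "stable 48 P \<or> card P = 12 \<and> stable 36 P"
proof -
  have dd: "dd P 144 36 48 n = 0" for n
    by (rule dd_eq_0[OF finite_sub_Z144[OF P(1)]]) (use C in \<open>auto simp: divisors_144\<close>)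
  define f where "f = (\<lambda>n. int (cnt P 144 n))"
  have f1: "f n - f (n + 36) - f (n + 48) + f (n + 84) = 0" for n
    using dd[of n] by (simp add: dd_def f_def add.commute add.left_commute)
  have fm: "f n = (if mem P n then 1 else 0)" for n by (simp add: f_def cnt_144[OF P(1)])
  have fk: "f n - f (n + 36 * k) = f (n + 48) - f (n + 48 + 36 * k)" for n k
  proof (induction k)
    case (Suc k)
    then show ?case using f1[of "n + 36 * k"] by (simp add: algebra_simps)
  qed simp
  let ?S = "{n\<in>P. \<forall>k<4. mem P (n + 36 * k)}" and ?R = "{n\<in>P. \<not> (\<forall>k<4. mem P (n + 36 * k))}"
  have fin: "finite P" using P finite_sub_Z144 by blast
  have mm: "mem P (n mod 144 + k) = mem P (n + k)" for n k by (rule mem_add_mod)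
  have mS: "mem ?S n \<longleftrightarrow> (\<forall>k<4. mem P (n + 36 * k))" for n
    by (auto simp: mem_def mod_add_left_eq dest: spec[of _ 0])
  have mR: "mem ?R n \<longleftrightarrow> mem P n \<and> \<not> (\<forall>k<4. mem P (n + 36 * k))" for n
    by (simp add: mem_def mod_add_left_eq)
  have sS: "stable 36 ?S"
    unfolding stable_def mS
  proof (intro allI impI)
    fix n k assume h: "\<forall>k<4. mem P (n + 36 * k)" and k: "(k::nat) < 4"
    show "mem P (n + 36 + 36 * k)"
    proof (cases "k = 3")
      case True
      then show ?thesis using h[rule_format, of 0] by (simp add: add.assoc)
    next
      case False
      then show ?thesis using h[rule_format, of "Suc k"] k by (simp add: add.assoc)
    qed
  qed
  have sR: "stable 48 ?R"
    unfolding stable_def mR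
  proof (intro allI impI)
    fix n assume "mem P n \<and> \<not> (\<forall>k<4. mem P (n + 36 * k))"
    then obtain k where k: "mem P n" "k < 4" "\<not> mem P (n + 36 * k)" by blast
    have "f (n + 48) - f (n + 48 + 36 * k) = 1" using fk[of n k] k by (simp add: fm)
    then have "mem P (n + 48)" "\<not> mem P (n + 48 + 36 * k)" by (auto simp: fm split: if_splits)
    then show "mem P (n + 48) \<and> \<not> (\<forall>k<4. mem P (n + 48 + 36 * k))" using k by blast
  qed
  have "4 dvd card ?S" using closed_dvd_card[OF _ sS] P by auto
  moreover have "3 dvd card ?R" using closed_dvd_card[OF _ sR] P by auto
  moreover have "card P = card ?S + card ?R"
  proof -
    have "P = ?S \<union> ?R" by blast
    then show ?thesis using fin card_Un_disjoint[of ?S ?R] by auto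
  qed
  ultimately have "card ?S = 0 \<or> card P = 12 \<and> card ?R = 0" using P(2) by presburger
  then show ?thesis
  proof
    assume "card ?S = 0"
    then have "?S = {}" using fin by simp
    then have "?R = P" by blast
    then show ?thesis using sR by metis
  next
    assume c: "card P = 12 \<and> card ?R = 0"
    then have "?R = {}" using fin by simp
    then have "?S = P" by blast
    then show ?thesis using sS c by metis
  qed
qed

lemma crt_iff:
  fixes a b m n :: nat
  assumes "coprime m n"
  shows "a mod (m * n) = b mod (m * n) \<longleftrightarrow> a mod m = b mod m \<and> a mod n = b mod n"
proof
  assume e: "a mod (m * n) = b mod (m * n)"
  show "a mod m = b mod m \<and> a mod n = b mod n"
    using mod_eq_dvd[OF e, of m] mod_eq_dvd[OF e, of n] by simp
next
  assume "a mod m = b mod m \<and> a mod n = b mod n"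
  then show "a mod (m * n) = b mod (m * n)"
    using coprime_cong_mult_nat[of a b m n] assms by (simp add: cong_def)
qed

lemma crt12: "a mod 12 = b mod (12::nat) \<longleftrightarrow> a mod 4 = b mod 4 \<and> a mod 3 = b mod 3"
  using crt_iff[of 4 3 a b] by (simp add: coprime_iff_gcd_eq_1 gcd_non_0_nat)

lemma crt24: "a mod 24 = b mod (24::nat) \<longleftrightarrow> a mod 8 = b mod 8 \<and> a mod 3 = b mod 3"
  using crt_iff[of 8 3 a b] by (simp add: coprime_iff_gcd_eq_1 gcd_non_0_nat)

lemma crt48: "a mod 48 = b mod (48::nat) \<longleftrightarrow> a mod 16 = b mod 16 \<and> a mod 3 = b mod 3"
  using crt_iff[of 16 3 a b] by (simp add: coprime_iff_gcd_eq_1 gcd_non_0_nat)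

lemma crt36: "a mod 36 = b mod (36::nat) \<longleftrightarrow> a mod 4 = b mod 4 \<and> a mod 9 = b mod 9"
  using crt_iff[of 4 9 a b] by (simp add: coprime_iff_gcd_eq_1 gcd_non_0_nat)

lemma crt72: "a mod 72 = b mod (72::nat) \<longleftrightarrow> a mod 8 = b mod 8 \<and> a mod 9 = b mod 9"
  using crt_iff[of 8 9 a b] by (simp add: coprime_iff_gcd_eq_1 gcd_non_0_nat)

lemma mod_double:
  fixes a b m :: nat
  assumes "a mod m = b mod m" "m > 0"
  shows "a mod (2 * m) = b mod (2 * m) \<or> a mod (2 * m) = (b + m) mod (2 * m)"
proof -
  have e: "n mod (2 * m) = m * (n div m mod 2) + n mod m" for n
    using mod_mult2_eq[of n m 2] by (simp add: mult.commute)
  have "(b + m) div m = b div m + 1" using assms by simp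
  moreover have "x mod 2 = y mod 2 \<or> x mod 2 = (y + 1) mod 2" for x y :: nat by presburger
  ultimately show ?thesis using assms unfolding e by (metis mod_add_self2)
qed

text \<open>A class modulo m splits into only two classes modulo 2m.\<close>

lemma mod_pigeonhole:
  fixes a b c m :: nat
  assumes "a mod m = b mod m" "b mod m = c mod m" "m > 0"
  shows "a mod (2 * m) = b mod (2 * m) \<or> a mod (2 * m) = c mod (2 * m) \<or> b mod (2 * m) = c mod (2 * m)"
proof -
  have e: "n mod (2 * m) = m * (n div m mod 2) + n mod m" for n
    using mod_mult2_eq[of n m 2] by (simp add: mult.commute)
  have "x mod 2 = y mod 2 \<or> x mod 2 = z mod 2 \<or> y mod 2 = z mod 2" for x y z :: nat
    by (simp add: mod2_eq_if)
  moreover have "x mod (2 * m) = y mod (2 * m)" if "x div m mod 2 = y div m mod 2" "x mod m = y mod m" for x y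
    by (simp only: e that)
  moreover have "a mod m = c mod m" using assms by simp
  ultimately show ?thesis using assms(1,2) by blast
qed

text \<open>A class modulo 3 consists of three classes modulo 9, and \<Phi>_9 makes their counts
  equal.\<close>

lemma Cyc_9_dvd:
  assumes "finite A" "9 \<in> Cyc A"
  shows "3 dvd card {a\<in>A. a mod 3 = t}"
proof (cases "t < 3")
  case True
  have c: "cnt A 9 (n + 3) = cnt A 9 n" for n
    by (rule Cyc_shift[OF assms]) simp
  have "card {a\<in>A. a mod 3 = t} = (\<Sum>i<9. card {a\<in>{a\<in>A. a mod 3 = t}. a mod 9 = i})"
    by (rule card_by_residue) (use assms in auto)
  also have "\<dots> = (\<Sum>i\<in>{t, t + 3, t + 6}. card {a\<in>{a\<in>A. a mod 3 = t}. a mod 9 = i})"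
  proof (intro sum.mono_neutral_right ballI)
    fix i assume i: "i \<in> {..<9} - {t, t + 3, t + 6}"
    have "{a\<in>{a\<in>A. a mod 3 = t}. a mod 9 = i} = {}"
    proof -
      have "a mod 3 \<noteq> t" if "a mod 9 = i" for a
      proof
        assume "a mod 3 = t"
        moreover have "a mod 9 = i mod 9" using that i by simp
        then have "a mod 3 = i mod 3" by (rule mod_eq_dvd) simp
        ultimately have "i mod 3 = t" by simp
        then have "i = t \<or> i = t + 3 \<or> i = t + 6" using i True by simp presburger
        then show False using i by simp
      qed
      then show ?thesis by blast
    qed
    then show "card {a\<in>{a\<in>A. a mod 3 = t}. a mod 9 = i} = 0" by (simp only: card.empty)
  qed (use True in auto)
  also have "\<dots> = (\<Sum>i\<in>{t, t + 3, t + 6}. cnt A 9 i)"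
  proof (intro sum.cong refl)
    fix i assume i: "i \<in> {t, t + 3, t + 6}"
    have "i mod 3 = t" using i True mod_add_eqI[of 3 3 0 t] mod_add_eqI[of 6 3 0 t] by auto
    then have "a mod 3 = t" if "a mod 9 = i mod 9" for a
      using mod_eq_dvd[OF that, of 3] by simp
    moreover have "i mod 9 = i" using i True by auto
    ultimately have "{a\<in>{a\<in>A. a mod 3 = t}. a mod 9 = i} = {a\<in>A. a mod 9 = i mod 9}" by auto
    then show "card {a\<in>{a\<in>A. a mod 3 = t}. a mod 9 = i} = cnt A 9 i" by (simp only: cnt_def)
  qed
  also have "\<dots> = 3 * cnt A 9 t" using c[of t] c[of "t + 3"] by (simp add: add.assoc)
  finally show ?thesis by simp
next
  case False
  then have "{a\<in>A. a mod 3 = t} = {}" by auto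
  then show ?thesis by (metis card.empty dvd_0_right)
qed

text \<open>The common setting for the factor of one parity and for a half of the other factor.
  Distinctness modulo 48 and modulo 72 is enforced by the differences 48 and 72 of the complementary
  factor, see \<open>inj48_if\<close> and \<open>inj72_if\<close>.\<close>

locale core =
  fixes Q :: "nat set"
  assumes Q: "Q \<subseteq> Z144"
    and inj48: "\<And>a b. a \<in> Q \<Longrightarrow> b \<in> Q \<Longrightarrow> a mod 48 = b mod 48 \<Longrightarrow> a = b"
    and inj72: "\<And>a b. a \<in> Q \<Longrightarrow> b \<in> Q \<Longrightarrow> a mod 72 = b mod 72 \<Longrightarrow> a = b"
    and C48: "48 \<in> Cyc Q"
begin

lemma fin: "finite Q" using Q finite_sub_Z144 by blast

lemma cnt48_le: "cnt Q 48 n \<le> 1"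
proof -
  have "\<forall>a\<in>{a\<in>Q. a mod 48 = n mod 48}. \<forall>b\<in>{a\<in>Q. a mod 48 = n mod 48}. a = b"
    by (auto intro: inj48)
  then show ?thesis unfolding cnt_def using card_le_Suc0_iff_eq[of "{a\<in>Q. a mod 48 = n mod 48}"] fin by simp
qed

lemma cnt72_le: "cnt Q 72 n \<le> 1"
proof -
  have "\<forall>a\<in>{a\<in>Q. a mod 72 = n mod 72}. \<forall>b\<in>{a\<in>Q. a mod 72 = n mod 72}. a = b"
    by (auto intro: inj72)
  then show ?thesis unfolding cnt_def using card_le_Suc0_iff_eq[of "{a\<in>Q. a mod 72 = n mod 72}"] fin by simp
qed

lemma cnt_pos: "q \<in> Q \<Longrightarrow> q mod d = n mod d \<Longrightarrow> cnt Q d n \<noteq> 0"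
  using cnt_eq_0_iff[OF fin] by blast

text \<open>As the elements of \<open>Q\<close> are distinct modulo 48, such a \<open>q'\<close> is congruent to \<open>q + 24\<close>
  modulo 48.\<close>

definition paired :: "nat \<Rightarrow> bool" where
  "paired q \<longleftrightarrow> (\<exists>q'\<in>Q. q' \<noteq> q \<and> q' mod 24 = q mod 24)"

lemma paired_mate:
  assumes "q \<in> Q" "q' \<in> Q" "q' \<noteq> q" "q' mod 24 = q mod 24"
  shows "q' mod 48 = (q + 24) mod 48"
  using mod_double[OF assms(4)] inj48[OF assms(2,1)] assms(3) by auto

lemma not_paired_cnt: "q \<in> Q \<Longrightarrow> \<not> paired q \<Longrightarrow> cnt Q 48 (q + 24) = 0"
proof (rule ccontr)
  assume q: "q \<in> Q" "\<not> paired q" and "cnt Q 48 (q + 24) \<noteq> 0"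
  then obtain a where a: "a \<in> Q" "a mod 48 = (q + 24) mod 48" using cnt_posE by blast
  have "a mod 24 = (q + 24) mod 24" using mod_eq_dvd[OF a(2), of 24] by simp
  then have "a mod 24 = q mod 24" using mod_add_eqI[of 24 24 0 q] by simp
  moreover have "a \<noteq> q" using a(2) shift_neq(2)[of 24 48 q] by auto
  ultimately show False using q(2) a(1) unfolding paired_def by blast
qed

text \<open>Counts modulo 48 are at most 1. If q + 24 is missing, c(q) + c(q + 40) = c(q + 24) + c(q
  + 16) leaves q + 16 present and q + 40 missing; as 40 = 16 + 24, the new element is again
  unpaired, and the step can be repeated.\<close>

lemma row:
  assumes "q \<in> Q" "\<not> paired q"
  obtains q1 q2 where "q1 \<in> Q" "q1 mod 48 = (q + 16) mod 48" "\<not> paired q1"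
    "q2 \<in> Q" "q2 mod 48 = (q + 32) mod 48" "\<not> paired q2"
proof -
  have step: "\<exists>r\<in>Q. r mod 48 = (q + 16) mod 48 \<and> \<not> paired r" if "q \<in> Q" "\<not> paired q" for q
  proof -
    have eq: "cnt Q 48 q + cnt Q 48 (q + 40) = cnt Q 48 (q + 24) + cnt Q 48 (q + 16)"
      using Cyc_six[OF fin C48, of q] by (simp add: add.assoc)
    have "cnt Q 48 q \<noteq> 0" using cnt_pos that by blast
    then have c: "cnt Q 48 (q + 16) \<noteq> 0" "cnt Q 48 (q + 40) = 0"
      using eq not_paired_cnt[OF that] cnt48_le[of "q + 16"] by simp_all
    obtain r where r: "r \<in> Q" "r mod 48 = (q + 16) mod 48" by (rule cnt_posE[OF c(1)])
    have "\<not> paired r"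
    proof
      assume "paired r"
      then obtain s where s: "s \<in> Q" "s \<noteq> r" "s mod 24 = r mod 24" by (auto simp: paired_def)
      have "s mod 48 = (r + 24) mod 48" using paired_mate[OF r(1) s] .
      also have "\<dots> = (q + 16 + 24) mod 48" by (rule mod_add_cong) (use r in auto)
      finally have "cnt Q 48 (q + 40) \<noteq> 0" using cnt_pos[OF s(1)] by (simp add: add.assoc)
      then show False using c by simp
    qed
    then show ?thesis using r by blast
  qed
  obtain q1 where q1: "q1 \<in> Q" "q1 mod 48 = (q + 16) mod 48" "\<not> paired q1" using step[OF assms] by blast
  obtain q2 where q2: "q2 \<in> Q" "q2 mod 48 = (q1 + 16) mod 48" "\<not> paired q2" using step[OF q1(1,3)] by blast
  have "(q1 + 16) mod 48 = (q + 16 + 16) mod 48" by (rule mod_add_cong) (use q1 in auto)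
  then have "q2 mod 48 = (q + 32) mod 48" using q2(2) by (simp add: add.assoc)
  then show ?thesis using that q1 q2 by blast
qed

lemma row_residue:
  assumes "q \<in> Q" "\<not> paired q" "t < 3"
  obtains u where "u \<in> Q" "u mod 16 = q mod 16" "u mod 3 = t" "\<not> paired u"
proof -
  obtain q1 q2 where q1: "q1 \<in> Q" "q1 mod 48 = (q + 16) mod 48" "\<not> paired q1"
    and q2: "q2 \<in> Q" "q2 mod 48 = (q + 32) mod 48" "\<not> paired q2" using row[OF assms(1,2)] by blast
  have m: "q1 mod 16 = q mod 16" "q2 mod 16 = q mod 16"
    using mod_eq_dvd[OF q1(2), of 16] mod_eq_dvd[OF q2(2), of 16] mod_add_eqI[of 16 16 0 q] mod_add_eqI[of 32 16 0 q]
    by simp_all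
  have n: "q1 mod 3 = (q + 1) mod 3" "q2 mod 3 = (q + 2) mod 3"
    using mod_eq_dvd[OF q1(2), of 3] mod_eq_dvd[OF q2(2), of 3] mod_add_eqI[of 16 3 1 q] mod_add_eqI[of 32 3 2 q]
    by simp_all
  have "t = q mod 3 \<or> t = (q + 1) mod 3 \<or> t = (q + 2) mod 3"
  proof -
    have "q mod 3 = 0 \<or> q mod 3 = 1 \<or> q mod 3 = 2" by auto
    moreover have "t = 0 \<or> t = 1 \<or> t = 2" using assms(3) by auto
    moreover have "(q + 1) mod 3 = (q mod 3 + 1) mod 3" "(q + 2) mod 3 = (q mod 3 + 2) mod 3"
      by (simp_all only: mod_add_left_eq)
    ultimately show ?thesis by (elim disjE) simp_all
  qed
  then show ?thesis
  proof (elim disjE)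
    assume "t = q mod 3"
    then show ?thesis using that[of q] assms by simp
  next
    assume "t = (q + 1) mod 3"
    then show ?thesis using that[of q1] q1 m n by simp
  next
    assume "t = (q + 2) mod 3"
    then show ?thesis using that[of q2] q2 m n by simp
  qed
qed

lemma finite_cell: "finite {a\<in>Q. P a}" using fin by simp

text \<open>If q + 36 were missing, the relation of order 72 would put q, q + 24 and q + 48 into Q
  modulo 72. They agree modulo 24, so two of them would agree modulo 48 and be equal.\<close>

lemma partner:
  assumes C72: "72 \<in> Cyc Q" and q: "q \<in> Q"
  obtains p where "p \<in> Q" "p mod 72 = (q + 36) mod 72"
proof -
  have eq: "cnt Q 72 n + cnt Q 72 (n + 60) = cnt Q 72 (n + 36) + cnt Q 72 (n + 24)" for n
    using Cyc_six[OF fin C72, of n] by (simp add: add.assoc)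
  have "cnt Q 72 (q + 36) \<noteq> 0"
  proof
    assume z: "cnt Q 72 (q + 36) = 0"
    have "cnt Q 72 q \<noteq> 0" using cnt_pos q by blast
    then have 1: "cnt Q 72 (q + 24) \<noteq> 0" "cnt Q 72 (q + 60) = 0"
      using eq[of q] z cnt72_le[of "q + 24"] by simp_all
    have 2: "cnt Q 72 (q + 48) \<noteq> 0"
      using eq[of "q + 24"] 1 by (simp add: add.assoc)
    obtain a where a: "a \<in> Q" "a mod 72 = (q + 24) mod 72" by (rule cnt_posE[OF 1(1)])
    obtain b where b: "b \<in> Q" "b mod 72 = (q + 48) mod 72" by (rule cnt_posE[OF 2])
    have "q mod 24 = a mod 24" "a mod 24 = b mod 24"
      using mod_eq_dvd[OF a(2), of 24] mod_eq_dvd[OF b(2), of 24] mod_add_eqI[of 24 24 0 q] mod_add_eqI[of 48 24 0 q]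
      by simp_all
    then have "q = a \<or> q = b \<or> a = b"
      using mod_pigeonhole[of q 24 a b] inj48 q a(1) b(1) by auto
    moreover have "(q + 24) mod 72 \<noteq> (q + 48) mod 72"
      using shift_neq(2)[of 24 72 "q + 24"] by (simp add: add.assoc)
    moreover have "q mod 72 \<noteq> (q + 24) mod 72" "q mod 72 \<noteq> (q + 48) mod 72" by (simp_all add: shift_neq)
    ultimately show False using a(2) b(2) by auto
  qed
  then show ?thesis using that cnt_posE by blast
qed

lemma partner_residues:
  fixes p q :: nat
  assumes "p mod 72 = (q + 36) mod 72"
  shows "p mod 24 = (q + 12) mod 24" "p mod 12 = q mod 12" "p mod 9 = q mod 9" "p \<noteq> q" "q mod 72 = (p + 36) mod 72"
    "q mod 24 = (p + 12) mod 24"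
proof -
  show "p mod 24 = (q + 12) mod 24" "p mod 12 = q mod 12" "p mod 9 = q mod 9"
    using mod_eq_dvd[OF assms, of 24] mod_eq_dvd[OF assms, of 12] mod_eq_dvd[OF assms, of 9]
      mod_add_eqI[of 36 24 12 q] mod_add_eqI[of 36 12 0 q] mod_add_eqI[of 36 9 0 q] by simp_all
  show "p \<noteq> q" using assms shift_neq[of 36 72 q] by auto
  have "(p + 36) mod 72 = (q + 36 + 36) mod 72" by (rule mod_add_cong) (use assms in auto)
  then show q: "q mod 72 = (p + 36) mod 72" using mod_add_eqI[of 72 72 0 q] by (simp add: add.assoc)
  show "q mod 24 = (p + 12) mod 24"
    using mod_eq_dvd[OF q, of 24] mod_add_eqI[of 36 24 12 p] by simp
qed

text \<open>If p were paired with some p', the partner of p' would lie in the class of q modulo 24.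
  As q is unpaired, it would be q, and then p' = p by distinctness modulo 72.\<close>

lemma partner_not_paired:
  assumes C72: "72 \<in> Cyc Q" and q: "q \<in> Q" "\<not> paired q" and p: "p \<in> Q" "p mod 72 = (q + 36) mod 72"
  shows "\<not> paired p"
proof
  assume "paired p"
  then obtain p' where p': "p' \<in> Q" "p' \<noteq> p" "p' mod 24 = p mod 24" by (auto simp: paired_def)
  obtain r where r: "r \<in> Q" "r mod 72 = (p' + 36) mod 72" using partner[OF C72 p'(1)] .
  have "r mod 24 = (p' + 12) mod 24" using partner_residues[OF r(2)] by simp
  also have "\<dots> = (p + 12) mod 24" by (rule mod_add_cong) (use p' in auto)
  also have "\<dots> = q mod 24" using partner_residues[OF p(2)] by simp
  finally have "r = q" using q r by (auto simp: paired_def)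
  then have "p' mod 72 = (q + 36) mod 72" using partner_residues(5)[OF r(2)] by simp
  then show False using inj72[OF p'(1) p(1)] p(2) p'(2) by simp
qed

text \<open>A class modulo 12 splits into two classes modulo 24, that of q and that of its partner,
  and neither contains a second element.\<close>

lemma cell_not_paired:
  assumes C72: "72 \<in> Cyc Q" and q: "q \<in> Q" "\<not> paired q"
  obtains p where "p \<in> Q" "p mod 72 = (q + 36) mod 72" "{a\<in>Q. a mod 12 = q mod 12} = {q, p}" "p \<noteq> q" "\<not> paired p"
proof -
  obtain p where p: "p \<in> Q" "p mod 72 = (q + 36) mod 72" using partner[OF C72 q(1)] .
  note pr = partner_residues[OF p(2)]
  have np: "\<not> paired p" using partner_not_paired[OF C72 q p] .
  have "a = q \<or> a = p" if "a \<in> Q" "a mod 12 = q mod 12" for a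
  proof -
    have "a mod 24 = q mod 24 \<or> a mod 24 = (q + 12) mod 24"
      using mod_double[of a 12 q] that by simp
    then have "a mod 24 = q mod 24 \<or> a mod 24 = p mod 24" using pr by simp
    then show ?thesis using q np that(1) p(1) by (auto simp: paired_def)
  qed
  then have "{a\<in>Q. a mod 12 = q mod 12} = {q, p}" using q p pr by auto
  then show ?thesis using that p pr np by blast
qed

text \<open>The row of q meets all three classes modulo 12 inside its class modulo 4, and each of
  these holds exactly an element and its partner.\<close>

lemma slice_not_paired:
  assumes C72: "72 \<in> Cyc Q" and q: "q \<in> Q" "\<not> paired q"
  shows "card {a\<in>Q. a mod 4 = q mod 4} = 6" "\<And>a. a \<in> Q \<Longrightarrow> a mod 4 = q mod 4 \<Longrightarrow> \<not> paired a"
proof -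
  have cell: "card {a\<in>{a\<in>Q. a mod 4 = q mod 4}. a mod 3 = t} = 2
      \<and> (\<forall>a\<in>Q. a mod 4 = q mod 4 \<longrightarrow> a mod 3 = t \<longrightarrow> \<not> paired a)" if t: "t < 3" for t
  proof -
    obtain u where u: "u \<in> Q" "u mod 16 = q mod 16" "u mod 3 = t" "\<not> paired u" using row_residue[OF q t] .
    obtain p where "p \<in> Q" "p mod 72 = (u + 36) mod 72"
      and p: "{a\<in>Q. a mod 12 = u mod 12} = {u, p}" "p \<noteq> u" "\<not> paired p"
      using cell_not_paired[OF C72 u(1,4)] .
    have u4: "u mod 4 = q mod 4" using mod_eq_dvd[OF u(2), of 4] by simp
    have "{a\<in>{a\<in>Q. a mod 4 = q mod 4}. a mod 3 = t} = {a\<in>Q. a mod 12 = u mod 12}"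
      unfolding crt12 using u4 u(3) by auto
    then have e: "{a\<in>{a\<in>Q. a mod 4 = q mod 4}. a mod 3 = t} = {u, p}" using p(1) by simp
    have "\<not> paired a" if "a \<in> Q" "a mod 4 = q mod 4" "a mod 3 = t" for a
    proof -
      have "a \<in> {a\<in>{a\<in>Q. a mod 4 = q mod 4}. a mod 3 = t}" using that by simp
      then have "a = u \<or> a = p" unfolding e by simp
      then show ?thesis using u p by auto
    qed
    moreover have "card {u, p} = 2" using p by simp
    ultimately show ?thesis using e by simp
  qed
  have "card {a\<in>Q. a mod 4 = q mod 4} = (\<Sum>t<3. card {a\<in>{a\<in>Q. a mod 4 = q mod 4}. a mod 3 = t})"
    by (rule card_by_residue) (use finite_cell in auto)
  also have "\<dots> = (\<Sum>t<(3::nat). 2)" by (intro sum.cong) (use cell in auto)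
  finally show "card {a\<in>Q. a mod 4 = q mod 4} = 6" by simp
  show "\<not> paired a" if "a \<in> Q" "a mod 4 = q mod 4" for a
    using cell[of "a mod 3"] that by simp
qed

text \<open>The element q, its mate and the partners of both are four elements; more do not fit,
  since a class modulo 12 has only four residues modulo 48. Two of the resulting differences are
  recorded because they will collide with differences of the other factor.\<close>

lemma paired_cell:
  assumes C72: "72 \<in> Cyc Q" and q: "q \<in> Q" "paired q"
  shows "card {a\<in>Q. a mod 12 = q mod 12} = 4"
    and "\<exists>q'\<in>Q. \<exists>p'\<in>Q. q' mod 8 = q mod 8 \<and> q' mod 16 \<noteq> q mod 16 \<and> q' mod 3 = q mod 3 \<and> q' mod 9 \<noteq> q mod 9 \<and>
       p' mod 4 = q mod 4 \<and> p' mod 8 \<noteq> q mod 8 \<and> p' mod 3 = q mod 3 \<and> p' mod 9 \<noteq> q mod 9"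
proof -
  obtain q' where q': "q' \<in> Q" "q' \<noteq> q" "q' mod 24 = q mod 24" using q by (auto simp: paired_def)
  obtain p where p: "p \<in> Q" "p mod 72 = (q + 36) mod 72" using partner[OF C72 q(1)] .
  obtain p' where p': "p' \<in> Q" "p' mod 72 = (q' + 36) mod 72" using partner[OF C72 q'(1)] .
  note pr = partner_residues[OF p(2)] and pr' = partner_residues[OF p'(2)]
  have ne24: "x mod 24 \<noteq> y mod 24" if "x mod 24 = (y + 12) mod 24" for x y :: nat
    using that shift_neq(1)[of 12 24 y] by simp
  have p'24: "p' mod 24 = (q + 12) mod 24"
    using pr'(1) mod_add_cong[OF q'(3) refl, of 12] by simp
  have d1: "q mod 24 \<noteq> p mod 24" "q mod 24 \<noteq> p' mod 24" using ne24[OF pr(1)] ne24[OF p'24] by auto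
  have pp': "p \<noteq> p'"
  proof
    assume "p = p'"
    then have "q mod 72 = q' mod 72" using pr(5) pr'(5) by simp
    then show False using inj72 q q' by blast
  qed
  have q'12: "q' mod 12 = q mod 12" using mod_eq_dvd[OF q'(3), of 12] by simp
  have sub: "{q, q', p, p'} \<subseteq> {a\<in>Q. a mod 12 = q mod 12}"
    using q q' p p' pr pr' q'12 by auto
  have "card {q, q', p, p'} = 4"
  proof -
    have "q \<noteq> p" "q \<noteq> p'" "q' \<noteq> p" "q' \<noteq> p'" "q \<noteq> q'" "p \<noteq> p'"
      using q'(2,3) d1 pp' by metis+
    then show ?thesis by simp
  qed
  moreover have "card {q, q', p, p'} \<le> card {a\<in>Q. a mod 12 = q mod 12}"
    by (rule card_mono[OF finite_cell sub])
  moreover have "card {a\<in>Q. a mod 12 = q mod 12} \<le> 4"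
  proof -
    have "card {a\<in>Q. a mod 12 = q mod 12} = card ((\<lambda>a. a mod 48) ` {a\<in>Q. a mod 12 = q mod 12})"
      by (rule card_image[symmetric]) (auto intro!: inj_onI inj48)
    also have "\<dots> \<le> card {n. n < 48 \<and> n mod 12 = q mod 12}"
      by (rule card_mono) (auto simp: mod_mod_cancel)
    also have "{n. n < 48 \<and> n mod 12 = q mod 12} \<subseteq> (\<lambda>k. 12 * k + q mod 12) ` {..<4}"
    proof
      fix n assume n: "n \<in> {n. n < 48 \<and> n mod 12 = q mod 12}"
      have "n = 12 * (n div 12) + q mod 12" using n by (metis (mono_tags, lifting) mem_Collect_eq mult_div_mod_eq)
      moreover have "n div 12 < 4" using n by auto
      ultimately show "n \<in> (\<lambda>k. 12 * k + q mod 12) ` {..<4}" by blast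
    qed
    then have "card {n. n < 48 \<and> n mod 12 = q mod 12} \<le> card ((\<lambda>k. 12 * k + q mod 12) ` {..<4})"
      by (intro card_mono) auto
    also have "\<dots> \<le> card {..<4::nat}" by (rule card_image_le) simp
    finally show ?thesis by simp
  qed
  ultimately show "card {a\<in>Q. a mod 12 = q mod 12} = 4" by simp
  have "q' mod 8 = q mod 8" "q' mod 3 = q mod 3" using q'(3) by (simp_all add: crt24)
  moreover have "q' mod 16 \<noteq> q mod 16" using inj48[OF q'(1) q(1)] q'(2) \<open>q' mod 3 = q mod 3\<close> by (auto simp: crt48)
  moreover have n9: "q' mod 9 \<noteq> q mod 9" using inj72[OF q'(1) q(1)] q'(2) \<open>q' mod 8 = q mod 8\<close> by (auto simp: crt72)
  moreover have p12: "p' mod 12 = q mod 12" using pr'(2) q'12 by simp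
  then have "p' mod 4 = q mod 4" "p' mod 3 = q mod 3" by (simp_all add: crt12)
  moreover have "p' mod 8 \<noteq> q mod 8" using d1(2) \<open>p' mod 3 = q mod 3\<close> by (auto simp: crt24)
  moreover have "p' mod 9 \<noteq> q mod 9" using pr'(3) n9 by simp
  ultimately show "\<exists>q'\<in>Q. \<exists>p'\<in>Q. q' mod 8 = q mod 8 \<and> q' mod 16 \<noteq> q mod 16 \<and> q' mod 3 = q mod 3 \<and> q' mod 9 \<noteq> q mod 9 \<and>
       p' mod 4 = q mod 4 \<and> p' mod 8 \<noteq> q mod 8 \<and> p' mod 3 = q mod 3 \<and> p' mod 9 \<noteq> q mod 9"
    using q'(1) p'(1) by blast
qed

lemma all_paired_dvd:
  assumes C72: "72 \<in> Cyc Q" and X: "X \<subseteq> Q" "\<And>a b. a \<in> X \<Longrightarrow> b \<in> Q \<Longrightarrow> a mod 12 = b mod 12 \<Longrightarrow> b \<in> X"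
    and pd: "\<And>a. a \<in> X \<Longrightarrow> paired a"
  shows "4 dvd card X"
proof -
  have "card X = (\<Sum>i<12. card {a\<in>X. a mod 12 = i})"
    by (rule card_by_residue) (use X fin finite_subset in auto)
  moreover have "4 dvd card {a\<in>X. a mod 12 = i}" for i
  proof (cases "{a\<in>X. a mod 12 = i} = {}")
    case False
    then obtain a where a: "a \<in> X" "a mod 12 = i" by blast
    then have "{a\<in>X. a mod 12 = i} = {b\<in>Q. b mod 12 = a mod 12}" using X by auto
    then show ?thesis using paired_cell(1)[OF C72 _ pd[OF a(1)]] a X by auto
  next
    case True
    then show ?thesis by (metis card.empty dvd_0_right)
  qed
  ultimately show ?thesis by (simp add: dvd_sum)
qed

lemma not_paired_if_card_6:
  assumes C72: "72 \<in> Cyc Q" and c: "card Q = 6" and a: "a \<in> Q"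
  shows "\<not> paired a"
proof -
  obtain q where q: "q \<in> Q" "\<not> paired q" using all_paired_dvd[OF C72, of Q] c by auto
  have "{a\<in>Q. a mod 4 = q mod 4} = Q"
    by (rule card_subset_eq[OF fin]) (use slice_not_paired(1)[OF C72 q] c in auto)
  then show ?thesis using slice_not_paired(2)[OF C72 q a] a by blast
qed

text \<open>A class modulo 4 with an unpaired element has 6 elements, so the other class of this
  parity has 6 as well. This is not a multiple of 4, so it contains an unpaired element too.\<close>

lemma not_paired_if_card_12:
  assumes C72: "72 \<in> Cyc Q" and c: "card Q = 12" and par: "\<And>a. a \<in> Q \<Longrightarrow> a mod 2 = r" and ex: "q \<in> Q" "\<not> paired q"
    and a: "a \<in> Q"
  shows "\<not> paired a"
proof (cases "a mod 4 = q mod 4")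
  case True
  then show ?thesis using slice_not_paired(2)[OF C72 ex a] by simp
next
  case False
  let ?X = "{b\<in>Q. b mod 4 \<noteq> q mod 4}"
  have "Q = {b\<in>Q. b mod 4 = q mod 4} \<union> ?X" by blast
  then have "card Q = card {b\<in>Q. b mod 4 = q mod 4} + card ?X"
    using card_Un_disjoint[of "{b\<in>Q. b mod 4 = q mod 4}" ?X] finite_cell by auto
  then have cX: "card ?X = 6" using slice_not_paired(1)[OF C72 ex] c by simp
  have "\<not> (\<forall>b\<in>?X. paired b)"
  proof
    assume "\<forall>b\<in>?X. paired b"
    then have "4 dvd card ?X" by (intro all_paired_dvd[OF C72]) (auto simp: crt12)
    then show False using cX by simp
  qed
  then obtain b where b: "b \<in> Q" "b mod 4 \<noteq> q mod 4" "\<not> paired b" by blast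
  have "a mod 4 = b mod 4"
  proof -
    have e4: "x mod 4 = y mod 4" if "x mod 2 = z mod 2" "y mod 2 = z mod 2" "x mod 4 \<noteq> z mod 4" "y mod 4 \<noteq> z mod 4" for x y z :: nat
      using mod_pigeonhole[of x 2 y z] that by auto
    show ?thesis by (rule e4[of a q b]) (use par a b ex False in auto)
  qed
  then show ?thesis using slice_not_paired(2)[OF C72 b(1,3) a] by simp
qed

text \<open>The row of a contains an element congruent to b modulo 3; if a and b agree modulo 8, it
  agrees with b modulo 24 and must be b. For the second claim, the class of a modulo 12 holds only a
  and its partner, and 36 is a multiple of 9.\<close>

lemma grid_if_not_paired:
  assumes C72: "72 \<in> Cyc Q" and np: "\<And>a. a \<in> Q \<Longrightarrow> \<not> paired a" and ab: "a \<in> Q" "b \<in> Q" "a mod 4 = b mod 4"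
  shows "a mod 8 = b mod 8 \<Longrightarrow> a mod 16 = b mod 16" "a mod 3 = b mod 3 \<Longrightarrow> a mod 9 = b mod 9"
proof -
  assume 8: "a mod 8 = b mod 8"
  obtain u where u: "u \<in> Q" "u mod 16 = a mod 16" "u mod 3 = b mod 3"
    using row_residue[OF ab(1) np[OF ab(1)], of "b mod 3"] by auto
  have "u mod 24 = b mod 24" using mod_eq_dvd[OF u(2), of 8] u 8 by (simp add: crt24)
  then have "u = b" using np[OF ab(2)] u(1) ab by (auto simp: paired_def)
  then show "a mod 16 = b mod 16" using u by simp
next
  assume 3: "a mod 3 = b mod 3"
  obtain p where "p \<in> Q" and p: "p mod 72 = (a + 36) mod 72" "{b\<in>Q. b mod 12 = a mod 12} = {a, p}"
    and "p \<noteq> a" "\<not> paired p"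
    using cell_not_paired[OF C72 ab(1) np[OF ab(1)]] .
  have "b \<in> {b\<in>Q. b mod 12 = a mod 12}" using 3 ab by (simp add: crt12)
  then have "b = a \<or> b = p" unfolding p(2) by simp
  then show "a mod 9 = b mod 9" using partner_residues(3)[OF p(1)] by auto
qed

text \<open>The elements in one class modulo 3 would number a multiple of 3 by \<Phi>_9 and a
  multiple of 4 by pairing. Having one parity and distinct residues modulo 48, they are at most
  8.\<close>

lemma Cyc_9_all_paired:
  assumes C72: "72 \<in> Cyc Q" and pd: "\<And>a. a \<in> Q \<Longrightarrow> paired a" and par: "\<And>a. a \<in> Q \<Longrightarrow> a mod 2 = r" and ne: "Q \<noteq> {}"
  shows "9 \<notin> Cyc Q"
proof
  assume C9: "9 \<in> Cyc Q"
  obtain q where q: "q \<in> Q" using ne by blast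
  let ?X = "{a\<in>Q. a mod 3 = q mod 3}"
  have "3 dvd card ?X" using Cyc_9_dvd[OF fin C9] .
  moreover have "4 dvd card ?X" by (rule all_paired_dvd[OF C72]) (use pd in \<open>auto simp: crt12\<close>)
  moreover have "card ?X \<le> 8"
  proof -
    have "card ?X = card ((\<lambda>a. a mod 48 div 6) ` ?X)"
    proof (rule card_image[symmetric], rule inj_onI)
      fix x y assume xy: "x \<in> ?X" "y \<in> ?X" "x mod 48 div 6 = y mod 48 div 6"
      have "x mod 2 = y mod 2" "x mod 3 = y mod 3" using par xy(1,2) by auto
      then have "x mod 6 = y mod 6" using crt_iff[of 2 3 x y] by simp
      then have "x mod 48 mod 6 = y mod 48 mod 6" by (simp add: mod_mod_cancel)
      then have "x mod 48 = y mod 48" using xy(3) by (metis div_mult_mod_eq)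
      then show "x = y" using inj48 xy by blast
    qed
    also have "\<dots> \<le> card {..<8::nat}"
    proof (rule card_mono)
      have "n mod 48 div 6 < 8" for n :: nat by (simp add: less_mult_imp_div_less)
      then show "(\<lambda>a. a mod 48 div 6) ` ?X \<subseteq> {..<8}" by auto
    qed simp
    finally show ?thesis by simp
  qed
  ultimately have "card ?X = 0" by presburger
  then show False using q fin by auto
qed

end

section \<open>Differences of one factor that are excluded from the other\<close>

lemma sim_iff:
  "sim a a' b b' \<longleftrightarrow> (a mod 2 = a' mod 2 \<longleftrightarrow> b mod 2 = b' mod 2) \<and> (a mod 4 = a' mod 4 \<longleftrightarrow> b mod 4 = b' mod 4) \<and>
    (a mod 8 = a' mod 8 \<longleftrightarrow> b mod 8 = b' mod 8) \<and> (a mod 16 = a' mod 16 \<longleftrightarrow> b mod 16 = b' mod 16) \<and>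
    (a mod 3 = a' mod 3 \<longleftrightarrow> b mod 3 = b' mod 3) \<and> (a mod 9 = a' mod 9 \<longleftrightarrow> b mod 9 = b' mod 9)"
  unfolding sim_def by blast

lemma less_144: "A \<subseteq> Z144 \<Longrightarrow> a \<in> A \<Longrightarrow> a < 144"
  by (auto simp: Z144_def)

lemma disjoint_diffs_commute:
  assumes "B \<subseteq> Z144" "disjoint_diffs A B"
  shows "disjoint_diffs B A"
  unfolding disjoint_diffs_def
proof (intro ballI impI)
  fix b b' a a' assume h: "b \<in> B" "b' \<in> B" "a \<in> A" "a' \<in> A" "sim b b' a a'"
  have "sim a a' b b'" using h(5) unfolding sim_iff by blast
  then have "a = a'" using disjoint_diffsD[OF assms(2)] h by blast
  then have "b mod 16 = b' mod 16" "b mod 9 = b' mod 9" using h(5) unfolding sim_iff by blast+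
  then show "b = b'" using crt_eq[OF less_144[OF assms(1) h(1)] less_144[OF assms(1) h(2)]] by simp
qed

lemma disjoint_diffs_mono: "disjoint_diffs A B \<Longrightarrow> A' \<subseteq> A \<Longrightarrow> B' \<subseteq> B \<Longrightarrow> disjoint_diffs A' B'"
  unfolding disjoint_diffs_def by blast

lemma mod_chain:
  fixes a b :: nat
  shows "a mod 16 = b mod 16 \<Longrightarrow> a mod 8 = b mod 8" "a mod 8 = b mod 8 \<Longrightarrow> a mod 4 = b mod 4"
    "a mod 4 = b mod 4 \<Longrightarrow> a mod 2 = b mod 2" "a mod 9 = b mod 9 \<Longrightarrow> a mod 3 = b mod 3"
  by (erule mod_eq_dvd, simp)+

lemma disjoint_diffs_mem:
  assumes "disjoint_diffs A B" "mem A x" "mem A y" "b \<in> B" "b' \<in> B" "sim x y b b'"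
  shows "x mod 144 = y mod 144"
proof -
  have "sim (x mod 144) (y mod 144) b b'"
    using assms(6) unfolding sim_iff by (simp add: mod_mod_cancel)
  then show ?thesis using disjoint_diffsD[OF assms(1)] assms by (auto simp: mem_def)
qed

text \<open>The difference 48 vanishes modulo 16 and modulo 3 but not modulo 9; distinct elements of
  B congruent modulo 48 would have a difference of the same class.\<close>

lemma inj48_if:
  assumes dis: "disjoint_diffs A B" and n: "mem A n" "mem A (n + 48)" and B: "B \<subseteq> Z144"
    and b: "b \<in> B" "b' \<in> B" "b mod 48 = b' mod 48"
  shows "b = b'"
proof (rule ccontr)
  assume ne: "b \<noteq> b'"
  have b16: "b mod 16 = b' mod 16" "b mod 3 = b' mod 3" using b(3) unfolding crt48 by auto
  then have b9: "b mod 9 \<noteq> b' mod 9" using crt_eq[OF less_144[OF B b(1)] less_144[OF B b(2)]] ne by auto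
  have n16: "n mod 16 = (n + 48) mod 16" "n mod 3 = (n + 48) mod 3"
    using mod_add_eqI[of 48 16 0 n] mod_add_eqI[of 48 3 0 n] by simp_all
  have "n mod 9 \<noteq> (n + 48) mod 9"
    using shift_neq(2)[of 3 9 n] mod_add_eqI[of 48 9 3 n] by simp
  then have "sim n (n + 48) b b'" unfolding sim_iff using b16 b9 n16 mod_chain by blast
  then have "n mod 144 = (n + 48) mod 144" using disjoint_diffs_mem[OF dis n b(1,2)] by blast
  then show False using shift_neq(2)[of 48 144 n] by simp
qed

lemma inj72_if:
  assumes dis: "disjoint_diffs A B" and n: "mem A n" "mem A (n + 72)" and B: "B \<subseteq> Z144"
    and b: "b \<in> B" "b' \<in> B" "b mod 72 = b' mod 72"
  shows "b = b'"
proof (rule ccontr)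
  assume ne: "b \<noteq> b'"
  have b8: "b mod 8 = b' mod 8" "b mod 9 = b' mod 9" using b(3) unfolding crt72 by auto
  then have b16: "b mod 16 \<noteq> b' mod 16" using crt_eq[OF less_144[OF B b(1)] less_144[OF B b(2)]] ne by auto
  have n8: "n mod 8 = (n + 72) mod 8" "n mod 9 = (n + 72) mod 9"
    using mod_add_eqI[of 72 8 0 n] mod_add_eqI[of 72 9 0 n] by simp_all
  have "n mod 16 \<noteq> (n + 72) mod 16"
    using shift_neq(2)[of 8 16 n] mod_add_eqI[of 72 16 8 n] by simp
  then have "sim n (n + 72) b b'" unfolding sim_iff using b16 b8 n8 mod_chain by blast
  then have "n mod 144 = (n + 72) mod 144" using disjoint_diffs_mem[OF dis n b(1,2)] by blast
  then show False using shift_neq(2)[of 72 144 n] by simp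
qed

lemma Cyc_9_triple:
  assumes "finite P" "9 \<in> Cyc P" "a \<in> P"
  obtains b c where "b \<in> P" "b mod 9 = (a + 3) mod 9" "c \<in> P" "c mod 9 = (a + 6) mod 9"
proof -
  have c: "cnt P 9 (n + 3) = cnt P 9 n" for n
    by (rule Cyc_shift[OF assms(1,2)]) simp
  have "cnt P 9 a \<noteq> 0" using cnt_eq_0_iff[OF assms(1)] assms(3) by blast
  then have "cnt P 9 (a + 3) \<noteq> 0" "cnt P 9 (a + 6) \<noteq> 0" using c[of a] c[of "a + 3"] by (simp_all add: add.assoc)
  then show ?thesis using that cnt_posE by metis
qed

lemma shifts_mod_9:
  fixes a b c :: nat
  assumes "b mod 9 = (a + 3) mod 9" "c mod 9 = (a + 6) mod 9"
  shows "b mod 3 = a mod 3" "c mod 3 = a mod 3" "b mod 9 \<noteq> a mod 9" "c mod 9 \<noteq> a mod 9" "b mod 9 \<noteq> c mod 9"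
  using mod_eq_dvd[OF assms(1), of 3] mod_eq_dvd[OF assms(2), of 3] mod_add_eqI[of 3 3 0 a] mod_add_eqI[of 6 3 0 a]
    shift_neq(1)[of 3 9 a] shift_neq(1)[of 6 9 a] shift_neq(1)[of 3 9 "a + 3"] assms
  by (simp_all add: add.assoc)

context core
begin

text \<open>Here P will be a half of the other factor in the case that \<Phi>_72 does not divide the
  factor of size 6. Its difference 36 makes elements of Q that are congruent modulo 4 and 9 equal;
  the rest depends on which side \<Phi>_9 divides.\<close>

lemma grid_2_2:
  assumes c: "card Q = 6" and par: "\<And>a. a \<in> Q \<Longrightarrow> a mod 2 = r"
    and P: "P \<subseteq> Z144" "stable 36 P" "\<not> stable 48 P" "\<And>a. a \<in> P \<Longrightarrow> a mod 2 = s"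
    and dis: "disjoint_diffs P Q" and C9: "9 \<in> Cyc P \<or> 9 \<in> Cyc Q"
    and ab: "a \<in> Q" "b \<in> Q"
  shows "a mod 4 = b mod 4 \<Longrightarrow> a mod 16 = b mod 16" "a mod 3 = b mod 3 \<Longrightarrow> a mod 9 = b mod 9"
proof -
  have finP: "finite P" using P finite_sub_Z144 by blast
  obtain p where p: "mem P p" "\<not> mem P (p + 48)" using P(3) by (auto simp: stable_def)
  define p0 where "p0 = p mod 144"
  have p0: "p0 \<in> P" "mem P p0" "\<not> mem P (p0 + 48)"
    using p by (simp_all add: p0_def mem_def mod_add_left_eq)
  have no36: "x mod 8 = y mod 8" if "x \<in> Q" "y \<in> Q" "x mod 4 = y mod 4" "x mod 9 = y mod 9" for x y
  proof (rule ccontr)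
    assume 8: "x mod 8 \<noteq> y mod 8"
    have m: "p0 mod 4 = (p0 + 36) mod 4" "p0 mod 9 = (p0 + 36) mod 9" "p0 mod 8 \<noteq> (p0 + 36) mod 8"
      using mod_add_eqI[of 36 4 0 p0] mod_add_eqI[of 36 9 0 p0] mod_add_eqI[of 36 8 4 p0] shift_neq(2)[of 4 8 p0] by simp_all
    have "sim p0 (p0 + 36) x y" unfolding sim_iff using 8 that m mod_chain by blast
    then have "p0 mod 144 = (p0 + 36) mod 144"
      using disjoint_diffs_mem[OF dis p0(2) _ that(1,2)] P(2) p0(2) by (auto simp: stable_def)
    then show False using shift_neq(2)[of 36 144 p0] by simp
  qed
  have eq: "x = y" if "x \<in> Q" "y \<in> Q" "x mod 4 = y mod 4" "x mod 9 = y mod 9" for x y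
    using no36[OF that] inj72[OF that(1,2)] that(4) by (simp add: crt72)
  have claim: "(a mod 4 = b mod 4 \<longrightarrow> a mod 16 = b mod 16) \<and> (a mod 3 = b mod 3 \<longrightarrow> a mod 9 = b mod 9)"
  proof (cases "9 \<in> Cyc P")
    case True
    obtain b1 c1 where b1: "b1 \<in> P" "b1 mod 9 = (p0 + 3) mod 9" and c1: "c1 \<in> P" "c1 mod 9 = (p0 + 6) mod 9"
      using Cyc_9_triple[OF finP True p0(1)] .
    note m9 = shifts_mod_9[OF b1(2) c1(2)]
    have fill: "mem P n" if "n mod 36 = d mod 36" "d \<in> P" for n d
      by (rule closed_fill[OF P(2) _ in_mem[OF P(1) that(2)] that(1)]) (use that P in \<open>auto simp: Z144_def\<close>)
    \<comment> \<open>Otherwise p0 + 48 would lie in the class of b1 modulo 36, and P contains that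
      class entirely.\<close>
    have b14: "b1 mod 4 \<noteq> p0 mod 4"
    proof
      assume 4: "b1 mod 4 = p0 mod 4"
      have "(p0 + 48) mod 4 = b1 mod 4" "(p0 + 48) mod 9 = b1 mod 9"
        using mod_add_eqI[of 48 4 0 p0] mod_add_eqI[of 48 9 3 p0] 4 b1 by simp_all
      then have "mem P (p0 + 48)" by (intro fill[OF _ b1(1)]) (simp add: crt36)
      then show False using p0 by simp
    qed
    \<comment> \<open>p0, b1, c1 have one parity, and p0, b1 lie in different classes modulo 4, so
      c1 shares its class with one of them.\<close>
    obtain d where d: "d \<in> P" "d mod 4 = c1 mod 4" "d mod 3 = c1 mod 3" "d mod 9 \<noteq> c1 mod 9"
    proof -
      have "p0 mod 2 = b1 mod 2" "b1 mod 2 = c1 mod 2" using P(4) p0 b1 c1 by auto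
      then have "p0 mod 4 = c1 mod 4 \<or> b1 mod 4 = c1 mod 4"
        using mod_pigeonhole[of p0 2 b1 c1] b14 by auto
      then show ?thesis using that[of p0] that[of b1] p0 b1 m9 by auto
    qed
    \<comment> \<open>P is a union of classes modulo 36, which leaves the residue modulo 16 free
      within the class modulo 4. The element x has the residues of c1 + j modulo 16 and of d modulo
      9 (81 and 64 are the Chinese remainder coefficients), so its difference from c1 has a 2-adic
      level that can be prescribed.\<close>
    have far: "\<exists>x. mem P x \<and> x mod 16 = (c1 + j) mod 16 \<and> x mod 9 = d mod 9" if j: "j mod 4 = 0" for j
    proof -
      define x where "x = 81 * (c1 + j) + 64 * d"
      have "x = (c1 + j) + 16 * (5 * (c1 + j) + 4 * d)" "x = d + 9 * (9 * (c1 + j) + 7 * d)"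
        by (simp_all add: x_def algebra_simps)
      then have x: "x mod 16 = (c1 + j) mod 16" "x mod 9 = d mod 9" by (metis mod_mult_self2)+
      have "x mod 4 = (c1 + j) mod 4" using mod_eq_dvd[OF x(1), of 4] by simp
      then have "x mod 4 = d mod 4" using d mod_add_eqI[of j 4 0 c1] j by simp
      then have "mem P x" by (intro fill[OF _ d(1)]) (use x in \<open>simp add: crt36\<close>)
      then show ?thesis using x by blast
    qed
    have memc: "mem P c1" using in_mem[OF P(1) c1(1)] .
    have far2: False if xy: "x \<in> Q" "y \<in> Q" "x mod 4 = y mod 4" "x mod 16 \<noteq> y mod 16" "x mod 3 = y mod 3" "x mod 9 \<noteq> y mod 9" for x y
    proof (cases "x mod 8 = y mod 8")
      case True
      obtain w where w: "mem P w" "w mod 16 = (c1 + 8) mod 16" "w mod 9 = d mod 9" using far[of 8] by auto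
      have "w mod 8 = c1 mod 8" using mod_eq_dvd[OF w(2), of 8] mod_add_eqI[of 8 8 0 c1] by simp
      moreover have "w mod 16 \<noteq> c1 mod 16" using w(2) shift_neq(1)[of 8 16 c1] by simp
      moreover have "w mod 3 = c1 mod 3" "w mod 9 \<noteq> c1 mod 9" using mod_eq_dvd[OF w(3), of 3] w(3) d by auto
      ultimately have "sim w c1 x y" unfolding sim_iff using True xy mod_chain by blast
      then have "w mod 144 = c1 mod 144" using disjoint_diffs_mem[OF dis w(1) memc xy(1,2)] by blast
      then show ?thesis using \<open>w mod 9 \<noteq> c1 mod 9\<close> mod_eq_dvd[of w 144 c1 9] by simp
    next
      case False
      obtain w where w: "mem P w" "w mod 16 = (c1 + 4) mod 16" "w mod 9 = d mod 9" using far[of 4] by auto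
      have "w mod 4 = c1 mod 4" using mod_eq_dvd[OF w(2), of 4] mod_add_eqI[of 4 4 0 c1] by simp
      moreover have "w mod 8 = (c1 + 4) mod 8" using mod_eq_dvd[OF w(2), of 8] by simp
      then have "w mod 8 \<noteq> c1 mod 8" using shift_neq(1)[of 4 8 c1] by simp
      moreover have "w mod 3 = c1 mod 3" "w mod 9 \<noteq> c1 mod 9" using mod_eq_dvd[OF w(3), of 3] w(3) d by auto
      ultimately have "sim w c1 x y" unfolding sim_iff using False xy mod_chain by blast
      then have "w mod 144 = c1 mod 144" using disjoint_diffs_mem[OF dis w(1) memc xy(1,2)] by blast
      then show ?thesis using \<open>w mod 9 \<noteq> c1 mod 9\<close> mod_eq_dvd[of w 144 c1 9] by simp
    qed
    \<comment> \<open>The remaining possibility is blocked by p0 and b1: equal parity, different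
      modulo 4, equal modulo 3, different modulo 9.\<close>
    have m3: "x mod 9 = y mod 9" if xy: "x \<in> Q" "y \<in> Q" "x mod 3 = y mod 3" for x y
    proof (rule ccontr)
      assume 9: "x mod 9 \<noteq> y mod 9"
      have 16: "x mod 16 \<noteq> y mod 16" using inj48[OF xy(1,2)] xy(3) 9 by (auto simp: crt48)
      have 2: "x mod 2 = y mod 2" using par xy by simp
      have 4: "x mod 4 \<noteq> y mod 4" using far2[OF xy(1,2) _ 16 xy(3) 9] by blast
      have "p0 mod 2 = b1 mod 2" using P(4) p0 b1 by auto
      then have "sim p0 b1 x y" unfolding sim_iff using 2 4 9 xy b14 m9 mod_chain by metis
      then have "p0 = b1" using disjoint_diffsD[OF dis p0(1) b1(1) xy(1,2)] by blast
      then show False using b14 by simp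
    qed
    have inj12: "x = y" if "x \<in> Q" "y \<in> Q" "x mod 4 = y mod 4" "x mod 3 = y mod 3" for x y
      using eq m3 that by blast
    have np: "\<not> paired x" if "x \<in> Q" for x
      using inj12 that mod_chain unfolding paired_def crt24 by blast
    have "a mod 16 = b mod 16" if 4: "a mod 4 = b mod 4"
    proof -
      obtain u where u: "u \<in> Q" "u mod 16 = a mod 16" "u mod 3 = b mod 3"
        using row_residue[OF ab(1) np[OF ab(1)], of "b mod 3"] by auto
      have "u mod 4 = b mod 4" using mod_eq_dvd[OF u(2), of 4] 4 by simp
      then have "u = b" using inj12 u ab by blast
      then show ?thesis using u by simp
    qed
    then show ?thesis using m3[OF ab] by blast
  next
    case False
    \<comment> \<open>This case is contradictory. Each class of Q modulo 3 has a multiple of 3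
      elements; it is the union of two classes modulo 12, each of even size at most 3 and hence at
      most 2.\<close>
    then have C9: "9 \<in> Cyc Q" using C9 by blast
    have N: "3 dvd card {x\<in>Q. x mod 3 = t}" for t using Cyc_9_dvd[OF fin C9] .
    have pd: "paired x" if x: "x \<in> Q" for x
    proof (rule ccontr)
      assume np: "\<not> paired x"
      have "card {x\<in>Q. x mod 3 = t} \<ge> 3" if t: "t < 3" for t
      proof -
        obtain u where "u \<in> Q" "u mod 3 = t" using row_residue[OF x np t] by metis
        then have "card {x\<in>Q. x mod 3 = t} \<noteq> 0" using fin by auto
        then show ?thesis using N[of t] by (auto dest: dvd_imp_le)
      qed
      then have "(\<Sum>t<3. card {x\<in>Q. x mod 3 = t}) \<ge> (\<Sum>t<(3::nat). 3)" by (intro sum_mono) auto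
      then show False using card_by_residue[OF fin, of 3] c by simp
    qed
    have c24: "card {y\<in>Q. y mod 24 = x mod 24} = 2" if x: "x \<in> Q" for x
    proof -
      obtain x' where x': "x' \<in> Q" "x' \<noteq> x" "x' mod 24 = x mod 24" using pd[OF x] by (auto simp: paired_def)
      have "y = x \<or> y = x'" if y: "y \<in> Q" "y mod 24 = x mod 24" for y
        using paired_mate[OF x y(1) _ y(2)] paired_mate[OF x x'] inj48[OF y(1) x'(1)] by auto
      then have "{y\<in>Q. y mod 24 = x mod 24} = {x, x'}" using x x' by auto
      then show ?thesis using x' by simp
    qed
    have c12: "card {y\<in>Q. y mod 12 = i} \<le> 2 \<and> even (card {y\<in>Q. y mod 12 = i})" for i
    proof -
      let ?X = "{y\<in>Q. y mod 12 = i}"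
      have "card ?X = (\<Sum>j<24. card {y\<in>?X. y mod 24 = j})"
        by (rule card_by_residue) (use fin in auto)
      moreover have "even (card {y\<in>?X. y mod 24 = j})" for j
      proof (cases "{y\<in>?X. y mod 24 = j} = {}")
        case True
        then show ?thesis by (metis card.empty even_zero)
      next
        case False
        then obtain x where x: "x \<in> Q" "x mod 12 = i" "x mod 24 = j" by blast
        have "y mod 12 = i" if "y mod 24 = j" for y
          using mod_eq_dvd[of y 24 x 12] that x by simp
        then have "{y\<in>?X. y mod 24 = j} = {y\<in>Q. y mod 24 = x mod 24}" using x by auto
        then show ?thesis using c24[OF x(1)] by simp
      qed
      ultimately have ev: "even (card ?X)" by (simp add: dvd_sum)
      have "card ?X = card ((\<lambda>y. y mod 9 div 3) ` ?X)"
      proof (rule card_image[symmetric], rule inj_onI)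
        fix x y assume xy: "x \<in> ?X" "y \<in> ?X" "x mod 9 div 3 = y mod 9 div 3"
        have "x mod 12 = y mod 12" using xy by simp
        then have 43: "x mod 4 = y mod 4" "x mod 3 = y mod 3" unfolding crt12 by auto
        then have "x mod 9 mod 3 = y mod 9 mod 3" by (simp add: mod_mod_cancel)
        then have "x mod 9 = y mod 9" using xy(3) by (metis div_mult_mod_eq)
        then show "x = y" using eq 43 xy by blast
      qed
      also have "\<dots> \<le> card {..<3::nat}"
      proof (rule card_mono)
        have "n mod 9 div 3 < 3" for n :: nat by (simp add: less_mult_imp_div_less)
        then show "(\<lambda>y. y mod 9 div 3) ` ?X \<subseteq> {..<3}" by auto
      qed simp
      finally have "card ?X \<le> 3" by simp
      then show ?thesis using ev by presburger
    qed
    let ?X = "{x\<in>Q. x mod 3 = a mod 3}"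
    have "?X = {x\<in>Q. x mod 12 = a mod 12} \<union> {x\<in>Q. x mod 12 = (a + 6) mod 12}"
    proof -
      have "x mod 3 = a mod 3 \<longleftrightarrow> x mod 12 = a mod 12 \<or> x mod 12 = (a + 6) mod 12" if x: "x \<in> Q" for x
      proof
        assume "x mod 3 = a mod 3"
        moreover have "x mod 2 = a mod 2" using par x ab by simp
        ultimately have "x mod 6 = a mod 6" using crt_iff[of 2 3 x a] by simp
        then show "x mod 12 = a mod 12 \<or> x mod 12 = (a + 6) mod 12" using mod_double[of x 6 a] by simp
      next
        assume "x mod 12 = a mod 12 \<or> x mod 12 = (a + 6) mod 12"
        then show "x mod 3 = a mod 3"
          using mod_eq_dvd[of x 12 a 3] mod_eq_dvd[of x 12 "a + 6" 3] mod_add_eqI[of 6 3 0 a] by auto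
      qed
      then show ?thesis by blast
    qed
    moreover have "{x\<in>Q. x mod 12 = a mod 12} \<inter> {x\<in>Q. x mod 12 = (a + 6) mod 12} = {}"
      using shift_neq(2)[of 6 12 a] by auto
    ultimately have "card ?X = card {x\<in>Q. x mod 12 = a mod 12} + card {x\<in>Q. x mod 12 = (a + 6) mod 12}"
      using finite_cell by (simp add: card_Un_disjoint)
    then have "card ?X \<le> 4" "even (card ?X)" using c12[of "a mod 12"] c12[of "(a + 6) mod 12"] by auto
    then have "card ?X = 0" using N[of "a mod 3"] by presburger
    then show ?thesis using ab fin by auto
  qed
  show "a mod 4 = b mod 4 \<Longrightarrow> a mod 16 = b mod 16" "a mod 3 = b mod 3 \<Longrightarrow> a mod 9 = b mod 9"
    using claim by auto
qed

end

text \<open>A set of pairwise related elements is part of a product: inside one class modulo M it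
  has at most one residue modulo 16 in each of the W classes modulo M * W, and at most one residue
  modulo 9 over each residue modulo 3. With 3 * W elements it is the full product, a grid.\<close>

definition RG :: "nat \<Rightarrow> nat \<Rightarrow> nat \<Rightarrow> nat \<Rightarrow> bool" where
  "RG M W a b \<longleftrightarrow> a mod M = b mod M \<and> (a mod (M * W) = b mod (M * W) \<longrightarrow> a mod 16 = b mod 16) \<and>
     (a mod 3 = b mod 3 \<longrightarrow> a mod 9 = b mod 9)"

text \<open>These are the differences that a full grid leaves free. Among elements congruent modulo
  M, it realizes those that are nonzero modulo M * W, except the ones that vanish modulo 3 and not
  modulo 9, and those that vanish modulo 16 and not modulo 3.\<close>

definition RC :: "nat \<Rightarrow> nat \<Rightarrow> nat \<Rightarrow> nat \<Rightarrow> bool" where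
  "RC M W a b \<longleftrightarrow> (a mod M = b mod M \<longrightarrow>
     (a mod (M * W) \<noteq> b mod (M * W) \<longrightarrow> a mod 3 = b mod 3 \<and> a mod 9 \<noteq> b mod 9) \<and>
     (a mod 16 = b mod 16 \<longrightarrow> a mod 3 = b mod 3))"

definition all_pairs :: "(nat \<Rightarrow> nat \<Rightarrow> bool) \<Rightarrow> nat set \<Rightarrow> bool" where
  "all_pairs R A \<longleftrightarrow> (\<forall>a\<in>A. \<forall>b\<in>A. R a b)"

text \<open>Grids of type (2, 2) and (4, 2) have 6 elements and occur in (I) and (III); those of
  type (2, 4) have 12 and occur in (IV). Type (4, 2) is also the building block in (II) and in the
  unions of two grids of (IV).\<close>

definition levels :: "nat \<Rightarrow> nat \<Rightarrow> bool" where
  "levels M W \<longleftrightarrow> (M, W) \<in> {(2, 2), (4, 2), (2, 4)}"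

lemma levelsE:
  assumes "levels M W"
  obtains "M = 2" "W = 2" | "M = 4" "W = 2" | "M = 2" "W = 4"
  using assms unfolding levels_def by blast

lemma all_pairsD: "all_pairs R A \<Longrightarrow> a \<in> A \<Longrightarrow> b \<in> A \<Longrightarrow> R a b"
  unfolding all_pairs_def by blast

lemma sim_RG_RC:
  assumes "levels M W" "sim a a' b b'" "RG M W b b'" "RC M W a a'"
  shows "a mod 16 = a' mod 16 \<and> a mod 9 = a' mod 9"
  using assms(1)
  by (cases rule: levelsE; use assms(2-4) in \<open>auto simp: sim_iff RG_def RC_def\<close>)

lemma RG_RC_disjoint:
  assumes "levels M W" "A \<subseteq> Z144"
    and "\<And>a a' b b'. a \<in> A \<Longrightarrow> a' \<in> A \<Longrightarrow> b \<in> B \<Longrightarrow> b' \<in> B \<Longrightarrow> sim a a' b b' \<Longrightarrow> RG M W b b' \<and> RC M W a a'"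
  shows "disjoint_diffs A B"
  unfolding disjoint_diffs_def
proof (intro ballI impI)
  fix a a' b b' assume h: "a \<in> A" "a' \<in> A" "b \<in> B" "b' \<in> B" "sim a a' b b'"
  have "a mod 16 = a' mod 16 \<and> a mod 9 = a' mod 9"
    using sim_RG_RC[OF assms(1) h(5)] assms(3)[OF h] by blast
  then show "a = a'" using crt_eq[OF less_144[OF assms(2) h(1)] less_144[OF assms(2) h(2)]] by blast
qed

lemma card_classes:
  assumes "levels M W"
  shows "card {c. c < M * W \<and> c mod M = q mod M} = W"
proof -
  have q: "q mod M < M" using assms by (cases rule: levelsE) auto
  have "{c. c < M * W \<and> c mod M = q mod M} = (\<lambda>k. q mod M + M * k) ` {..<W}"
  proof (intro equalityI subsetI)
    fix c assume c: "c \<in> {c. c < M * W \<and> c mod M = q mod M}"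
    then have "c = q mod M + M * (c div M)" by (metis (mono_tags, lifting) mem_Collect_eq mod_mult_div_eq)
    moreover have "c div M < W" using c by (simp add: less_mult_imp_div_less mult.commute)
    ultimately show "c \<in> (\<lambda>k. q mod M + M * k) ` {..<W}" by blast
  next
    fix c assume "c \<in> (\<lambda>k. q mod M + M * k) ` {..<W}"
    then obtain k where k: "k < W" "c = q mod M + M * k" by auto
    have "M * Suc k \<le> M * W" using k by (intro mult_le_mono2) simp
    then show "c \<in> {c. c < M * W \<and> c mod M = q mod M}" using k q by simp
  qed
  moreover have "inj_on (\<lambda>k. q mod M + M * k) {..<W}" using q by (auto simp: inj_on_def)
  ultimately show ?thesis by (simp add: card_image)
qed

text \<open>There are W * 3 pairs of a class modulo M * W in the given class modulo M and a residue
  modulo 3. The elements have distinct pairs, so every pair occurs.\<close>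

lemma grid_full:
  assumes lv: "levels M W" and B: "B \<subseteq> Z144" "all_pairs (RG M W) B" "card B = 3 * W" and q: "q \<in> B" "x mod M = q mod M"
  obtains b where "b \<in> B" "b mod (M * W) = x mod (M * W)" "b mod 3 = y mod 3"
proof -
  let ?f = "\<lambda>b. (b mod (M * W), b mod 3)"
  let ?T = "{c. c < M * W \<and> c mod M = q mod M} \<times> {..<3::nat}"
  have MW: "M * W > 0" "M > 0" using lv by (cases rule: levelsE; simp)+
  have inj: "inj_on ?f B"
  proof (rule inj_onI)
    fix a b assume ab: "a \<in> B" "b \<in> B" "?f a = ?f b"
    then have "RG M W a b" using B(2) all_pairsD by blast
    then have "a mod 16 = b mod 16" "a mod 9 = b mod 9" using ab(3) by (auto simp: RG_def)
    then show "a = b" using crt_eq[OF less_144[OF B(1) ab(1)] less_144[OF B(1) ab(2)]] by blast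
  qed
  have sub: "?f ` B \<subseteq> ?T"
  proof
    fix z assume "z \<in> ?f ` B"
    then obtain b where b: "b \<in> B" "z = ?f b" by blast
    have "b mod M = q mod M" using all_pairsD[OF B(2) b(1) q(1)] by (simp add: RG_def)
    then have "b mod (M * W) mod M = q mod M" by (simp add: mod_mod_cancel)
    then show "z \<in> ?T" using b MW by simp
  qed
  have "card ?T = W * 3" using card_classes[OF lv] by (simp add: card_cartesian_product)
  then have "?f ` B = ?T"
    using sub card_image[OF inj] B(3) by (intro card_subset_eq) auto
  moreover have "(x mod (M * W), y mod 3) \<in> ?T" using q MW by (simp add: mod_mod_cancel)
  ultimately have "(x mod (M * W), y mod 3) \<in> ?f ` B" by simp
  then show ?thesis using that by auto
qed

lemma mod_mono:
  fixes a b :: nat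
  shows "a mod k = b mod k \<Longrightarrow> m dvd k \<Longrightarrow> a mod m = b mod m"
  by (rule mod_eq_dvd)

text \<open>A full grid realizes the differences that the relation \<open>RC\<close> forbids.\<close>

lemma RC_if_disjoint:
  assumes lv: "levels M W" and B: "B \<subseteq> Z144" "all_pairs (RG M W) B" "card B = 3 * W" and dis: "disjoint_diffs A B"
  shows "all_pairs (RC M W) A"
  unfolding all_pairs_def
proof (intro ballI)
  fix a a' assume a: "a \<in> A" "a' \<in> A"
  have "B \<noteq> {}" using lv B(3) by (cases rule: levelsE) auto
  then obtain q where q: "q \<in> B" by blast
  have no: False if "sim a a' b q" "b \<in> B" "a \<noteq> a'" for b
    using disjoint_diffsD[OF dis a that(2) q that(1)] that(3) by blast
  have MW: "M dvd 16" "M * W dvd 16" "M dvd M * W" "2 dvd M" using lv by (cases rule: levelsE; simp)+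
  have step: "RC M W a a'" if aM: "a mod M = a' mod M"
  proof -
    have 1: "a mod 3 = a' mod 3 \<and> a mod 9 \<noteq> a' mod 9" if ne: "a mod (M * W) \<noteq> a' mod (M * W)"
    proof (rule ccontr)
      assume n: "\<not> ?thesis"
      \<comment> \<open>l is the 2-adic level of the difference: a and a' agree modulo l and not
        modulo 2l. It is M, or possibly 2M if W = 4.\<close>
      define l where "l = (if a mod (2 * M) = a' mod (2 * M) then 2 * M else M)"
      have l: "a mod l = a' mod l" "a mod (2 * l) \<noteq> a' mod (2 * l)" "2 * l dvd M * W" "M dvd l"
        using lv aM ne by (cases rule: levelsE; auto simp: l_def)+
      \<comment> \<open>The grid element b, shifted from q by l, is chosen to agree with q modulo 3
        exactly when a and a' agree.\<close>
      define y where "y = (if a mod 3 = a' mod 3 then q else q + 1)"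
      have "(q + l) mod M = q mod M" using l(4) by (auto elim!: dvdE)
      then obtain b where b: "b \<in> B" "b mod (M * W) = (q + l) mod (M * W)" "b mod 3 = y mod 3"
        using grid_full[OF lv B q] by blast
      have l0: "l > 0" using lv by (cases rule: levelsE) (auto simp: l_def)
      have b2: "b mod (2 * l) = (q + l) mod (2 * l)" using b(2) l(3) by (rule mod_mono)
      then have "b mod (2 * l) \<noteq> q mod (2 * l)" using shift_neq(1)[of l "2 * l" q] l0 by simp
      moreover have "b mod l = q mod l" using mod_eq_dvd[OF b2, of l] by simp
      moreover have "b mod 3 = q mod 3 \<longleftrightarrow> a mod 3 = a' mod 3"
        using b(3) shift_neq(1)[of 1 3 q] by (simp add: y_def)
      moreover have "b mod 3 = q mod 3 \<Longrightarrow> b mod 9 = q mod 9"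
        using all_pairsD[OF B(2) b(1) q] by (simp add: RG_def)
      then have "b mod 9 = q mod 9 \<longleftrightarrow> a mod 9 = a' mod 9"
        using n mod_chain(4)[of a a'] mod_chain(4)[of b q] calculation(3) by blast
      moreover have "l = 2 \<or> l = 4" using lv l by (cases rule: levelsE; auto simp: l_def split: if_splits)
      ultimately have "sim a a' b q"
        using l(1,2)
      proof (elim disjE)
        assume h: "l = 2" "a mod l = a' mod l" "a mod (2 * l) \<noteq> a' mod (2 * l)" "b mod (2 * l) \<noteq> q mod (2 * l)" "b mod l = q mod l"
          and m: "b mod 3 = q mod 3 \<longleftrightarrow> a mod 3 = a' mod 3" "b mod 9 = q mod 9 \<longleftrightarrow> a mod 9 = a' mod 9"
        have "a mod 2 = a' mod 2" using h(1,2) by simp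
        moreover have "a mod 4 \<noteq> a' mod 4" using h(1,3) by simp
        moreover have "b mod 4 \<noteq> q mod 4" using h(1,4) by simp
        moreover have "b mod 2 = q mod 2" using h(1,5) by simp
        ultimately show ?thesis unfolding sim_iff using m mod_chain[of a a'] mod_chain[of b q] by blast
      next
        assume h: "l = 4" "a mod l = a' mod l" "a mod (2 * l) \<noteq> a' mod (2 * l)" "b mod (2 * l) \<noteq> q mod (2 * l)" "b mod l = q mod l"
          and m: "b mod 3 = q mod 3 \<longleftrightarrow> a mod 3 = a' mod 3" "b mod 9 = q mod 9 \<longleftrightarrow> a mod 9 = a' mod 9"
        have "a mod 4 = a' mod 4" using h(1,2) by simp
        moreover have "a mod 8 \<noteq> a' mod 8" using h(1,3) by simp
        moreover have "b mod 8 \<noteq> q mod 8" using h(1,4) by simp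
        moreover have "b mod 4 = q mod 4" using h(1,5) by simp
        ultimately show ?thesis unfolding sim_iff using m mod_chain[of a a'] mod_chain[of b q] by blast
      qed
      then show False using no b(1) ne by blast
    qed
    have 2: "a mod 3 = a' mod 3" if 16: "a mod 16 = a' mod 16"
    proof (rule ccontr)
      assume 3: "a mod 3 \<noteq> a' mod 3"
      obtain b where b: "b \<in> B" "b mod (M * W) = q mod (M * W)" "b mod 3 = (q + 1) mod 3"
        using grid_full[OF lv B q refl, of "q + 1"] .
      have "b mod 16 = q mod 16" using all_pairsD[OF B(2) b(1) q] b(2) by (simp add: RG_def)
      moreover have "b mod 3 \<noteq> q mod 3" using b(3) shift_neq(1)[of 1 3 q] by simp
      ultimately have "sim a a' b q"
        using 16 3 mod_chain[of a a'] mod_chain[of b q] unfolding sim_iff by blast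
      then show False using no b(1) 3 by blast
    qed
    show ?thesis unfolding RC_def using 1 2 by blast
  qed
  then show "RC M W a a'" unfolding RC_def by blast
qed

text \<open>Some half is not stable under 72, so by the dichotomy of order 144 it contains two
  elements 48 apart; the same holds with 48 and 72 exchanged.\<close>

lemma stable_72_not_stable:
  assumes "A \<subseteq> Z144" "\<And>i. i < 2 \<Longrightarrow> 144 \<in> Cyc {a\<in>A. a mod 2 = i}" "\<not> stable 48 A" "\<not> stable 72 A"
  shows "\<exists>n. mem A n \<and> mem A (n + 48)" "\<exists>n. mem A n \<and> mem A (n + 72)"
proof -
  have sub: "mem {a\<in>A. a mod 2 = i} n \<Longrightarrow> mem A n" for i n by (simp add: mem_def)
  have "\<not> (\<forall>i<2. stable 72 {a\<in>A. a mod 2 = i})"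
    using stable_by_residue[where m=2 and g=72, OF assms(1)] assms(4) by auto
  then obtain i where i: "i < 2" "\<not> stable 72 {a\<in>A. a mod 2 = i}" by blast
  show "\<exists>n. mem A n \<and> mem A (n + 48)"
    using dichotomy_no_48[OF _ assms(2)[OF i(1)]] i(2) assms(1) sub by blast
  have "\<not> (\<forall>i<2. stable 48 {a\<in>A. a mod 2 = i})"
    using stable_by_residue[where m=2 and g=48, OF assms(1)] assms(3) by auto
  then obtain i where i: "i < 2" "\<not> stable 48 {a\<in>A. a mod 2 = i}" by blast
  show "\<exists>n. mem A n \<and> mem A (n + 72)"
    using dichotomy_no_72[OF _ assms(2)[OF i(1)]] i(2) assms(1) sub by blast
qed

text \<open>B is the factor of one parity. Up to the order of the factors, the alternatives are
  those of (I), (III) and (II) and the two kinds of pairs in (IV).\<close>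

definition shape :: "nat set \<Rightarrow> nat set \<Rightarrow> bool" where
  "shape A B \<longleftrightarrow>
     card B = 6 \<and> all_pairs (RG 2 2) B \<and> all_pairs (RC 2 2) A \<or>
     card B = 6 \<and> all_pairs (RG 4 2) B \<and> all_pairs (RC 4 2) A \<or>
     card B = 12 \<and> all_pairs (\<lambda>a b. a mod 2 = b mod 2 \<and> RC 4 2 a b) B \<and> all_pairs (\<lambda>a b. a mod 2 = b mod 2 \<longrightarrow> RG 4 2 a b) A \<or>
     card B = 12 \<and> all_pairs (\<lambda>a b. a mod 2 = b mod 2 \<and> (a mod 4 = b mod 4 \<longrightarrow> RG 4 2 a b)) B \<and>
       (all_pairs (RG 2 4) B \<and> all_pairs (RC 2 4) A \<or>
        all_pairs (\<lambda>a b. RC 4 2 a b \<and> (a mod 2 = b mod 2 \<longrightarrow> a mod 4 = b mod 4)) A)"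

locale half_tiling =
  fixes A B r
  assumes np: "nonperiodic_tiling A B" and par: "\<And>b. b \<in> B \<Longrightarrow> b mod 2 = r"
begin

abbreviation part where "part i \<equiv> {a\<in>A. a mod 2 = i}"

lemmas D = nonperiodic_tilingD[OF np]

lemma dis: "disjoint_diffs A B" using tiling_disjoint_diffs[OF D(1)] .

lemma dis': "disjoint_diffs B A" using disjoint_diffs_commute[OF D(3) dis] .

lemma part_sub: "part i \<subseteq> Z144" using D(2) by auto

lemma half: "i < 2 \<Longrightarrow> d dvd 144 \<Longrightarrow> d > 2 \<Longrightarrow> d \<in> Cyc (part i) \<or> d \<in> Cyc B"
  using Cyc_half[OF D(1) par] by blast

lemma cards: "card B = 6 \<and> (\<forall>i<2. card (part i) = 12) \<or> card B = 12 \<and> (\<forall>i<2. card (part i) = 6)"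
proof (cases "card B = 6")
  case True
  then show ?thesis using card_half[OF np par] by auto
next
  case False
  then have "card B = 12" using card_half[OF np par, of 0] by auto
  then show ?thesis using card_half[OF np par] by auto
qed

text \<open>If \<Phi>_144 divides B, then B cannot have 6 elements, and neither \<Phi>_48 nor
  \<Phi>_72 can divide it. So these divide both halves of A, which have 6 elements and become
  grids.\<close>

lemma shape_X:
  assumes C: "144 \<in> Cyc B"
  shows "shape A B"
proof -
  have "card B \<noteq> 6" using Cyc_144_card_6[OF D(3) _ C] D by blast
  then have c: "card B = 12" "\<And>i. i < 2 \<Longrightarrow> card (part i) = 6" using cards by auto
  have "48 \<notin> Cyc B" using Cyc_48_144_stable[OF D(3) _ _ C] c D by blast
  then have C48: "48 \<in> Cyc (part i)" if "i < 2" for i using half[OF that, of 48] by simp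
  have "stable 72 B" if "stable 36 B"
    using closed_mult[OF that, of _ 2] by (simp add: stable_def)
  then have "72 \<notin> Cyc B" using Cyc_72_144_stable[OF D(3) _ _ C] c D by blast
  then have C72: "72 \<in> Cyc (part i)" if "i < 2" for i using half[OF that, of 72] by simp
  obtain n where n: "mem B n" "mem B (n + 48)" using dichotomy_no_48[OF D(3) C] D by blast
  obtain m where m: "mem B m" "mem B (m + 72)" using dichotomy_no_72[OF D(3) C] D by blast
  have G: "all_pairs (RG 4 2) (part i)" if i: "i < 2" for i
  proof -
    interpret core "part i"
    proof
      show "part i \<subseteq> Z144" by (rule part_sub)
      show "a = b" if "a \<in> part i" "b \<in> part i" "a mod 48 = b mod 48" for a b
        using inj48_if[OF dis' n D(2)] that by blast
      show "a = b" if "a \<in> part i" "b \<in> part i" "a mod 72 = b mod 72" for a b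
        using inj72_if[OF dis' m D(2)] that by blast
      show "48 \<in> Cyc (part i)" using C48[OF i] .
    qed
    note np = not_paired_if_card_6[OF C72[OF i] c(2)[OF i]]
    have all4: "a mod 4 = b mod 4" if ab: "a \<in> part i" "b \<in> part i" for a b
    proof -
      have "{x\<in>part i. x mod 4 = b mod 4} = part i"
        by (rule card_subset_eq[OF fin]) (use slice_not_paired(1)[OF C72[OF i] ab(2) np[OF ab(2)]] c(2)[OF i] in auto)
      then show ?thesis using ab(1) by blast
    qed
    show ?thesis unfolding all_pairs_def RG_def
    proof (intro ballI conjI impI)
      fix a b assume ab: "a \<in> part i" "b \<in> part i"
      show 4: "a mod 4 = b mod 4" using all4[OF ab] .
      show "a mod 16 = b mod 16" if "a mod (4 * 2) = b mod (4 * 2)"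
        using grid_if_not_paired(1)[OF C72[OF i] np ab 4] that by simp
      show "a mod 9 = b mod 9" if "a mod 3 = b mod 3"
        using grid_if_not_paired(2)[OF C72[OF i] np ab 4] that by simp
    qed
  qed
  have "all_pairs (RC 4 2) B"
    by (rule RC_if_disjoint[of 4 2 "part 0"])
      (use G[of 0] c(2)[of 0] part_sub disjoint_diffs_mono[OF dis', of B "part 0"] in \<open>auto simp: levels_def\<close>)
  then have "all_pairs (\<lambda>a b. a mod 2 = b mod 2 \<and> RC 4 2 a b) B" using par by (simp add: all_pairs_def)
  moreover have "all_pairs (\<lambda>a b. a mod 2 = b mod 2 \<longrightarrow> RG 4 2 a b) A"
    unfolding all_pairs_def
  proof (intro ballI impI)
    fix a b assume "a \<in> A" "b \<in> A" "a mod 2 = b mod 2"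
    then show "RG 4 2 a b" using all_pairsD[OF G[of "b mod 2"], of a b] by simp
  qed
  ultimately show ?thesis using c unfolding shape_def by blast
qed

text \<open>Now \<Phi>_144 divides both halves of A. As A is not periodic, it contains the
  differences 48 and 72, which gives the distinctness in \<open>core\<close>; without \<Phi>_48 on
  the side of B both halves of A would be stable under 72.\<close>

lemma Y_facts:
  assumes C: "144 \<notin> Cyc B"
  shows "\<And>i. i < 2 \<Longrightarrow> 144 \<in> Cyc (part i)" "core B"
proof -
  show C144: "144 \<in> Cyc (part i)" if "i < 2" for i using half[OF that, of 144] C by simp
  obtain n where n: "mem A n" "mem A (n + 48)"
    using stable_72_not_stable(1)[OF D(2) C144 D(4,5)] by blast
  obtain m where m: "mem A m" "mem A (m + 72)"
    using stable_72_not_stable(2)[OF D(2) C144 D(4,5)] by blast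
  have "48 \<in> Cyc B"
  proof (rule ccontr)
    assume "48 \<notin> Cyc B"
    then have "stable 72 (part i)" if "i < 2" for i
      using Cyc_48_144_stable[OF part_sub _ _ C144[OF that]] half[OF that, of 48] cards that by auto
    then have "stable 72 A" by (rule stable_by_residue[OF D(2)]) auto
    then show False using D by simp
  qed
  then show "core B"
    using D(3) inj48_if[OF dis n D(3)] inj72_if[OF dis m D(3)] by unfold_locales
qed

lemma exists_stable_part:
  assumes st: "\<And>i. i < 2 \<Longrightarrow> stable 48 (part i) \<or> stable g (part i)"
  obtains i where "i < 2" "stable g (part i)" "\<not> stable 48 (part i)"
proof -
  have "\<not> (\<forall>i<2. stable 48 (part i))"
    using stable_by_residue[where m=2 and g=48, OF D(2)] D(4) by auto
  then show ?thesis using that st by blast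
qed

text \<open>Whether \<Phi>_72 divides B decides the 2-adic level at which the two rows of B
  separate: 4 if it does, 2 if not.\<close>

lemma shape_Y_6:
  assumes C: "144 \<notin> Cyc B" and c: "card B = 6"
  shows "shape A B"
proof -
  note C144 = Y_facts(1)[OF C]
  interpret core B by (rule Y_facts(2)[OF C])
  show ?thesis
  proof (cases "72 \<in> Cyc B")
    case True
    note np = not_paired_if_card_6[OF True c]
    have all4: "a mod 4 = b mod 4" if ab: "a \<in> B" "b \<in> B" for a b
    proof -
      have "{x\<in>B. x mod 4 = b mod 4} = B"
        by (rule card_subset_eq[OF fin]) (use slice_not_paired(1)[OF True ab(2) np[OF ab(2)]] c in auto)
      then show ?thesis using ab(1) by blast
    qed
    have G: "all_pairs (RG 4 2) B"
      unfolding all_pairs_def RG_def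
    proof (intro ballI conjI impI)
      fix a b assume ab: "a \<in> B" "b \<in> B"
      show 4: "a mod 4 = b mod 4" using all4[OF ab] .
      show "a mod 16 = b mod 16" if "a mod (4 * 2) = b mod (4 * 2)"
        using grid_if_not_paired(1)[OF True np ab 4] that by simp
      show "a mod 9 = b mod 9" if "a mod 3 = b mod 3"
        using grid_if_not_paired(2)[OF True np ab 4] that by simp
    qed
    have "all_pairs (RC 4 2) A"
      by (rule RC_if_disjoint[OF _ D(3) G _ dis]) (use c in \<open>simp_all add: levels_def\<close>)
    then show ?thesis using G c unfolding shape_def by blast
  next
    case False
    have c12: "card (part i) = 12" if "i < 2" for i using cards c that by auto
    have "stable 48 (part i) \<or> stable 36 (part i)" if "i < 2" for i
      using Cyc_72_144_stable[OF part_sub _ _ C144[OF that]] half[OF that, of 72] c12[OF that] False by auto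
    then obtain i where i: "i < 2" "stable 36 (part i)" "\<not> stable 48 (part i)" by (rule exists_stable_part)
    have dp: "disjoint_diffs (part i) B" by (rule disjoint_diffs_mono[OF dis]) auto
    have C9: "9 \<in> Cyc (part i) \<or> 9 \<in> Cyc B" using half[OF i(1), of 9] by simp
    have p2: "\<And>a. a \<in> part i \<Longrightarrow> a mod 2 = i" by simp
    have g: "x mod 4 = y mod 4 \<Longrightarrow> x mod 16 = y mod 16" "x mod 3 = y mod 3 \<Longrightarrow> x mod 9 = y mod 9"
      if "x \<in> B" "y \<in> B" for x y
      using grid_2_2[where r=r and s=i, OF c _ part_sub i(2,3) _ dp C9 that] par by simp_all
    have G: "all_pairs (RG 2 2) B"
      unfolding all_pairs_def RG_def
    proof (intro ballI conjI impI)
      fix a b assume ab: "a \<in> B" "b \<in> B"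
      show "a mod 2 = b mod 2" using par ab by simp
      show "a mod 16 = b mod 16" if "a mod (2 * 2) = b mod (2 * 2)" using g(1)[OF ab] that by simp
      show "a mod 9 = b mod 9" if "a mod 3 = b mod 3" using g(2)[OF ab that] .
    qed
    have "all_pairs (RC 2 2) A"
      by (rule RC_if_disjoint[OF _ D(3) G _ dis]) (use c in \<open>simp_all add: levels_def\<close>)
    then show ?thesis using G c unfolding shape_def by blast
  qed
qed

text \<open>B turns out to be a union of two grids, one in each class modulo 4 of its parity. If
  their residues modulo 9 match, the union is one grid of 12 elements; otherwise the differences
  between the two grids force A into a single class modulo 4 for each parity.\<close>

lemma shape_Y_12:
  assumes C: "144 \<notin> Cyc B" and c: "card B = 12"
  shows "shape A B"
proof -
  note C144 = Y_facts(1)[OF C]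
  interpret core B by (rule Y_facts(2)[OF C])
  have c6: "card (part i) = 6" if "i < 2" for i using cards c that by auto
  have st: "stable 48 (part i) \<or> stable 72 (part i)" if "i < 2" for i
    using Cyc_144_card_6[OF part_sub c6[OF that] C144[OF that]] .
  have C72: "72 \<in> Cyc B"
  proof (rule ccontr)
    assume "72 \<notin> Cyc B"
    then have "stable 48 (part i)" if "i < 2" for i
      using Cyc_72_144_stable[OF part_sub _ _ C144[OF that]] half[OF that, of 72] c6[OF that] by auto
    then have "stable 48 A" by (rule stable_by_residue[OF D(2)]) auto
    then show False using D by simp
  qed
  \<comment> \<open>If every element of B were paired, the differences inside a class of B modulo 12
    would meet those that \<Phi>_9 and stability under 72 produce in a half of A.\<close>
  have "\<exists>q\<in>B. \<not> paired q"
  proof (rule ccontr)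
    assume "\<not> ?thesis"
    then have pd: "\<And>a. a \<in> B \<Longrightarrow> paired a" by blast
    obtain q where q: "q \<in> B" using c by fastforce
    have "9 \<notin> Cyc B" by (rule Cyc_9_all_paired[OF C72 pd par]) (use q in auto)
    obtain i where i: "i < 2" "stable 72 (part i)" "\<not> stable 48 (part i)" using exists_stable_part[OF st] .
    have C9: "9 \<in> Cyc (part i)" using half[OF i(1), of 9] \<open>9 \<notin> Cyc B\<close> by simp
    have finp: "finite (part i)" using part_sub finite_sub_Z144 by blast
    have "part i \<noteq> {}" using c6[OF i(1)] by (metis card.empty zero_neq_numeral)
    then obtain a where a: "a \<in> part i" by blast
    obtain b1 c1 where b1: "b1 \<in> part i" "b1 mod 9 = (a + 3) mod 9" and c1: "c1 \<in> part i" "c1 mod 9 = (a + 6) mod 9"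
      using Cyc_9_triple[OF finp C9 a] .
    note m9 = shifts_mod_9[OF b1(2) c1(2)]
    have "a mod 4 = b1 mod 4 \<or> a mod 4 = c1 mod 4 \<or> b1 mod 4 = c1 mod 4"
      using mod_pigeonhole[of a 2 b1 c1] a b1 c1 by auto
    then obtain x y where xy: "x \<in> part i" "y \<in> part i" "x mod 4 = y mod 4" "x mod 3 = y mod 3" "x mod 9 \<noteq> y mod 9"
    proof (elim disjE)
      assume "a mod 4 = b1 mod 4"
      then show ?thesis using that[of a b1] a b1(1) m9 by simp
    next
      assume "a mod 4 = c1 mod 4"
      then show ?thesis using that[of a c1] a c1(1) m9 by simp
    next
      assume "b1 mod 4 = c1 mod 4"
      then show ?thesis using that[of b1 c1] b1(1) c1(1) m9 by simp
    qed
    obtain q' p' where q': "q' \<in> B" "q' mod 8 = q mod 8" "q' mod 16 \<noteq> q mod 16" "q' mod 3 = q mod 3" "q' mod 9 \<noteq> q mod 9"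
      and p': "p' \<in> B" "p' mod 4 = q mod 4" "p' mod 8 \<noteq> q mod 8" "p' mod 3 = q mod 3" "p' mod 9 \<noteq> q mod 9"
      using paired_cell(2)[OF C72 q pd[OF q]] by blast
    have mA: "mem A x" "mem A y" using xy in_mem[OF D(2)] by auto
    have my: "mem A (y + 72)"
    proof -
      have "mem (part i) y" using in_mem[OF part_sub xy(2)] .
      then have "mem (part i) (y + 72)" using i(2) by (simp add: stable_def)
      then show ?thesis by (simp add: mem_def)
    qed
    have y72: "(y + 72) mod 8 = y mod 8" "(y + 72) mod 9 = y mod 9" "(y + 72) mod 16 = (y + 8) mod 16"
      using mod_add_eqI[of 72 8 0 y] mod_add_eqI[of 72 9 0 y] mod_add_eqI[of 72 16 8 y] by simp_all
    have y3: "(y + 72) mod 3 = y mod 3" using y72(2) by (rule mod_chain)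
    have diff: "u mod 144 \<noteq> v mod 144" if "u mod 9 \<noteq> v mod 9" for u v :: nat
      using mod_eq_dvd[of u 144 v 9] that by auto
    show False
    proof (cases "x mod 8 = y mod 8")
      case False
      have "sim x y p' q" unfolding sim_iff using False xy p' mod_chain[of x y] mod_chain[of p' q] by blast
      then show False using disjoint_diffs_mem[OF dis mA p'(1) q] diff[OF xy(5)] by blast
    next
      case True
      \<comment> \<open>Replacing y by y + 72 switches the residue modulo 16 within its class modulo
        8 and keeps the residue modulo 9, so the two elements may be taken to differ modulo
        16.\<close>
      have "\<exists>z. mem A z \<and> x mod 16 \<noteq> z mod 16 \<and> z mod 8 = y mod 8 \<and> z mod 3 = y mod 3 \<and> z mod 9 = y mod 9"
      proof (cases "x mod 16 = y mod 16")
        case True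
        then have "x mod 16 \<noteq> (y + 72) mod 16" using y72(3) shift_neq(2)[of 8 16 y] by simp
        then show ?thesis using my y72 y3 by blast
      next
        case False
        then show ?thesis using mA by blast
      qed
      then obtain z where z: "mem A z" "x mod 16 \<noteq> z mod 16" "z mod 8 = y mod 8" "z mod 3 = y mod 3" "z mod 9 = y mod 9" by blast
      have "x mod 8 = z mod 8" using z(3) True by metis
      have "x mod 3 = z mod 3" using z(4) xy(4) by metis
      have "x mod 9 \<noteq> z mod 9" using z(5) xy(5) by metis
      have "sim x z q' q" unfolding sim_iff
        using \<open>x mod 9 \<noteq> z mod 9\<close> z(2) q' mod_chain[of x z] mod_chain[of q' q] \<open>x mod 8 = z mod 8\<close> \<open>x mod 3 = z mod 3\<close> by blast
      then show False using disjoint_diffs_mem[OF dis mA(1) z(1) q'(1) q] diff \<open>x mod 9 \<noteq> z mod 9\<close> by blast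
    qed
  qed
  then obtain q0 where q0: "q0 \<in> B" "\<not> paired q0" by blast
  have np: "\<not> paired a" if "a \<in> B" for a
    using not_paired_if_card_12[OF C72 c _ q0 that, of r] par by simp
  have gr: "RG 4 2 a b" if "a \<in> B" "b \<in> B" "a mod 4 = b mod 4" for a b
    unfolding RG_def using grid_if_not_paired[OF C72 np that] that by simp
  have BB: "all_pairs (\<lambda>a b. a mod 2 = b mod 2 \<and> (a mod 4 = b mod 4 \<longrightarrow> RG 4 2 a b)) B"
    unfolding all_pairs_def using gr par by simp
  let ?S = "\<lambda>q. {b\<in>B. b mod 4 = q mod 4}"
  have S6: "card (?S q) = 6" if "q \<in> B" for q using slice_not_paired(1)[OF C72 that np[OF that]] .
  have SG: "all_pairs (RG 4 2) (?S q)" for q unfolding all_pairs_def using gr by simp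
  have SZ: "?S q \<subseteq> Z144" for q using D(3) by auto
  have lv42: "levels 4 2" by (simp add: levels_def)
  have RC42: "all_pairs (RC 4 2) A"
    by (rule RC_if_disjoint[OF lv42 SZ SG _ disjoint_diffs_mono[OF dis]]) (use S6[OF q0(1)] in auto)
  have other: "\<exists>q1\<in>B. q1 mod 4 \<noteq> q0 mod 4"
  proof (rule ccontr)
    assume "\<not> ?thesis"
    then have "?S q0 = B" by blast
    then show False using S6[OF q0(1)] c by simp
  qed
  then obtain q1 where q1: "q1 \<in> B" "q1 mod 4 \<noteq> q0 mod 4" by blast
  have q12: "q1 mod 2 = q0 mod 2" using par q0 q1 by simp
  have res: "\<exists>b\<in>B. b mod 4 = q1 mod 4 \<and> b mod 3 = y mod 3" for y
  proof -
    have q1S: "q1 \<in> ?S q1" using q1 by simp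
    show ?thesis
      using grid_full[OF lv42 SZ SG _ q1S, of q1 y] S6[OF q1(1)] by auto
  qed
  have no1: "a mod 3 = a' mod 3" if a: "a \<in> A" "a' \<in> A" "a mod 2 = a' mod 2" "a mod 4 \<noteq> a' mod 4" for a a'
  proof (rule ccontr)
    assume 3: "a mod 3 \<noteq> a' mod 3"
    obtain b where b: "b \<in> B" "b mod 4 = q1 mod 4" "b mod 3 = (q0 + 1) mod 3" using res by blast
    have "b mod 4 \<noteq> q0 mod 4" "b mod 2 = q0 mod 2" "b mod 3 \<noteq> q0 mod 3"
      using b q1 par q0 shift_neq(1)[of 1 3 q0] by auto
    then have "sim a a' b q0" unfolding sim_iff using 3 a mod_chain[of a a'] mod_chain[of b q0] by blast
    then show False using disjoint_diffsD[OF dis a(1,2) b(1) q0(1)] 3 by blast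
  qed
  show ?thesis
  proof (cases "all_pairs (RG 2 4) B")
    case True
    have "all_pairs (RC 2 4) A"
      by (rule RC_if_disjoint[OF _ D(3) True _ dis]) (use c in \<open>simp_all add: levels_def\<close>)
    then show ?thesis using True BB c unfolding shape_def by blast
  next
    case False
    then obtain b b' where b: "b \<in> B" "b' \<in> B" "\<not> RG 2 4 b b'" unfolding all_pairs_def by blast
    have b2: "b mod 2 = b' mod 2" using b par by simp
    have b8: "b mod 16 = b' mod 16" if "b mod 8 = b' mod 8"
      using gr[OF b(1,2)] that mod_chain(2)[OF that] by (simp add: RG_def)
    have b39: "b mod 3 = b' mod 3" "b mod 9 \<noteq> b' mod 9" using b(3) b2 b8 by (auto simp: RG_def)
    have b4: "b mod 4 \<noteq> b' mod 4" using gr[OF b(1,2)] b39 by (auto simp: RG_def)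
    \<comment> \<open>The pair b, b' blocks this class for A.\<close>
    have no3: False if x: "mem A x" "mem A y" "x mod 2 = y mod 2" "x mod 4 \<noteq> y mod 4" "x mod 3 = y mod 3" "x mod 9 \<noteq> y mod 9" for x y
    proof -
      have "sim x y b b'" unfolding sim_iff using x b2 b4 b39 mod_chain[of x y] mod_chain[of b b'] by blast
      then have "x mod 144 = y mod 144" using disjoint_diffs_mem[OF dis x(1,2) b(1,2)] by blast
      then show False using x(6) mod_eq_dvd[of x 144 y 9] by simp
    qed
    \<comment> \<open>Two of three elements with residues r, r + 3, r + 6 modulo 9 would share a
      class modulo 4, and a grid has only one residue modulo 9 over each residue modulo 3.\<close>
    have n9: "9 \<notin> Cyc B"
    proof
      assume C9: "9 \<in> Cyc B"
      obtain b1 c1 where b1: "b1 \<in> B" "b1 mod 9 = (q0 + 3) mod 9" and c1: "c1 \<in> B" "c1 mod 9 = (q0 + 6) mod 9"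
        using Cyc_9_triple[OF fin C9 q0(1)] .
      note m9 = shifts_mod_9[OF b1(2) c1(2)]
      have "q0 mod 4 = b1 mod 4 \<or> q0 mod 4 = c1 mod 4 \<or> b1 mod 4 = c1 mod 4"
        using mod_pigeonhole[of q0 2 b1 c1] par q0 b1 c1 by auto
      moreover have gr9: "x mod 9 = y mod 9" if "x \<in> B" "y \<in> B" "x mod 4 = y mod 4" "x mod 3 = y mod 3" for x y
        using gr[OF that(1-3)] that(4) unfolding RG_def by blast
      ultimately show False
        using gr9[OF q0(1) b1(1)] gr9[OF q0(1) c1(1)] gr9[OF b1(1) c1(1)] m9 by metis
    qed
    have "a mod 4 = a' mod 4" if a: "a \<in> A" "a' \<in> A" "a mod 2 = a' mod 2" for a a'
    proof (rule ccontr)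
      assume 4: "a mod 4 \<noteq> a' mod 4"
      have m: "mem A a" "mem A a'" using a in_mem[OF D(2)] by auto
      have 3: "a mod 3 = a' mod 3" using no1 a 4 by blast
      have 9: "a mod 9 = a' mod 9" using no3[OF m a(3) 4 3] by blast
      define i where "i = a mod 2"
      have i: "i < 2" by (simp add: i_def)
      have ai: "a \<in> part i" "a' \<in> part i" using a by (auto simp: i_def)
      have mi: "mem (part i) a" "mem (part i) a'" using in_mem[OF part_sub ai(1)] in_mem[OF part_sub ai(2)] .
      from st[OF i] show False
      proof
        \<comment> \<open>a' + 48 keeps the residues modulo 4 and 3 and moves the one modulo 9,
          which produces the blocked class.\<close>
        assume "stable 48 (part i)"
        then have "mem (part i) (a' + 48)" using mi by (simp add: stable_def)
        then have m': "mem A (a' + 48)" by (simp add: mem_def)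
        have k: "(a' + 48) mod 4 = a' mod 4" "(a' + 48) mod 2 = a' mod 2" "(a' + 48) mod 3 = a' mod 3" "(a' + 48) mod 9 = (a' + 3) mod 9"
          using mod_add_eqI[of 48 4 0 a'] mod_add_eqI[of 48 2 0 a'] mod_add_eqI[of 48 3 0 a'] mod_add_eqI[of 48 9 3 a'] by simp_all
        have "a mod 9 \<noteq> (a' + 48) mod 9" using 9 k(4) shift_neq(2)[of 3 9 a'] by simp
        then show False using no3[OF m(1) m'] k a(3) 4 3 by simp
      next
        \<comment> \<open>a, a' and their shifts by 72 are four elements with one residue modulo 9.
          By \<Phi>_9 there are as many with the residue 3 further on, but the half has only 6
          elements.\<close>
        assume s72: "stable 72 (part i)"
        have "9 \<in> Cyc (part i)" using half[OF i, of 9] n9 by simp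
        have finp: "finite (part i)" using part_sub finite_sub_Z144 by blast
        have ml: "mem (part i) (a + 72)" "mem (part i) (a' + 72)" using mi s72 by (simp_all add: stable_def)
        let ?F = "{a mod 144, a' mod 144, (a + 72) mod 144, (a' + 72) mod 144}"
        have sh: "n mod 144 \<noteq> (n + 72) mod 144" "(n + 72) mod 4 = n mod 4" "(n + 72) mod 9 = n mod 9" for n :: nat
          using shift_neq(2)[of 72 144 n] mod_add_eqI[of 72 4 0 n] mod_add_eqI[of 72 9 0 n] by simp_all
        have d4: "u mod 144 \<noteq> v mod 144" if "u mod 4 \<noteq> v mod 4" for u v :: nat
          using mod_eq_dvd[of u 144 v 4] that by auto
        have F4: "card ?F = 4"
          using sh(1)[of a] sh(1)[of a'] d4[of a a'] d4[of a "a' + 72"] d4[of "a + 72" a'] d4[of "a + 72" "a' + 72"] 4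
          by (simp add: sh(2))
        have subF: "?F \<subseteq> {x\<in>part i. x mod 9 = a mod 9}"
          using mi ml 9 unfolding mem_def by (simp add: mod_mod_cancel sh(3))
        have fs: "finite {x\<in>part i. x mod 9 = y}" for y
          by (rule finite_subset[OF _ finp]) blast
        have "4 \<le> card {x\<in>part i. x mod 9 = a mod 9}" using card_mono[OF fs subF] by (simp only: F4)
        then have c4: "cnt (part i) 9 a \<ge> 4" by (simp only: cnt_def)
        have sft: "cnt (part i) 9 (n + 3) = cnt (part i) 9 n" for n
          by (rule Cyc_shift[OF finp \<open>9 \<in> Cyc (part i)\<close>]) simp
        have "cnt (part i) 9 a + cnt (part i) 9 (a + 3) \<le> card (part i)"
        proof -
          have "{x\<in>part i. x mod 9 = a mod 9} \<inter> {x\<in>part i. x mod 9 = (a + 3) mod 9} = {}"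
            using shift_neq(2)[of 3 9 a] by auto
          then have "cnt (part i) 9 a + cnt (part i) 9 (a + 3)
             = card ({x\<in>part i. x mod 9 = a mod 9} \<union> {x\<in>part i. x mod 9 = (a + 3) mod 9})"
            unfolding cnt_def using card_Un_disjoint[OF fs fs] by (simp only:)
          also have "\<dots> \<le> card (part i)" by (rule card_mono[OF finp]) auto
          finally show ?thesis .
        qed
        then show False using c4 sft[of a] c6[OF i] by simp
      qed
    qed
    then have "all_pairs (\<lambda>a b. RC 4 2 a b \<and> (a mod 2 = b mod 2 \<longrightarrow> a mod 4 = b mod 4)) A"
      using RC42 unfolding all_pairs_def by blast
    then show ?thesis using BB c unfolding shape_def by blast
  qed
qed

theorem shape: "shape A B"
  using shape_X shape_Y_6 shape_Y_12 cards by blast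

end

theorem nonperiodic_tiling_shape:
  assumes "nonperiodic_tiling A B"
  shows "shape A B \<or> shape B A"
  using one_class_mod_2[OF assms]
proof
  assume "\<exists>r. \<forall>b\<in>B. b mod 2 = r"
  then obtain r where "\<forall>b\<in>B. b mod 2 = r" by blast
  then interpret half_tiling A B r using assms by unfold_locales auto
  show ?thesis using shape by blast
next
  assume "\<exists>r. \<forall>a\<in>A. a mod 2 = r"
  then obtain r where "\<forall>a\<in>A. a mod 2 = r" by blast
  then interpret half_tiling B A r using assms nonperiodic_tiling_commute by unfold_locales auto
  show ?thesis using shape by blast
qed

section \<open>Counting\<close>

text \<open>A subset is the same as the family of its slices, and these can be chosen
  independently.\<close>

lemma card_slices:
  fixes \<kappa> :: "'a \<Rightarrow> 'b"
  assumes I: "finite I" and F: "\<And>i S. i \<in> I \<Longrightarrow> S \<in> F i \<Longrightarrow> S \<subseteq> {u\<in>U. \<kappa> u = i}" and U: "\<And>u. u \<in> U \<Longrightarrow> \<kappa> u \<in> I"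
  shows "card {A. A \<subseteq> U \<and> (\<forall>i\<in>I. {a\<in>A. \<kappa> a = i} \<in> F i)} = (\<Prod>i\<in>I. card (F i))"
proof -
  let ?L = "{A. A \<subseteq> U \<and> (\<forall>i\<in>I. {a\<in>A. \<kappa> a = i} \<in> F i)}"
  let ?f = "\<lambda>A. \<lambda>i\<in>I. {a\<in>A. \<kappa> a = i}"
  have "bij_betw ?f ?L (PiE I F)"
  proof (rule bij_betw_imageI)
    show "inj_on ?f ?L"
    proof (rule inj_onI)
      fix A B assume A: "A \<in> ?L" and B: "B \<in> ?L" and eq: "?f A = ?f B"
      have "{a\<in>A. \<kappa> a = i} = {a\<in>B. \<kappa> a = i}" if "i \<in> I" for i
        using fun_cong[OF eq, of i] that by simp
      moreover have "\<kappa> a \<in> I" if "a \<in> A \<union> B" for a using that A B U by blast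
      ultimately show "A = B" by blast
    qed
    show "?f ` ?L = PiE I F"
    proof (intro equalityI subsetI)
      fix f assume f: "f \<in> PiE I F"
      let ?A = "\<Union>i\<in>I. f i"
      have fi: "f i \<subseteq> {u\<in>U. \<kappa> u = i}" if "i \<in> I" for i using F[OF that] f that by (auto simp: PiE_iff)
      have sl: "{a\<in>?A. \<kappa> a = i} = f i" if "i \<in> I" for i using fi that by blast
      have "?A \<in> ?L" using fi sl f by (auto simp: PiE_iff)
      moreover have "f = ?f ?A"
      proof
        fix i
        show "f i = ?f ?A i" using sl f by (cases "i \<in> I") (auto simp: PiE_iff extensional_def)
      qed
      ultimately show "f \<in> ?f ` ?L" by blast
    qed auto
  qed
  then have "card ?L = card (PiE I F)" by (rule bij_betw_same_card)
  then show ?thesis using I by (simp add: card_PiE)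
qed

lemma card_residue_pair:
  assumes co: "coprime k m" and km: "k * m dvd 144" and xt: "x < k" "t < m"
  shows "card {n. n < 144 \<and> n mod k = x \<and> n mod m = t} = 144 div (k * m)"
proof -
  obtain c where c: "[c = x] (mod k)" "[c = t] (mod m)"
    using binary_chinese_remainder_nat[OF co, of x t] by blast
  have km0: "k * m > 0" using xt by simp
  have "n mod k = x \<and> n mod m = t \<longleftrightarrow> n mod (k * m) = c mod (k * m)" for n
    using crt_iff[OF co, of n c] c xt by (auto simp: cong_def)
  then have "{n. n < 144 \<and> n mod k = x \<and> n mod m = t} = {n. n < 144 \<and> n mod (k * m) = c mod (k * m)}" by blast
  then show ?thesis using card_residue_class[OF km, of "c mod (k * m)"] km0 by simp
qed

text \<open>The cardinality is the largest one for which the residue modulo \<open>m\<close> can be a function of the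
  one modulo \<open>k\<close>.\<close>

definition functional_sets :: "nat \<Rightarrow> nat set \<Rightarrow> nat \<Rightarrow> nat set \<Rightarrow> nat set set" where
  "functional_sets k I m J = {A. A \<subseteq> {n. n < 144 \<and> n mod k \<in> I \<and> n mod m \<in> J} \<and>
     card A = card I * (144 div (k * m)) \<and> (\<forall>a\<in>A. \<forall>b\<in>A. a mod k = b mod k \<longrightarrow> a mod m = b mod m)}"

locale residue_pair =
  fixes k m :: nat and I J :: "nat set"
  assumes co: "coprime k m" and km: "k * m dvd 144" and I: "I \<subseteq> {..<k}" and J: "J \<subseteq> {..<m}"
begin

definition line where "line x t = {n. n < 144 \<and> n mod k = x \<and> n mod m = t}"

lemma card_line: "x \<in> I \<Longrightarrow> t \<in> J \<Longrightarrow> card (line x t) = 144 div (k * m)"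
  unfolding line_def using card_residue_pair[OF co km] I J by auto

lemma finite_line: "finite (line x t)" by (simp add: line_def)

lemma pos: "144 div (k * m) > 0"
  using km by (metis dvd_div_eq_0_iff gr0I zero_neq_numeral)

lemma finI: "finite I" using I finite_subset by blast

lemma slice_line:
  assumes A: "A \<subseteq> {n. n < 144 \<and> n mod k \<in> I \<and> n mod m \<in> J}"
    and f: "\<forall>a\<in>A. \<forall>b\<in>A. a mod k = b mod k \<longrightarrow> a mod m = b mod m" and a: "a \<in> A"
  shows "{b\<in>A. b mod k = a mod k} \<subseteq> line (a mod k) (a mod m)"
  using A f a unfolding line_def by blast

lemma slice_le:
  assumes A: "A \<subseteq> {n. n < 144 \<and> n mod k \<in> I \<and> n mod m \<in> J}"
    and f: "\<forall>a\<in>A. \<forall>b\<in>A. a mod k = b mod k \<longrightarrow> a mod m = b mod m"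
  shows "card {b\<in>A. b mod k = x} \<le> 144 div (k * m)"
proof (cases "{b\<in>A. b mod k = x} = {}")
  case True
  then show ?thesis by (metis card.empty le0)
next
  case False
  then obtain a where a: "a \<in> A" "a mod k = x" by blast
  have "card {b\<in>A. b mod k = x} \<le> card (line (a mod k) (a mod m))"
    using slice_line[OF A f a(1)] a(2) finite_line by (simp add: card_mono)
  then show ?thesis using card_line a A by auto
qed

lemma card_slices_sum:
  assumes A: "A \<subseteq> {n. n < 144 \<and> n mod k \<in> I \<and> n mod m \<in> J}"
  shows "card A = (\<Sum>x\<in>I. card {b\<in>A. b mod k = x})"
proof -
  have "finite A" using A by (rule finite_subset) simp
  then have "(\<Sum>x\<in>I. \<Sum>b\<in>{b\<in>A. b mod k = x}. 1) = (\<Sum>b\<in>A. 1::nat)"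
    using A finI by (intro sum.group) auto
  then show ?thesis by simp
qed

lemma card_le:
  assumes A: "A \<subseteq> {n. n < 144 \<and> n mod k \<in> I \<and> n mod m \<in> J}"
    and f: "\<forall>a\<in>A. \<forall>b\<in>A. a mod k = b mod k \<longrightarrow> a mod m = b mod m"
  shows "card A \<le> card I * (144 div (k * m))"
proof -
  have "card A \<le> (\<Sum>x\<in>I. 144 div (k * m))"
    unfolding card_slices_sum[OF A] by (rule sum_mono) (rule slice_le[OF A f])
  then show ?thesis by simp
qed

text \<open>Each slice lies in one line, and a line has 144 / (k * m) elements; the prescribed
  cardinality is reached only if every slice is a whole line.\<close>

lemma functional_sets_iff:
  "A \<in> functional_sets k I m J \<longleftrightarrow> A \<subseteq> {n. n < 144 \<and> n mod k \<in> I} \<and> (\<forall>x\<in>I. {b\<in>A. b mod k = x} \<in> line x ` J)"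
proof
  assume "A \<in> functional_sets k I m J"
  then have A: "A \<subseteq> {n. n < 144 \<and> n mod k \<in> I \<and> n mod m \<in> J}" and c: "card A = card I * (144 div (k * m))"
    and f: "\<forall>a\<in>A. \<forall>b\<in>A. a mod k = b mod k \<longrightarrow> a mod m = b mod m"
    unfolding functional_sets_def mem_Collect_eq by blast+
  have "{b\<in>A. b mod k = x} \<in> line x ` J" if x: "x \<in> I" for x
  proof -
    have "(\<Sum>x\<in>I. card {b\<in>A. b mod k = x}) = (\<Sum>x\<in>I. 144 div (k * m))"
      using card_slices_sum[OF A] c by simp
    then have s: "card {b\<in>A. b mod k = x} = 144 div (k * m)"
      using sum_mono_inv[OF _ _ x finI, of "\<lambda>x. card {b\<in>A. b mod k = x}" "\<lambda>x. 144 div (k * m)"] slice_le[OF A f] by blast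
    then have "{b\<in>A. b mod k = x} \<noteq> {}" using pos by (metis card.empty less_irrefl)
    then obtain a where a: "a \<in> A" "a mod k = x" by blast
    have t: "a mod m \<in> J" using A a by blast
    have "{b\<in>A. b mod k = x} = line x (a mod m)"
      using slice_line[OF A f a(1)] a(2) finite_line s card_line[OF x t] by (intro card_subset_eq) auto
    then show ?thesis using t by blast
  qed
  then show "A \<subseteq> {n. n < 144 \<and> n mod k \<in> I} \<and> (\<forall>x\<in>I. {b\<in>A. b mod k = x} \<in> line x ` J)" using A by blast
next
  assume h: "A \<subseteq> {n. n < 144 \<and> n mod k \<in> I} \<and> (\<forall>x\<in>I. {b\<in>A. b mod k = x} \<in> line x ` J)"
  have mJ: "\<exists>t\<in>J. {b\<in>A. b mod k = a mod k} = line (a mod k) t" if "a \<in> A" for a using h that by blast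
  have A: "A \<subseteq> {n. n < 144 \<and> n mod k \<in> I \<and> n mod m \<in> J}"
  proof
    fix a assume a: "a \<in> A"
    obtain t where t: "t \<in> J" "{b\<in>A. b mod k = a mod k} = line (a mod k) t" using mJ[OF a] by blast
    have "a \<in> line (a mod k) t" using a t(2) by blast
    then show "a \<in> {n. n < 144 \<and> n mod k \<in> I \<and> n mod m \<in> J}" using t(1) a h by (auto simp: line_def)
  qed
  have cA: "card A = (\<Sum>x\<in>I. 144 div (k * m))"
    unfolding card_slices_sum[OF A]
  proof (intro sum.cong refl)
    fix x assume x: "x \<in> I"
    then obtain t where "t \<in> J" "{b\<in>A. b mod k = x} = line x t" using h by blast
    then show "card {b\<in>A. b mod k = x} = 144 div (k * m)" using card_line[OF x] by simp
  qed
  have f: "a mod m = b mod m" if "a \<in> A" "b \<in> A" "a mod k = b mod k" for a b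
  proof -
    obtain t where t: "{c\<in>A. c mod k = a mod k} = line (a mod k) t" using mJ[OF \<open>a \<in> A\<close>] by blast
    have "a \<in> line (a mod k) t" "b \<in> line (a mod k) t" using t that by auto
    then show ?thesis by (simp add: line_def)
  qed
  have "card A = card I * (144 div (k * m))" using cA by simp
  then show "A \<in> functional_sets k I m J" unfolding functional_sets_def using A f by blast
qed

lemma functional_sets_full:
  assumes "A \<in> functional_sets k I m J" "a \<in> A" "n < 144" "n mod k = a mod k" "n mod m = a mod m"
  shows "n \<in> A"
proof -
  have "a mod k \<in> I" using assms(1,2) unfolding functional_sets_def by blast
  then obtain t where t: "{b\<in>A. b mod k = a mod k} = line (a mod k) t" using assms(1) unfolding functional_sets_iff by blast
  have "a \<in> line (a mod k) t" using t assms by blast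
  then have "n \<in> line (a mod k) t" using assms by (simp add: line_def)
  then show ?thesis using t by blast
qed

lemma functional_sets_stable:
  assumes A: "A \<in> functional_sets k I m J" and g: "k dvd g" "m dvd g"
  shows "stable g A"
  unfolding stable_def
proof (intro allI impI)
  fix n assume n: "mem A n"
  have d: "k dvd 144" "m dvd 144" using km by (meson dvd_mult_left dvd_mult_right)+
  have e: "(n + g) mod j = n mod j" if "j dvd g" for j using that by (auto elim!: dvdE)
  have "(n + g) mod 144 \<in> A"
    by (rule functional_sets_full[OF A, of "n mod 144"]) (use n e g d in \<open>auto simp: mem_def mod_mod_cancel\<close>)
  then show "mem A (n + g)" by (simp add: mem_def)
qed

lemma card_functional_sets: "card (functional_sets k I m J) = card J ^ card I"
proof -
  have "functional_sets k I m J = {A. A \<subseteq> {n. n < 144 \<and> n mod k \<in> I} \<and> (\<forall>x\<in>I. {b\<in>A. b mod k = x} \<in> line x ` J)}"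
    using functional_sets_iff by blast
  also have "card \<dots> = (\<Prod>x\<in>I. card (line x ` J))"
    by (rule card_slices[OF finI]) (auto simp: line_def)
  also have "\<dots> = (\<Prod>x\<in>I. card J)"
  proof (intro prod.cong refl card_image inj_onI)
    fix x s t assume x: "x \<in> I" and st: "s \<in> J" "t \<in> J" "line x s = line x t"
    have "line x s \<noteq> {}" using card_line[OF x st(1)] pos by (metis card.empty less_irrefl)
    then show "s = t" using st(3) by (auto simp: line_def)
  qed
  finally show ?thesis by simp
qed

end

section \<open>Translation classes\<close>

lemma tclass_self: "A \<subseteq> Z144 \<Longrightarrow> A \<in> tclass A"
proof -
  assume A: "A \<subseteq> Z144"
  have "translate 0 A = A"
    using A by (auto simp: translate_def Z144_def image_iff subset_iff)
  then show ?thesis unfolding tclass_def by (metis (mono_tags, lifting) Z144_def atLeastLessThan_iff le0 mem_Collect_eq zero_less_numeral)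
qed

lemma translate_translate: "translate g (translate h A) = translate ((h + g) mod 144) A"
  unfolding translate_def image_image
  by (intro image_cong refl) (simp add: mod_add_left_eq mod_add_right_eq add.assoc)

lemma tclass_subset: "A' \<in> tclass A \<Longrightarrow> tclass A' \<subseteq> tclass A"
  unfolding tclass_def by (auto simp: translate_translate Z144_def)

lemma tclass_sym: "A \<subseteq> Z144 \<Longrightarrow> A' \<in> tclass A \<Longrightarrow> A \<in> tclass A'"
proof -
  assume A: "A \<subseteq> Z144" and "A' \<in> tclass A"
  then obtain g where g: "g < 144" "A' = translate g A" by (auto simp: tclass_def Z144_def)
  have "translate ((144 - g) mod 144) A' = translate 0 A"
    unfolding g(2) translate_translate using g(1) by (simp add: mod_add_right_eq)
  also have "\<dots> = A" using A by (auto simp: translate_def Z144_def image_iff subset_iff)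
  finally show ?thesis unfolding tclass_def Z144_def by force
qed

lemma tclass_eq: "A \<subseteq> Z144 \<Longrightarrow> A' \<in> tclass A \<Longrightarrow> tclass A' = tclass A"
  using tclass_subset tclass_sym by blast

text \<open>Two equal translates would differ by a period. So classes of non-periodic sets are
  counted by counting sets and dividing by 144.\<close>

lemma card_tclass:
  assumes A: "A \<subseteq> Z144" "\<not> periodic A"
  shows "card (tclass A) = 144"
proof -
  have "inj_on (\<lambda>g. translate g A) Z144"
  proof (rule linorder_inj_onI)
    fix g h assume gh: "g < h" "g \<in> Z144" "h \<in> Z144"
    show "translate g A \<noteq> translate h A"
    proof
      assume "translate g A = translate h A"
      then have "translate (144 - g) (translate g A) = translate (144 - g) (translate h A)" by simp
      then have "translate 0 A = translate ((h + (144 - g)) mod 144) A"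
        using gh unfolding translate_translate by (simp add: Z144_def)
      moreover have "translate 0 A = A" using A by (auto simp: translate_def Z144_def image_iff subset_iff)
      moreover have "(h + (144 - g)) mod 144 = h - g"
      proof -
        have "h + (144 - g) = (h - g) + 144" using gh by (simp add: Z144_def)
        then have "(h + (144 - g)) mod 144 = (h - g) mod 144" by (metis mod_add_self2)
        moreover have "h - g < 144" using gh by (simp add: Z144_def)
        ultimately show ?thesis by (metis mod_less)
      qed
      ultimately have "translate (h - g) A = A" by simp
      moreover have "h - g \<in> Z144" "h - g \<noteq> 0" using gh by (auto simp: Z144_def)
      ultimately show False using A(2) unfolding periodic_def by blast
    qed
  qed auto
  moreover have "tclass A = (\<lambda>g. translate g A) ` Z144" by (auto simp: tclass_def)
  ultimately show ?thesis by (simp add: card_image Z144_def)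
qed

lemma card_classes_144:
  assumes F: "\<And>A. A \<in> F \<Longrightarrow> A \<subseteq> Z144 \<and> \<not> periodic A" and tr: "\<And>A. A \<in> F \<Longrightarrow> tclass A \<subseteq> F"
  shows "card F = 144 * card (tclass ` F)" "finite (tclass ` F)"
proof -
  have "F \<subseteq> Pow Z144" using F by blast
  then have fin: "finite F" by (rule finite_subset) simp
  then show fT: "finite (tclass ` F)" by simp
  have "F = \<Union> (tclass ` F)"
  proof
    show "F \<subseteq> \<Union> (tclass ` F)"
    proof
      fix A assume "A \<in> F"
      then show "A \<in> \<Union> (tclass ` F)" using tclass_self[of A] F by blast
    qed
    show "\<Union> (tclass ` F) \<subseteq> F" using tr by (rule UN_least)
  qed
  moreover have "card (\<Union> (tclass ` F)) = (\<Sum>C\<in>tclass ` F. card C)"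
  proof (rule card_Union_disjoint)
    show "pairwise disjnt (tclass ` F)"
    proof (rule pairwiseI)
      fix C D assume CD: "C \<in> tclass ` F" "D \<in> tclass ` F" "C \<noteq> D"
      show "disjnt C D"
      proof (rule ccontr)
        assume "\<not> disjnt C D"
        then obtain X where X: "X \<in> C" "X \<in> D" unfolding disjnt_def by blast
        obtain A B where "A \<in> F" "C = tclass A" "B \<in> F" "D = tclass B" using CD by blast
        then have "tclass X = C" "tclass X = D" using tclass_eq X F by blast+
        then show False using CD by simp
      qed
    qed
    show "finite C" if "C \<in> tclass ` F" for C using that tr fin finite_subset by blast
  qed
  moreover have "card C = 144" if "C \<in> tclass ` F" for C using that F card_tclass by blast
  ultimately show "card F = 144 * card (tclass ` F)" by simp
qed

section \<open>Numbers of grids and of pieces of complements\<close>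

definition grids :: "nat \<Rightarrow> nat \<Rightarrow> nat \<Rightarrow> nat set set" where
  "grids M W r = {B. B \<subseteq> {n. n < 144 \<and> n mod M = r} \<and> card B = 3 * W \<and> all_pairs (RG M W) B}"

lemma card_singletons: "card ((\<lambda>x. {x}) ` S) = card S"
  by (rule card_image) simp

lemma card_sum_slices:
  assumes "finite I" "finite X" "\<And>x. x \<in> X \<Longrightarrow> \<kappa> x \<in> I"
  shows "card X = (\<Sum>i\<in>I. card {x\<in>X. \<kappa> x = i})"
proof -
  have "(\<Sum>i\<in>I. \<Sum>x\<in>{x\<in>X. \<kappa> x = i}. 1) = (\<Sum>x\<in>X. 1::nat)"
    using assms by (intro sum.group) auto
  then show ?thesis by simp
qed

lemma levels_pos: "levels M W \<Longrightarrow> M > 0 \<and> W > 0 \<and> M * W > 0 \<and> M * W dvd 16 \<and> M * W dvd 8 \<and> M dvd M * W"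
  by (erule levelsE) simp_all

text \<open>A full grid is a product of a set of residues modulo 16 and one of residues modulo 9.
  The first picks one of 16 / (M * W) residues in each of W classes, the second one of 3 residues in
  each of 3 classes, whence 3^3 = 27.\<close>

lemma card_grids:
  assumes lv: "levels M W" and r: "r < M"
  shows "card (grids M W r) = (16 div (M * W)) ^ W * 27"
proof -
  define C where "C = {c. c < M * W \<and> c mod M = r}"
  define FX where "FX = {X. X \<subseteq> {x. x < 16 \<and> x mod M = r} \<and>
    (\<forall>c\<in>C. {x\<in>X. x mod (M * W) = c} \<in> (\<lambda>x. {x}) ` {x. x < 16 \<and> x mod (M * W) = c})}"
  define FY where "FY = {Y. Y \<subseteq> {y. y < 9} \<and>
    (\<forall>t\<in>{..<3}. {y\<in>Y. y mod 3 = t} \<in> (\<lambda>y. {y}) ` {y. y < 9 \<and> y mod 3 = (t::nat)})}"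
  note ps = levels_pos[OF lv]
  have cC: "card C = W" using card_classes[OF lv, of r] r by (simp add: C_def)
  have finC: "finite C" by (simp add: C_def)
  have mm: "x mod (M * W) mod M = x mod M" for x by (simp add: mod_mod_cancel)
  have cFX: "card FX = (16 div (M * W)) ^ W"
  proof -
    have "card FX = (\<Prod>c\<in>C. card ((\<lambda>x. {x}) ` {x. x < 16 \<and> x mod (M * W) = c}))"
      unfolding FX_def
    proof (rule card_slices[OF finC])
      fix c S assume c: "c \<in> C" "S \<in> (\<lambda>x. {x}) ` {x. x < 16 \<and> x mod (M * W) = c}"
      then show "S \<subseteq> {u \<in> {x. x < 16 \<and> x mod M = r}. u mod (M * W) = c}"
        using mm by (auto simp: C_def)
    next
      fix u assume "u \<in> {x. x < 16 \<and> x mod M = r}"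
      then show "u mod (M * W) \<in> C" using mm ps by (simp add: C_def)
    qed
    also have "\<dots> = (\<Prod>c\<in>C. 16 div (M * W))"
      using card_residue_class[of "M * W" 16] ps by (intro prod.cong refl) (simp add: card_singletons C_def)
    finally show ?thesis using cC by simp
  qed
  have cFY: "card FY = 27"
  proof -
    have "card FY = (\<Prod>t\<in>{..<3}. card ((\<lambda>y. {y}) ` {y. y < 9 \<and> y mod 3 = (t::nat)}))"
      unfolding FY_def by (rule card_slices) auto
    also have "\<dots> = (\<Prod>t\<in>{..<3::nat}. 3)"
      using card_residue_class[of 3 9] by (intro prod.cong refl) (simp add: card_singletons)
    finally show ?thesis by simp
  qed
  let ?P = "\<lambda>z. {n. n < 144 \<and> n mod 16 \<in> fst z \<and> n mod 9 \<in> snd z}"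
  have ex: "\<exists>n. n < 144 \<and> n mod 16 = x \<and> n mod 9 = y" if "x < 16" "y < 9" for x y :: nat
  proof -
    have "card {n. n < 144 \<and> n mod 16 = x \<and> n mod 9 = y} = 1"
      using card_residue_pair[of 16 9 x y] that by (simp add: coprime_iff_gcd_eq_1 gcd_non_0_nat)
    then have "{n. n < 144 \<and> n mod 16 = x \<and> n mod 9 = y} \<noteq> {}" by (metis card.empty zero_neq_one)
    then show ?thesis by blast
  qed
  have FXD: "x < 16 \<and> x mod M = r" if "X \<in> FX" "x \<in> X" for x X using that unfolding FX_def by blast
  have FYD: "y < 9" if "Y \<in> FY" "y \<in> Y" for y Y using that unfolding FY_def by blast
  have FX1: "\<exists>x. {x\<in>X. x mod (M * W) = c} = {x}" if "X \<in> FX" "c \<in> C" for X c using that unfolding FX_def by blast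
  have FY1: "\<exists>y. {y\<in>Y. y mod 3 = t} = {y}" if "Y \<in> FY" "t < 3" for Y t using that unfolding FY_def by blast
  have rC: "r \<in> C" using r ps by (cases rule: levelsE[OF lv]) (auto simp: C_def)
  have ne: "X \<noteq> {}" if "X \<in> FX" for X using FX1[OF that rC] by blast
  have neY: "Y \<noteq> {}" if "Y \<in> FY" for Y using FY1[OF that zero_less_numeral] by blast
  have im: "(\<lambda>n. (n mod 16, n mod 9)) ` ?P z = fst z \<times> snd z" if "z \<in> FX \<times> FY" for z
  proof
    show "fst z \<times> snd z \<subseteq> (\<lambda>n. (n mod 16, n mod 9)) ` ?P z"
    proof
      fix w assume w: "w \<in> fst z \<times> snd z"
      then have "fst w < 16" "snd w < 9" using that FXD[of "fst z" "fst w"] FYD[of "snd z" "snd w"] by auto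
      then obtain n where n: "n < 144" "n mod 16 = fst w" "n mod 9 = snd w" using ex by blast
      then have "n \<in> ?P z" "w = (n mod 16, n mod 9)" using w by auto
      then show "w \<in> (\<lambda>n. (n mod 16, n mod 9)) ` ?P z" by blast
    qed
  qed auto
  have "bij_betw ?P (FX \<times> FY) (grids M W r)"
  proof (rule bij_betw_imageI)
    show "inj_on ?P (FX \<times> FY)"
    proof (rule inj_onI)
      fix z w assume z: "z \<in> FX \<times> FY" and w: "w \<in> FX \<times> FY" and eq: "?P z = ?P w"
      have "fst z \<times> snd z = fst w \<times> snd w" using im[OF z] im[OF w] eq by simp
      then show "z = w" using ne neY z w by (metis mem_Times_iff prod.collapse times_eq_iff)
    qed
    show "?P ` (FX \<times> FY) = grids M W r"
    proof (intro equalityI subsetI)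
      fix B assume "B \<in> ?P ` (FX \<times> FY)"
      then obtain z where z: "z \<in> FX \<times> FY" "B = ?P z" by blast
      have zF: "fst z \<in> FX" "snd z \<in> FY" using z(1) by auto
      have sub: "B \<subseteq> {n. n < 144 \<and> n mod M = r}"
      proof
        fix n assume n: "n \<in> B"
        have "n mod 16 mod M = r" using FXD[OF zF(1)] n z(2) by blast
        moreover have "M dvd 16" using lv by (cases rule: levelsE) auto
        ultimately show "n \<in> {n. n < 144 \<and> n mod M = r}" using n z(2) by (simp add: mod_mod_cancel)
      qed
      have finX: "finite (fst z)" using FXD[OF zF(1)] by (meson finite_nat_set_iff_bounded)
      have finY: "finite (snd z)" using FYD[OF zF(2)] by (meson finite_nat_set_iff_bounded)
      have "card (fst z) = (\<Sum>c\<in>C. card {x\<in>fst z. x mod (M * W) = c})"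
        by (rule card_sum_slices[OF finC finX]) (use FXD[OF zF(1)] mm ps in \<open>simp add: C_def\<close>)
      also have "\<dots> = (\<Sum>c\<in>C. 1)" using FX1[OF zF(1)] by (intro sum.cong refl) force
      finally have cX: "card (fst z) = W" using cC by simp
      have "card (snd z) = (\<Sum>t<3. card {y\<in>snd z. y mod 3 = t})"
        by (rule card_sum_slices[OF _ finY]) auto
      also have "\<dots> = (\<Sum>t<(3::nat). 1)" using FY1[OF zF(2)] by (intro sum.cong refl) force
      finally have cY: "card (snd z) = 3" by simp
      have "card B = card ((\<lambda>n. (n mod 16, n mod 9)) ` B)"
        by (rule card_image[symmetric], rule inj_onI) (use z(2) crt_eq in auto)
      also have "\<dots> = 3 * W" using im[OF z(1)] cX cY by (simp add: z(2) card_cartesian_product)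
      finally have cB: "card B = 3 * W" .
      have "RG M W a b" if ab: "a \<in> B" "b \<in> B" for a b
        unfolding RG_def
      proof (intro conjI impI)
        show "a mod M = b mod M" using sub ab by blast
        assume e: "a mod (M * W) = b mod (M * W)"
        let ?c = "a mod (M * W)"
        have "?c \<in> C" using ps sub ab mm by (auto simp: C_def)
        then obtain x where x: "{x\<in>fst z. x mod (M * W) = ?c} = {x}" using FX1[OF zF(1)] by blast
        have "a mod 16 \<in> {x\<in>fst z. x mod (M * W) = ?c}" "b mod 16 \<in> {x\<in>fst z. x mod (M * W) = ?c}"
          using ab z(2) e ps by (auto simp: mod_mod_cancel)
        then show "a mod 16 = b mod 16" unfolding x by simp
      next
        assume e: "a mod 3 = b mod 3"
        obtain y where y: "{y\<in>snd z. y mod 3 = a mod 3} = {y}" using FY1[OF zF(2), of "a mod 3"] by auto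
        have "a mod 9 \<in> {y\<in>snd z. y mod 3 = a mod 3}" "b mod 9 \<in> {y\<in>snd z. y mod 3 = a mod 3}"
          using ab z(2) e by (auto simp: mod_mod_cancel)
        then show "a mod 9 = b mod 9" unfolding y by simp
      qed
      then show "B \<in> grids M W r" using sub cB by (simp add: grids_def all_pairs_def)
    next
      fix B assume "B \<in> grids M W r"
      then have B: "B \<subseteq> {n. n < 144 \<and> n mod M = r}" "card B = 3 * W" "all_pairs (RG M W) B" by (auto simp: grids_def)
      have BZ: "B \<subseteq> Z144" using B(1) by (auto simp: Z144_def)
      have "B \<noteq> {}" using B(2) ps by auto
      then obtain q where q: "q \<in> B" by blast
      have qr: "q mod M = r" using B(1) q by blast
      have full: "\<exists>b\<in>B. b mod (M * W) = x mod (M * W) \<and> b mod 3 = y mod 3" if "x mod M = r" for x y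
        using grid_full[OF lv BZ B(3,2) q, of x y] that qr by auto
      let ?X = "(\<lambda>b. b mod 16) ` B" and ?Y = "(\<lambda>b. b mod 9) ` B"
      have d: "b mod 16 mod (M * W) = b mod (M * W)" "b mod 16 mod M = b mod M" "b mod 9 mod 3 = b mod 3" for b
      proof -
        have "M dvd 16" using lv by (cases rule: levelsE) auto
        then show "b mod 16 mod (M * W) = b mod (M * W)" "b mod 16 mod M = b mod M" "b mod 9 mod 3 = b mod 3"
          using ps by (simp_all add: mod_mod_cancel)
      qed
      have "?X \<in> FX"
        unfolding FX_def
      proof (intro CollectI conjI ballI)
        show "?X \<subseteq> {x. x < 16 \<and> x mod M = r}" using B(1) d by auto
        fix c assume c: "c \<in> C"
        then obtain b where b: "b \<in> B" "b mod (M * W) = c" using full[of c 0] by (auto simp: C_def)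
        have "{x\<in>?X. x mod (M * W) = c} = {b mod 16}"
        proof (intro equalityI subsetI)
          fix x assume "x \<in> {x\<in>?X. x mod (M * W) = c}"
          then obtain b' where b': "b' \<in> B" "x = b' mod 16" "b' mod (M * W) = c" using d(1) by auto
          then show "x \<in> {b mod 16}" using all_pairsD[OF B(3) b'(1) b(1)] b(2) by (simp add: RG_def)
        qed (use b d(1) in auto)
        then show "{x\<in>?X. x mod (M * W) = c} \<in> (\<lambda>x. {x}) ` {x. x < 16 \<and> x mod (M * W) = c}" using b d by auto
      qed
      moreover have "?Y \<in> FY"
        unfolding FY_def
      proof (intro CollectI conjI ballI)
        show "?Y \<subseteq> {y. y < 9}" by auto
        fix t :: nat assume t: "t \<in> {..<3}"
        then obtain b where b: "b \<in> B" "b mod 3 = t" using full[OF qr, of t] by auto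
        have "{y\<in>?Y. y mod 3 = t} = {b mod 9}"
        proof (intro equalityI subsetI)
          fix y assume "y \<in> {y\<in>?Y. y mod 3 = t}"
          then obtain b' where b': "b' \<in> B" "y = b' mod 9" "b' mod 3 = t" using d(3) by auto
          then show "y \<in> {b mod 9}" using all_pairsD[OF B(3) b'(1) b(1)] b(2) by (simp add: RG_def)
        qed (use b d(3) in auto)
        then show "{y\<in>?Y. y mod 3 = t} \<in> (\<lambda>y. {y}) ` {y. y < 9 \<and> y mod 3 = t}" using b d by auto
      qed
      moreover have "B = ?P (?X, ?Y)"
      proof (intro equalityI subsetI)
        fix n assume "n \<in> ?P (?X, ?Y)"
        then obtain b1 b2 where n: "n < 144" "b1 \<in> B" "n mod 16 = b1 mod 16" "b2 \<in> B" "n mod 9 = b2 mod 9" by auto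
        obtain b where b: "b \<in> B" "b mod (M * W) = b1 mod (M * W)" "b mod 3 = b2 mod 3"
          using full[of b1 b2] B(1) n(2) by blast
        have "b mod 16 = b1 mod 16" "b mod 9 = b2 mod 9"
          using all_pairsD[OF B(3) b(1) n(2)] all_pairsD[OF B(3) b(1) n(4)] b by (auto simp: RG_def)
        then have "b = n" using crt_eq[of b n] n b less_144[OF BZ b(1)] by simp
        then show "n \<in> B" using b by simp
      qed (use B(1) in auto)
      ultimately show "B \<in> ?P ` (FX \<times> FY)" by blast
    qed
  qed
  then show ?thesis using cFX cFY by (simp add: bij_betw_same_card[symmetric] card_cartesian_product)
qed

text \<open>48 / (M * W) is the largest possible size, see \<open>card_le\<close> in the locale
  below. A complement of the required cardinality therefore consists of one piece in each admissible
  class modulo M.\<close>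

definition pieces :: "nat \<Rightarrow> nat \<Rightarrow> nat \<Rightarrow> nat set set" where
  "pieces M W j = {P. P \<subseteq> {n. n < 144 \<and> n mod M = j} \<and> card P = 48 div (M * W) \<and> all_pairs (RC M W) P}"

lemma card_UN_const:
  assumes "finite I" "\<And>i. i \<in> I \<Longrightarrow> card (F i) = c" "\<And>i. i \<in> I \<Longrightarrow> finite (F i)"
    "\<And>i j S. i \<in> I \<Longrightarrow> j \<in> I \<Longrightarrow> S \<in> F i \<Longrightarrow> S \<in> F j \<Longrightarrow> i = j"
  shows "card (\<Union>i\<in>I. F i) = card I * c"
proof -
  have "card (\<Union>i\<in>I. F i) = (\<Sum>i\<in>I. card (F i))"
    by (rule card_UN_disjoint) (use assms in blast)+
  then show ?thesis using assms by simp
qed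

lemma finite_functional_sets: "finite (functional_sets k I m J)"
proof (rule finite_subset)
  show "functional_sets k I m J \<subseteq> Pow {..<144}" unfolding functional_sets_def by auto
qed simp

lemma functional_sets_mod:
  assumes "A \<in> functional_sets k I m J" "a \<in> A"
  shows "a < 144" "a mod k \<in> I" "a mod m \<in> J"
  using assms unfolding functional_sets_def by blast+

lemma functional_sets_eq:
  assumes "A \<in> functional_sets k I m J" "a \<in> A" "b \<in> A" "a mod k = b mod k"
  shows "a mod m = b mod m"
  using assms unfolding functional_sets_def by blast

lemma functional_sets_card: "A \<in> functional_sets k I m J \<Longrightarrow> card A = card I * (144 div (k * m))"
  unfolding functional_sets_def by blast

lemma functional_setsI:
  assumes "\<And>a. a \<in> A \<Longrightarrow> a < 144 \<and> a mod k \<in> I \<and> a mod m \<in> J" "card A = card I * (144 div (k * m))"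
    "\<And>a b. a \<in> A \<Longrightarrow> b \<in> A \<Longrightarrow> a mod k = b mod k \<Longrightarrow> a mod m = b mod m"
  shows "A \<in> functional_sets k I m J"
  unfolding functional_sets_def using assms by blast

text \<open>A piece is of one of two types: in one class modulo M * W with the residue modulo 3 a
  function of that modulo 16 (\<open>T1\<close>), or in one class modulo 3 with the class modulo M *
  W a function of the residue modulo 9 (\<open>T2\<close>). \<open>T1\<close> turns out to be the
  pieces stable under 48, \<open>T1s\<close> those of them also stable under 72, and
  \<open>T12\<close> the pieces of both types.\<close>

locale piece_count =
  fixes M W j :: nat
  assumes lv: "levels M W" and j: "j < M"
begin

definition R where "R = {r. r < M * W \<and> r mod M = j}"
abbreviation t1 where "t1 r \<equiv> functional_sets 16 {x. x < 16 \<and> x mod (M * W) = r} 3 {..<3}"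
abbreviation t1s where "t1s r \<equiv> functional_sets 8 {x. x < 8 \<and> x mod (M * W) = r} 3 {..<3}"
abbreviation t2 where "t2 t \<equiv> functional_sets 9 {y. y < 9 \<and> y mod 3 = t} (M * W) R"
abbreviation t12 where "t12 r \<equiv> functional_sets (M * W) {r} 3 {..<3}"
definition T1 where "T1 = (\<Union>r\<in>R. t1 r)"
definition T1s where "T1s = (\<Union>r\<in>R. t1s r)"
definition T2 where "T2 = (\<Union>t<3. t2 t)"
definition T12 where "T12 = (\<Union>r\<in>R. t12 r)"

lemma MW: "M * W = 4 \<or> M * W = 8" "M dvd M * W" "M dvd 144" "M dvd 16" "M dvd 8" "M * W dvd 144" "M * W dvd 16" "M * W dvd 8" "M > 0" "M * W > 0"
  "M dvd 48" "M dvd 72" "M * W dvd 48" "M * W dvd 72"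
  using lv by (cases rule: levelsE; simp)+

lemma modM: "x mod (M * W) mod M = x mod M" by (simp add: mod_mod_cancel)

lemma mod16: "x mod 16 mod (M * W) = x mod (M * W)" using MW by (simp add: mod_mod_cancel)

lemma mod8: "x mod 8 mod (M * W) = x mod (M * W)" using MW by (simp add: mod_mod_cancel)

lemma mod93: "x mod 9 mod 3 = x mod (3::nat)" by (simp add: mod_mod_cancel)

lemma finR: "finite R" by (simp add: R_def)

lemma cardR: "card R = W" using card_classes[OF lv, of j] j by (simp add: R_def)

lemma in_R: "x mod (M * W) \<in> R \<longleftrightarrow> x mod M = j" using MW modM by (simp add: R_def)

lemma copr: "coprime 16 (3::nat)" "coprime 8 (3::nat)" "coprime 9 (M * W)" "coprime (M * W) 3"
proof -
  have c: "coprime 16 (3::nat)" "coprime 8 (3::nat)" "coprime 4 (3::nat)" "coprime 9 (4::nat)" "coprime 9 (8::nat)"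
    by (simp_all add: coprime_iff_gcd_eq_1 gcd_non_0_nat)
  then show "coprime 16 (3::nat)" "coprime 8 (3::nat)" by blast+
  show "coprime 9 (M * W)" "coprime (M * W) 3" using MW(1) c by metis+
qed

lemma rp1: "residue_pair 16 3 {x. x < 16 \<and> x mod (M * W) = r} {..<3}"
  by unfold_locales (use copr in auto)

lemma rp1s: "residue_pair 8 3 {x. x < 8 \<and> x mod (M * W) = r} {..<3}"
  by unfold_locales (use copr in auto)

lemma rp2: "residue_pair 9 (M * W) {y. y < 9 \<and> y mod 3 = t} R"
  by unfold_locales (use copr MW(1) in \<open>auto simp: R_def\<close>)

lemma rp12: "r \<in> R \<Longrightarrow> residue_pair (M * W) 3 {r} {..<3}"
  by unfold_locales (use copr MW(1) in \<open>auto simp: R_def\<close>)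

lemma card_index:
  "r \<in> R \<Longrightarrow> card {x. x < 16 \<and> x mod (M * W) = r} = 16 div (M * W)"
  "r \<in> R \<Longrightarrow> card {x. x < 8 \<and> x mod (M * W) = r} = 8 div (M * W)"
  "t < 3 \<Longrightarrow> card {y. y < 9 \<and> y mod 3 = (t::nat)} = 3"
  using card_residue_class[of "M * W" 16 r] card_residue_class[of "M * W" 8 r] card_residue_class[of 3 9 t] MW
  by (auto simp: R_def)

lemma sizes:
  "16 div (M * W) * 3 = 48 div (M * W)" "8 div (M * W) * 6 = 48 div (M * W)"
  "3 * (144 div (9 * (M * W))) = 48 div (M * W)" "144 div (M * W * 3) = 48 div (M * W)" "48 div (M * W) > 0"
  using MW(1) by auto

lemma pieces_mem: "P \<in> pieces M W j \<Longrightarrow> a \<in> P \<Longrightarrow> a < 144 \<and> a mod M = j"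
  unfolding pieces_def by blast

lemma pieces_RC: "P \<in> pieces M W j \<Longrightarrow> a \<in> P \<Longrightarrow> b \<in> P \<Longrightarrow> RC M W a b"
  unfolding pieces_def using all_pairsD by blast

lemma piecesI:
  assumes "\<And>a. a \<in> P \<Longrightarrow> a < 144 \<and> a mod M = j" "card P = 48 div (M * W)"
    "\<And>a b. a \<in> P \<Longrightarrow> b \<in> P \<Longrightarrow> RC M W a b"
  shows "P \<in> pieces M W j"
  unfolding pieces_def all_pairs_def using assms by blast

lemma ne: "card P = 48 div (M * W) \<Longrightarrow> \<exists>a. a \<in> P"
  using sizes(5) by (metis card.empty ex_in_conv less_irrefl)

lemma single_class_T1:
  assumes P: "P \<in> pieces M W j" and s: "\<And>a b. a \<in> P \<Longrightarrow> b \<in> P \<Longrightarrow> a mod (M * W) = b mod (M * W)"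
  shows "P \<in> T1"
proof -
  have c: "card P = 48 div (M * W)" using P by (simp add: pieces_def)
  obtain a where a: "a \<in> P" using ne[OF c] by blast
  have r: "a mod (M * W) \<in> R" using pieces_mem[OF P a] in_R by simp
  have "P \<in> t1 (a mod (M * W))"
  proof (rule functional_setsI)
    show "b < 144 \<and> b mod 16 \<in> {x. x < 16 \<and> x mod (M * W) = a mod (M * W)} \<and> b mod 3 \<in> {..<3}" if "b \<in> P" for b
      using pieces_mem[OF P that] s[OF that a] mod16 by simp
    show "card P = card {x. x < 16 \<and> x mod (M * W) = a mod (M * W)} * (144 div (16 * 3))"
      using c card_index(1)[OF r] sizes(1) by simp
    show "b mod 3 = c mod 3" if "b \<in> P" "c \<in> P" "b mod 16 = c mod 16" for b c
      using pieces_RC[OF P that(1,2)] that(3) pieces_mem[OF P that(1)] pieces_mem[OF P that(2)] unfolding RC_def by metis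
  qed
  then show ?thesis using r by (auto simp: T1_def)
qed

lemma single_third_T2:
  assumes P: "P \<in> pieces M W j" and s: "\<And>a b. a \<in> P \<Longrightarrow> b \<in> P \<Longrightarrow> a mod 3 = b mod 3"
  shows "P \<in> T2"
proof -
  have c: "card P = 48 div (M * W)" using P by (simp add: pieces_def)
  obtain a where a: "a \<in> P" using ne[OF c] by blast
  have "P \<in> t2 (a mod 3)"
  proof (rule functional_setsI)
    show "b < 144 \<and> b mod 9 \<in> {y. y < 9 \<and> y mod 3 = a mod 3} \<and> b mod (M * W) \<in> R" if "b \<in> P" for b
      using pieces_mem[OF P that] s[OF that a] mod93 in_R by simp
    show "card P = card {y. y < 9 \<and> y mod 3 = a mod 3} * (144 div (9 * (M * W)))"
      using c card_index(3)[of "a mod 3"] sizes(3) by simp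
    show "b mod (M * W) = c mod (M * W)" if "b \<in> P" "c \<in> P" "b mod 9 = c mod 9" for b c
      using pieces_RC[OF P that(1,2)] that(3) pieces_mem[OF P that(1)] pieces_mem[OF P that(2)] unfolding RC_def by metis
  qed
  then show ?thesis unfolding T2_def by (intro UN_I[of "a mod 3"]) simp_all
qed

lemma T1_pieces: "P \<in> T1 \<Longrightarrow> P \<in> pieces M W j"
proof -
  assume "P \<in> T1"
  then obtain r where r: "r \<in> R" "P \<in> t1 r" by (auto simp: T1_def)
  have m: "a mod (M * W) = r" if "a \<in> P" for a
    using functional_sets_mod(2)[OF r(2) that] mod16[of a] by simp
  show ?thesis
  proof (rule piecesI)
    show "a < 144 \<and> a mod M = j" if "a \<in> P" for a
      using functional_sets_mod(1)[OF r(2) that] m[OF that] r(1) in_R[of a] by simp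
    show "card P = 48 div (M * W)" using functional_sets_card[OF r(2)] card_index(1)[OF r(1)] sizes(1) by simp
    show "RC M W a b" if "a \<in> P" "b \<in> P" for a b
      unfolding RC_def using m[OF that(1)] m[OF that(2)] functional_sets_eq[OF r(2) that] by simp
  qed
qed

lemma T2_pieces: "P \<in> T2 \<Longrightarrow> P \<in> pieces M W j"
proof -
  assume "P \<in> T2"
  then obtain t where t: "t < 3" "P \<in> t2 t" by (auto simp: T2_def)
  have m: "a mod 3 = t" if "a \<in> P" for a
    using functional_sets_mod(2)[OF t(2) that] mod93[of a] by simp
  show ?thesis
  proof (rule piecesI)
    show "a < 144 \<and> a mod M = j" if "a \<in> P" for a
      using functional_sets_mod[OF t(2) that] in_R[of a] by simp
    show "card P = 48 div (M * W)" using functional_sets_card[OF t(2)] card_index(3)[OF t(1)] sizes(3) by simp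
    show "RC M W a b" if "a \<in> P" "b \<in> P" for a b
      unfolding RC_def using m[OF that(1)] m[OF that(2)] functional_sets_eq[OF t(2) that] by metis
  qed
qed

lemma T1_class: "P \<in> T1 \<Longrightarrow> a \<in> P \<Longrightarrow> b \<in> P \<Longrightarrow> a mod (M * W) = b mod (M * W)"
proof -
  assume "P \<in> T1" and ab: "a \<in> P" "b \<in> P"
  then obtain r where r: "P \<in> t1 r" by (auto simp: T1_def)
  show ?thesis
    using functional_sets_mod(2)[OF r ab(1)] functional_sets_mod(2)[OF r ab(2)] mod16[of a] mod16[of b] by simp
qed

lemma T2_third: "P \<in> T2 \<Longrightarrow> a \<in> P \<Longrightarrow> b \<in> P \<Longrightarrow> a mod 3 = b mod 3"
proof -
  assume "P \<in> T2" and ab: "a \<in> P" "b \<in> P"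
  then obtain t where t: "P \<in> t2 t" by (auto simp: T2_def)
  show ?thesis
    using functional_sets_mod(2)[OF t ab(1)] functional_sets_mod(2)[OF t ab(2)] mod93[of a] mod93[of b] by simp
qed

text \<open>Elements in different classes modulo M * W agree modulo 3. A third element differs
  modulo M * W from at least one of two such elements, so it has the same residue modulo 3.\<close>

lemma RC_dichotomy:
  assumes P: "\<And>a. a \<in> P \<Longrightarrow> a mod M = j" "\<And>a b. a \<in> P \<Longrightarrow> b \<in> P \<Longrightarrow> RC M W a b"
  shows "(\<forall>a\<in>P. \<forall>b\<in>P. a mod (M * W) = b mod (M * W)) \<or> (\<forall>a\<in>P. \<forall>b\<in>P. a mod 3 = b mod 3)"
proof (rule ccontr)
  assume n: "\<not> ?thesis"
  then obtain a b where ab: "a \<in> P" "b \<in> P" "a mod (M * W) \<noteq> b mod (M * W)" by blast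
  have r: "x mod 3 = y mod 3" if "x \<in> P" "y \<in> P" "x mod (M * W) \<noteq> y mod (M * W)" for x y
    using P(2)[OF that(1,2)] P(1)[OF that(1)] P(1)[OF that(2)] that(3) unfolding RC_def by simp
  have "c mod 3 = a mod 3" if c: "c \<in> P" for c
    using r[OF c ab(1)] r[OF c ab(2)] r[OF ab] ab(3) by metis
  then have "\<forall>x\<in>P. \<forall>y\<in>P. x mod 3 = y mod 3" by metis
  then show False using n by blast
qed

lemma C1: "pieces M W j = T1 \<union> T2"
proof (intro equalityI subsetI)
  fix P assume P: "P \<in> pieces M W j"
  show "P \<in> T1 \<union> T2"
    using RC_dichotomy[of P] pieces_mem[OF P] pieces_RC[OF P] single_class_T1[OF P] single_third_T2[OF P] by blast
qed (use T1_pieces T2_pieces in auto)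

lemma T1_stable: "P \<in> T1 \<Longrightarrow> stable 48 P"
  unfolding T1_def using residue_pair.functional_sets_stable[OF rp1, of P _ 48] by auto

lemma T2_stable: "P \<in> T2 \<Longrightarrow> stable 72 P"
  unfolding T2_def using residue_pair.functional_sets_stable[OF rp2, of P _ 72] MW by auto

text \<open>Only pieces of the second type need an argument: shifts by 48 reach every residue modulo
  9 over the common residue modulo 3 and keep the residue modulo M * W, so this residue is
  constant.\<close>

lemma C2: "{P \<in> pieces M W j. stable 48 P} = T1"
proof (intro equalityI subsetI)
  fix P assume "P \<in> {P \<in> pieces M W j. stable 48 P}"
  then have P: "P \<in> pieces M W j" and st: "stable 48 P" by auto
  show "P \<in> T1"
  proof (cases "P \<in> T2")
    case False
    then show ?thesis using P C1 by blast
  next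
    case True
    then obtain t where t: "t < 3" "P \<in> t2 t" by (auto simp: T2_def)
    have PZ: "P \<subseteq> Z144" using pieces_mem[OF P] by (auto simp: Z144_def)
    show ?thesis
    proof (rule single_class_T1[OF P])
      fix a b assume ab: "a \<in> P" "b \<in> P"
      have "a mod 3 = b mod 3" using T2_third[OF True ab] .
      have "\<exists>k<3. b mod 9 = (a + 3 * k) mod 9"
      proof -
        have e: "n mod 9 = 3 * (n div 3 mod 3) + n mod 3" for n :: nat using mod_mult2_eq[of n 3 3] by simp
        \<comment> \<open>2 is -1 modulo 3: the number of steps is b div 3 - a div 3.\<close>
        have "(b div 3 + 2 * (a div 3)) mod 3 < 3" by simp
        moreover have "b mod 9 = (a + 3 * ((b div 3 + 2 * (a div 3)) mod 3)) mod 9"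
        proof -
          have d: "(a + 3 * k) div 3 = a div 3 + k" "(a + 3 * k) mod 3 = a mod 3" for k by simp_all
          have "(a div 3 + (b div 3 + 2 * (a div 3)) mod 3) mod 3 = (3 * (a div 3) + b div 3) mod 3"
            by (simp add: mod_add_right_eq algebra_simps)
          then show ?thesis unfolding e d using \<open>a mod 3 = b mod 3\<close> by simp
        qed
        ultimately show ?thesis by blast
      qed
      then obtain k where k: "k < 3" "b mod 9 = (a + 3 * k) mod 9" by blast
      let ?c = "(a + 48 * k) mod 144"
      have c: "?c \<in> P" using closed_mult[OF st in_mem[OF PZ ab(1)], of k] by (simp add: mem_def)
      have "?c mod 9 = (a + 48 * k) mod 9" by (simp add: mod_mod_cancel)
      also have "\<dots> = (a + 3 * k) mod 9"
      proof -
        have "a + 48 * k = (a + 3 * k) + 9 * (5 * k)" by simp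
        then show ?thesis by (metis mod_mult_self2)
      qed
      finally have "b mod 9 = ?c mod 9" using k by simp
      then have "b mod (M * W) = ?c mod (M * W)" using functional_sets_eq[OF t(2) ab(2) c] by simp
      also have "\<dots> = (a + 48 * k) mod (M * W)" using MW by (simp add: mod_mod_cancel)
      also have "\<dots> = a mod (M * W)"
      proof -
        obtain q where "48 = M * W * q" using MW(13) by blast
        then have "a + 48 * k = a + M * W * (q * k)" by (simp only: mult.assoc)
        then show ?thesis by (simp only: mod_mult_self2)
      qed
      finally show "a mod (M * W) = b mod (M * W)" by simp
    qed
  qed
qed (use T1_pieces T1_stable in auto)

lemma C3: "T1 \<inter> T2 = T12"
proof (intro equalityI subsetI)
  fix P assume P: "P \<in> T1 \<inter> T2"
  then have p: "P \<in> pieces M W j" using T1_pieces by blast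
  have c: "card P = 48 div (M * W)" using p by (simp add: pieces_def)
  obtain a where a: "a \<in> P" using ne[OF c] by blast
  have r: "a mod (M * W) \<in> R" using pieces_mem[OF p a] in_R by simp
  have "P \<in> t12 (a mod (M * W))"
  proof (rule functional_setsI)
    show "b < 144 \<and> b mod (M * W) \<in> {a mod (M * W)} \<and> b mod 3 \<in> {..<3}" if "b \<in> P" for b
      using pieces_mem[OF p that] T1_class[of P b a] P that a by simp
    show "card P = card {a mod (M * W)} * (144 div (M * W * 3))" using c sizes(4) by simp
    show "b mod 3 = c mod 3" if "b \<in> P" "c \<in> P" for b c using T2_third[of P b c] P that by simp
  qed
  then show "P \<in> T12" using r by (auto simp: T12_def)
next
  fix P assume "P \<in> T12"
  then obtain r where r: "r \<in> R" "P \<in> t12 r" by (auto simp: T12_def)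
  have m: "a mod (M * W) = r" if "a \<in> P" for a using functional_sets_mod(2)[OF r(2) that] by simp
  have t: "a mod 3 = b mod 3" if "a \<in> P" "b \<in> P" for a b
    using functional_sets_eq[OF r(2) that] m that by simp
  have p: "P \<in> pieces M W j"
  proof (rule piecesI)
    show "a < 144 \<and> a mod M = j" if "a \<in> P" for a
      using functional_sets_mod(1)[OF r(2) that] m[OF that] r(1) in_R[of a] by simp
    show "card P = 48 div (M * W)" using functional_sets_card[OF r(2)] sizes(4) by simp
    show "RC M W a b" if "a \<in> P" "b \<in> P" for a b
      unfolding RC_def using m[OF that(1)] m[OF that(2)] t[OF that] by simp
  qed
  have "P \<in> T1" by (rule single_class_T1[OF p]) (use m in simp)
  moreover have "P \<in> T2" by (rule single_third_T2[OF p t])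
  ultimately show "P \<in> T1 \<inter> T2" ..
qed

text \<open>72 is 8 modulo 16 and 0 modulo 3, so stability means that the residue modulo 3 depends
  on the residue modulo 8 alone.\<close>

lemma C4: "{P \<in> T1. stable 72 P} = T1s"
proof (intro equalityI subsetI)
  fix P assume "P \<in> {P \<in> T1. stable 72 P}"
  then have P: "P \<in> T1" and st: "stable 72 P" by auto
  then obtain r where r: "r \<in> R" "P \<in> t1 r" by (auto simp: T1_def)
  have PZ: "P \<subseteq> Z144" using pieces_mem[OF T1_pieces[OF P]] by (auto simp: Z144_def)
  have m: "a mod (M * W) = r" if "a \<in> P" for a
    using functional_sets_mod(2)[OF r(2) that] mod16[of a] by simp
  have "P \<in> t1s r"
  proof (rule functional_setsI)
    show "b < 144 \<and> b mod 8 \<in> {x. x < 8 \<and> x mod (M * W) = r} \<and> b mod 3 \<in> {..<3}" if "b \<in> P" for b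
      using functional_sets_mod(1)[OF r(2) that] m[OF that] mod8 by simp
    show "card P = card {x. x < 8 \<and> x mod (M * W) = r} * (144 div (8 * 3))"
      using functional_sets_card[OF r(2)] card_index(1,2)[OF r(1)] sizes by simp
    show "a mod 3 = b mod 3" if ab: "a \<in> P" "b \<in> P" "a mod 8 = b mod 8" for a b
    proof (cases "a mod 16 = b mod 16")
      case True
      then show ?thesis using functional_sets_eq[OF r(2) ab(1,2)] by simp
    next
      case False
      then have "a mod 16 = (b + 8) mod 16" using mod_double[of a 8 b] ab(3) by simp
      also have "\<dots> = (b + 72) mod 16" using mod_add_eqI[of 8 16 72 b] by simp
      finally have e: "a mod 16 = (b + 72) mod 144 mod 16" by (simp add: mod_mod_cancel)
      have "(b + 72) mod 144 \<in> P" using st in_mem[OF PZ ab(2)] by (simp add: stable_def mem_def)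
      then have "a mod 3 = (b + 72) mod 144 mod 3" using functional_sets_eq[OF r(2) ab(1) _ e] by simp
      also have "\<dots> = (b + 72) mod 3" by (simp add: mod_mod_cancel)
      also have "\<dots> = b mod 3" using mod_add_eqI[of 72 3 0 b] by simp
      finally show ?thesis .
    qed
  qed
  then show "P \<in> T1s" using r by (auto simp: T1s_def)
next
  fix P assume "P \<in> T1s"
  then obtain r where r: "r \<in> R" "P \<in> t1s r" by (auto simp: T1s_def)
  have m: "a mod (M * W) = r" if "a \<in> P" for a
    using functional_sets_mod(2)[OF r(2) that] mod8[of a] by simp
  have "P \<in> t1 r"
  proof (rule functional_setsI)
    show "b < 144 \<and> b mod 16 \<in> {x. x < 16 \<and> x mod (M * W) = r} \<and> b mod 3 \<in> {..<3}" if "b \<in> P" for b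
      using functional_sets_mod(1)[OF r(2) that] m[OF that] mod16 by simp
    show "card P = card {x. x < 16 \<and> x mod (M * W) = r} * (144 div (16 * 3))"
      using functional_sets_card[OF r(2)] card_index(1,2)[OF r(1)] sizes by simp
    show "a mod 3 = b mod 3" if "a \<in> P" "b \<in> P" "a mod 16 = b mod 16" for a b
      using functional_sets_eq[OF r(2) that(1,2)] mod_chain(1)[OF that(3)] by simp
  qed
  moreover have "stable 72 P" by (rule residue_pair.functional_sets_stable[OF rp1s r(2)]) simp_all
  ultimately show "P \<in> {P \<in> T1. stable 72 P}" using r by (auto simp: T1_def)
qed

lemma cards:
  "card T1 = W * 3 ^ (16 div (M * W))" "card T1s = W * 3 ^ (8 div (M * W))" "card T2 = 3 * W ^ 3" "card T12 = W * 3"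
  "finite T1" "finite T1s" "finite T2" "finite T12"
proof -
  note fin = finite_functional_sets
  have nn: "\<exists>a. a \<in> S" if "S \<in> T1 \<union> T2" for S using that C1 ne pieces_def by auto
  show "finite T1" "finite T1s" "finite T2" "finite T12"
    unfolding T1_def T1s_def T2_def T12_def using finR fin by blast+
  have "card (\<Union>r\<in>R. t1 r) = card R * 3 ^ (16 div (M * W))"
  proof (rule card_UN_const[OF finR _ fin])
    show "card (t1 r) = 3 ^ (16 div (M * W))" if "r \<in> R" for r
      using residue_pair.card_functional_sets[OF rp1, of r] card_index(1)[OF that] by simp
    fix r s S assume h: "r \<in> R" "s \<in> R" "S \<in> t1 r" "S \<in> t1 s"
    then have "S \<in> T1 \<union> T2" by (auto simp: T1_def)
    then obtain a where "a \<in> S" using nn by blast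
    then show "r = s" using functional_sets_mod(2)[OF h(3)] functional_sets_mod(2)[OF h(4)] by blast
  qed
  then show "card T1 = W * 3 ^ (16 div (M * W))" using cardR by (simp add: T1_def)
  have "card (\<Union>r\<in>R. t1s r) = card R * 3 ^ (8 div (M * W))"
  proof (rule card_UN_const[OF finR _ fin])
    show "card (t1s r) = 3 ^ (8 div (M * W))" if "r \<in> R" for r
      using residue_pair.card_functional_sets[OF rp1s, of r] card_index(2)[OF that] by simp
    fix r s S assume h: "r \<in> R" "s \<in> R" "S \<in> t1s r" "S \<in> t1s s"
    then have "S \<in> T1 \<union> T2" using C4 by (auto simp: T1s_def)
    then obtain a where "a \<in> S" using nn by blast
    then show "r = s" using functional_sets_mod(2)[OF h(3)] functional_sets_mod(2)[OF h(4)] by blast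
  qed
  then show "card T1s = W * 3 ^ (8 div (M * W))" using cardR by (simp add: T1s_def)
  have "card (\<Union>r\<in>R. t12 r) = card R * 3"
  proof (rule card_UN_const[OF finR _ fin])
    show "card (t12 r) = 3" if "r \<in> R" for r
      using residue_pair.card_functional_sets[OF rp12[OF that]] by simp
    fix r s S assume h: "r \<in> R" "s \<in> R" "S \<in> t12 r" "S \<in> t12 s"
    then have "S \<in> T1 \<union> T2" using C3 by (auto simp: T12_def)
    then obtain a where "a \<in> S" using nn by blast
    then show "r = s" using functional_sets_mod(2)[OF h(3)] functional_sets_mod(2)[OF h(4)] by blast
  qed
  then show "card T12 = W * 3" using cardR by (simp add: T12_def)
  have "card (\<Union>t\<in>{..<3}. t2 t) = card {..<3::nat} * W ^ 3"
  proof (rule card_UN_const[OF _ _ fin])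
    show "card (t2 t) = W ^ 3" if "t \<in> {..<3}" for t
      using residue_pair.card_functional_sets[OF rp2, of t] card_index(3)[of t] cardR that by simp
    fix r s S assume h: "r \<in> {..<3}" "s \<in> {..<3}" "S \<in> t2 r" "S \<in> t2 s"
    then have "S \<in> T1 \<union> T2" by (auto simp: T2_def)
    then obtain a where "a \<in> S" using nn by blast
    then show "r = s" using functional_sets_mod(2)[OF h(3)] functional_sets_mod(2)[OF h(4)] by blast
  qed simp
  then show "card T2 = 3 * W ^ 3" by (simp add: T2_def)
qed

text \<open>Inclusion and exclusion for the two types, with the overlap added on the left to stay
  clear of truncated subtraction.\<close>

lemma card_pieces:
  "card (pieces M W j) + W * 3 = W * 3 ^ (16 div (M * W)) + 3 * W ^ 3"
  "card {P \<in> pieces M W j. stable 48 P} = W * 3 ^ (16 div (M * W))"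
  "card {P \<in> pieces M W j. stable 72 P} + W * 3 = W * 3 ^ (8 div (M * W)) + 3 * W ^ 3"
  "card {P \<in> pieces M W j. stable 48 P \<and> stable 72 P} = W * 3 ^ (8 div (M * W))"
proof -
  show "card (pieces M W j) + W * 3 = W * 3 ^ (16 div (M * W)) + 3 * W ^ 3"
    using card_Un_Int[OF cards(5,7)] unfolding C1 C3 cards by simp
  show "card {P \<in> pieces M W j. stable 48 P} = W * 3 ^ (16 div (M * W))"
    unfolding C2 cards ..
  have "{P \<in> pieces M W j. stable 72 P} = T1s \<union> T2"
    unfolding C1 C4[symmetric] using T2_stable by blast
  moreover have "T1s \<inter> T2 = T12"
    unfolding C3[symmetric] C4[symmetric] using T2_stable by blast
  ultimately show "card {P \<in> pieces M W j. stable 72 P} + W * 3 = W * 3 ^ (8 div (M * W)) + 3 * W ^ 3"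
    using card_Un_Int[OF cards(6,7)] cards by simp
  have e: "{P \<in> pieces M W j. stable 48 P \<and> stable 72 P} = T1s"
    unfolding C4[symmetric] C2[symmetric] by blast
  show "card {P \<in> pieces M W j. stable 48 P \<and> stable 72 P} = W * 3 ^ (8 div (M * W))"
    unfolding e cards ..
qed

lemma card_le:
  assumes P: "\<And>a. a \<in> P \<Longrightarrow> a < 144 \<and> a mod M = j" "\<And>a b. a \<in> P \<Longrightarrow> b \<in> P \<Longrightarrow> RC M W a b"
  shows "card P \<le> 48 div (M * W)"
proof (cases "P = {}")
  case False
  then obtain a where a: "a \<in> P" by blast
  consider "\<forall>a\<in>P. \<forall>b\<in>P. a mod (M * W) = b mod (M * W)" | "\<forall>a\<in>P. \<forall>b\<in>P. a mod 3 = b mod 3"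
    using RC_dichotomy[of P] P by blast
  then show ?thesis
  proof cases
    case 1
    have r: "a mod (M * W) \<in> R" using P(1)[OF a] in_R by simp
    have "card P \<le> card {x. x < 16 \<and> x mod (M * W) = a mod (M * W)} * (144 div (16 * 3))"
    proof (rule residue_pair.card_le[OF rp1])
      show "P \<subseteq> {n. n < 144 \<and> n mod 16 \<in> {x. x < 16 \<and> x mod (M * W) = a mod (M * W)} \<and> n mod 3 \<in> {..<3}}"
      proof
        fix b assume b: "b \<in> P"
        have "b mod (M * W) = a mod (M * W)" using 1 a b by blast
        then show "b \<in> {n. n < 144 \<and> n mod 16 \<in> {x. x < 16 \<and> x mod (M * W) = a mod (M * W)} \<and> n mod 3 \<in> {..<3}}"
          using P(1)[OF b] mod16[of b] by simp
      qed
      show "\<forall>a\<in>P. \<forall>b\<in>P. a mod 16 = b mod 16 \<longrightarrow> a mod 3 = b mod 3"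
        using P unfolding RC_def by metis
    qed
    then show ?thesis using card_index(1)[OF r] sizes(1) by simp
  next
    case 2
    have "card P \<le> card {y. y < 9 \<and> y mod 3 = a mod 3} * (144 div (9 * (M * W)))"
    proof (rule residue_pair.card_le[OF rp2])
      show "P \<subseteq> {n. n < 144 \<and> n mod 9 \<in> {y. y < 9 \<and> y mod 3 = a mod 3} \<and> n mod (M * W) \<in> R}"
      proof
        fix b assume b: "b \<in> P"
        have "b mod 3 = a mod 3" using 2 a b by blast
        then show "b \<in> {n. n < 144 \<and> n mod 9 \<in> {y. y < 9 \<and> y mod 3 = a mod 3} \<and> n mod (M * W) \<in> R}"
          using P(1)[OF b] mod93[of b] in_R[of b] by simp
      qed
      show "\<forall>a\<in>P. \<forall>b\<in>P. a mod 9 = b mod 9 \<longrightarrow> a mod (M * W) = b mod (M * W)"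
        using P unfolding RC_def by metis
    qed
    then show ?thesis using card_index(3)[of "a mod 3"] sizes(3) by simp
  qed
qed simp

end

definition complements :: "nat \<Rightarrow> nat \<Rightarrow> nat set \<Rightarrow> nat set set" where
  "complements M W I = {A. A \<subseteq> {n. n < 144 \<and> n mod M \<in> I} \<and> card A = card I * (48 div (M * W)) \<and>
     all_pairs (RC M W) A \<and> \<not> stable 48 A \<and> \<not> stable 72 A}"

lemma stable_slices:
  assumes A: "A \<subseteq> {n. n < 144 \<and> n mod m \<in> I}" and m: "m dvd 144" "m dvd g" "m > 0"
  shows "stable g A \<longleftrightarrow> (\<forall>i\<in>I. stable g {a\<in>A. a mod m = i})"
proof
  assume st: "stable g A"
  show "\<forall>i\<in>I. stable g {a\<in>A. a mod m = i}"
    unfolding stable_def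
  proof (intro ballI allI impI)
    fix i n assume "mem {a\<in>A. a mod m = i} n"
    then have n: "mem A n" "n mod 144 mod m = i" by (auto simp: mem_def)
    have "(n + g) mod m = n mod m" using m(2) by (auto elim!: dvdE)
    then have "(n + g) mod 144 mod m = i" using n(2) m(1) by (simp add: mod_mod_cancel)
    moreover have "mem A (n + g)" using st n by (simp add: stable_def)
    ultimately show "mem {a\<in>A. a mod m = i} (n + g)" by (simp add: mem_def)
  qed
next
  assume st: "\<forall>i\<in>I. stable g {a\<in>A. a mod m = i}"
  show "stable g A"
  proof (rule stable_by_residue[where m=m])
    show "A \<subseteq> Z144" using A by (auto simp: Z144_def)
    fix i assume "i < m"
    show "stable g {a\<in>A. a mod m = i}"
    proof (cases "i \<in> I")
      case False
      then have e: "{a\<in>A. a mod m = i} = {}" using A by blast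
      show ?thesis unfolding e by (simp add: stable_def mem_def)
    qed (use st in blast)
  qed (rule m)
qed

lemma slices_card_eq:
  assumes "finite I" "finite A" "\<And>a. a \<in> A \<Longrightarrow> \<kappa> a \<in> I" "\<And>i. i \<in> I \<Longrightarrow> card {a\<in>A. \<kappa> a = i} \<le> s"
  shows "card A = card I * s \<longleftrightarrow> (\<forall>i\<in>I. card {a\<in>A. \<kappa> a = i} = s)"
proof
  assume "card A = card I * s"
  then have "(\<Sum>i\<in>I. card {a\<in>A. \<kappa> a = i}) = (\<Sum>i\<in>I. s)"
    using card_sum_slices[OF assms(1-3)] by simp
  then show "\<forall>i\<in>I. card {a\<in>A. \<kappa> a = i} = s"
    using sum_mono_inv[of "\<lambda>i. card {a\<in>A. \<kappa> a = i}" I "\<lambda>i. s"] assms(1,4) by blast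
next
  assume "\<forall>i\<in>I. card {a\<in>A. \<kappa> a = i} = s"
  then show "card A = card I * s" using card_sum_slices[OF assms(1-3)] by simp
qed

text \<open>Inclusion and exclusion: from the n^|I| choices of pieces those stable under 48 and
  those stable under 72 are removed. Both shifts are multiples of M, so stability is tested slice by
  slice and the corrections are powers as well.\<close>

lemma card_complements:
  assumes lv: "levels M W" and I: "I \<subseteq> {..<M}"
    and n: "\<And>j. j < M \<Longrightarrow> card (pieces M W j) = n"
    and a: "\<And>j. j < M \<Longrightarrow> card {P \<in> pieces M W j. stable 48 P} = a"
    and b: "\<And>j. j < M \<Longrightarrow> card {P \<in> pieces M W j. stable 72 P} = b"
    and c: "\<And>j. j < M \<Longrightarrow> card {P \<in> pieces M W j. stable 48 P \<and> stable 72 P} = c"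
  shows "card (complements M W I) + a ^ card I + b ^ card I = n ^ card I + c ^ card I"
proof -
  have finI: "finite I" using I finite_subset by blast
  have M: "M dvd 144" "M dvd 48" "M dvd 72" "M > 0" using lv by (cases rule: levelsE; simp)+
  let ?U = "{n. n < 144 \<and> n mod M \<in> I}"
  define L where "L = (\<lambda>F :: nat \<Rightarrow> nat set set. {A. A \<subseteq> ?U \<and> (\<forall>i\<in>I. {a\<in>A. a mod M = i} \<in> F i)})"
  have cL: "card (L F) = k ^ card I" if "\<And>i. i < M \<Longrightarrow> F i \<subseteq> pieces M W i \<and> card (F i) = k" for F k
  proof -
    have "card (L F) = (\<Prod>i\<in>I. card (F i))"
      unfolding L_def
    proof (rule card_slices[OF finI])
      fix i S assume "i \<in> I" "S \<in> F i"
      then have "S \<in> pieces M W i" using that[of i] I by blast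
      then show "S \<subseteq> {u \<in> ?U. u mod M = i}" using \<open>i \<in> I\<close> unfolding pieces_def by blast
    qed blast
    also have "\<dots> = (\<Prod>i\<in>I. k)" using that I by (intro prod.cong) auto
    finally show ?thesis by simp
  qed
  have finL: "finite (L F)" for F
  proof (rule finite_subset)
    show "L F \<subseteq> Pow {..<144}" by (auto simp: L_def)
  qed simp
  let ?X = "L (pieces M W)" and ?Y = "L (\<lambda>j. {P \<in> pieces M W j. stable 48 P})"
    and ?Z = "L (\<lambda>j. {P \<in> pieces M W j. stable 72 P})"
  have X: "A \<in> ?X \<longleftrightarrow> A \<subseteq> ?U \<and> card A = card I * (48 div (M * W)) \<and> all_pairs (RC M W) A" for A
  proof (cases "A \<subseteq> ?U")
    case True
    have fin: "finite A" using True by (rule finite_subset) simp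
    have sub: "{a\<in>A. a mod M = i} \<subseteq> {n. n < 144 \<and> n mod M = i}" for i using True by blast
    have loc: "all_pairs (RC M W) A \<longleftrightarrow> (\<forall>i\<in>I. all_pairs (RC M W) {a\<in>A. a mod M = i})"
    proof
      assume h: "\<forall>i\<in>I. all_pairs (RC M W) {a\<in>A. a mod M = i}"
      show "all_pairs (RC M W) A"
        unfolding all_pairs_def
      proof (intro ballI)
        fix a b assume ab: "a \<in> A" "b \<in> A"
        show "RC M W a b"
        proof (cases "a mod M = b mod M")
          case t: True
          have "b mod M \<in> I" using ab True by blast
          then show ?thesis using h ab t unfolding all_pairs_def by blast
        qed (simp add: RC_def)
      qed
    qed (auto simp: all_pairs_def)
    have le: "card {a\<in>A. a mod M = i} \<le> 48 div (M * W)" if i: "i \<in> I" and r: "all_pairs (RC M W) A" for i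
    proof -
      interpret piece_count M W i by unfold_locales (use lv I i in auto)
      show ?thesis by (rule card_le) (use True r in \<open>auto simp: all_pairs_def\<close>)
    qed
    have card: "card A = card I * (48 div (M * W)) \<longleftrightarrow> (\<forall>i\<in>I. card {a\<in>A. a mod M = i} = 48 div (M * W))"
      if r: "all_pairs (RC M W) A"
      by (rule slices_card_eq[OF finI fin _ le[OF _ r]]) (use True in blast)
    show ?thesis unfolding L_def pieces_def using True sub loc card by blast
  qed (auto simp: L_def)
  have Y: "A \<in> ?Y \<longleftrightarrow> A \<in> ?X \<and> stable 48 A" and Z: "A \<in> ?Z \<longleftrightarrow> A \<in> ?X \<and> stable 72 A" for A
    unfolding L_def using stable_slices[OF _ M(1,2,4), of A I] stable_slices[OF _ M(1,3,4), of A I] by blast+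
  have V: "?Y \<inter> ?Z = L (\<lambda>j. {P \<in> pieces M W j. stable 48 P \<and> stable 72 P})" unfolding L_def by blast
  have F: "complements M W I = ?X - (?Y \<union> ?Z)"
    unfolding complements_def using X Y Z by blast
  have "?Y \<union> ?Z \<subseteq> ?X" using Y Z by blast
  then have "card (complements M W I) = card ?X - card (?Y \<union> ?Z)" "card (?Y \<union> ?Z) \<le> card ?X"
    unfolding F using finL by (auto intro: card_Diff_subset card_mono)
  moreover have "card ?Y + card ?Z = card (?Y \<union> ?Z) + card (?Y \<inter> ?Z)"
    by (rule card_Un_Int[OF finL finL])
  moreover have "card ?X = n ^ card I" "card ?Y = a ^ card I" "card ?Z = b ^ card I" "card (?Y \<inter> ?Z) = c ^ card I"
    unfolding V using n a b c by (auto intro!: cL)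
  ultimately show ?thesis by simp
qed

lemma piece_numbers:
  shows "j < 2 \<Longrightarrow> card (pieces 2 2 j) = 180 \<and> card {P \<in> pieces 2 2 j. stable 48 P} = 162 \<and>
      card {P \<in> pieces 2 2 j. stable 72 P} = 36 \<and> card {P \<in> pieces 2 2 j. stable 48 P \<and> stable 72 P} = 18"
    and "j < 4 \<Longrightarrow> card (pieces 4 2 j) = 36 \<and> card {P \<in> pieces 4 2 j. stable 48 P} = 18 \<and>
      card {P \<in> pieces 4 2 j. stable 72 P} = 24 \<and> card {P \<in> pieces 4 2 j. stable 48 P \<and> stable 72 P} = 6"
    and "j < 2 \<Longrightarrow> card (pieces 2 4 j) = 216 \<and> card {P \<in> pieces 2 4 j. stable 48 P} = 36 \<and>
      card {P \<in> pieces 2 4 j. stable 72 P} = 192 \<and> card {P \<in> pieces 2 4 j. stable 48 P \<and> stable 72 P} = 12"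
  using piece_count.card_pieces[of 2 2 j] piece_count.card_pieces[of 4 2 j] piece_count.card_pieces[of 2 4 j]
  by (auto simp: piece_count_def levels_def)

text \<open>180^2 + 18^2 - 162^2 - 36^2 = 36 * 144, which is the source of the 36 classes in
  (I).\<close>

lemma card_complements_22: "card (complements 2 2 {0, 1}) = 5184"
  using card_complements[of 2 2 "{0, 1}" 180 162 36 18] piece_numbers(1) by (simp add: levels_def)

lemma card_complements_24: "card (complements 2 4 {0, 1}) = 8640"
  using card_complements[of 2 4 "{0, 1}" 216 36 192 12] piece_numbers(3) by (simp add: levels_def)

lemma card_complements_42: "card (complements 4 2 {0, 1, 2, 3}) = 1244160"
  using card_complements[of 4 2 "{0, 1, 2, 3}" 36 18 24 6] piece_numbers(2) by (simp add: levels_def)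

lemma card_complements_42_pair: "i < 4 \<Longrightarrow> j < 4 \<Longrightarrow> i \<noteq> j \<Longrightarrow> card (complements 4 2 {i, j}) = 432"
  using card_complements[of 4 2 "{i, j}" 36 18 24 6] piece_numbers(2) by (simp add: levels_def)

section \<open>Translation-invariant families and their sizes\<close>

definition tinv :: "(nat \<Rightarrow> nat \<Rightarrow> bool) \<Rightarrow> bool" where
  "tinv R \<longleftrightarrow> (\<forall>a b g. R ((a + g) mod 144) ((b + g) mod 144) = R a b)"

lemma mod_translate_iff:
  "(m::nat) dvd 144 \<Longrightarrow> (a + g) mod 144 mod m = (b + g) mod 144 mod m \<longleftrightarrow> a mod m = b mod m"
  by (simp add: mod_mod_cancel mod_add_cong_iff)

lemma tinv_mod: "m dvd 144 \<Longrightarrow> tinv (\<lambda>a b. a mod m = b mod m)"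
  unfolding tinv_def using mod_translate_iff by blast

lemma tinv_conj: "tinv R \<Longrightarrow> tinv S \<Longrightarrow> tinv (\<lambda>a b. R a b \<and> S a b)"
  and tinv_imp: "tinv R \<Longrightarrow> tinv S \<Longrightarrow> tinv (\<lambda>a b. R a b \<longrightarrow> S a b)"
  and tinv_not: "tinv R \<Longrightarrow> tinv (\<lambda>a b. \<not> R a b)"
  by (simp_all add: tinv_def)

lemma tinv_RG: "levels M W \<Longrightarrow> tinv (RG M W)"
  unfolding RG_def by (intro tinv_conj tinv_imp tinv_mod; erule levelsE; simp)

lemma tinv_RC: "levels M W \<Longrightarrow> tinv (RC M W)"
  unfolding RC_def by (intro tinv_conj tinv_imp tinv_not tinv_mod; erule levelsE; simp)

definition family :: "nat \<Rightarrow> (nat \<Rightarrow> nat \<Rightarrow> bool) \<Rightarrow> nat set set" where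
  "family k R = {A. A \<subseteq> Z144 \<and> card A = k \<and> all_pairs R A \<and> \<not> periodic A}"

lemma translate_back:
  assumes "A \<subseteq> Z144" "g < 144"
  shows "translate (144 - g) (translate g A) = A"
proof -
  have "translate (144 - g) (translate g A) = translate 0 A" using assms by (simp add: translate_translate)
  also have "\<dots> = A" using assms by (auto simp: translate_def Z144_def image_iff subset_iff)
  finally show ?thesis .
qed

lemma periodic_translate:
  assumes A: "A \<subseteq> Z144" "g < 144" and p: "periodic (translate g A)"
  shows "periodic A"
proof -
  obtain h where h: "h \<in> Z144" "h \<noteq> 0" "translate h (translate g A) = translate g A"
    using p by (auto simp: periodic_def)
  have "translate (144 - g) (translate h (translate g A)) = translate h (translate (144 - g) (translate g A))"
    unfolding translate_translate by (simp add: mod_add_left_eq mod_add_right_eq add_ac)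
  then have "translate h A = A" using h(3) translate_back[OF A] by simp
  then show ?thesis using h by (auto simp: periodic_def)
qed

lemma all_pairs_translate: "tinv R \<Longrightarrow> all_pairs R A \<Longrightarrow> all_pairs R (translate g A)"
  unfolding all_pairs_def translate_def tinv_def by blast

lemma family_tclass:
  assumes R: "tinv R" and A: "A \<in> family k R"
  shows "tclass A \<subseteq> family k R"
proof
  fix B assume "B \<in> tclass A"
  then obtain g where g: "g < 144" "B = translate g A" by (auto simp: tclass_def Z144_def)
  have A': "A \<subseteq> Z144" "card A = k" "all_pairs R A" "\<not> periodic A" using A by (auto simp: family_def)
  show "B \<in> family k R"
    unfolding family_def g(2)
    using translate_subset card_translate[OF A'(1)] all_pairs_translate[OF R A'(3)] periodic_translate[OF A'(1) g(1)] A' by blast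
qed

text \<open>A period may be taken to be 48 or 72, so it would produce two elements that agree modulo
  16 and 3 but not modulo 9, or modulo 8 but not modulo 16.\<close>

lemma nonperiodic_grid:
  assumes A: "A \<subseteq> Z144" "A \<noteq> {}"
    and R: "\<And>a b. a \<in> A \<Longrightarrow> b \<in> A \<Longrightarrow> a mod 8 = b mod 8 \<Longrightarrow> a mod 16 = b mod 16"
      "\<And>a b. a \<in> A \<Longrightarrow> b \<in> A \<Longrightarrow> a mod 16 = b mod 16 \<Longrightarrow> a mod 3 = b mod 3 \<Longrightarrow> a mod 9 = b mod 9"
  shows "\<not> periodic A"
proof
  obtain a where a: "a \<in> A" using A by blast
  note ma = in_mem[OF A(1) a]
  assume "periodic A"
  then have "stable 48 A \<or> stable 72 A" using periodic_iff[OF A(1)] by blast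
  then show False
  proof
    assume "stable 48 A"
    then have b: "(a + 48) mod 144 \<in> A" using ma by (simp add: stable_def mem_def)
    have "(a + 48) mod 144 mod 16 = a mod 16" "(a + 48) mod 144 mod 3 = a mod 3"
      using mod_add_eqI[of 48 16 0 a] mod_add_eqI[of 48 3 0 a] by (simp_all add: mod_mod_cancel)
    then have "(a + 48) mod 144 mod 9 = a mod 9" using R(2)[OF b a] by blast
    then have "(a + 48) mod 9 = a mod 9" by (simp add: mod_mod_cancel)
    then show False using mod_add_eqI[of 48 9 3 a] shift_neq(1)[of 3 9 a] by simp
  next
    assume "stable 72 A"
    then have b: "(a + 72) mod 144 \<in> A" using ma by (simp add: stable_def mem_def)
    have "(a + 72) mod 144 mod 8 = a mod 8"
      using mod_add_eqI[of 72 8 0 a] by (simp add: mod_mod_cancel)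
    then have "(a + 72) mod 144 mod 16 = a mod 16" using R(1)[OF b a] by blast
    then have "(a + 72) mod 16 = a mod 16" by (simp add: mod_mod_cancel)
    then show False using mod_add_eqI[of 72 16 8 a] shift_neq(1)[of 8 16 a] by simp
  qed
qed

definition weak_grid :: "(nat \<Rightarrow> nat \<Rightarrow> bool) \<Rightarrow> bool" where
  "weak_grid R \<longleftrightarrow> (\<forall>a b. R a b \<longrightarrow> (a mod 8 = b mod 8 \<longrightarrow> a mod 16 = b mod 16) \<and>
     (a mod 16 = b mod 16 \<longrightarrow> a mod 3 = b mod 3 \<longrightarrow> a mod 9 = b mod 9))"

lemma family_weak_grid:
  assumes "weak_grid R" "k > 0"
  shows "family k R = {A. A \<subseteq> Z144 \<and> card A = k \<and> all_pairs R A}"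
proof -
  have "\<not> periodic A" if A: "A \<subseteq> Z144" "card A = k" "all_pairs R A" for A
  proof (rule nonperiodic_grid[OF A(1)])
    show "A \<noteq> {}" using A(2) assms(2) by auto
    show "a mod 16 = b mod 16" if "a \<in> A" "b \<in> A" "a mod 8 = b mod 8" for a b
      using all_pairsD[OF A(3) that(1,2)] assms(1) that(3) unfolding weak_grid_def by blast
    show "a mod 9 = b mod 9" if "a \<in> A" "b \<in> A" "a mod 16 = b mod 16" "a mod 3 = b mod 3" for a b
      using all_pairsD[OF A(3) that(1,2)] assms(1) that(3,4) unfolding weak_grid_def by blast
  qed
  then show ?thesis unfolding family_def by blast
qed

lemma weak_grid_RG: "levels M W \<Longrightarrow> weak_grid (RG M W)"
  unfolding weak_grid_def
proof (intro allI impI)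
  fix a b assume lv: "levels M W" and r: "RG M W a b"
  show "(a mod 8 = b mod 8 \<longrightarrow> a mod 16 = b mod 16) \<and> (a mod 16 = b mod 16 \<longrightarrow> a mod 3 = b mod 3 \<longrightarrow> a mod 9 = b mod 9)"
    using lv r mod_chain(2)[of a b] by (cases rule: levelsE) (auto simp: RG_def)
qed

text \<open>Together with the next three relations this covers (II) and the unions in (IV): one grid
  in each parity (\<open>R_half\<close>), one grid in each class modulo 4 of a single parity
  (\<open>R_double\<close>), and the complementary sets, of one parity (\<open>R_even\<close>) or
  with one class modulo 4 per parity (\<open>R_split\<close>).\<close>

definition R_half :: "nat \<Rightarrow> nat \<Rightarrow> bool" where "R_half a b \<longleftrightarrow> (a mod 2 = b mod 2 \<longrightarrow> RG 4 2 a b)"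
definition R_double :: "nat \<Rightarrow> nat \<Rightarrow> bool" where
  "R_double a b \<longleftrightarrow> a mod 2 = b mod 2 \<and> (a mod 4 = b mod 4 \<longrightarrow> RG 4 2 a b)"
definition R_even :: "nat \<Rightarrow> nat \<Rightarrow> bool" where "R_even a b \<longleftrightarrow> a mod 2 = b mod 2 \<and> RC 4 2 a b"
definition R_split :: "nat \<Rightarrow> nat \<Rightarrow> bool" where
  "R_split a b \<longleftrightarrow> RC 4 2 a b \<and> (a mod 2 = b mod 2 \<longrightarrow> a mod 4 = b mod 4)"

lemma lv: "levels 2 2" "levels 4 2" "levels 2 4" by (simp_all add: levels_def)

lemma tinv_rels: "tinv R_half" "tinv R_double" "tinv R_even" "tinv R_split"
  unfolding R_half_def R_double_def R_even_def R_split_def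
  by (intro tinv_conj tinv_imp tinv_mod tinv_RG tinv_RC lv; simp)+

lemma weak_grid_rels: "weak_grid R_half" "weak_grid R_double"
  unfolding weak_grid_def R_half_def R_double_def
  using weak_grid_RG[OF lv(2)] mod_chain unfolding weak_grid_def by blast+

lemma card_family_RG:
  assumes l: "levels M W"
  shows "card (family (3 * W) (RG M W)) = M * ((16 div (M * W)) ^ W * 27)"
proof -
  have W: "W > 0" "M > 0" using levels_pos[OF l] by auto
  have F: "family (3 * W) (RG M W) = (\<Union>r<M. grids M W r)"
  proof (intro equalityI subsetI)
    fix A assume "A \<in> family (3 * W) (RG M W)"
    then have A: "A \<subseteq> Z144" "card A = 3 * W" "all_pairs (RG M W) A" by (auto simp: family_def)
    then obtain a where a: "a \<in> A" using W by fastforce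
    have "b mod M = a mod M" if "b \<in> A" for b using all_pairsD[OF A(3) that a] by (simp add: RG_def)
    then have "A \<in> grids M W (a mod M)" using A by (auto simp: grids_def Z144_def)
    then show "A \<in> (\<Union>r<M. grids M W r)" using W by auto
  next
    fix A assume "A \<in> (\<Union>r<M. grids M W r)"
    then show "A \<in> family (3 * W) (RG M W)"
      using family_weak_grid[OF weak_grid_RG[OF l], of "3 * W"] W by (auto simp: grids_def Z144_def)
  qed
  have "card (\<Union>r\<in>{..<M}. grids M W r) = card {..<M} * ((16 div (M * W)) ^ W * 27)"
  proof (rule card_UN_const)
    show "card (grids M W r) = (16 div (M * W)) ^ W * 27" if "r \<in> {..<M}" for r using card_grids[OF l] that by simp
    show "finite (grids M W r)" for r
      by (rule finite_subset[of _ "Pow {..<144}"]) (auto simp: grids_def)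
    fix r s A assume h: "A \<in> grids M W r" "A \<in> grids M W s"
    then obtain a where "a \<in> A" using W by (fastforce simp: grids_def)
    then show "r = s" using h by (auto simp: grids_def)
  qed simp
  then show ?thesis using F by simp
qed

lemma RG_card_le:
  assumes l: "levels M W" and B: "B \<subseteq> Z144" "all_pairs (RG M W) B"
  shows "card B \<le> 3 * W"
proof (cases "B = {}")
  case False
  then obtain q where q: "q \<in> B" by blast
  let ?f = "\<lambda>b. (b mod (M * W), b mod 3)"
  have MW: "M * W > 0" using levels_pos[OF l] by auto
  have "inj_on ?f B"
  proof (rule inj_onI)
    fix a b assume ab: "a \<in> B" "b \<in> B" "?f a = ?f b"
    then have "RG M W a b" using B(2) all_pairsD by blast
    then have "a mod 16 = b mod 16" "a mod 9 = b mod 9" using ab(3) by (auto simp: RG_def)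
    then show "a = b" using crt_eq[OF less_144[OF B(1) ab(1)] less_144[OF B(1) ab(2)]] by blast
  qed
  then have "card B = card (?f ` B)" by (rule card_image[symmetric])
  also have "\<dots> \<le> card ({c. c < M * W \<and> c mod M = q mod M} \<times> {..<3::nat})"
  proof (rule card_mono)
    show "?f ` B \<subseteq> {c. c < M * W \<and> c mod M = q mod M} \<times> {..<3}"
    proof
      fix z assume "z \<in> ?f ` B"
      then obtain b where b: "b \<in> B" "z = ?f b" by blast
      have "b mod M = q mod M" using all_pairsD[OF B(2) b(1) q] by (simp add: RG_def)
      then show "z \<in> {c. c < M * W \<and> c mod M = q mod M} \<times> {..<3}" using b MW by (simp add: mod_mod_cancel)
    qed
  qed simp
  also have "\<dots> = 3 * W" using card_classes[OF l, of q] by (simp add: card_cartesian_product)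
  finally show ?thesis .
qed simp

lemma family_complements:
  assumes l: "levels M W" and k: "k = M * (48 div (M * W))"
  shows "family k (RC M W) = complements M W {..<M}"
proof -
  have "M > 0" using levels_pos[OF l] by auto
  then have "A \<subseteq> {n. n < 144 \<and> n mod M \<in> {..<M}} \<longleftrightarrow> A \<subseteq> Z144" for A by (auto simp: Z144_def)
  then show ?thesis
    unfolding family_def complements_def using periodic_iff k by auto
qed

lemma card_family_RC: "card (family 24 (RC 2 2)) = 5184" "card (family 24 (RC 4 2)) = 1244160" "card (family 12 (RC 2 4)) = 8640"
proof -
  have s: "{..<2} = {0, 1::nat}" "{..<4} = {0, 1, 2, 3::nat}" by auto
  show "card (family 24 (RC 2 2)) = 5184" "card (family 24 (RC 4 2)) = 1244160" "card (family 12 (RC 2 4)) = 8640"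
    using family_complements[OF lv(1), of 24] family_complements[OF lv(2), of 24] family_complements[OF lv(3), of 12]
      card_complements_22 card_complements_42 card_complements_24 by (simp_all add: s)
qed

lemma finite_complements: "finite (complements M W I)"
  by (rule finite_subset[of _ "Pow {..<144}"]) (auto simp: complements_def)

lemma mod_4_cases: "n mod 2 = 0 \<longleftrightarrow> n mod 4 = 0 \<or> n mod 4 = 2" "n mod 2 = 1 \<longleftrightarrow> n mod 4 = 1 \<or> n mod 4 = (3::nat)"
  by presburger+

text \<open>Within one parity there are two classes modulo 4, each holding at most 6 related
  elements, so 12 is again the extreme size that \<open>complements\<close> describes.\<close>

lemma family_even_complements: "family 12 R_even = complements 4 2 {0, 2} \<union> complements 4 2 {1, 3}"
proof (intro equalityI subsetI)
  fix A assume "A \<in> family 12 R_even"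
  then have A: "A \<subseteq> Z144" "card A = 12" "all_pairs R_even A" "\<not> periodic A" by (auto simp: family_def)
  obtain a where a: "a \<in> A" using A(2) by fastforce
  have p: "b mod 2 = a mod 2" if "b \<in> A" for b using all_pairsD[OF A(3) that a] by (simp add: R_even_def)
  have RC: "all_pairs (RC 4 2) A" using A(3) by (auto simp: all_pairs_def R_even_def)
  have "(\<forall>b\<in>A. b mod 2 = 0) \<or> (\<forall>b\<in>A. b mod 2 = 1)" using p by (metis mod2_eq_if)
  then have "A \<subseteq> {n. n < 144 \<and> n mod 4 \<in> {0, 2}} \<or> A \<subseteq> {n. n < 144 \<and> n mod 4 \<in> {1, 3}}"
  proof
    assume h: "\<forall>b\<in>A. b mod 2 = 0"
    have "b < 144 \<and> b mod 4 \<in> {0, 2}" if "b \<in> A" for b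
      using less_144[OF A(1) that] mod_4_cases(1)[of b] h that by simp
    then show ?thesis by blast
  next
    assume h: "\<forall>b\<in>A. b mod 2 = 1"
    have "b < 144 \<and> b mod 4 \<in> {1, 3}" if "b \<in> A" for b
      using less_144[OF A(1) that] mod_4_cases(2)[of b] h that by simp
    then show ?thesis by blast
  qed
  moreover have np: "\<not> stable 48 A" "\<not> stable 72 A" using A(4) periodic_iff[OF A(1)] by auto
  have "A \<in> complements 4 2 I" if "A \<subseteq> {n. n < 144 \<and> n mod 4 \<in> I}" "card I = 2" for I
    unfolding complements_def using that A(2) RC np by simp
  ultimately show "A \<in> complements 4 2 {0, 2} \<union> complements 4 2 {1, 3}" by (elim disjE) simp_all
next
  fix A assume A: "A \<in> complements 4 2 {0, 2} \<union> complements 4 2 {1, 3}"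
  then have AZ: "A \<subseteq> Z144" unfolding complements_def Z144_def by auto
  have "\<exists>r. \<forall>b\<in>A. b mod 2 = r"
    using A
  proof
    assume h: "A \<in> complements 4 2 {0, 2}"
    have "b mod 2 = 0" if "b \<in> A" for b
    proof -
      have "b mod 4 \<in> {0, 2}" using h that unfolding complements_def by blast
      then show ?thesis using mod_4_cases(1)[of b] by simp
    qed
    then show ?thesis by blast
  next
    assume h: "A \<in> complements 4 2 {1, 3}"
    have "b mod 2 = 1" if "b \<in> A" for b
    proof -
      have "b mod 4 \<in> {1, 3}" using h that unfolding complements_def by blast
      then show ?thesis using mod_4_cases(2)[of b] by simp
    qed
    then show ?thesis by blast
  qed
  then obtain r where r: "\<And>b. b \<in> A \<Longrightarrow> b mod 2 = r" by blast
  have c: "card A = 12" "all_pairs (RC 4 2) A" "\<not> stable 48 A" "\<not> stable 72 A"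
    using A by (auto simp: complements_def)
  then show "A \<in> family 12 R_even"
    unfolding family_def using AZ periodic_iff[OF AZ] r by (simp add: all_pairs_def R_even_def)
qed

lemma card_family_even: "card (family 12 R_even) = 864"
proof -
  have "complements 4 2 {0, 2} \<inter> complements 4 2 {1, 3} = {}"
  proof (rule ccontr)
    assume "\<not> ?thesis"
    then obtain A where A: "A \<in> complements 4 2 {0, 2}" "A \<in> complements 4 2 {1, 3}" by blast
    then have "card A = 12" by (simp add: complements_def)
    then obtain a where "a \<in> A" by fastforce
    then have "a mod 4 \<in> {0, 2}" "a mod 4 \<in> {1, 3}" using A unfolding complements_def by blast+
    then show False by auto
  qed
  then show ?thesis unfolding family_even_complements
    using finite_complements card_complements_42_pair[of 0 2] card_complements_42_pair[of 1 3] by (simp add: card_Un_disjoint)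
qed

lemma card_grids_42: "i < 4 \<Longrightarrow> card (grids 4 2 i) = 108"
  using card_grids[OF lv(2)] by simp

lemma finite_grids: "finite (grids M W r)"
  by (rule finite_subset[of _ "Pow {..<144}"]) (auto simp: grids_def)

lemma grids_disjoint: "A \<in> grids 4 2 r \<Longrightarrow> A \<in> grids 4 2 s \<Longrightarrow> r = s"
proof -
  assume h: "A \<in> grids 4 2 r" "A \<in> grids 4 2 s"
  then have "card A = 6" by (simp add: grids_def)
  then obtain a where "a \<in> A" by fastforce
  then show "r = s" using h by (auto simp: grids_def)
qed

lemma grids_42I:
  assumes "A \<subseteq> Z144" "card A = 6" "all_pairs (RG 4 2) A" "q \<in> A"
  shows "A \<in> grids 4 2 (q mod 4)"
proof -
  have "a mod 4 = q mod 4" if "a \<in> A" for a using all_pairsD[OF assms(3) that assms(4)] by (simp add: RG_def)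
  then have "A \<subseteq> {n. n < 144 \<and> n mod 4 = q mod 4}" using less_144[OF assms(1)] by blast
  then show ?thesis unfolding grids_def using assms(2,3) by simp
qed

text \<open>A half has at most 6 elements, so 12 forces a full grid in one of the two classes modulo
  4 of each parity, with 108 + 108 choices per parity.\<close>

lemma card_family_half: "card (family 12 R_half) = 46656"
proof -
  let ?F = "\<lambda>i. grids 4 2 i \<union> grids 4 2 (i + 2)"
  let ?L = "{A. A \<subseteq> {..<144} \<and> (\<forall>i\<in>{..<2}. {a\<in>A. a mod 2 = i} \<in> ?F i)}"
  have par: "n mod 2 = i \<longleftrightarrow> n mod 4 = i \<or> n mod 4 = i + 2" if "i < 2" for n i :: nat
    using that mod_4_cases[of n] by (cases "i = 0") auto
  have F: "family 12 R_half = ?L"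
  proof (intro equalityI subsetI)
    fix A assume "A \<in> family 12 R_half"
    then have A: "A \<subseteq> Z144" "card A = 12" "all_pairs R_half A" by (auto simp: family_def)
    have fin: "finite A" using A finite_sub_Z144 by blast
    have sub: "{a\<in>A. a mod 2 = i} \<subseteq> Z144" for i using A by auto
    have RG: "all_pairs (RG 4 2) {a\<in>A. a mod 2 = i}" for i using A(3) by (auto simp: all_pairs_def R_half_def)
    have "card A = card {..<2::nat} * 6 \<longleftrightarrow> (\<forall>i\<in>{..<2}. card {a\<in>A. a mod 2 = i} = 6)"
    proof (rule slices_card_eq[OF _ fin])
      show "card {a\<in>A. a mod 2 = i} \<le> 6" for i using RG_card_le[OF lv(2) sub RG, of i] by simp
    qed auto
    then have c: "card {a\<in>A. a mod 2 = i} = 6" if "i < 2" for i using A(2) that by simp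
    have "{a\<in>A. a mod 2 = i} \<in> ?F i" if i: "i < 2" for i
    proof -
      have "{a\<in>A. a mod 2 = i} \<noteq> {}" using c[OF i] by (metis card.empty zero_neq_numeral)
      then obtain q where q: "q \<in> {a\<in>A. a mod 2 = i}" by blast
      then have "q mod 4 = i \<or> q mod 4 = i + 2" using par[OF i] by blast
      then show ?thesis using grids_42I[OF sub c[OF i] RG q] by auto
    qed
    then show "A \<in> ?L" using A by (auto simp: Z144_def)
  next
    fix A assume A: "A \<in> ?L"
    then have AZ: "A \<subseteq> Z144" by (auto simp: Z144_def)
    then have fin: "finite A" using finite_sub_Z144 by blast
    have g: "card {a\<in>A. a mod 2 = i} = 6 \<and> all_pairs (RG 4 2) {a\<in>A. a mod 2 = i}" if "i < 2" for i
    proof -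
      have "{a\<in>A. a mod 2 = i} \<in> ?F i" using A that by blast
      then show ?thesis unfolding grids_def by auto
    qed
    have "card A = (\<Sum>i\<in>{..<2}. card {a\<in>A. a mod 2 = i})"
      by (rule card_sum_slices) (use fin in auto)
    also have "\<dots> = (\<Sum>i\<in>{..<2::nat}. 6)" by (intro sum.cong) (use g in auto)
    finally have "card A = 12" by simp
    moreover have "R_half a b" if "a \<in> A" "b \<in> A" for a b
      unfolding R_half_def
    proof
      assume "a mod 2 = b mod 2"
      then show "RG 4 2 a b" using g[of "b mod 2"] that by (auto simp: all_pairs_def)
    qed
    ultimately show "A \<in> family 12 R_half"
      unfolding family_weak_grid[OF weak_grid_rels(1), of 12, simplified] using AZ by (simp add: all_pairs_def)
  qed
  have "card ?L = (\<Prod>i\<in>{..<2}. card (?F i))"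
  proof (rule card_slices)
    fix i S assume i: "i \<in> {..<2::nat}" and S: "S \<in> ?F i"
    have "s < 144 \<and> s mod 2 = i" if "s \<in> S" for s
      using S that par[of i s] i unfolding grids_def by auto
    then show "S \<subseteq> {u \<in> {..<144}. u mod 2 = i}" by auto
  qed auto
  also have "\<dots> = (\<Prod>i\<in>{..<2::nat}. 216)"
  proof (intro prod.cong refl)
    fix i :: nat assume i: "i \<in> {..<2}"
    have "grids 4 2 i \<inter> grids 4 2 (i + 2) = {}" using grids_disjoint[of _ i "i + 2"] by auto
    then show "card (?F i) = 216" using card_grids_42[of i] card_grids_42[of "i + 2"] i finite_grids
      by (simp add: card_Un_disjoint)
  qed
  finally show ?thesis using F by simp
qed

text \<open>Both classes modulo 4 of one parity carry a full grid, which gives 2 * 108^2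
  sets.\<close>

lemma card_family_double: "card (family 12 R_double) = 23328"
proof -
  let ?D = "\<lambda>r. {A. A \<subseteq> {n. n < 144 \<and> n mod 4 \<in> {r, r + 2}} \<and> (\<forall>i\<in>{r, r + 2}. {a\<in>A. a mod 4 = i} \<in> grids 4 2 i)}"
  have par: "n mod 2 = i \<longleftrightarrow> n mod 4 \<in> {i, i + 2}" if "i < 2" for n i :: nat
    using that mod_4_cases[of n] by (cases "i = 0") auto
  have F: "family 12 R_double = (\<Union>r\<in>{..<2}. ?D r)"
  proof (intro equalityI subsetI)
    fix A assume "A \<in> family 12 R_double"
    then have A: "A \<subseteq> Z144" "card A = 12" "all_pairs R_double A" by (auto simp: family_def)
    have fin: "finite A" using A finite_sub_Z144 by blast
    obtain q where q: "q \<in> A" using A(2) by fastforce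
    define r where "r = q mod 2"
    have r: "r < 2" by (simp add: r_def)
    have p: "a mod 2 = r" if "a \<in> A" for a using all_pairsD[OF A(3) that q] by (simp add: R_double_def r_def)
    have m: "a mod 4 \<in> {r, r + 2}" if "a \<in> A" for a using p[OF that] par[OF r] by blast
    have sub: "{a\<in>A. a mod 4 = i} \<subseteq> Z144" for i using A by auto
    have RG: "all_pairs (RG 4 2) {a\<in>A. a mod 4 = i}" for i using A(3) by (auto simp: all_pairs_def R_double_def)
    have "card A = card {r, r + 2} * 6 \<longleftrightarrow> (\<forall>i\<in>{r, r + 2}. card {a\<in>A. a mod 4 = i} = 6)"
    proof (rule slices_card_eq[OF _ fin m])
      show "card {a\<in>A. a mod 4 = i} \<le> 6" for i using RG_card_le[OF lv(2) sub RG, of i] by simp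
    qed auto
    moreover have "card A = card {r, r + 2} * 6" using A(2) by simp
    ultimately have c: "card {a\<in>A. a mod 4 = i} = 6" if "i \<in> {r, r + 2}" for i using that by blast
    have "{a\<in>A. a mod 4 = i} \<in> grids 4 2 i" if i: "i \<in> {r, r + 2}" for i
    proof -
      have "{a\<in>A. a mod 4 = i} \<noteq> {}" using c[OF i] by (metis card.empty zero_neq_numeral)
      then obtain q where q: "q \<in> {a\<in>A. a mod 4 = i}" by blast
      then show ?thesis using grids_42I[OF sub c[OF i] RG q] by simp
    qed
    then have "A \<in> ?D r" using less_144[OF A(1)] m by blast
    then show "A \<in> (\<Union>r\<in>{..<2}. ?D r)" using r by blast
  next
    fix A assume "A \<in> (\<Union>r\<in>{..<2}. ?D r)"
    then obtain r where r: "r < 2" and A: "A \<in> ?D r" by blast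
    then have AZ: "A \<subseteq> Z144" by (auto simp: Z144_def)
    then have fin: "finite A" using finite_sub_Z144 by blast
    have g: "card {a\<in>A. a mod 4 = i} = 6 \<and> all_pairs (RG 4 2) {a\<in>A. a mod 4 = i}" if "i \<in> {r, r + 2}" for i
    proof -
      have "{a\<in>A. a mod 4 = i} \<in> grids 4 2 i" using A that by blast
      then show ?thesis unfolding grids_def by auto
    qed
    have m: "a mod 4 \<in> {r, r + 2}" if "a \<in> A" for a using A that by blast
    have "card A = (\<Sum>i\<in>{r, r + 2}. card {a\<in>A. a mod 4 = i})"
      by (rule card_sum_slices[OF _ fin m]) auto
    also have "\<dots> = (\<Sum>i\<in>{r, r + 2}. 6)" by (intro sum.cong) (use g in auto)
    finally have "card A = 12" by simp
    moreover have "R_double a b" if "a \<in> A" "b \<in> A" for a b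
      unfolding R_double_def
    proof (intro conjI impI)
      show "a mod 2 = b mod 2" using par[OF r, of a] par[OF r, of b] m[OF that(1)] m[OF that(2)] by metis
      assume "a mod 4 = b mod 4"
      then show "RG 4 2 a b" using g[OF m[OF that(2)]] that by (auto simp: all_pairs_def)
    qed
    ultimately show "A \<in> family 12 R_double"
      unfolding family_weak_grid[OF weak_grid_rels(2), of 12, simplified] using AZ by (simp add: all_pairs_def)
  qed
  have "card (\<Union>r\<in>{..<2}. ?D r) = card {..<2::nat} * 11664"
  proof (rule card_UN_const)
    show "card (?D r) = 11664" if "r \<in> {..<2}" for r
    proof -
      have "card (?D r) = (\<Prod>i\<in>{r, r + 2}. card (grids 4 2 i))"
        by (rule card_slices) (auto simp: grids_def)
      also have "\<dots> = (\<Prod>i\<in>{r, r + 2}. 108)" using card_grids_42 that by (intro prod.cong) auto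
      finally show ?thesis by simp
    qed
    show "finite (?D r)" for r by (rule finite_subset[of _ "Pow {..<144}"]) auto
    fix r s S assume h: "r \<in> {..<2}" "s \<in> {..<2}" "S \<in> ?D r" "S \<in> ?D s"
    have "{a\<in>S. a mod 4 = r} \<in> grids 4 2 r" using h by blast
    then have "card {a\<in>S. a mod 4 = r} = 6" by (simp add: grids_def)
    then have "{a\<in>S. a mod 4 = r} \<noteq> {}" by (metis card.empty zero_neq_numeral)
    then obtain a where "a \<in> S" by blast
    then have "a mod 4 \<in> {r, r + 2}" "a mod 4 \<in> {s, s + 2}" using h by blast+
    then show "r = s" using par[of r a] par[of s a] h by auto
  qed simp
  then show ?thesis using F by simp
qed

lemma single_class_card_le:
  assumes A: "A \<subseteq> Z144" "all_pairs (RC 4 2) A" and jj: "\<And>a. a \<in> A \<Longrightarrow> a mod 4 = j" "j < 4"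
  shows "card A \<le> 6"
proof -
  interpret piece_count 4 2 j by unfold_locales (use lv jj in auto)
  have "card A \<le> 48 div (4 * 2)"
  proof (rule card_le)
    show "a < 144 \<and> a mod 4 = j" if "a \<in> A" for a using less_144[OF A(1) that] jj(1)[OF that] by simp
    show "RC 4 2 a b" if "a \<in> A" "b \<in> A" for a b using all_pairsD[OF A(2) that] .
  qed
  then show ?thesis by simp
qed

text \<open>A single class modulo 4 holds at most 6 elements, so both parities occur, with one class
  each: four choices of classes and 432 sets for each.\<close>

lemma card_family_split: "card (family 12 R_split) = 1728"
proof -
  let ?P = "{0, 2::nat} \<times> {1, 3::nat}"
  let ?C = "\<lambda>p. complements 4 2 {fst p, snd p}"
  have F: "family 12 R_split = (\<Union>p\<in>?P. ?C p)"
  proof (intro equalityI subsetI)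
    fix A assume "A \<in> family 12 R_split"
    then have A: "A \<subseteq> Z144" "card A = 12" "all_pairs R_split A" "\<not> periodic A" by (auto simp: family_def)
    have RC: "all_pairs (RC 4 2) A" using A(3) by (auto simp: all_pairs_def R_split_def)
    have cls: "a mod 4 = b mod 4" if "a \<in> A" "b \<in> A" "a mod 2 = b mod 2" for a b
      using all_pairsD[OF A(3) that(1,2)] that(3) by (simp add: R_split_def)
    have ex: "\<exists>a\<in>A. a mod 2 = i" if i: "i < 2" for i
    proof (rule ccontr)
      assume n: "\<not> ?thesis"
      obtain q where q: "q \<in> A" using A(2) by fastforce
      have "a mod 2 = q mod 2" if "a \<in> A" for a
      proof -
        have "a mod 2 \<noteq> i" "q mod 2 \<noteq> i" using n q that by auto
        then show ?thesis using i by auto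
      qed
      then have "a mod 4 = q mod 4" if "a \<in> A" for a using cls[OF that q] that by simp
      then show False using single_class_card_le[OF A(1) RC, of "q mod 4"] A(2) by simp
    qed
    obtain e where e: "e \<in> A" "e mod 2 = 0" using ex[of 0] by auto
    obtain q where q: "q \<in> A" "q mod 2 = 1" using ex[of 1] by auto
    have "a mod 4 \<in> {e mod 4, q mod 4}" if "a \<in> A" for a
      using cls[OF that e(1)] cls[OF that q(1)] e(2) q(2) by (metis insertCI mod2_eq_if)
    then have sub: "A \<subseteq> {n. n < 144 \<and> n mod 4 \<in> {e mod 4, q mod 4}}" using less_144[OF A(1)] by blast
    have eq4: "e mod 4 \<in> {0, 2}" "q mod 4 \<in> {1, 3}" using mod_4_cases(1)[of e] mod_4_cases(2)[of q] e q by auto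
    have "e mod 4 \<noteq> q mod 4" using mod_chain(3)[of e q] e(2) q(2) by auto
    then have cA: "card A = card {e mod 4, q mod 4} * (48 div (4 * 2))" using A(2) by simp
    have np: "\<not> stable 48 A" "\<not> stable 72 A" using A(4) periodic_iff[OF A(1)] by auto
    have h: "A \<in> ?C (e mod 4, q mod 4)"
      unfolding complements_def fst_conv snd_conv using sub cA RC np by blast
    have "(e mod 4, q mod 4) \<in> ?P" using eq4 by (rule SigmaI)
    then show "A \<in> (\<Union>p\<in>?P. ?C p)" using h by (rule UN_I)
  next
    fix A assume "A \<in> (\<Union>p\<in>?P. ?C p)"
    then obtain p where p: "p \<in> ?P" "A \<in> ?C p" by blast
    have AZ: "A \<subseteq> Z144" using p(2) unfolding complements_def Z144_def by auto
    have p2: "fst p \<noteq> snd p" "fst p mod 2 = 0" "snd p mod 2 = 1" using p(1) by auto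
    have A: "card A = 12" "all_pairs (RC 4 2) A" "\<not> stable 48 A" "\<not> stable 72 A"
      using p(2) p2(1) by (auto simp: complements_def)
    have m: "a mod 4 = fst p \<or> a mod 4 = snd p" if "a \<in> A" for a
      using p(2) that unfolding complements_def by blast
    have m2: "a mod 4 mod 2 = a mod 2" for a :: nat by (simp add: mod_mod_cancel)
    have m': "a mod 4 = (if a mod 2 = 0 then fst p else snd p)" if "a \<in> A" for a
      using m[OF that]
    proof
      assume h: "a mod 4 = fst p"
      then have "a mod 2 = 0" using m2[of a] p2(2) by simp
      then show ?thesis using h by simp
    next
      assume h: "a mod 4 = snd p"
      then have "a mod 2 = 1" using m2[of a] p2(3) by simp
      then show ?thesis using h by simp
    qed
    have "a mod 4 = b mod 4" if ab: "a \<in> A" "b \<in> A" "a mod 2 = b mod 2" for a b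
      using m'[OF ab(1)] m'[OF ab(2)] ab(3) by simp
    then have "all_pairs R_split A" using A(2) unfolding all_pairs_def R_split_def by blast
    moreover have "\<not> periodic A" using A(3,4) periodic_iff[OF AZ] by blast
    ultimately show "A \<in> family 12 R_split" unfolding family_def using A(1) AZ by blast
  qed
  have "card (\<Union>p\<in>?P. ?C p) = card ?P * 432"
  proof (rule card_UN_const)
    show "card (?C p) = 432" if "p \<in> ?P" for p
      using that card_complements_42_pair[of "fst p" "snd p"] by auto
    show "finite (?C p)" for p by (rule finite_complements)
    fix p s S assume h: "p \<in> ?P" "s \<in> ?P" "S \<in> ?C p" "S \<in> ?C s"
    show "p = s"
    proof (rule ccontr)
      \<comment> \<open>Two different choices share at most one class modulo 4, which cannot hold 12
        elements.\<close>
      assume ne: "p \<noteq> s"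
      have m: "a mod 4 \<in> {fst p, snd p} \<inter> {fst s, snd s}" if "a \<in> S" for a using h(3,4) that unfolding complements_def by blast
      have "\<exists>j<4. {fst p, snd p} \<inter> {fst s, snd s} \<subseteq> {j}" using h(1,2) ne by (auto intro: exI[of _ "0::nat"])
      then obtain j where j: "j < 4" "\<And>a. a \<in> S \<Longrightarrow> a mod 4 = j" using m by blast
      have SZ: "S \<subseteq> Z144" "all_pairs (RC 4 2) S" using h(3) unfolding complements_def Z144_def by auto
      have "card S = 12" using h(1,3) by (auto simp: complements_def)
      then show False using single_class_card_le[OF SZ j(2,1)] by simp
    qed
  qed simp
  then show ?thesis using F by simp
qed

text \<open>A grid of 12 elements is a union of two grids with matching residues modulo 9; the
  unions without this match become \<open>S1\<close>.\<close>

lemma RG24_double: "family 12 (RG 2 4) \<subseteq> family 12 R_double"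
proof
  fix A assume A: "A \<in> family 12 (RG 2 4)"
  have "R_double a b" if "RG 2 4 a b" for a b
    using that unfolding RG_def R_double_def by simp
  then show "A \<in> family 12 R_double" using A unfolding family_def all_pairs_def by blast
qed

text \<open>The sets that also tile with unmatched unions of grids sit inside the complements of the
  grids of 12 elements; what is left becomes \<open>S2\<close>.\<close>

lemma split_RC24: "family 12 R_split \<subseteq> family 12 (RC 2 4)"
proof
  fix A assume A: "A \<in> family 12 R_split"
  have "RC 2 4 a b" if "R_split a b" for a b
    using that unfolding RC_def R_split_def by simp
  then show "A \<in> family 12 (RC 2 4)" using A unfolding family_def all_pairs_def by blast
qed

text \<open>The alternatives are (I), (II), (III) and the two kinds of pairs in (IV). The
  complements of the grids of type (2, 4) are written as a union so that \<open>T2'''\<close> and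
  \<open>S2\<close> appear separately.\<close>

definition pairing :: "nat set \<Rightarrow> nat set \<Rightarrow> bool" where
  "pairing A B \<longleftrightarrow> A \<in> family 24 (RC 2 2) \<and> B \<in> family 6 (RG 2 2) \<or>
     A \<in> family 12 R_even \<and> B \<in> family 12 R_half \<or>
     A \<in> family 24 (RC 4 2) \<and> B \<in> family 6 (RG 4 2) \<or>
     A \<in> family 12 (RG 2 4) \<and> B \<in> family 12 R_split \<union> (family 12 (RC 2 4) - family 12 R_split) \<or>
     A \<in> family 12 R_double - family 12 (RG 2 4) \<and> B \<in> family 12 R_split"

lemma family_tiling:
  assumes l: "levels M W" and A: "A \<in> family k R" and B: "B \<in> family k' S" and kk: "k * k' = 144"
    and RS: "\<And>a a' b b'. R a a' \<Longrightarrow> S b b' \<Longrightarrow> sim a a' b b' \<Longrightarrow> RG M W b b' \<and> RC M W a a'"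
  shows "nonperiodic_tiling A B"
proof -
  have AB: "A \<subseteq> Z144" "card A = k" "all_pairs R A" "\<not> periodic A" "B \<subseteq> Z144" "card B = k'" "all_pairs S B" "\<not> periodic B"
    using A B by (auto simp: family_def)
  have "disjoint_diffs A B"
    by (rule RG_RC_disjoint[OF l AB(1)]) (use RS all_pairsD[OF AB(3)] all_pairsD[OF AB(7)] in blast)
  then have "tiling A B" by (intro disjoint_diffs_tiling[OF AB(1,5)]) (use AB kk in simp)
  then show ?thesis using AB by (simp add: nonperiodic_tiling_def)
qed

lemma tiling_22: "A \<in> family 24 (RC 2 2) \<Longrightarrow> B \<in> family 6 (RG 2 2) \<Longrightarrow> nonperiodic_tiling A B"
  using family_tiling[OF lv(1), of A 24 "RC 2 2" B 6 "RG 2 2"] by simp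

lemma tiling_42: "A \<in> family 24 (RC 4 2) \<Longrightarrow> B \<in> family 6 (RG 4 2) \<Longrightarrow> nonperiodic_tiling A B"
  using family_tiling[OF lv(2), of A 24 "RC 4 2" B 6 "RG 4 2"] by simp

lemma tiling_24: "A \<in> family 12 (RC 2 4) \<Longrightarrow> B \<in> family 12 (RG 2 4) \<Longrightarrow> nonperiodic_tiling A B"
  using family_tiling[OF lv(3), of A 12 "RC 2 4" B 12 "RG 2 4"] by simp

lemma tiling_even_half: "A \<in> family 12 R_even \<Longrightarrow> B \<in> family 12 R_half \<Longrightarrow> nonperiodic_tiling A B"
  using family_tiling[OF lv(2), of A 12 R_even B 12 R_half] by (simp add: R_even_def R_half_def sim_iff)

lemma tiling_split_double: "A \<in> family 12 R_split \<Longrightarrow> B \<in> family 12 R_double \<Longrightarrow> nonperiodic_tiling A B"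
  using family_tiling[OF lv(2), of A 12 R_split B 12 R_double] by (simp add: R_split_def R_double_def sim_iff)

theorem nonperiodic_tiling_iff: "nonperiodic_tiling A B \<longleftrightarrow> pairing A B \<or> pairing B A"
proof
  assume np: "nonperiodic_tiling A B"
  have "pairing A B \<or> pairing B A" if np: "nonperiodic_tiling A B" and s: "shape A B" for A B
  proof -
    note D = nonperiodic_tilingD[OF np]
    have npA: "\<not> periodic A" "\<not> periodic B" using np by (auto simp: nonperiodic_tiling_def)
    have c: "card A = 24" if "card B = 6" using D(8) that by simp
    have c': "card A = 12" if "card B = 12" using D(8) that by simp
    have fA: "A \<in> family k R \<longleftrightarrow> card A = k \<and> all_pairs R A" and fB: "B \<in> family k R \<longleftrightarrow> card B = k \<and> all_pairs R B" for k R
      using D(2,3) npA by (auto simp: family_def)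
    show ?thesis
      using s unfolding shape_def
    proof (elim disjE conjE)
      assume h: "card B = 6" "all_pairs (RG 2 2) B" "all_pairs (RC 2 2) A"
      then show ?thesis unfolding pairing_def fA fB using c by simp
    next
      assume h: "card B = 6" "all_pairs (RG 4 2) B" "all_pairs (RC 4 2) A"
      then show ?thesis unfolding pairing_def fA fB using c by simp
    next
      assume h: "card B = 12" "all_pairs (\<lambda>a b. a mod 2 = b mod 2 \<and> RC 4 2 a b) B" "all_pairs (\<lambda>a b. a mod 2 = b mod 2 \<longrightarrow> RG 4 2 a b) A"
      then have "B \<in> family 12 R_even" "A \<in> family 12 R_half"
        unfolding fA fB using c' by (simp_all only: all_pairs_def R_even_def R_half_def)
      then show ?thesis by (simp add: pairing_def)
    next
      assume h: "card B = 12" "all_pairs (RG 2 4) B" "all_pairs (RC 2 4) A"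
      then have "B \<in> family 12 (RG 2 4)" "A \<in> family 12 (RC 2 4)" unfolding fA fB using c' by simp_all
      then show ?thesis by (simp add: pairing_def)
    next
      assume h: "card B = 12" "all_pairs (\<lambda>a b. a mod 2 = b mod 2 \<and> (a mod 4 = b mod 4 \<longrightarrow> RG 4 2 a b)) B"
        "all_pairs (\<lambda>a b. RC 4 2 a b \<and> (a mod 2 = b mod 2 \<longrightarrow> a mod 4 = b mod 4)) A"
      then have "B \<in> family 12 R_double" "A \<in> family 12 R_split"
        unfolding fA fB using c' by (simp_all only: all_pairs_def R_double_def R_split_def)
      then show ?thesis by (simp add: pairing_def)
    qed
  qed
  then show "pairing A B \<or> pairing B A"
    using nonperiodic_tiling_shape[OF np] np nonperiodic_tiling_commute by blast
next
  have "nonperiodic_tiling A B" if "pairing A B" for A B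
    using that unfolding pairing_def
    using tiling_22 tiling_42 tiling_24 tiling_even_half tiling_split_double RG24_double split_RC24 nonperiodic_tiling_commute by blast
  then show "pairing A B \<or> pairing B A \<Longrightarrow> nonperiodic_tiling A B" using nonperiodic_tiling_commute by blast
qed

section \<open>Values of Cyc\<close>

lemma shift_cong:
  fixes a q s d m :: nat
  assumes "a mod d = (q + s) mod d" "m dvd d"
  shows "m dvd s \<Longrightarrow> a mod m = q mod m" "0 < s mod m \<Longrightarrow> a mod m \<noteq> q mod m"
proof -
  have e: "a mod m = (q + s) mod m" using assms by (rule mod_eq_dvd)
  show "a mod m = q mod m" if "m dvd s" using e that by (auto elim!: dvdE)
  assume p: "0 < s mod m"
  have "(q + s) mod m = (q + s mod m) mod m" by (simp add: mod_add_right_eq)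
  then show "a mod m \<noteq> q mod m"
    using e p shift_neq(1)[OF p, of m q] by (cases "m = 0") simp_all
qed

text \<open>The count at q is positive, while both counts on the other side of the relation of order
  d vanish.\<close>

lemma not_Cyc_six:
  assumes A: "finite A" "q \<in> A" "6 dvd d"
    and "\<And>a. a \<in> A \<Longrightarrow> a mod d \<noteq> (q + d div 2) mod d" "\<And>a. a \<in> A \<Longrightarrow> a mod d \<noteq> (q + d div 3) mod d"
  shows "d \<notin> Cyc A"
proof
  assume d: "d \<in> Cyc A"
  have "cnt A d (q + d div 2) = 0" "cnt A d (q + d div 3) = 0"
    using assms(4,5) cnt_eq_0_iff[OF A(1)] by blast+
  moreover have "cnt A d q \<noteq> 0" using cnt_eq_0_iff[OF A(1)] A(2) by blast
  ultimately show False using Cyc_six[OF A(1) d A(3), of q] by simp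
qed

lemma not_Cyc_shift:
  assumes A: "finite A" "q \<in> A"
    and s: "\<forall>k\<in>{1,2,3,4,6,8,9,12,16,18,24,36,48,72,144}. k dvd d \<longrightarrow> \<not> k dvd s \<longrightarrow> k = d"
    and "\<And>a. a \<in> A \<Longrightarrow> a mod d \<noteq> (q + s) mod d"
  shows "d \<notin> Cyc A"
proof
  assume d: "d \<in> Cyc A"
  have "cnt A d (q + s) = 0" using assms(4) cnt_eq_0_iff[OF A(1)] by blast
  moreover have "cnt A d q \<noteq> 0" using cnt_eq_0_iff[OF A(1)] A(2) by blast
  ultimately show False using Cyc_shift[OF A(1) d s, of q] by simp
qed

text \<open>Each hypothesis keeps the shifts d/2 and d/3 of q (d/p if d is a power of p) out of A:
  such a shift changes the finest residue at one prime and preserves all coarser ones.\<close>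

lemma not_Cyc_grid:
  assumes fin: "finite A" and q: "q \<in> A"
  shows "(\<And>a. a \<in> A \<Longrightarrow> a mod 2 = q mod 2) \<Longrightarrow> 2 \<notin> Cyc A"
    "(\<And>a. a \<in> A \<Longrightarrow> a mod 2 = q mod 2 \<Longrightarrow> a mod 4 = q mod 4) \<Longrightarrow> 4 \<notin> Cyc A"
    "(\<And>a. a \<in> A \<Longrightarrow> a mod 4 = q mod 4 \<Longrightarrow> a mod 8 = q mod 8) \<Longrightarrow> 8 \<notin> Cyc A"
    "(\<And>a. a \<in> A \<Longrightarrow> a mod 8 = q mod 8 \<Longrightarrow> a mod 16 = q mod 16) \<Longrightarrow> 16 \<notin> Cyc A"
    "(\<And>a. a \<in> A \<Longrightarrow> a mod 3 = q mod 3 \<Longrightarrow> a mod 9 = q mod 9) \<Longrightarrow> 9 \<notin> Cyc A"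
    "(\<And>a. a \<in> A \<Longrightarrow> a mod 2 = q mod 2) \<Longrightarrow> (\<And>a. a \<in> A \<Longrightarrow> a mod 2 = q mod 2 \<Longrightarrow> a mod 3 = q mod 3 \<Longrightarrow> a mod 9 = q mod 9) \<Longrightarrow> 18 \<notin> Cyc A"
    "(\<And>a. a \<in> A \<Longrightarrow> a mod 2 = q mod 2 \<Longrightarrow> a mod 4 = q mod 4) \<Longrightarrow> (\<And>a. a \<in> A \<Longrightarrow> a mod 4 = q mod 4 \<Longrightarrow> a mod 3 = q mod 3 \<Longrightarrow> a mod 9 = q mod 9) \<Longrightarrow> 36 \<notin> Cyc A"
    "(\<And>a. a \<in> A \<Longrightarrow> a mod 4 = q mod 4 \<Longrightarrow> a mod 8 = q mod 8) \<Longrightarrow> (\<And>a. a \<in> A \<Longrightarrow> a mod 8 = q mod 8 \<Longrightarrow> a mod 3 = q mod 3 \<Longrightarrow> a mod 9 = q mod 9) \<Longrightarrow> 72 \<notin> Cyc A"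
    "(\<And>a. a \<in> A \<Longrightarrow> a mod 8 = q mod 8 \<Longrightarrow> a mod 16 = q mod 16) \<Longrightarrow> (\<And>a. a \<in> A \<Longrightarrow> a mod 16 = q mod 16 \<Longrightarrow> a mod 3 = q mod 3 \<Longrightarrow> a mod 9 = q mod 9) \<Longrightarrow> 144 \<notin> Cyc A"
proof -
  note sc = shift_cong
  show "2 \<notin> Cyc A" if h: "\<And>a. a \<in> A \<Longrightarrow> a mod 2 = q mod 2"
  proof (rule not_Cyc_shift[OF fin q, of 2 1])
    show "a mod 2 \<noteq> (q + 1) mod 2" if "a \<in> A" for a using sc(2)[of a 2 q 1 2] h[OF that] by auto
  qed simp
  show "4 \<notin> Cyc A" if h: "\<And>a. a \<in> A \<Longrightarrow> a mod 2 = q mod 2 \<Longrightarrow> a mod 4 = q mod 4"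
  proof (rule not_Cyc_shift[OF fin q, of 4 2])
    show "a mod 4 \<noteq> (q + 2) mod 4" if "a \<in> A" for a
      using sc(1)[of a 4 q 2 2] sc(2)[of a 4 q 2 4] h[OF that] by auto
  qed simp
  show "8 \<notin> Cyc A" if h: "\<And>a. a \<in> A \<Longrightarrow> a mod 4 = q mod 4 \<Longrightarrow> a mod 8 = q mod 8"
  proof (rule not_Cyc_shift[OF fin q, of 8 4])
    show "a mod 8 \<noteq> (q + 4) mod 8" if "a \<in> A" for a
      using sc(1)[of a 8 q 4 4] sc(2)[of a 8 q 4 8] h[OF that] by auto
  qed simp
  show "16 \<notin> Cyc A" if h: "\<And>a. a \<in> A \<Longrightarrow> a mod 8 = q mod 8 \<Longrightarrow> a mod 16 = q mod 16"
  proof (rule not_Cyc_shift[OF fin q, of 16 8])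
    show "a mod 16 \<noteq> (q + 8) mod 16" if "a \<in> A" for a
      using sc(1)[of a 16 q 8 8] sc(2)[of a 16 q 8 16] h[OF that] by auto
  qed simp
  show "9 \<notin> Cyc A" if h: "\<And>a. a \<in> A \<Longrightarrow> a mod 3 = q mod 3 \<Longrightarrow> a mod 9 = q mod 9"
  proof (rule not_Cyc_shift[OF fin q, of 9 3])
    show "a mod 9 \<noteq> (q + 3) mod 9" if "a \<in> A" for a
      using sc(1)[of a 9 q 3 3] sc(2)[of a 9 q 3 9] h[OF that] by auto
  qed simp
  show "18 \<notin> Cyc A" if h: "\<And>a. a \<in> A \<Longrightarrow> a mod 2 = q mod 2"
    "\<And>a. a \<in> A \<Longrightarrow> a mod 2 = q mod 2 \<Longrightarrow> a mod 3 = q mod 3 \<Longrightarrow> a mod 9 = q mod 9"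
  proof (rule not_Cyc_six[OF fin q, of 18])
    fix a assume a: "a \<in> A"
    show "a mod 18 \<noteq> (q + 18 div 2) mod 18" using sc(2)[of a 18 q 9 2] h(1)[OF a] by auto
    show "a mod 18 \<noteq> (q + 18 div 3) mod 18"
      using sc(1)[of a 18 q 6 2] sc(1)[of a 18 q 6 3] sc(2)[of a 18 q 6 9] h(2)[OF a] by auto
  qed simp
  show "36 \<notin> Cyc A" if h: "\<And>a. a \<in> A \<Longrightarrow> a mod 2 = q mod 2 \<Longrightarrow> a mod 4 = q mod 4"
    "\<And>a. a \<in> A \<Longrightarrow> a mod 4 = q mod 4 \<Longrightarrow> a mod 3 = q mod 3 \<Longrightarrow> a mod 9 = q mod 9"
  proof (rule not_Cyc_six[OF fin q, of 36])
    fix a assume a: "a \<in> A"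
    show "a mod 36 \<noteq> (q + 36 div 2) mod 36" using sc(1)[of a 36 q 18 2] sc(2)[of a 36 q 18 4] h(1)[OF a] by auto
    show "a mod 36 \<noteq> (q + 36 div 3) mod 36"
      using sc(1)[of a 36 q 12 4] sc(1)[of a 36 q 12 3] sc(2)[of a 36 q 12 9] h(2)[OF a] by auto
  qed simp
  show "72 \<notin> Cyc A" if h: "\<And>a. a \<in> A \<Longrightarrow> a mod 4 = q mod 4 \<Longrightarrow> a mod 8 = q mod 8"
    "\<And>a. a \<in> A \<Longrightarrow> a mod 8 = q mod 8 \<Longrightarrow> a mod 3 = q mod 3 \<Longrightarrow> a mod 9 = q mod 9"
  proof (rule not_Cyc_six[OF fin q, of 72])
    fix a assume a: "a \<in> A"
    show "a mod 72 \<noteq> (q + 72 div 2) mod 72" using sc(1)[of a 72 q 36 4] sc(2)[of a 72 q 36 8] h(1)[OF a] by auto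
    show "a mod 72 \<noteq> (q + 72 div 3) mod 72"
      using sc(1)[of a 72 q 24 8] sc(1)[of a 72 q 24 3] sc(2)[of a 72 q 24 9] h(2)[OF a] by auto
  qed simp
  show "144 \<notin> Cyc A" if h: "\<And>a. a \<in> A \<Longrightarrow> a mod 8 = q mod 8 \<Longrightarrow> a mod 16 = q mod 16"
    "\<And>a. a \<in> A \<Longrightarrow> a mod 16 = q mod 16 \<Longrightarrow> a mod 3 = q mod 3 \<Longrightarrow> a mod 9 = q mod 9"
  proof (rule not_Cyc_six[OF fin q, of 144])
    fix a assume a: "a \<in> A"
    show "a mod 144 \<noteq> (q + 144 div 2) mod 144" using sc(1)[of a 144 q 72 8] sc(2)[of a 144 q 72 16] h(1)[OF a] by auto
    show "a mod 144 \<noteq> (q + 144 div 3) mod 144"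
      using sc(1)[of a 144 q 48 16] sc(1)[of a 144 q 48 3] sc(2)[of a 144 q 48 9] h(2)[OF a] by auto
  qed simp
qed

section \<open>Orders excluded for grids and unions of grids\<close>

lemma family_R: "A \<in> family k R \<Longrightarrow> a \<in> A \<Longrightarrow> b \<in> A \<Longrightarrow> R a b"
  unfolding family_def using all_pairsD by blast

lemma family_finite: "A \<in> family k R \<Longrightarrow> finite A"
  unfolding family_def using finite_sub_Z144 by blast

lemma family_ex: "A \<in> family k R \<Longrightarrow> k > 0 \<Longrightarrow> \<exists>q. q \<in> A"
  unfolding family_def by (metis (mono_tags, lifting) card.empty ex_in_conv less_irrefl mem_Collect_eq)

lemma family_not_stable: "A \<in> family k R \<Longrightarrow> \<not> stable 48 A \<and> \<not> stable 72 A"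
  unfolding family_def using periodic_iff by blast

lemma RG22_not_Cyc:
  assumes "A \<in> family 6 (RG 2 2)"
  shows "Cyc A \<inter> {2,8,9,16,18,72,144} = {}"
proof -
  obtain q where q: "q \<in> A" using family_ex[OF assms] by auto
  note fin = family_finite[OF assms] and R = family_R[OF assms]
  have R2: "a mod 2 = q mod 2" and R16: "a mod 4 = q mod 4 \<Longrightarrow> a mod 16 = q mod 16" and R9: "a mod 3 = q mod 3 \<Longrightarrow> a mod 9 = q mod 9"
    if "a \<in> A" for a using R[OF that q] by (simp_all add: RG_def)
  have R8: "a mod 4 = q mod 4 \<Longrightarrow> a mod 8 = q mod 8" and R8': "a mod 8 = q mod 8 \<Longrightarrow> a mod 16 = q mod 16" if "a \<in> A" for a
    using R16[OF that] mod_chain by blast+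
  note n = not_Cyc_grid[OF fin q]
  show ?thesis using n(1)[OF R2] n(3)[OF R8] n(4)[OF R8'] n(5)[OF R9] n(6)[OF R2 R9] n(8)[OF R8 R9] n(9)[OF R8' R9] by blast
qed

lemma RG42_not_Cyc:
  assumes "A \<in> family 6 (RG 4 2)"
  shows "Cyc A \<inter> {2,4,9,16,18,36,144} = {}"
proof -
  obtain q where q: "q \<in> A" using family_ex[OF assms] by auto
  note fin = family_finite[OF assms] and R = family_R[OF assms]
  have R4: "a mod 4 = q mod 4" and R16: "a mod 8 = q mod 8 \<Longrightarrow> a mod 16 = q mod 16" and R9: "a mod 3 = q mod 3 \<Longrightarrow> a mod 9 = q mod 9"
    if "a \<in> A" for a using R[OF that q] by (simp_all add: RG_def)
  have R2: "a mod 2 = q mod 2" if "a \<in> A" for a using R4[OF that] mod_chain by blast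
  note n = not_Cyc_grid[OF fin q]
  show ?thesis using n(1)[OF R2] n(2)[OF R4] n(4)[OF R16] n(5)[OF R9] n(6)[OF R2 R9] n(7)[OF R4 R9] n(9)[OF R16 R9] by blast
qed

lemma no_triple_9:
  fixes a b c m :: nat
  assumes fin: "finite A" and a: "a \<in> A" and R: "\<forall>a\<in>A. \<forall>b\<in>A. a mod (2 * m) = b mod (2 * m) \<longrightarrow> a mod 3 = b mod 3 \<longrightarrow> a mod 9 = b mod 9"
    and m: "\<forall>a\<in>A. \<forall>b\<in>A. a mod m = b mod m" "m > 0"
    and b: "b \<in> A" "b mod 9 = (a + 3) mod 9" and c: "c \<in> A" "c mod 9 = (a + 6) mod 9"
  shows False
proof -
  note s = shifts_mod_9[OF b(2) c(2)]
  have "a mod (2 * m) = b mod (2 * m) \<or> a mod (2 * m) = c mod (2 * m) \<or> b mod (2 * m) = c mod (2 * m)"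
    using m a b(1) c(1) by (intro mod_pigeonhole) blast+
  then show False using R a b(1) c(1) s by metis
qed

lemma double_not_Cyc:
  assumes "A \<in> family 12 R_double"
  shows "Cyc A \<inter> {2,9,16,18,144} = {}"
proof -
  obtain q where q: "q \<in> A" using family_ex[OF assms] by auto
  note fin = family_finite[OF assms] and R = family_R[OF assms]
  have R2: "a mod 2 = b mod 2" if "a \<in> A" "b \<in> A" for a b using R[OF that] by (simp add: R_double_def)
  have R9: "a mod 9 = b mod 9" if "a \<in> A" "b \<in> A" "a mod (2 * 2) = b mod (2 * 2)" "a mod 3 = b mod 3" for a b
    using R[OF that(1,2)] that(3,4) by (simp add: R_double_def RG_def)
  have R16: "a mod 16 = q mod 16" if "a \<in> A" "a mod 8 = q mod 8" for a
    using R[OF that(1) q] that(2) mod_chain(2)[OF that(2)] by (simp add: R_double_def RG_def)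
  have R9': "a mod 9 = q mod 9" if "a \<in> A" "a mod 16 = q mod 16" "a mod 3 = q mod 3" for a
    using R9[OF that(1) q _ that(3)] mod_chain(1)[OF that(2)] mod_chain(2)[of a q] by simp
  note n = not_Cyc_grid[OF fin q]
  have trip: False if "a \<in> A" "b \<in> A" "b mod 9 = (a + 3) mod 9" "c \<in> A" "c mod 9 = (a + 6) mod 9" for a b c
  proof -
    have "\<forall>a\<in>A. \<forall>b\<in>A. a mod (2 * 2) = b mod (2 * 2) \<longrightarrow> a mod 3 = b mod 3 \<longrightarrow> a mod 9 = b mod 9" using R9 by blast
    moreover have "\<forall>a\<in>A. \<forall>b\<in>A. a mod 2 = b mod 2" using R2 by blast
    ultimately show False using no_triple_9[OF fin that(1) _ _ zero_less_numeral that(2-5)] by blast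
  qed
  have "9 \<notin> Cyc A"
  proof
    assume "9 \<in> Cyc A"
    then obtain b c where "b \<in> A" "b mod 9 = (q + 3) mod 9" "c \<in> A" "c mod 9 = (q + 6) mod 9"
      using Cyc_9_triple[OF fin _ q] by blast
    then show False using trip[OF q] by blast
  qed
  moreover have "18 \<notin> Cyc A"
  proof
    assume C: "18 \<in> Cyc A"
    \<comment> \<open>The shift by 9 changes the parity, so the relation of order 18 forces the
      shift by 6; two such steps produce three residues modulo 9 over one residue modulo 3.\<close>
    have step: "\<exists>b\<in>A. b mod 18 = (p + 6) mod 18" if p: "p \<in> A" for p
    proof -
      have z: "cnt A 18 (p + 9) = 0"
      proof -
        have "a mod 18 \<noteq> (p + 9) mod 18" if "a \<in> A" for a
          using shift_cong(2)[of a 18 p 9 2] R2[OF that p] by auto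
        then show ?thesis using cnt_eq_0_iff[OF fin] by blast
      qed
      have "cnt A 18 p \<noteq> 0" using cnt_eq_0_iff[OF fin] p by blast
      then have "cnt A 18 (p + 6) \<noteq> 0" using Cyc_six[OF fin C, of p] z by simp
      then show ?thesis by (metis cnt_posE)
    qed
    obtain b where b: "b \<in> A" "b mod 18 = (q + 6) mod 18" using step[OF q] by blast
    obtain c where c: "c \<in> A" "c mod 18 = (b + 6) mod 18" using step[OF b(1)] by blast
    have b9: "b mod 9 = (q + 6) mod 9" using mod_eq_dvd[OF b(2), of 9] by simp
    have "c mod 9 = (b + 6) mod 9" using mod_eq_dvd[OF c(2), of 9] by simp
    also have "\<dots> = (q + 6 + 6) mod 9" by (rule mod_add_cong) (use b9 in auto)
    also have "\<dots> = (q + 3) mod 9" using mod_add_eqI[of 12 9 3 q] by (simp add: add.assoc)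
    finally show False using trip[OF q c(1) _ b(1) b9] by blast
  qed
  ultimately show ?thesis
    using n(1)[OF R2[OF _ q]] n(4)[OF R16] n(9)[OF R16 R9'] by blast
qed

lemma half_not_Cyc:
  assumes "A \<in> family 12 R_half"
  shows "Cyc A \<inter> {4,9,16,36,144} = {}"
proof -
  obtain q where q: "q \<in> A" using family_ex[OF assms] by auto
  note fin = family_finite[OF assms] and R = family_R[OF assms]
  have G: "RG 4 2 a b" if "a \<in> A" "b \<in> A" "a mod 2 = b mod 2" for a b using R[OF that(1,2)] that(3) by (simp add: R_half_def)
  have R4: "a mod 4 = q mod 4" if "a \<in> A" "a mod 2 = q mod 2" for a using G[OF that(1) q that(2)] by (simp add: RG_def)
  have R16: "a mod 16 = q mod 16" if "a \<in> A" "a mod 8 = q mod 8" for a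
    using G[OF that(1) q] that(2) mod_chain(2)[OF that(2)] mod_chain(3)[of a q] by (simp add: RG_def)
  have R9: "a mod 9 = b mod 9" if "a \<in> A" "b \<in> A" "a mod (2 * 1) = b mod (2 * 1)" "a mod 3 = b mod 3" for a b
    using G[OF that(1,2)] that(3,4) by (simp add: RG_def)
  have R9': "a mod 9 = q mod 9" if "a \<in> A" "a mod 4 = q mod 4" "a mod 3 = q mod 3" for a
    using R9[OF that(1) q _ that(3)] mod_chain(3)[OF that(2)] by simp
  have R9'': "a mod 9 = q mod 9" if "a \<in> A" "a mod 16 = q mod 16" "a mod 3 = q mod 3" for a
    using R9'[OF that(1) _ that(3)] mod_chain(1)[OF that(2)] mod_chain(2)[of a q] by simp
  note n = not_Cyc_grid[OF fin q]
  have "9 \<notin> Cyc A"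
  proof
    assume "9 \<in> Cyc A"
    then obtain b c where "b \<in> A" "b mod 9 = (q + 3) mod 9" "c \<in> A" "c mod 9 = (q + 6) mod 9"
      using Cyc_9_triple[OF fin _ q] by blast
    moreover have "\<forall>a\<in>A. \<forall>b\<in>A. a mod (2 * 1) = b mod (2 * 1) \<longrightarrow> a mod 3 = b mod 3 \<longrightarrow> a mod 9 = b mod 9"
      using R9 by blast
    moreover have "\<forall>a\<in>A. \<forall>b\<in>A. a mod 1 = b mod 1" by simp
    ultimately show False using no_triple_9[OF fin q _ _ zero_less_one] by blast
  qed
  then show ?thesis using n(2)[OF R4] n(4)[OF R16] n(7)[OF R4 R9'] n(9)[OF R16 R9''] by blast
qed

text \<open>Without matching residues there are a, b in different classes modulo 4 that agree modulo
  3 and not modulo 9. At a the relation of order 36 cannot use a + 12, so it forces a + 18, an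
  element in the class of b modulo 4 with the residue of a modulo 9; this contradicts the grid
  structure there.\<close>

lemma double_36_not_Cyc:
  assumes "A \<in> family 12 R_double - family 12 (RG 2 4)"
  shows "36 \<notin> Cyc A"
    and "\<exists>a\<in>A. \<exists>b\<in>A. a mod 2 = b mod 2 \<and> a mod 4 \<noteq> b mod 4 \<and> a mod 3 = b mod 3 \<and> a mod 9 \<noteq> b mod 9"
proof -
  have Af: "A \<in> family 12 R_double" using assms by blast
  note fin = family_finite[OF Af] and R = family_R[OF Af]
  have "\<not> all_pairs (RG 2 4) A" using assms by (auto simp: family_def)
  then obtain a b where ab: "a \<in> A" "b \<in> A" "\<not> RG 2 4 a b" unfolding all_pairs_def by blast
  have G: "RG 4 2 x y" if "x \<in> A" "y \<in> A" "x mod 4 = y mod 4" for x y using R[OF that(1,2)] that(3) by (simp add: R_double_def)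
  have P: "x mod 2 = y mod 2" if "x \<in> A" "y \<in> A" for x y using R[OF that] by (simp add: R_double_def)
  have "a mod 16 = b mod 16" if "a mod 8 = b mod 8"
    using G[OF ab(1,2) mod_chain(2)[OF that]] that by (simp add: RG_def)
  then have 39: "a mod 3 = b mod 3" "a mod 9 \<noteq> b mod 9" using ab(3) P[OF ab(1,2)] by (auto simp: RG_def)
  have 4: "a mod 4 \<noteq> b mod 4" using G[OF ab(1,2)] 39 by (auto simp: RG_def)
  show "\<exists>a\<in>A. \<exists>b\<in>A. a mod 2 = b mod 2 \<and> a mod 4 \<noteq> b mod 4 \<and> a mod 3 = b mod 3 \<and> a mod 9 \<noteq> b mod 9"
    using ab 4 39 P[OF ab(1,2)] by blast
  show "36 \<notin> Cyc A"
  proof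
    assume C: "36 \<in> Cyc A"
    have "cnt A 36 (a + 12) = 0"
    proof -
      have "y mod 36 \<noteq> (a + 12) mod 36" if y: "y \<in> A" for y
      proof
        assume e: "y mod 36 = (a + 12) mod 36"
        have "y mod 4 = a mod 4" "y mod 3 = a mod 3" "y mod 9 \<noteq> a mod 9"
          using shift_cong(1)[OF e, of 4] shift_cong(1)[OF e, of 3] shift_cong(2)[OF e, of 9] by simp_all
        then show False using G[OF y ab(1)] by (simp add: RG_def)
      qed
      then show ?thesis using cnt_eq_0_iff[OF fin] by blast
    qed
    moreover have "cnt A 36 a \<noteq> 0" using cnt_eq_0_iff[OF fin] ab(1) by blast
    ultimately have "cnt A 36 (a + 18) \<noteq> 0" using Cyc_six[OF fin C, of a] by simp
    then obtain y where y: "y \<in> A" "y mod 36 = (a + 18) mod 36" by (rule cnt_posE)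
    have y': "y mod 9 = a mod 9" "y mod 4 \<noteq> a mod 4" "y mod 3 = a mod 3"
      using shift_cong(1)[OF y(2), of 9] shift_cong(2)[OF y(2), of 4] shift_cong(1)[OF y(2), of 3] by simp_all
    have "y mod 4 = b mod 4"
      using mod_pigeonhole[of a 2 b y] P[OF ab(1,2)] P[OF ab(2) y(1)] 4 y'(2) by auto
    then have "y mod 9 = b mod 9" using G[OF y(1) ab(2)] y'(3) 39(1) by (simp add: RG_def)
    then show False using y'(1) 39(2) by simp
  qed
qed

section \<open>Orders excluded for complements\<close>

lemma Cyc_sub: "Cyc A \<subseteq> {2,3,4,6,8,9,12,16,18,24,36,48,72,144}"
proof
  fix d assume "d \<in> Cyc A"
  then have "d dvd 144" "d \<noteq> 1" by (auto simp: Cyc_iff)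
  then show "d \<in> {2,3,4,6,8,9,12,16,18,24,36,48,72,144}" unfolding divisors_144 by blast
qed

lemma cnt_total: "finite A \<Longrightarrow> m > 0 \<Longrightarrow> card A = (\<Sum>i<m. cnt A m i)"
  unfolding cnt_def by (simp add: card_by_residue[of A m])

lemma cnt_double: 
  assumes "finite A" "m > 0"
  shows "cnt A m n = cnt A (2 * m) n + cnt A (2 * m) (n + m)"
proof -
  have "{a\<in>A. a mod m = n mod m} = {a\<in>A. a mod (2 * m) = n mod (2 * m)} \<union> {a\<in>A. a mod (2 * m) = (n + m) mod (2 * m)}"
  proof -
    have "a mod m = n mod m" if "a mod (2 * m) = (n + m) mod (2 * m)" for a
      using mod_eq_dvd[OF that, of m] by simp
    moreover have "a mod m = n mod m" if "a mod (2 * m) = n mod (2 * m)" for a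
      using mod_eq_dvd[OF that, of m] by simp
    ultimately show ?thesis using mod_double[OF _ assms(2), of _ n] by blast
  qed
  moreover have "{a\<in>A. a mod (2 * m) = n mod (2 * m)} \<inter> {a\<in>A. a mod (2 * m) = (n + m) mod (2 * m)} = {}"
    using shift_neq(2)[of m "2 * m" n] assms(2) by auto
  ultimately show ?thesis unfolding cnt_def using assms(1) by (simp add: card_Un_disjoint)
qed

lemma cnt_1: "cnt A 1 n = card A"
  by (simp add: cnt_def)

lemma cnt_card:
  assumes "finite A"
  shows "card A = cnt A 2 0 + cnt A 2 1" "cnt A 2 n = cnt A 4 n + cnt A 4 (n + 2)"
    "cnt A 4 n = cnt A 8 n + cnt A 8 (n + 4)" "cnt A 8 n = cnt A 16 n + cnt A 16 (n + 8)"
  using cnt_double[OF assms, of 1 0] cnt_double[OF assms, of 2 n] cnt_double[OF assms, of 4 n] cnt_double[OF assms, of 8 n] cnt_1[of A 0]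
  by simp_all

lemma Cyc_3_9_card: "finite A \<Longrightarrow> 3 \<in> Cyc A \<Longrightarrow> 9 \<in> Cyc A \<Longrightarrow> 9 dvd card A"
proof -
  assume A: "finite A" "3 \<in> Cyc A" "9 \<in> Cyc A"
  have "cnt A 9 (n + 1) = cnt A 9 n" for n
  proof (rule Cyc_shift_invariant[OF A(1)])
    fix d :: nat assume d: "d dvd 9" "\<not> d dvd 1"
    have "d dvd 144" by (rule dvd_trans[OF d(1)]) simp
    then have "d = 3 \<or> d = 9" using d unfolding divisors_144 by auto
    then show "d \<in> Cyc A" using A by blast
  qed simp_all
  then have e: "cnt A 9 n = cnt A 9 0" for n by (induction n) auto
  have "card A = (\<Sum>i<9. cnt A 9 i)" using cnt_total[OF A(1), of 9] by simp
  also have "\<dots> = (\<Sum>i<(9::nat). cnt A 9 0)" by (intro sum.cong refl) (rule e)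
  finally have "card A = (\<Sum>i<(9::nat). cnt A 9 0)" .
  then show ?thesis by simp
qed

lemma Cyc_16: "finite A \<Longrightarrow> 16 \<in> Cyc A \<Longrightarrow> cnt A 16 (n + 8) = cnt A 16 n"
  by (rule Cyc_shift) simp_all

lemma Cyc_8: "finite A \<Longrightarrow> 8 \<in> Cyc A \<Longrightarrow> cnt A 8 (n + 4) = cnt A 8 n"
  by (rule Cyc_shift) simp_all

lemma Cyc_4: "finite A \<Longrightarrow> 4 \<in> Cyc A \<Longrightarrow> cnt A 4 (n + 2) = cnt A 4 n"
  by (rule Cyc_shift) simp_all

lemma Cyc_2: "finite A \<Longrightarrow> 2 \<in> Cyc A \<Longrightarrow> cnt A 2 (n + 1) = cnt A 2 n"
  by (rule Cyc_shift) simp_all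

text \<open>Each of the orders 2, 4, 8, 16 makes the two halves of a class equally large, so each
  contributes a factor 2 to the cardinality.\<close>

lemma Cyc_powers_2:
  assumes A: "finite A" and C: "16 \<in> Cyc A"
  shows "2 \<in> Cyc A \<Longrightarrow> 4 \<in> Cyc A \<Longrightarrow> 8 dvd card A" "2 \<in> Cyc A \<Longrightarrow> 8 \<in> Cyc A \<Longrightarrow> 8 dvd card A"
    "4 \<in> Cyc A \<Longrightarrow> 8 \<in> Cyc A \<Longrightarrow> 8 dvd card A" "2 \<in> Cyc A \<Longrightarrow> 4 \<in> Cyc A \<Longrightarrow> 8 \<in> Cyc A \<Longrightarrow> 16 dvd card A"
proof -
  note c = cnt_card[OF A]
  have c8: "cnt A 8 n = 2 * cnt A 16 n" for n using c(4)[of n] Cyc_16[OF A C, of n] by simp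
  have c4: "cnt A 4 n = 2 * (cnt A 16 n + cnt A 16 (n + 4))" for n using c(3)[of n] c8[of n] c8[of "n + 4"] by simp
  have c4b: "cnt A 4 n = 4 * cnt A 16 n" if "8 \<in> Cyc A" for n using c(3)[of n] c8[of n] Cyc_8[OF A that, of n] by simp
  have c2: "cnt A 2 n = 2 * cnt A 4 n" if "4 \<in> Cyc A" for n using c(2)[of n] Cyc_4[OF A that, of n] by simp
  have c1: "card A = 2 * cnt A 2 0" if "2 \<in> Cyc A" using c(1) Cyc_2[OF A that, of 0] by simp
  show "8 dvd card A" if "2 \<in> Cyc A" "4 \<in> Cyc A" using c1[OF that(1)] c2[OF that(2), of 0] c4[of 0] by simp
  show "8 dvd card A" if "2 \<in> Cyc A" "8 \<in> Cyc A"
    using c1[OF that(1)] c(2)[of 0, unfolded add_0] c4b[OF that(2), of 0] c4b[OF that(2), of 2] by simp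
  show "8 dvd card A" if "4 \<in> Cyc A" "8 \<in> Cyc A"
    using c(1) c2[OF that(1), of 0] c2[OF that(1), of 1] c4b[OF that(2), of 0] c4b[OF that(2), of 1] by simp
  show "16 dvd card A" if "2 \<in> Cyc A" "4 \<in> Cyc A" "8 \<in> Cyc A"
    using c1[OF that(1)] c2[OF that(2), of 0] c4b[OF that(3), of 0] by simp
qed

text \<open>With c(n) = 1 and c(n + s) = 0 the mixed difference reads 1 + c(n + s + t) = c(n + t),
  so n + t is present.\<close>

lemma stable_if_no_shift:
  assumes A: "A \<subseteq> Z144" and C: "\<And>d. d dvd 144 \<Longrightarrow> \<not> d dvd s \<Longrightarrow> \<not> d dvd t \<Longrightarrow> d \<in> Cyc A"
    and no: "\<And>n. mem A n \<Longrightarrow> \<not> mem A (n + s)"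
  shows "stable t A"
  unfolding stable_def
proof (intro allI impI)
  fix n assume n: "mem A n"
  have "dd A 144 s t n = 0" by (rule dd_eq_0[OF finite_sub_Z144[OF A] dvd_refl C])
  then show "mem A (n + t)" using n no[OF n] by (auto simp: dd_def cnt_144[OF A] split: if_splits)
qed

text \<open>A shift by 16 keeps the residue modulo 16 and changes that modulo 3, so it always leaves
  A. With orders 48 and 144 present, A would then be stable under 72.\<close>

lemma RC_not_Cyc_48:
  assumes A: "A \<subseteq> Z144" "144 \<in> Cyc A" "\<not> stable 72 A"
    and R: "\<And>a b. a \<in> A \<Longrightarrow> b \<in> A \<Longrightarrow> a mod 16 = b mod 16 \<Longrightarrow> a mod 3 = b mod 3"
  shows "48 \<notin> Cyc A"
proof
  assume C: "48 \<in> Cyc A"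
  have "stable 72 A"
  proof (rule stable_if_no_shift[OF A(1), of 16])
    show "d \<in> Cyc A" if "d dvd 144" "\<not> d dvd 16" "\<not> d dvd 72" for d using that C A(2) unfolding divisors_144 by auto
    fix n assume n: "mem A n"
    show "\<not> mem A (n + 16)"
    proof
      assume m: "mem A (n + 16)"
      have "(n + 16) mod 144 mod 16 = n mod 144 mod 16" by (simp add: mod_mod_cancel)
      then have "(n + 16) mod 144 mod 3 = n mod 144 mod 3" using R m n unfolding mem_def by blast
      then have "(n + 16) mod 3 = n mod 3" by (simp add: mod_mod_cancel)
      then show False using mod_add_eqI[of 16 3 1 n] shift_neq(1)[of 1 3 n] by simp
    qed
  qed
  then show False using A by simp
qed

text \<open>The same argument with steps 36 and 48, and with steps 18 and 48; the orders 36, 72 and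
  144 are the divisors that divide neither 18 nor 48.\<close>

lemma RC_not_Cyc_36_72:
  assumes A: "A \<subseteq> Z144" "144 \<in> Cyc A" "\<not> stable 48 A"
  shows "(\<And>a b. a \<in> A \<Longrightarrow> b \<in> A \<Longrightarrow> a mod 4 = b mod 4 \<Longrightarrow> a mod 9 = b mod 9 \<Longrightarrow> a mod 8 = b mod 8) \<Longrightarrow> 72 \<notin> Cyc A"
    "72 \<in> Cyc A \<Longrightarrow> (\<And>a b. a \<in> A \<Longrightarrow> b \<in> A \<Longrightarrow> a mod 2 = b mod 2 \<Longrightarrow> a mod 9 = b mod 9 \<Longrightarrow> a mod 4 = b mod 4) \<Longrightarrow> 36 \<notin> Cyc A"
proof -
  show "72 \<notin> Cyc A" if R: "\<And>a b. a \<in> A \<Longrightarrow> b \<in> A \<Longrightarrow> a mod 4 = b mod 4 \<Longrightarrow> a mod 9 = b mod 9 \<Longrightarrow> a mod 8 = b mod 8"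
  proof
    assume C: "72 \<in> Cyc A"
    have "stable 48 A"
    proof (rule stable_if_no_shift[OF A(1), of 36])
      show "d \<in> Cyc A" if "d dvd 144" "\<not> d dvd 36" "\<not> d dvd 48" for d using that C A(2) unfolding divisors_144 by auto
      fix n assume n: "mem A n"
      show "\<not> mem A (n + 36)"
      proof
        assume m: "mem A (n + 36)"
        have "(n + 36) mod 144 mod 4 = n mod 144 mod 4" "(n + 36) mod 144 mod 9 = n mod 144 mod 9"
          using mod_add_eqI[of 36 4 0 n] mod_add_eqI[of 36 9 0 n] by (simp_all add: mod_mod_cancel)
        then have "(n + 36) mod 144 mod 8 = n mod 144 mod 8" using R m n unfolding mem_def by blast
        then have "(n + 36) mod 8 = n mod 8" by (simp add: mod_mod_cancel)
        then show False using mod_add_eqI[of 36 8 4 n] shift_neq(1)[of 4 8 n] by simp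
      qed
    qed
    then show False using A by simp
  qed
  show "36 \<notin> Cyc A" if C72: "72 \<in> Cyc A"
    and R: "\<And>a b. a \<in> A \<Longrightarrow> b \<in> A \<Longrightarrow> a mod 2 = b mod 2 \<Longrightarrow> a mod 9 = b mod 9 \<Longrightarrow> a mod 4 = b mod 4"
  proof
    assume C: "36 \<in> Cyc A"
    have "stable 48 A"
    proof (rule stable_if_no_shift[OF A(1), of 18])
      show "d \<in> Cyc A" if "d dvd 144" "\<not> d dvd 18" "\<not> d dvd 48" for d using that C C72 A(2) unfolding divisors_144 by auto
      fix n assume n: "mem A n"
      show "\<not> mem A (n + 18)"
      proof
        assume m: "mem A (n + 18)"
        have "(n + 18) mod 144 mod 2 = n mod 144 mod 2" "(n + 18) mod 144 mod 9 = n mod 144 mod 9"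
          using mod_add_eqI[of 18 2 0 n] mod_add_eqI[of 18 9 0 n] by (simp_all add: mod_mod_cancel)
        then have "(n + 18) mod 144 mod 4 = n mod 144 mod 4" using R m n unfolding mem_def by blast
        then have "(n + 18) mod 4 = n mod 4" by (simp add: mod_mod_cancel)
        then show False using mod_add_eqI[of 18 4 2 n] shift_neq(1)[of 2 4 n] by simp
      qed
    qed
    then show False using A by simp
  qed
qed

text \<open>In the relation of order 6h the class of n modulo 2h contributes its whole size at n and
  nothing at n + 2h. So the count at n + 3h reaches the size of the class of n + h, which is the
  same; that class lies there entirely, and 3h is 0 modulo 3.\<close>

lemma two_slices:
  assumes A: "finite A" and h: "h = 1 \<or> h = 2" and C: "6 * h \<in> Cyc A"
    and c: "card {a\<in>A. a mod (2 * h) = n mod (2 * h)} = card {a\<in>A. a mod (2 * h) = (n + h) mod (2 * h)}"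
    and P: "\<And>a. a \<in> A \<Longrightarrow> a mod (2 * h) = n mod (2 * h) \<Longrightarrow> a mod 3 = n mod 3"
    and a: "a \<in> A" "a mod (2 * h) = (n + h) mod (2 * h)"
  shows "a mod 3 = n mod 3"
proof -
  let ?c = "cnt A (6 * h)" and ?Q = "{a\<in>A. a mod (2 * h) = (n + h) mod (2 * h)}"
  have co: "coprime (2 * h) 3" using h by (elim disjE) (simp_all add: coprime_iff_gcd_eq_1 gcd_non_0_nat)
  have crt: "x mod (6 * h) = y mod (6 * h) \<longleftrightarrow> x mod (2 * h) = y mod (2 * h) \<and> x mod 3 = y mod 3" for x y
    using crt_iff[OF co, of x y] by (simp add: mult.commute mult.left_commute)
  have s: "(n + 2 * h) mod (2 * h) = n mod (2 * h)" "(n + 3 * h) mod (2 * h) = (n + h) mod (2 * h)"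
    "(n + 5 * h) mod (2 * h) = (n + h) mod (2 * h)" "(n + 3 * h) mod 3 = n mod 3"
    using mod_add_eqI[of "3 * h" "2 * h" h n] mod_add_eqI[of "5 * h" "2 * h" h n] h by auto
  have s3: "(n + 2 * h) mod 3 \<noteq> n mod 3" "(n + 5 * h) mod 3 \<noteq> n mod 3"
    using h mod_add_eqI[of 4 3 1 n] mod_add_eqI[of 5 3 2 n] mod_add_eqI[of 10 3 1 n] shift_neq(1)[of 1 3 n] shift_neq(1)[of 2 3 n]
    by auto
  have "?c (n + 2 * h) = 0"
  proof -
    have "x mod (6 * h) \<noteq> (n + 2 * h) mod (6 * h)" if "x \<in> A" for x
      using P[OF that] s(1) s3(1) unfolding crt by auto
    then show ?thesis using cnt_eq_0_iff[OF A] by blast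
  qed
  moreover have "?c n = card {a\<in>A. a mod (2 * h) = n mod (2 * h)}"
    unfolding cnt_def crt using P by (intro arg_cong[of _ _ card]) blast
  moreover have "?c n + ?c (n + 5 * h) = ?c (n + 3 * h) + ?c (n + 2 * h)"
    using Cyc_six[OF A C, of n] h by (auto simp: add.assoc)
  ultimately have e: "?c (n + 3 * h) = card ?Q + ?c (n + 5 * h)" using c by simp
  have "{a\<in>A. a mod (6 * h) = (n + 3 * h) mod (6 * h)} \<subseteq> ?Q" unfolding crt using s by auto
  moreover have "finite ?Q" using A by simp
  moreover have "card ?Q \<le> card {a\<in>A. a mod (6 * h) = (n + 3 * h) mod (6 * h)}" using e by (simp add: cnt_def)
  ultimately have "{a\<in>A. a mod (6 * h) = (n + 3 * h) mod (6 * h)} = ?Q" by (intro card_seteq)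
  then have "a mod (6 * h) = (n + 3 * h) mod (6 * h)" using a by blast
  then show ?thesis unfolding crt using s by simp
qed

lemma ex_residue_3:
  fixes n e t :: nat
  assumes "e mod 3 \<noteq> 0"
  shows "\<exists>k<3. (n + e * k) mod 3 = t mod 3"
proof -
  have all: "\<forall>x\<in>set [0..<3]. \<forall>y\<in>set [1..<3]. \<forall>t\<in>set [0..<3]. list_ex (\<lambda>k. (x + y * k) mod 3 = t) [0,1,2::nat]"
    by code_simp
  have "list_ex (\<lambda>k. (n mod 3 + e mod 3 * k) mod 3 = t mod 3) [0,1,2]"
    by (rule all[rule_format]) (use assms in auto)
  then obtain k where k: "k \<in> set [0,1,2]" "(n mod 3 + e mod 3 * k) mod 3 = t mod 3" unfolding list_ex_iff by blast
  have "(n + e * k) mod 3 = (n mod 3 + e mod 3 * k) mod 3"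
    by (rule mod_add_cong) (simp_all add: mod_mult_left_eq)
  then have "k < 3 \<and> (n + e * k) mod 3 = t mod 3" using k by auto
  then show ?thesis by blast
qed

text \<open>The opposite class n + e/2 is empty, so the relation of order 3e becomes equality of the
  counts at m and m + e, and the slice is spread evenly over the residues modulo 3. Each third is
  stable under 48, hence of size a multiple of 3.\<close>

lemma single_slice:
  assumes A: "A \<subseteq> Z144" and e: "e = 4 \<or> e = 8" and C: "3 * e \<in> Cyc A"
    and no: "\<And>a. a \<in> A \<Longrightarrow> a mod e \<noteq> (n + e div 2) mod e"
    and st: "stable 48 {a\<in>A. a mod e = n mod e}"
  shows "9 dvd card {a\<in>A. a mod e = n mod e}"
proof -
  have fin: "finite A" using A finite_sub_Z144 by blast
  let ?c = "cnt A (3 * e)" and ?P = "{a\<in>A. a mod e = n mod e}"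
  have co: "coprime e 3" using e by (elim disjE) (simp_all add: coprime_iff_gcd_eq_1 gcd_non_0_nat)
  have crt: "x mod (3 * e) = y mod (3 * e) \<longleftrightarrow> x mod e = y mod e \<and> x mod 3 = y mod 3" for x y
    using crt_iff[OF co, of x y] by (simp add: mult.commute)
  have step: "?c (m + e) = ?c m" if m: "m mod e = n mod e" for m
  proof -
    have z: "?c (m + j) = 0" if j: "j mod e = (e div 2) mod e" for j
    proof -
      have "x mod (3 * e) \<noteq> (m + j) mod (3 * e)" if x: "x \<in> A" for x
      proof
        assume "x mod (3 * e) = (m + j) mod (3 * e)"
        then have "x mod e = (m + j) mod e" unfolding crt by simp
        also have "\<dots> = (n + e div 2) mod e" using m j by (rule mod_add_cong)
        finally show False using no[OF x] by simp
      qed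
      then show ?thesis using cnt_eq_0_iff[OF fin] by blast
    qed
    have "?c m + ?c (m + (3 * e div 2 + e)) = ?c (m + 3 * e div 2) + ?c (m + e)"
      using Cyc_six[OF fin C, of m] e by (auto simp: add.assoc)
    moreover have "?c (m + 3 * e div 2) = 0" "?c (m + (3 * e div 2 + e)) = 0"
      by (rule z; use e in auto; fail)+
    ultimately show ?thesis by simp
  qed
  have ck: "?c (n + e * k) = ?c n" for k
  proof (induction k)
    case (Suc k)
    have "?c (n + e * k + e) = ?c (n + e * k)" by (rule step) simp
    then show ?case using Suc by (simp add: algebra_simps)
  qed simp
  have "card ?P = (\<Sum>t<3. card {a\<in>?P. a mod 3 = t})"
    by (rule card_by_residue) (use fin in auto)
  also have "\<dots> = (\<Sum>t<(3::nat). ?c n)"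
  proof (intro sum.cong refl)
    fix t :: nat assume t: "t \<in> {..<3}"
    obtain k where k: "(n + e * k) mod 3 = t mod 3" using ex_residue_3[of e n t] e by auto
    have "{a\<in>?P. a mod 3 = t} = {a\<in>A. a mod (3 * e) = (n + e * k) mod (3 * e)}"
      unfolding crt using k t by auto
    then have "card {a\<in>?P. a mod 3 = t} = ?c (n + e * k)" by (simp add: cnt_def)
    then show "card {a\<in>?P. a mod 3 = t} = ?c n" using ck by simp
  qed
  finally have P: "card ?P = 3 * ?c n" by simp
  let ?X = "{a\<in>A. a mod (3 * e) = n mod (3 * e)}"
  have d: "3 * e dvd 48" "3 * e dvd 144" "e dvd 144" using e by auto
  have "stable 48 ?X"
    unfolding stable_def
  proof (intro allI impI)
    fix m assume "mem ?X m"
    then have m: "m mod 144 \<in> A" "m mod 144 mod (3 * e) = n mod (3 * e)" by (auto simp: mem_def)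
    then have "mem ?P m" unfolding crt by (simp add: mem_def)
    then have "mem ?P (m + 48)" using st by (simp add: stable_def)
    moreover have "(m + 48) mod (3 * e) = m mod (3 * e)" using mod_add_eqI[of 48 "3 * e" 0 m] d(1) by simp
    then have "(m + 48) mod 144 mod (3 * e) = n mod (3 * e)" using m(2) d(2) by (simp add: mod_mod_cancel)
    ultimately show "mem ?X (m + 48)" by (simp add: mem_def)
  qed
  then have "3 dvd card ?X" using closed_dvd_card[of ?X 48] A by auto
  then have "3 dvd ?c n" by (simp add: cnt_def)
  then show ?thesis using P by auto
qed

lemma slice_pieces:
  assumes l: "levels M W" and I: "I \<subseteq> {..<M}" and A: "A \<in> complements M W I" and i: "i \<in> I"
  shows "{a\<in>A. a mod M = i} \<in> pieces M W i"
proof -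
  have A': "A \<subseteq> {n. n < 144 \<and> n mod M \<in> I}" "card A = card I * (48 div (M * W))" "all_pairs (RC M W) A"
    using A by (auto simp: complements_def)
  have fin: "finite A" by (rule finite_subset[OF A'(1)]) simp
  have "card {a\<in>A. a mod M = k} \<le> 48 div (M * W)" if "k \<in> I" for k
  proof -
    interpret piece_count M W k using l I that by unfold_locales auto
    show ?thesis by (rule card_le) (use A'(1) all_pairsD[OF A'(3)] in auto)
  qed
  then have "card {a\<in>A. a mod M = i} = 48 div (M * W)"
    using slices_card_eq[of I A "\<lambda>a. a mod M" "48 div (M * W)"] finite_subset[OF I] fin A'(1,2) i by auto
  then show ?thesis unfolding pieces_def all_pairs_def using A'(1) all_pairsD[OF A'(3)] by auto
qed

text \<open>A complement is not stable under 72, so some slice is a piece of the first type only; it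
  is not stable under 48, so some slice is of the second type only. These two slices obstruct the
  orders 6, 12 and 24.\<close>

lemma complement_class:
  assumes l: "levels M W" and I: "I \<subseteq> {..<M}" and A: "A \<in> complements M W I"
  shows "\<exists>n\<in>A. stable 48 {a\<in>A. a mod M = n mod M} \<and> (\<forall>a\<in>A. a mod M = n mod M \<longrightarrow> a mod (M * W) = n mod (M * W))"
    and "\<exists>n\<in>A. \<forall>a\<in>A. a mod M = n mod M \<longrightarrow> a mod 3 = n mod 3"
    and "\<exists>n\<in>A. \<exists>a\<in>A. a mod 3 \<noteq> n mod 3"
    and "n mod M \<in> I \<Longrightarrow> cnt A M n = 48 div (M * W)"
proof -
  have A': "A \<subseteq> {n. n < 144 \<and> n mod M \<in> I}" "\<not> stable 48 A" "\<not> stable 72 A" using A by (auto simp: complements_def)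
  have M: "M dvd 144" "M dvd 48" "M dvd 72" "M > 0" using l by (auto elim: levelsE)
  have P: "{a\<in>A. a mod M = i} \<in> pieces M W i" if "i \<in> I" for i by (rule slice_pieces[OF l I A that])
  have ne: "\<exists>n\<in>A. n mod M = i" if "\<not> stable g {a\<in>A. a mod M = i}" for g i
  proof -
    obtain x where "x mod 144 \<in> {a\<in>A. a mod M = i}" using \<open>\<not> stable g _\<close> unfolding stable_def mem_def by blast
    then show ?thesis by blast
  qed
  obtain i where i: "i \<in> I" "\<not> stable 72 {a\<in>A. a mod M = i}" using stable_slices[OF A'(1) M(1,3,4)] A' by blast
  obtain m where m: "m \<in> A" "m mod M = i" using ne[OF i(2)] by blast
  interpret pi: piece_count M W i using l I i by unfold_locales auto
  have T1: "{a\<in>A. a mod M = i} \<in> pi.T1" using P[OF i(1)] pi.C1 pi.T2_stable i(2) by blast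
  show "\<exists>n\<in>A. stable 48 {a\<in>A. a mod M = n mod M} \<and> (\<forall>a\<in>A. a mod M = n mod M \<longrightarrow> a mod (M * W) = n mod (M * W))"
  proof (intro bexI[OF _ m(1)] conjI ballI impI)
    show "stable 48 {a\<in>A. a mod M = m mod M}" unfolding m(2) by (rule pi.T1_stable[OF T1])
    fix a assume "a \<in> A" "a mod M = m mod M"
    then show "a mod (M * W) = m mod (M * W)" using pi.T1_class[OF T1, of a m] m by blast
  qed
  have "\<exists>a\<in>{a\<in>A. a mod M = i}. \<exists>b\<in>{a\<in>A. a mod M = i}. a mod 3 \<noteq> b mod 3"
    using pi.single_third_T2[OF P[OF i(1)]] pi.T2_stable i(2) by blast
  then show "\<exists>n\<in>A. \<exists>a\<in>A. a mod 3 \<noteq> n mod 3" by blast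
  obtain j where j: "j \<in> I" "\<not> stable 48 {a\<in>A. a mod M = j}" using stable_slices[OF A'(1) M(1,2,4)] A' by blast
  obtain k where k: "k \<in> A" "k mod M = j" using ne[OF j(2)] by blast
  interpret pj: piece_count M W j using l I j by unfold_locales auto
  have T2: "{a\<in>A. a mod M = j} \<in> pj.T2" using P[OF j(1)] pj.C1 pj.T1_stable j(2) by blast
  show "\<exists>n\<in>A. \<forall>a\<in>A. a mod M = n mod M \<longrightarrow> a mod 3 = n mod 3"
  proof (intro bexI[OF _ k(1)] ballI impI)
    fix a assume "a \<in> A" "a mod M = k mod M"
    then show "a mod 3 = k mod 3" using pj.T2_third[OF T2, of a k] k by blast
  qed
  show "cnt A M n = 48 div (M * W)" if "n mod M \<in> I"
    using P[OF that] by (simp add: cnt_def pieces_def)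
qed

text \<open>A slice inside one class modulo M * W faces an empty class at distance e/2, so 9 would
  divide its size, which is 12 or 6.\<close>

lemma complement_not_Cyc_3e:
  assumes l: "levels M W" and I: "I \<subseteq> {..<M}" and A: "A \<in> complements M W I"
    and e: "e = 4 \<or> e = 8" "e dvd M * W" "M dvd e div 2"
  shows "3 * e \<notin> Cyc A"
proof
  assume C: "3 * e \<in> Cyc A"
  have AZ: "A \<subseteq> Z144" "A \<subseteq> {n. n mod M \<in> I}" using A by (auto simp: complements_def Z144_def)
  obtain n where n: "n \<in> A" "stable 48 {a\<in>A. a mod M = n mod M}" "\<And>a. a \<in> A \<Longrightarrow> a mod M = n mod M \<Longrightarrow> a mod (M * W) = n mod (M * W)"
    using complement_class(1)[OF l I A] by blast
  have Me: "M dvd e" using dvd_trans[OF e(3), of e] e(1) by auto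
  have s: "{a\<in>A. a mod e = n mod e} = {a\<in>A. a mod M = n mod M}"
    using mod_eq_dvd[OF n(3) e(2)] mod_eq_dvd[OF _ Me] by blast
  have "9 dvd card {a\<in>A. a mod e = n mod e}"
  proof (rule single_slice[OF AZ(1) e(1) C])
    fix a assume a: "a \<in> A"
    show "a mod e \<noteq> (n + e div 2) mod e"
    proof
      assume h: "a mod e = (n + e div 2) mod e"
      have "a mod M = n mod M" using shift_cong(1)[OF h Me e(3)] .
      then have "a mod e = n mod e" using s a by blast
      then show False using h shift_neq(2)[of "e div 2" e n] e(1) by auto
    qed
  qed (use n(2) s in simp)
  moreover have "card {a\<in>A. a mod e = n mod e} = 48 div (M * W)"
    using complement_class(4)[OF l I A, of n] n(1) AZ(2) s by (auto simp: cnt_def)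
  ultimately show False using l by (auto elim: levelsE)
qed

lemma complement_third_step:
  assumes l: "levels M W" and I: "I \<subseteq> {..<M}" and A: "A \<in> complements M W I"
    and h: "h = 1 \<or> h = 2" "M = 2 * h" and C: "6 * h \<in> Cyc A"
    and n: "n mod M \<in> I" "(n + h) mod M \<in> I" "\<And>a. a \<in> A \<Longrightarrow> a mod M = n mod M \<Longrightarrow> a mod 3 = n mod 3"
    and a: "a \<in> A" "a mod h = n mod h"
  shows "a mod 3 = n mod 3"
proof -
  have fin: "finite A" using A by (auto simp: complements_def intro: finite_subset[of _ "{..<144}"])
  have "a mod M = n mod M \<or> a mod M = (n + h) mod M" using mod_double[OF a(2)] h by auto
  then show ?thesis
  proof
    assume "a mod M = (n + h) mod M"
    then show ?thesis
      using two_slices[OF fin h(1) C, of n a] complement_class(4)[OF l I A n(1)] complement_class(4)[OF l I A n(2)] n(3) a(1) h(2)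
      by (simp add: cnt_def)
  qed (use n a in blast)
qed

text \<open>Order 6 would carry the common residue modulo 3 of one slice over to the other parity,
  and A would lie in one class modulo 3.\<close>

lemma complement_not_Cyc_6:
  assumes l: "levels 2 W" and A: "A \<in> complements 2 W {..<2}"
  shows "6 \<notin> Cyc A"
proof
  assume C: "6 \<in> Cyc A"
  obtain n where n: "n \<in> A" "\<And>a. a \<in> A \<Longrightarrow> a mod 2 = n mod 2 \<Longrightarrow> a mod 3 = n mod 3"
    using complement_class(2)[OF l _ A] by blast
  have "a mod 3 = n mod 3" if "a \<in> A" for a
  proof (rule complement_third_step[OF l _ A, of 1 n])
    show "6 * 1 \<in> Cyc A" using C by simp
  qed (use n(2) that in simp_all)
  then show False using complement_class(3)[OF l _ A] by auto
qed

lemma family_even_third: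
  assumes A: "A \<in> family 12 R_even"
  shows "12 \<notin> Cyc A" "24 \<notin> Cyc A"
proof -
  obtain I :: "nat set" where I: "I \<subseteq> {..<4}" "A \<in> complements 4 2 I" "\<And>n. n mod 4 \<in> I \<Longrightarrow> (n + 2) mod 4 \<in> I"
  proof -
    have "(n + 2) mod 4 \<in> {0, 2}" if "n mod 4 \<in> {0, 2::nat}" for n using that by simp presburger
    moreover have "(n + 2) mod 4 \<in> {1, 3}" if "n mod 4 \<in> {1, 3::nat}" for n using that by simp presburger
    ultimately show thesis using that[of "{0, 2}"] that[of "{1, 3}"] A unfolding family_even_complements by auto
  qed
  show "24 \<notin> Cyc A" using complement_not_Cyc_3e[OF lv(2) I(1,2), of 8] by simp
  show "12 \<notin> Cyc A"
  proof
    assume C: "12 \<in> Cyc A"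
    obtain n where n: "n \<in> A" "\<And>a. a \<in> A \<Longrightarrow> a mod 4 = n mod 4 \<Longrightarrow> a mod 3 = n mod 3"
      using complement_class(2)[OF lv(2) I(1,2)] by blast
    have nI: "n mod 4 \<in> I" using n(1) I(2) by (auto simp: complements_def)
    have "a mod 3 = n mod 3" if "a \<in> A" for a
    proof (rule complement_third_step[OF lv(2) I(1,2), of 2 n])
      show "a mod 2 = n mod 2" using family_R[OF A that n(1)] by (simp add: R_even_def)
      show "6 * 2 \<in> Cyc A" using C by simp
    qed (use n(2) that nI I(3)[OF nI] in simp_all)
    then show False using complement_class(3)[OF lv(2) I(1,2)] by auto
  qed
qed

text \<open>Order 12 carries a common residue modulo 3 from a class modulo 4 to its whole parity,
  and order 6 from this parity to all of A.\<close>

lemma RC42_not_Cyc_6_12: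
  assumes A: "A \<in> family 24 (RC 4 2)"
  shows "\<not> (6 \<in> Cyc A \<and> 12 \<in> Cyc A)"
proof
  assume C: "6 \<in> Cyc A \<and> 12 \<in> Cyc A"
  have A': "A \<in> complements 4 2 {..<4}" using family_complements[OF lv(2), of 24] A by simp
  note fin = family_finite[OF A]
  obtain n where n: "n \<in> A" "\<And>a. a \<in> A \<Longrightarrow> a mod 4 = n mod 4 \<Longrightarrow> a mod 3 = n mod 3"
    using complement_class(2)[OF lv(2) _ A'] by blast
  have n2: "a mod 3 = n mod 3" if "a \<in> A" "a mod 2 = n mod 2" for a
  proof (rule complement_third_step[OF lv(2) _ A', of 2 n])
    show "6 * 2 \<in> Cyc A" using C by simp
  qed (use n(2) that in simp_all)
  have c: "cnt A 2 k = 12" for k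
    using cnt_card(2)[OF fin, of k] complement_class(4)[OF lv(2) _ A', of k] complement_class(4)[OF lv(2) _ A', of "k + 2"] by simp
  have "a mod 3 = n mod 3" if a: "a \<in> A" for a
  proof -
    have "a mod 2 = n mod 2 \<or> a mod 2 = (n + 1) mod 2" using mod_double[of a 1 n] by simp
    then show ?thesis
    proof
      assume "a mod 2 = (n + 1) mod 2"
      then show ?thesis
        using two_slices[OF fin, of 1 n a] C c[of n] c[of "n + 1"] n2 a by (simp add: cnt_def)
    qed (use n2 a in blast)
  qed
  then show False using complement_class(3)[OF lv(2) _ A'] by auto
qed

text \<open>Elements of equal parity in different classes modulo 4 have different residues modulo 9,
  so x + 18 is never present modulo 36 and the relation of order 36 closes A under x + 12. Starting
  from a, these steps reach b + 18, which is excluded.\<close>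

lemma split_36_not_Cyc:
  assumes A: "A \<in> family 12 (RC 2 4) - family 12 R_split"
  shows "36 \<notin> Cyc A"
    and "\<exists>a\<in>A. \<exists>b\<in>A. a mod 2 = b mod 2 \<and> a mod 4 \<noteq> b mod 4 \<and> a mod 3 = b mod 3 \<and> a mod 9 \<noteq> b mod 9"
proof -
  have Af: "A \<in> family 12 (RC 2 4)" using A by blast
  note fin = family_finite[OF Af] and R = family_R[OF Af]
  have R': "a mod 3 = b mod 3 \<and> a mod 9 \<noteq> b mod 9" if "a \<in> A" "b \<in> A" "a mod 2 = b mod 2" "a mod 4 \<noteq> b mod 4" for a b
    using R[OF that(1,2)] that(3,4) mod_chain(2)[of a b] by (auto simp: RC_def)
  have "RC 4 2 a b" if "a \<in> A" "b \<in> A" for a b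
    using R[OF that] mod_chain(3)[of a b] by (auto simp: RC_def)
  moreover have "\<not> all_pairs R_split A" using A by (auto simp: family_def)
  ultimately obtain a b where ab: "a \<in> A" "b \<in> A" "a mod 2 = b mod 2" "a mod 4 \<noteq> b mod 4"
    unfolding all_pairs_def R_split_def by blast
  then show "\<exists>a\<in>A. \<exists>b\<in>A. a mod 2 = b mod 2 \<and> a mod 4 \<noteq> b mod 4 \<and> a mod 3 = b mod 3 \<and> a mod 9 \<noteq> b mod 9"
    using R' by blast
  show "36 \<notin> Cyc A"
  proof
    assume C: "36 \<in> Cyc A"
    let ?c = "cnt A 36"
    have z: "?c (x + 18) = 0" if x: "x \<in> A" for x
    proof -
      have "y mod 36 \<noteq> (x + 18) mod 36" if y: "y \<in> A" for y
      proof
        assume e: "y mod 36 = (x + 18) mod 36"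
        have "y mod 2 = x mod 2" "y mod 4 \<noteq> x mod 4" "y mod 9 = x mod 9"
          using shift_cong(1)[OF e, of 2] shift_cong(2)[OF e, of 4] shift_cong(1)[OF e, of 9] by simp_all
        then show False using R'[OF y x] by blast
      qed
      then show ?thesis using cnt_eq_0_iff[OF fin] by blast
    qed
    have step: "\<exists>y\<in>A. y mod 36 = (x + 12) mod 36" if x: "x \<in> A" for x
    proof -
      have "?c x \<noteq> 0" using cnt_eq_0_iff[OF fin] x by blast
      then have "?c (x + 12) \<noteq> 0" using Cyc_six[OF fin C, of x] z[OF x] by simp
      then show ?thesis by (metis cnt_posE)
    qed
    have a12: "\<exists>y\<in>A. y mod 36 = (a + 12 * k) mod 36" for k
    proof (induction k)
      case (Suc k)
      then obtain x where x: "x \<in> A" "x mod 36 = (a + 12 * k) mod 36" by blast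
      obtain y where y: "y \<in> A" "y mod 36 = (x + 12) mod 36" using step[OF x(1)] by blast
      have "(x + 12) mod 36 = (a + 12 * k + 12) mod 36" by (rule mod_add_cong[OF x(2) refl])
      then show ?case using y by (intro bexI[of _ y]) (simp_all add: algebra_simps)
    qed (use ab(1) in auto)
    have b: "(b + 18) mod 4 = a mod 4"
    proof -
      have "(b + 2) mod 4 \<noteq> b mod 4" by (rule shift_neq) simp_all
      moreover have "a mod 4 = b mod 4 \<or> a mod 4 = (b + 2) mod 4" using mod_double[OF ab(3)] by simp
      ultimately show ?thesis using ab(4) mod_add_eqI[of 18 4 2 b] by simp
    qed
    have b3: "(b + 18) mod 3 = a mod 3" using R'[OF ab] mod_add_eqI[of 18 3 0 b] by simp
    obtain k where k: "(b + 18) mod 9 = (a + 12 * k) mod 9"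
    proof -
      have all: "\<forall>x\<in>set [0..<9]. \<forall>y\<in>set [0..<9]. x mod 3 = y mod 3 \<longrightarrow> list_ex (\<lambda>k. x = (y + 12 * k) mod 9) [0,1,2::nat]"
        by code_simp
      have "list_ex (\<lambda>k. (b + 18) mod 9 = (a mod 9 + 12 * k) mod 9) [0,1,2]"
        by (rule all[rule_format]) (simp_all add: b3 mod_mod_cancel)
      then obtain k where "(b + 18) mod 9 = (a mod 9 + 12 * k) mod 9" unfolding list_ex_iff by blast
      then show thesis using that[of k] by (simp only: mod_add_left_eq)
    qed
    obtain y where y: "y \<in> A" "y mod 36 = (a + 12 * k) mod 36" using a12 by blast
    have "(a + 12 * k) mod 4 = (b + 18) mod 4" using b mod_add_eqI[of "12 * k" 4 0 a] by simp
    then have "y mod 36 = (b + 18) mod 36" using y(2) k crt36[of "a + 12 * k" "b + 18"] by simp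
    then show False using z[OF ab(2)] cnt_eq_0_iff[OF fin] y(1) by blast
  qed
qed

lemma constant_cnt_9:
  assumes "finite A" "\<And>n. cnt A 9 (n + 1) = cnt A 9 n"
  shows "9 dvd card A"
proof -
  have e: "cnt A 9 n = cnt A 9 0" for n using assms(2) by (induction n) auto
  have "card A = (\<Sum>i<9. cnt A 9 i)" using cnt_total[OF assms(1), of 9] by simp
  also have "\<dots> = (\<Sum>i<(9::nat). cnt A 9 0)" by (intro sum.cong refl) (rule e)
  finally show ?thesis by simp
qed

text \<open>6 and 18 are the divisors of 18 that divide neither 9 nor 2. In the mixed difference
  with steps 9 and 2 the terms of the missing parity vanish, and what remains says that counts
  modulo 9 are invariant under a shift by 2, hence constant.\<close>

lemma Cyc_6_18_card:
  assumes fin: "finite A" and C: "6 \<in> Cyc A" "18 \<in> Cyc A" and p: "\<And>a b. a \<in> A \<Longrightarrow> b \<in> A \<Longrightarrow> a mod 2 = b mod 2"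
  shows "9 dvd card A"
proof (rule constant_cnt_9[OF fin])
  let ?c = "cnt A 18"
  have z: "?c n = 0 \<or> ?c (n + k) = 0" if "k mod 2 = 1" for n k
  proof (rule ccontr)
    assume "\<not> ?thesis"
    then obtain a b where ab: "a \<in> A" "a mod 18 = n mod 18" "b \<in> A" "b mod 18 = (n + k) mod 18" by (metis cnt_posE)
    have "a mod 2 = n mod 2" using mod_eq_dvd[OF ab(2), of 2] by simp
    moreover have "b mod 2 \<noteq> n mod 2" using shift_cong(2)[OF ab(4), of 2] that by simp
    ultimately show False using p[OF ab(1,3)] by simp
  qed
  have s: "?c n + ?c (n + 11) = ?c (n + 9) + ?c (n + 2)" for n
  proof -
    have "dd A 18 9 2 n = 0"
    proof (rule dd_eq_0[OF fin])
      fix d :: nat assume d: "d dvd 18" "\<not> d dvd 9" "\<not> d dvd 2"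
      have "d dvd 144" by (rule dvd_trans[OF d(1)]) simp
      then have "d = 6 \<or> d = 18" using d unfolding divisors_144 by auto
      then show "d \<in> Cyc A" using C by blast
    qed simp
    then have "int (?c n + ?c (n + 11)) = int (?c (n + 9) + ?c (n + 2))" unfolding dd_def by (simp add: ac_simps)
    then show ?thesis by linarith
  qed
  have s2: "cnt A 9 (n + 2) = cnt A 9 n" for n
  proof -
    have "cnt A 9 (n + 2) = ?c (n + 2) + ?c (n + 11)" "cnt A 9 n = ?c n + ?c (n + 9)"
      using cnt_double[OF fin, of 9 "n + 2"] cnt_double[OF fin, of 9 n] by (simp_all add: ac_simps)
    moreover have "?c (n + 2) = 0 \<or> ?c (n + 9) = 0" "?c (n + 2) = 0 \<or> ?c (n + 11) = 0"
      using z[of 7 "n + 2"] z[of 9 "n + 2"] by (simp_all add: ac_simps)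
    moreover have "?c n = 0 \<or> ?c (n + 9) = 0" "?c n = 0 \<or> ?c (n + 11) = 0"
      using z[of 9 n] z[of 11 n] by simp_all
    ultimately show ?thesis using s[of n] by linarith
  qed
  have s2k: "cnt A 9 (n + 2 * k) = cnt A 9 n" for n k
  proof (induction k)
    case (Suc k)
    then show ?case using s2[of "n + 2 * k"] by (simp add: algebra_simps)
  qed simp
  show "cnt A 9 (n + 1) = cnt A 9 n" for n
  proof -
    \<comment> \<open>5 is the inverse of 2 modulo 9: five shifts by 2 amount to a shift by
      1.\<close>
    have "(n + 2 * 5) mod 9 = (n + 1) mod 9" by (rule mod_add_eqI) simp
    then have "cnt A 9 (n + 1) = cnt A 9 (n + 2 * 5)" unfolding cnt_def by presburger
    then show ?thesis using s2k[of n 5] by (rule trans)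
  qed
qed

section \<open>Assembling the values of Cyc\<close>

definition "divs = {2,3,4,6,8,9,12,16,18,24,36,48,72,144::nat}"

text \<open>S collects the orders known to be present, N those known to be absent, X those left
  open.\<close>

lemma Cyc_eq:
  assumes "S \<subseteq> Cyc A" "Cyc A \<inter> N = {}" "S \<union> N \<union> X = divs"
  shows "Cyc A = S \<union> (Cyc A \<inter> X)"
  using assms Cyc_sub[of A] unfolding divs_def[symmetric] by blast

text \<open>Every order belongs to one of the two factors, so what a partner lacks is present here.
  A single partner is enough, which is why some member of each family has to be exhibited.\<close>

lemma Cyc_cover:
  assumes t: "nonperiodic_tiling A B" and N: "Cyc B \<inter> N = {}" "N \<subseteq> divs"
  shows "N \<subseteq> Cyc A"
proof
  fix d assume d: "d \<in> N"
  then have "d dvd 144" "d > 1" using N(2) unfolding divisors_144 divs_def by auto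
  then show "d \<in> Cyc A" using Cyc_tiling[OF nonperiodic_tilingD(1)[OF t]] N d by blast
qed

lemma family_basic:
  assumes "A \<in> family k R"
  shows "A \<subseteq> Z144" "finite A" "card A = k" "\<not> stable 48 A" "\<not> stable 72 A"
  using assms family_finite[OF assms] family_not_stable[OF assms] by (auto simp: family_def)

lemma family_nonempty:
  shows "\<exists>B. B \<in> family 6 (RG 2 2)" "\<exists>B. B \<in> family 6 (RG 4 2)" "\<exists>B. B \<in> family 12 (RG 2 4)"
    "\<exists>B. B \<in> family 12 R_half" "\<exists>B. B \<in> family 12 R_even" "\<exists>B. B \<in> family 24 (RC 2 2)" "\<exists>B. B \<in> family 24 (RC 4 2)"
    "\<exists>B. B \<in> family 12 R_split"
    "\<exists>B. B \<in> family 12 R_double - family 12 (RG 2 4)" "\<exists>B. B \<in> family 12 (RC 2 4) - family 12 R_split"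
proof -
  have ne: "\<exists>B. B \<in> F" if "card F > 0" for F :: "nat set set" using that by (auto simp: card_gt_0_iff)
  have fin: "finite (family k R)" for k R
    by (rule finite_subset[of _ "Pow Z144"]) (auto simp: family_def)
  show "\<exists>B. B \<in> family 6 (RG 2 2)" by (rule ne) (use card_family_RG[OF lv(1)] in simp)
  show "\<exists>B. B \<in> family 6 (RG 4 2)" by (rule ne) (use card_family_RG[OF lv(2)] in simp)
  show "\<exists>B. B \<in> family 12 (RG 2 4)" by (rule ne) (use card_family_RG[OF lv(3)] in simp)
  show "\<exists>B. B \<in> family 12 R_half" by (rule ne) (simp add: card_family_half)
  show "\<exists>B. B \<in> family 12 R_even" by (rule ne) (simp add: card_family_even)
  show "\<exists>B. B \<in> family 24 (RC 2 2)" by (rule ne) (simp add: card_family_RC)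
  show "\<exists>B. B \<in> family 24 (RC 4 2)" by (rule ne) (simp add: card_family_RC)
  show "\<exists>B. B \<in> family 12 R_split" by (rule ne) (simp add: card_family_split)
  show "\<exists>B. B \<in> family 12 R_double - family 12 (RG 2 4)"
    by (rule ne) (use card_Diff_subset[OF fin RG24_double] card_family_RG[OF lv(3)] card_family_double in simp)
  show "\<exists>B. B \<in> family 12 (RC 2 4) - family 12 R_split"
    by (rule ne) (use card_Diff_subset[OF fin split_RC24] card_family_RC card_family_split in simp)
qed

lemma RC22_Cyc_sup: "A \<in> family 24 (RC 2 2) \<Longrightarrow> {2,8,9,16,18,72,144} \<subseteq> Cyc A"
proof -
  assume A: "A \<in> family 24 (RC 2 2)"
  obtain B where B: "B \<in> family 6 (RG 2 2)" using family_nonempty(1) by blast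
  show ?thesis by (rule Cyc_cover[OF tiling_22[OF A B] RG22_not_Cyc[OF B]]) (simp add: divs_def)
qed

lemma RC42_Cyc_sup: "A \<in> family 24 (RC 4 2) \<Longrightarrow> {2,4,9,16,18,36,144} \<subseteq> Cyc A"
proof -
  assume A: "A \<in> family 24 (RC 4 2)"
  obtain B where B: "B \<in> family 6 (RG 4 2)" using family_nonempty(2) by blast
  show ?thesis by (rule Cyc_cover[OF tiling_42[OF A B] RG42_not_Cyc[OF B]]) (simp add: divs_def)
qed

lemma RC24_Cyc_sup: "A \<in> family 12 (RC 2 4) \<Longrightarrow> {2,9,16,18,144} \<subseteq> Cyc A"
proof -
  assume A: "A \<in> family 12 (RC 2 4)"
  obtain B where B: "B \<in> family 12 (RG 2 4)" using family_nonempty(3) by blast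
  show ?thesis by (rule Cyc_cover[OF tiling_24[OF A B] double_not_Cyc[OF subsetD[OF RG24_double B]]]) (simp add: divs_def)
qed

lemma split_Cyc_sup: "A \<in> family 12 R_split \<Longrightarrow> 36 \<in> Cyc A"
proof -
  assume A: "A \<in> family 12 R_split"
  obtain B where B: "B \<in> family 12 R_double - family 12 (RG 2 4)" using family_nonempty(9) by blast
  have "{36} \<subseteq> Cyc A"
    by (rule Cyc_cover[OF tiling_split_double[OF A]]) (use B double_36_not_Cyc(1)[OF B] in \<open>auto simp: divs_def\<close>)
  then show ?thesis by simp
qed

lemma even_Cyc_sup: "A \<in> family 12 R_even \<Longrightarrow> {4,9,16,36,144} \<subseteq> Cyc A"
proof -
  assume A: "A \<in> family 12 R_even"
  obtain B where B: "B \<in> family 12 R_half" using family_nonempty(4) by blast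
  show ?thesis by (rule Cyc_cover[OF tiling_even_half[OF A B] half_not_Cyc[OF B]]) (simp add: divs_def)
qed

lemma RC22_not_Cyc:
  assumes A: "A \<in> family 24 (RC 2 2)"
  shows "Cyc A \<inter> {3,4,6,12,36,48} = {}"
proof -
  note b = family_basic[OF A] and S = RC22_Cyc_sup[OF A]
  have c: "A \<in> complements 2 2 {..<2}" using family_complements[OF lv(1), of 24] A by simp
  have R: "RC 2 2 x y" if "x \<in> A" "y \<in> A" for x y using family_R[OF A that] .
  have "3 \<notin> Cyc A" using Cyc_3_9_card[OF b(2)] S b(3) by auto
  moreover have "4 \<notin> Cyc A" using Cyc_powers_2(4)[OF b(2)] S b(3) by auto
  moreover have "6 \<notin> Cyc A" using complement_not_Cyc_6[OF lv(1) c] .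
  moreover have "12 \<notin> Cyc A" using complement_not_Cyc_3e[OF lv(1) _ c, of 4] by simp
  moreover have "48 \<notin> Cyc A"
  proof (rule RC_not_Cyc_48[OF b(1) _ b(5)])
    show "x mod 3 = y mod 3" if "x \<in> A" "y \<in> A" "x mod 16 = y mod 16" for x y
      using R[OF that(1,2)] that(3) mod_eq_dvd[OF that(3), of 2] by (simp add: RC_def)
  qed (use S in simp)
  moreover have "36 \<notin> Cyc A"
  proof (rule RC_not_Cyc_36_72(2)[OF b(1) _ b(4)])
    show "x mod 4 = y mod 4" if "x \<in> A" "y \<in> A" "x mod 2 = y mod 2" "x mod 9 = y mod 9" for x y
      using R[OF that(1,2)] that(3,4) by (auto simp: RC_def)
  qed (use S in simp_all)
  ultimately show ?thesis by blast
qed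

lemma RC42_not_Cyc:
  assumes A: "A \<in> family 24 (RC 4 2)"
  shows "Cyc A \<inter> {3,8,24,48,72} = {}"
proof -
  note b = family_basic[OF A] and S = RC42_Cyc_sup[OF A]
  have c: "A \<in> complements 4 2 {..<4}" using family_complements[OF lv(2), of 24] A by simp
  have R: "RC 4 2 x y" if "x \<in> A" "y \<in> A" for x y using family_R[OF A that] .
  have "3 \<notin> Cyc A" using Cyc_3_9_card[OF b(2)] S b(3) by auto
  moreover have "8 \<notin> Cyc A" using Cyc_powers_2(4)[OF b(2)] S b(3) by auto
  moreover have "24 \<notin> Cyc A" using complement_not_Cyc_3e[OF lv(2) _ c, of 8] by simp
  moreover have "48 \<notin> Cyc A"
  proof (rule RC_not_Cyc_48[OF b(1) _ b(5)])
    show "x mod 3 = y mod 3" if "x \<in> A" "y \<in> A" "x mod 16 = y mod 16" for x y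
      using R[OF that(1,2)] that(3) mod_eq_dvd[OF that(3), of 4] by (simp add: RC_def)
  qed (use S in simp)
  moreover have "72 \<notin> Cyc A"
  proof (rule RC_not_Cyc_36_72(1)[OF b(1) _ b(4)])
    show "x mod 8 = y mod 8" if "x \<in> A" "y \<in> A" "x mod 4 = y mod 4" "x mod 9 = y mod 9" for x y
      using R[OF that(1,2)] that(3,4) by (auto simp: RC_def)
  qed (use S in simp_all)
  ultimately show ?thesis by blast
qed

lemma even_not_Cyc:
  assumes A: "A \<in> family 12 R_even" and C: "18 \<in> Cyc A"
  shows "Cyc A \<inter> {2,3,6,8,12,24,48,72} = {}"
proof -
  note b = family_basic[OF A] and S = even_Cyc_sup[OF A]
  have R: "RC 4 2 x y" and P: "x mod 2 = y mod 2" if "x \<in> A" "y \<in> A" for x y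
    using family_R[OF A that] by (simp_all add: R_even_def)
  obtain q where q: "q \<in> A" using family_ex[OF A] by auto
  have "2 \<notin> Cyc A" using not_Cyc_grid(1)[OF b(2) q] P[OF _ q] by blast
  moreover have "3 \<notin> Cyc A" using Cyc_3_9_card[OF b(2)] S b(3) by auto
  moreover have "8 \<notin> Cyc A" using Cyc_powers_2(3)[OF b(2)] S b(3) by auto
  moreover have "6 \<notin> Cyc A"
  proof
    assume "6 \<in> Cyc A"
    from Cyc_6_18_card[OF b(2) this C P] show False using b(3) by simp
  qed
  moreover have "48 \<notin> Cyc A"
  proof (rule RC_not_Cyc_48[OF b(1) _ b(5)])
    show "x mod 3 = y mod 3" if "x \<in> A" "y \<in> A" "x mod 16 = y mod 16" for x y
      using R[OF that(1,2)] that(3) mod_eq_dvd[OF that(3), of 4] by (simp add: RC_def)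
  qed (use S in simp)
  moreover have "72 \<notin> Cyc A"
  proof (rule RC_not_Cyc_36_72(1)[OF b(1) _ b(4)])
    show "x mod 8 = y mod 8" if "x \<in> A" "y \<in> A" "x mod 4 = y mod 4" "x mod 9 = y mod 9" for x y
      using R[OF that(1,2)] that(3,4) by (auto simp: RC_def)
  qed (use S in simp_all)
  ultimately show ?thesis using family_even_third[OF A] by blast
qed

lemma RC24_not_Cyc:
  assumes A: "A \<in> family 12 (RC 2 4)"
  shows "Cyc A \<inter> {3,4,6,8,12,24,48,72} = {}"
proof -
  note b = family_basic[OF A] and S = RC24_Cyc_sup[OF A]
  have c: "A \<in> complements 2 4 {..<2}" using family_complements[OF lv(3), of 12] A by simp
  have R: "RC 2 4 x y" if "x \<in> A" "y \<in> A" for x y using family_R[OF A that] .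
  have "3 \<notin> Cyc A" using Cyc_3_9_card[OF b(2)] S b(3) by auto
  moreover have "4 \<notin> Cyc A" using Cyc_powers_2(1)[OF b(2)] S b(3) by auto
  moreover have "8 \<notin> Cyc A" using Cyc_powers_2(2)[OF b(2)] S b(3) by auto
  moreover have "6 \<notin> Cyc A" using complement_not_Cyc_6[OF lv(3) c] .
  moreover have "12 \<notin> Cyc A" "24 \<notin> Cyc A"
    using complement_not_Cyc_3e[OF lv(3) _ c, of 4] complement_not_Cyc_3e[OF lv(3) _ c, of 8] by simp_all
  moreover have "48 \<notin> Cyc A"
  proof (rule RC_not_Cyc_48[OF b(1) _ b(5)])
    show "x mod 3 = y mod 3" if "x \<in> A" "y \<in> A" "x mod 16 = y mod 16" for x y
      using R[OF that(1,2)] that(3) mod_eq_dvd[OF that(3), of 2] by (simp add: RC_def)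
  qed (use S in simp)
  moreover have "72 \<notin> Cyc A"
  proof (rule RC_not_Cyc_36_72(1)[OF b(1) _ b(4)])
    show "x mod 8 = y mod 8" if "x \<in> A" "y \<in> A" "x mod 4 = y mod 4" "x mod 9 = y mod 9" for x y
      using R[OF that(1,2)] that(3,4) mod_chain(3)[OF that(3)] by (auto simp: RC_def)
  qed (use S in simp_all)
  ultimately show ?thesis by blast
qed

section \<open>The classification\<close>

text \<open>An executable certificate of membership in a family: non-periodicity is witnessed by one
  element whose shift by 48 leaves the set and one whose shift by 72 does.\<close>

definition sample :: "nat \<Rightarrow> (nat \<Rightarrow> nat \<Rightarrow> bool) \<Rightarrow> nat list \<Rightarrow> bool" where
  "sample k R xs \<longleftrightarrow> distinct xs \<and> length xs = k \<and> list_all (\<lambda>a. a < 144 \<and> list_all (R a) xs) xs \<and>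
     list_ex (\<lambda>a. (a + 48) mod 144 \<notin> set xs) xs \<and> list_ex (\<lambda>a. (a + 72) mod 144 \<notin> set xs) xs"

lemma sample_family:
  assumes "sample k R xs"
  shows "set xs \<in> family k R"
proof -
  have sub: "set xs \<subseteq> Z144" using assms by (auto simp: sample_def list_all_iff Z144_def)
  have "\<not> stable g (set xs)" if g: "list_ex (\<lambda>a. (a + g) mod 144 \<notin> set xs) xs" for g
  proof
    assume "stable g (set xs)"
    moreover obtain a where "a \<in> set xs" "(a + g) mod 144 \<notin> set xs" using g unfolding list_ex_iff by blast
    moreover have "a mod 144 = a" using sub \<open>a \<in> set xs\<close> less_144 by simp
    ultimately show False unfolding stable_def mem_def by metis
  qed
  then have "\<not> periodic (set xs)" using assms periodic_iff[OF sub] unfolding sample_def by blast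
  moreover have "card (set xs) = k" "all_pairs R (set xs)"
    using assms by (auto simp: sample_def distinct_card list_all_iff all_pairs_def)
  ultimately show ?thesis using sub unfolding family_def by blast
qed

definition residue_count :: "nat list \<Rightarrow> nat \<Rightarrow> nat \<Rightarrow> nat" where
  "residue_count xs d n = length (filter (\<lambda>a. a mod d = n mod d) xs)"

definition Cyc_test :: "nat \<Rightarrow> nat list \<Rightarrow> bool" where
  "Cyc_test d xs \<longleftrightarrow> list_all (\<lambda>n. residue_count xs d n + residue_count xs d (n + d div 2 + d div 3) =
     residue_count xs d (n + d div 2) + residue_count xs d (n + d div 3)) [0..<d]"

text \<open>For orders divisible by 6 the relation is necessary by \<open>Cyc_six\<close> and
  sufficient by \<open>dd_Cyc\<close>, so these orders can be decided by evaluating residue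
  counts.\<close>

lemma Cyc_set_iff:
  assumes xs: "distinct xs" and d: "d dvd 144" "6 dvd d"
  shows "d \<in> Cyc (set xs) \<longleftrightarrow> Cyc_test d xs"
proof -
  have c: "cnt (set xs) d n = residue_count xs d n" for n
    using distinct_card[OF distinct_filter[OF xs]] by (simp add: cnt_def residue_count_def)
  have d0: "d > 1" "\<not> d dvd d div 2" "\<not> d dvd d div 3" using d unfolding divisors_144 by auto
  show ?thesis
  proof
    assume "d \<in> Cyc (set xs)"
    then show "Cyc_test d xs"
      using Cyc_six[OF _ _ d(2), of "set xs"] unfolding Cyc_test_def c[symmetric] list_all_iff by blast
  next
    assume t: "Cyc_test d xs"
    show "d \<in> Cyc (set xs)"
    proof (rule dd_Cyc[OF _ d(1) d0])
      fix n assume "n < d"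
      then have "residue_count xs d n + residue_count xs d (n + d div 2 + d div 3) =
          residue_count xs d (n + d div 2) + residue_count xs d (n + d div 3)"
        using t unfolding Cyc_test_def list_all_iff by simp
      then show "dd (set xs) d (d div 2) (d div 3) n = 0" unfolding dd_def c by linarith
    qed simp
  qed
qed

lemmas sample_simps = sample_def RG_def RC_def R_half_def R_double_def R_even_def R_split_def Cyc_test_def residue_count_def upt_conv_Cons

text \<open>The second set is there for the value of Cyc containing 24, which the first set
  lacks.\<close>

lemma samples_22:
  "set [0,17,20,23,28,29,40,48,53,59,65,68,76,88,89,95,96,101,116,124,125,131,136,137] \<in> family 24 (RC 2 2)"
  "set [3,24,27,32,33,36,39,44,63,69,72,75,80,84,92,99,105,111,120,128,132,135,140,141] \<in> family 24 (RC 2 2)"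
  "set [0,32,58,90,112,122] \<in> family 6 (RG 2 2)"
  by (rule sample_family, simp add: sample_simps)+

text \<open>The third set is there for the value of Cyc containing 18, which the second set
  lacks.\<close>

lemma samples_even_half:
  "set [0,34,40,46,48,58,88,96,106,118,130,136] \<in> family 12 R_even"
  "set [0,16,29,44,57,73,80,93,108,109,124,137] \<in> family 12 R_half"
  "set [10,27,54,59,63,86,90,91,95,118,122,127] \<in> family 12 R_half"
  by (rule sample_family, simp add: sample_simps)+

text \<open>The second and third sets realize the values of Cyc containing 12 and 6; the first has
  neither.\<close>

lemma samples_42:
  "set [0,9,17,26,27,34,39,40,48,51,57,65,74,82,88,96,99,105,111,113,122,123,130,136] \<in> family 24 (RC 4 2)"
  "set [2,8,15,21,23,29,32,50,56,62,63,69,71,74,77,80,104,111,117,119,122,125,128,134] \<in> family 24 (RC 4 2)"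
  "set [0,7,12,15,24,25,33,46,55,58,63,70,72,73,81,84,96,103,111,118,121,129,130,142] \<in> family 24 (RC 4 2)"
  "set [0,36,64,80,100,116] \<in> family 6 (RG 4 2)"
  by (rule sample_family, simp add: sample_simps)+

lemma samples_24:
  "set [0,18,28,44,54,64,80,82,98,108,118,134] \<in> family 12 (RG 2 4)"
  "set [0,16,30,44,58,74,80,94,108,110,124,138] \<in> family 12 R_double"
  "set [0,33,40,45,48,57,88,96,105,117,129,136] \<in> family 12 R_split"
  "set [0,27,30,35,60,72,75,83,102,123,131,132] \<in> family 12 (RC 2 4)"
  by (rule sample_family, simp add: sample_simps)+

lemma samples_Cyc:
  "24 \<notin> Cyc (set [0,17,20,23,28,29,40,48,53,59,65,68,76,88,89,95,96,101,116,124,125,131,136,137])"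
  "24 \<in> Cyc (set [3,24,27,32,33,36,39,44,63,69,72,75,80,84,92,99,105,111,120,128,132,135,140,141])"
  "18 \<notin> Cyc (set [0,16,29,44,57,73,80,93,108,109,124,137])"
  "18 \<in> Cyc (set [10,27,54,59,63,86,90,91,95,118,122,127])"
  "6 \<notin> Cyc (set [0,9,17,26,27,34,39,40,48,51,57,65,74,82,88,96,99,105,111,113,122,123,130,136])"
  "12 \<notin> Cyc (set [0,9,17,26,27,34,39,40,48,51,57,65,74,82,88,96,99,105,111,113,122,123,130,136])"
  "12 \<in> Cyc (set [2,8,15,21,23,29,32,50,56,62,63,69,71,74,77,80,104,111,117,119,122,125,128,134])"
  "6 \<in> Cyc (set [0,7,12,15,24,25,33,46,55,58,63,70,72,73,81,84,96,103,111,118,121,129,130,142])"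
  by (subst Cyc_set_iff; simp add: sample_simps)+

lemma not_familyI: "a \<in> A \<Longrightarrow> b \<in> A \<Longrightarrow> \<not> R a b \<Longrightarrow> A \<notin> family k R"
  unfolding family_def all_pairs_def by blast

lemma samples_diff:
  "set [0,16,30,44,58,74,80,94,108,110,124,138] \<in> family 12 R_double - family 12 (RG 2 4)"
  "set [0,27,30,35,60,72,75,83,102,123,131,132] \<in> family 12 (RC 2 4) - family 12 R_split"
  using samples_24(2,4) not_familyI[of 0 _ 30 "RG 2 4" 12] not_familyI[of 0 _ 30 R_split 12]
  by (simp_all add: RG_def R_split_def RC_def)

lemma Cyc_RC22:
  assumes A: "A \<in> family 24 (RC 2 2)"
  shows "Cyc A = {2,8,9,16,18,72,144} \<union> (Cyc A \<inter> {24})"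
  by (rule Cyc_eq[OF RC22_Cyc_sup[OF A] RC22_not_Cyc[OF A]]) (auto simp: divs_def)

lemma Cyc_RG22:
  assumes B: "B \<in> family 6 (RG 2 2)"
  shows "Cyc B = {3,4,6,12,24,36,48}"
proof -
  note t = nonperiodic_tiling_commute[THEN iffD1, OF tiling_22[OF _ B]]
  have "{3,4,6,12,36,48} \<subseteq> Cyc B"
    by (rule Cyc_cover[OF t[OF samples_22(1)] RC22_not_Cyc[OF samples_22(1)]]) (simp add: divs_def)
  \<comment> \<open>Order 24 varies within the partner family, so the cover has to use the sample
    that lacks it.\<close>
  moreover have "{24} \<subseteq> Cyc B"
    by (rule Cyc_cover[OF t[OF samples_22(1)]]) (use samples_Cyc(1) in \<open>simp_all add: divs_def\<close>)
  ultimately have "{3,4,6,12,24,36,48} \<subseteq> Cyc B" by blast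
  from Cyc_eq[OF this RG22_not_Cyc[OF B], of "{}"] show ?thesis by (auto simp: divs_def)
qed

lemma Cyc_RC42:
  assumes A: "A \<in> family 24 (RC 4 2)"
  shows "Cyc A = {2,4,9,16,18,36,144} \<union> (Cyc A \<inter> {6,12})"
  by (rule Cyc_eq[OF RC42_Cyc_sup[OF A] RC42_not_Cyc[OF A]]) (auto simp: divs_def)

lemma Cyc_RG42:
  assumes B: "B \<in> family 6 (RG 4 2)"
  shows "Cyc B = {3,6,8,12,24,48,72}"
proof -
  note t = nonperiodic_tiling_commute[THEN iffD1, OF tiling_42[OF _ B]]
  have "{3,8,24,48,72} \<subseteq> Cyc B"
    by (rule Cyc_cover[OF t[OF samples_42(1)] RC42_not_Cyc[OF samples_42(1)]]) (simp add: divs_def)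
  moreover have "{6,12} \<subseteq> Cyc B"
    by (rule Cyc_cover[OF t[OF samples_42(1)]]) (use samples_Cyc(5,6) in \<open>simp_all add: divs_def\<close>)
  ultimately have "{3,6,8,12,24,48,72} \<subseteq> Cyc B" by blast
  from Cyc_eq[OF this RG42_not_Cyc[OF B], of "{}"] show ?thesis by (auto simp: divs_def)
qed

lemma Cyc_R_even:
  assumes A: "A \<in> family 12 R_even"
  shows "Cyc A = {4,9,16,18,36,144}" "Cyc A \<inter> {2,3,6,8,12,24,48,72} = {}"
proof -
  \<comment> \<open>The partner chosen here is the sample without order 18, so that order must be
    present in A.\<close>
  have "{18} \<subseteq> Cyc A"
    by (rule Cyc_cover[OF tiling_even_half[OF A samples_even_half(2)]]) (use samples_Cyc(3) in \<open>simp_all add: divs_def\<close>)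
  then have s: "{4,9,16,18,36,144} \<subseteq> Cyc A" and 18: "18 \<in> Cyc A" using even_Cyc_sup[OF A] by auto
  show n: "Cyc A \<inter> {2,3,6,8,12,24,48,72} = {}" by (rule even_not_Cyc[OF A 18])
  from Cyc_eq[OF s n, of "{}"] show "Cyc A = {4,9,16,18,36,144}" by (auto simp: divs_def)
qed

lemma Cyc_R_half:
  assumes B: "B \<in> family 12 R_half"
  shows "Cyc B = {2,3,6,8,12,24,48,72} \<union> (Cyc B \<inter> {18})"
proof (rule Cyc_eq[OF _ half_not_Cyc[OF B]])
  show "{2,3,6,8,12,24,48,72} \<subseteq> Cyc B"
    by (rule Cyc_cover[OF nonperiodic_tiling_commute[THEN iffD1, OF tiling_even_half[OF samples_even_half(1) B]] Cyc_R_even(2)[OF samples_even_half(1)]])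
      (simp add: divs_def)
qed (auto simp: divs_def)

lemma Cyc_R_split:
  assumes A: "A \<in> family 12 R_split"
  shows "Cyc A = {2,9,16,18,36,144}"
proof -
  have A': "A \<in> family 12 (RC 2 4)" using A split_RC24 by blast
  have "{2,9,16,18,36,144} \<subseteq> Cyc A" using RC24_Cyc_sup[OF A'] split_Cyc_sup[OF A] by blast
  from Cyc_eq[OF this RC24_not_Cyc[OF A'], of "{}"] show ?thesis by (auto simp: divs_def)
qed

lemma Cyc_RC24_diff:
  assumes A: "A \<in> family 12 (RC 2 4) - family 12 R_split"
  shows "Cyc A = {2,9,16,18,144}"
proof -
  have A': "A \<in> family 12 (RC 2 4)" using A by blast
  have n: "Cyc A \<inter> {3,4,6,8,12,24,36,48,72} = {}" using RC24_not_Cyc[OF A'] split_36_not_Cyc(1)[OF A] by blast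
  from Cyc_eq[OF RC24_Cyc_sup[OF A'] n, of "{}"] show ?thesis by (auto simp: divs_def)
qed

lemma Cyc_RG24:
  assumes B: "B \<in> family 12 (RG 2 4)"
  shows "Cyc B = {3,4,6,8,12,24,36,48,72}"
proof -
  have S: "set [0,27,30,35,60,72,75,83,102,123,131,132] \<in> family 12 (RC 2 4)" using samples_diff(2) by blast
  have "{3,4,6,8,12,24,36,48,72} \<subseteq> Cyc B"
    by (rule Cyc_cover[OF nonperiodic_tiling_commute[THEN iffD1, OF tiling_24[OF S B]]])
      (use Cyc_RC24_diff[OF samples_diff(2)] in \<open>simp_all add: divs_def\<close>)
  from Cyc_eq[OF this double_not_Cyc[OF subsetD[OF RG24_double B]], of "{}"] show ?thesis by (auto simp: divs_def)
qed

lemma Cyc_double_diff: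
  assumes B: "B \<in> family 12 R_double - family 12 (RG 2 4)"
  shows "Cyc B = {3,4,6,8,12,24,48,72}"
proof -
  have B': "B \<in> family 12 R_double" using B by blast
  have s: "{3,4,6,8,12,24,48,72} \<subseteq> Cyc B"
    by (rule Cyc_cover[OF nonperiodic_tiling_commute[THEN iffD1, OF tiling_split_double[OF samples_24(3) B']]])
      (use Cyc_R_split[OF samples_24(3)] in \<open>simp_all add: divs_def\<close>)
  have n: "Cyc B \<inter> {2,9,16,18,36,144} = {}" using double_not_Cyc[OF B'] double_36_not_Cyc(1)[OF B] by blast
  from Cyc_eq[OF s n, of "{}"] show ?thesis by (auto simp: divs_def)
qed

section \<open>Collections of translation classes\<close>

definition classwise :: "nat set set \<Rightarrow> bool" where
  "classwise F \<longleftrightarrow> F \<subseteq> {A. A \<subseteq> Z144 \<and> \<not> periodic A} \<and> (\<forall>A\<in>F. tclass A \<subseteq> F)"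

lemma classwiseD: "classwise F \<Longrightarrow> A \<in> F \<Longrightarrow> tclass A \<subseteq> F"
  by (simp add: classwise_def)

lemma classwise_family: "tinv R \<Longrightarrow> classwise (family k R)"
  using family_tclass unfolding classwise_def by (auto simp: family_def)

lemma classwise_Diff:
  assumes F: "classwise F" and G: "classwise G"
  shows "classwise (F - G)"
proof -
  have "tclass A \<subseteq> F - G" if A: "A \<in> F - G" for A
  proof
    fix B assume B: "B \<in> tclass A"
    have AZ: "A \<subseteq> Z144" using A F by (auto simp: classwise_def)
    have "B \<notin> G" using A G tclass_self[OF AZ] tclass_eq[OF AZ B] unfolding classwise_def by blast
    then show "B \<in> F - G" using A B F unfolding classwise_def by blast
  qed
  then show ?thesis using F unfolding classwise_def by blast
qed

lemma tclass_image_iff: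
  assumes F: "classwise F" and A: "A \<subseteq> Z144"
  shows "tclass A \<in> tclass ` F \<longleftrightarrow> A \<in> F"
proof
  assume "tclass A \<in> tclass ` F"
  then obtain B where B: "B \<in> F" "tclass A = tclass B" by blast
  then show "A \<in> F" using tclass_self[OF A] F unfolding classwise_def by blast
qed blast

lemma collection_classes:
  assumes F: "classwise F" and c: "card F = 144 * n"
    and K: "\<And>A. A \<in> F \<Longrightarrow> card A = m \<and> Cyc A \<in> K" "\<And>D. D \<in> K \<Longrightarrow> \<exists>A\<in>F. Cyc A = D"
  shows "collection (tclass ` F) n m K"
proof -
  have F': "A \<subseteq> Z144 \<and> \<not> periodic A" "tclass A \<subseteq> F" if "A \<in> F" for A using F that unfolding classwise_def by blast+
  have "\<exists>C\<in>tclass ` F. \<exists>A\<in>C. Cyc A = D" if DK: "D \<in> K" for D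
  proof -
    obtain A where "A \<in> F" "Cyc A = D" using K(2)[OF DK] by blast
    then show ?thesis using tclass_self[of A] F'(1) by blast
  qed
  moreover have "tclass ` F \<subseteq> tclass ` {A. A \<subseteq> Z144 \<and> \<not> periodic A}" using F'(1) by blast
  moreover have "card (tclass ` F) = n" "finite (tclass ` F)" using card_classes_144[OF F'] c by simp_all
  moreover have "\<forall>C\<in>tclass ` F. \<forall>A\<in>C. card A = m \<and> Cyc A \<in> K" using K(1) F'(2) by blast
  ultimately show ?thesis unfolding collection_def by blast
qed

lemma family_card: "A \<in> family k R \<Longrightarrow> card A = k"
  by (simp add: family_def)

lemma card_family_Diff: "G \<subseteq> family k R \<Longrightarrow> card (family k R - G) = card (family k R) - card G"
  by (rule card_Diff_subset) (auto intro!: finite_subset[of _ "Pow Z144"] simp: family_def)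

lemmas classwise_families = classwise_family[OF tinv_RG[OF lv(1)]] classwise_family[OF tinv_RG[OF lv(2)]]
  classwise_family[OF tinv_RG[OF lv(3)]] classwise_family[OF tinv_RC[OF lv(1)]] classwise_family[OF tinv_RC[OF lv(2)]]
  classwise_family[OF tinv_RC[OF lv(3)]] tinv_rels[THEN classwise_family]

lemma collection_22:
  "collection (tclass ` family 24 (RC 2 2)) 36 24 {{2,8,9,16,18,24,72,144}, {2,8,9,16,18,72,144}}"
  "collection (tclass ` family 6 (RG 2 2)) 6 6 {{3,4,6,12,24,36,48}}"
proof -
  note F = samples_22
  have C: "Cyc A = (if 24 \<in> Cyc A then {2,8,9,16,18,24,72,144} else {2,8,9,16,18,72,144})" if "A \<in> family 24 (RC 2 2)" for A
    using Cyc_RC22[OF that] by auto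
  show "collection (tclass ` family 24 (RC 2 2)) 36 24 {{2,8,9,16,18,24,72,144}, {2,8,9,16,18,72,144}}"
  proof (rule collection_classes)
    show "card A = 24 \<and> Cyc A \<in> {{2,8,9,16,18,24,72,144}, {2,8,9,16,18,72,144}}" if "A \<in> family 24 (RC 2 2)" for A
      using family_card[OF that] C[OF that] by (metis insertCI)
    fix D :: "nat set" assume "D \<in> {{2,8,9,16,18,24,72,144}, {2,8,9,16,18,72,144}}"
    then show "\<exists>A\<in>family 24 (RC 2 2). Cyc A = D"
      using C[OF F(1)] C[OF F(2)] samples_Cyc(1,2) F(1,2) by (metis insertE singletonD)
  qed (use classwise_families card_family_RC in simp_all)
  show "collection (tclass ` family 6 (RG 2 2)) 6 6 {{3,4,6,12,24,36,48}}"
    by (rule collection_classes)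
      (use classwise_families card_family_RG[OF lv(1)] family_card Cyc_RG22 F(3) in auto)
qed

lemma collection_even_half:
  "collection (tclass ` family 12 R_even) 6 12 {{4,9,16,18,36,144}}"
  "collection (tclass ` family 12 R_half) 324 12 {{2,3,6,8,12,18,24,48,72}, {2,3,6,8,12,24,48,72}}"
proof -
  note F = samples_even_half
  have C: "Cyc A = (if 18 \<in> Cyc A then {2,3,6,8,12,18,24,48,72} else {2,3,6,8,12,24,48,72})" if "A \<in> family 12 R_half" for A
    using Cyc_R_half[OF that] by auto
  show "collection (tclass ` family 12 R_half) 324 12 {{2,3,6,8,12,18,24,48,72}, {2,3,6,8,12,24,48,72}}"
  proof (rule collection_classes)
    show "card A = 12 \<and> Cyc A \<in> {{2,3,6,8,12,18,24,48,72}, {2,3,6,8,12,24,48,72}}" if "A \<in> family 12 R_half" for A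
      using family_card[OF that] C[OF that] by (metis insertCI)
    fix D :: "nat set" assume "D \<in> {{2,3,6,8,12,18,24,48,72}, {2,3,6,8,12,24,48,72}}"
    then show "\<exists>A\<in>family 12 R_half. Cyc A = D"
      using C[OF F(2)] C[OF F(3)] samples_Cyc(3,4) F(2,3) by (metis insertE singletonD)
  qed (use classwise_families card_family_half in simp_all)
  show "collection (tclass ` family 12 R_even) 6 12 {{4,9,16,18,36,144}}"
    by (rule collection_classes)
      (use classwise_families card_family_even family_card Cyc_R_even(1) F(1) in auto)
qed

lemma collection_42:
  "collection (tclass ` family 24 (RC 4 2)) 8640 24 {{2,4,9,12,16,18,36,144}, {2,4,6,9,16,18,36,144}, {2,4,9,16,18,36,144}}"
  "collection (tclass ` family 6 (RG 4 2)) 3 6 {{3,6,8,12,24,48,72}}"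
proof -
  note F = samples_42
  have C: "Cyc A = (if 12 \<in> Cyc A then {2,4,9,12,16,18,36,144} else if 6 \<in> Cyc A then {2,4,6,9,16,18,36,144} else {2,4,9,16,18,36,144})"
    if "A \<in> family 24 (RC 4 2)" for A
    using Cyc_RC42[OF that] RC42_not_Cyc_6_12[OF that] by auto
  show "collection (tclass ` family 24 (RC 4 2)) 8640 24 {{2,4,9,12,16,18,36,144}, {2,4,6,9,16,18,36,144}, {2,4,9,16,18,36,144}}"
  proof (rule collection_classes)
    show "card A = 24 \<and> Cyc A \<in> {{2,4,9,12,16,18,36,144}, {2,4,6,9,16,18,36,144}, {2,4,9,16,18,36,144}}"
      if "A \<in> family 24 (RC 4 2)" for A
      using family_card[OF that] C[OF that] by (metis insertCI)
    fix D :: "nat set" assume D: "D \<in> {{2,4,9,12,16,18,36,144}, {2,4,6,9,16,18,36,144}, {2,4,9,16,18,36,144}}"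
    show "\<exists>A\<in>family 24 (RC 4 2). Cyc A = D"
      using D
    proof (elim insertE emptyE)
      assume "D = {2,4,9,12,16,18,36,144}"
      then show ?thesis using C[OF F(2)] samples_Cyc(7) F(2) by metis
    next
      assume "D = {2,4,6,9,16,18,36,144}"
      then show ?thesis using C[OF F(3)] samples_Cyc(8) RC42_not_Cyc_6_12[OF F(3)] F(3) by metis
    next
      assume "D = {2,4,9,16,18,36,144}"
      then show ?thesis using C[OF F(1)] samples_Cyc(5,6) F(1) by metis
    qed
  qed (use classwise_families card_family_RC in simp_all)
  show "collection (tclass ` family 6 (RG 4 2)) 3 6 {{3,6,8,12,24,48,72}}"
    by (rule collection_classes)
      (use classwise_families card_family_RG[OF lv(2)] family_card Cyc_RG42 F(4) in auto)
qed

lemma collection_24: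
  "collection (tclass ` family 12 (RG 2 4)) 6 12 {{3,4,6,8,12,24,36,48,72}}"
  "collection (tclass ` (family 12 R_double - family 12 (RG 2 4))) 156 12 {{3,4,6,8,12,24,48,72}}"
  "collection (tclass ` family 12 R_split) 12 12 {{2,9,16,18,36,144}}"
  "collection (tclass ` (family 12 (RC 2 4) - family 12 R_split)) 48 12 {{2,9,16,18,144}}"
proof -
  show "collection (tclass ` family 12 (RG 2 4)) 6 12 {{3,4,6,8,12,24,36,48,72}}"
    by (rule collection_classes)
      (use classwise_families card_family_RG[OF lv(3)] family_card Cyc_RG24 samples_24(1) in auto)
  show "collection (tclass ` family 12 R_split) 12 12 {{2,9,16,18,36,144}}"
    by (rule collection_classes)
      (use classwise_families card_family_split family_card Cyc_R_split samples_24(3) in auto)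
  show "collection (tclass ` (family 12 R_double - family 12 (RG 2 4))) 156 12 {{3,4,6,8,12,24,48,72}}"
  proof (rule collection_classes)
    show "classwise (family 12 R_double - family 12 (RG 2 4))" by (rule classwise_Diff; rule classwise_families)
    show "card (family 12 R_double - family 12 (RG 2 4)) = 144 * 156"
      using card_family_Diff[OF RG24_double] card_family_double card_family_RG[OF lv(3)] by simp
  qed (use family_card Cyc_double_diff samples_diff(1) in auto)
  show "collection (tclass ` (family 12 (RC 2 4) - family 12 R_split)) 48 12 {{2,9,16,18,144}}"
  proof (rule collection_classes)
    show "classwise (family 12 (RC 2 4) - family 12 R_split)" by (rule classwise_Diff; rule classwise_families)
    show "card (family 12 (RC 2 4) - family 12 R_split) = 144 * 48"
      using card_family_Diff[OF split_RC24] card_family_split card_family_RC(3) by simp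
  qed (use family_card Cyc_RC24_diff samples_diff(2) in auto)
qed

text \<open>Both sets contain a pair of one and the same class: equal modulo 2 and not modulo 4,
  equal modulo 3 and not modulo 9. These are the pairs that also exclude order 36 on either
  side.\<close>

lemma diffs_not_tiling:
  assumes "A \<in> family 12 R_double - family 12 (RG 2 4)" "B \<in> family 12 (RC 2 4) - family 12 R_split"
  shows "\<not> tiling A B"
proof
  assume "tiling A B"
  then have D: "disjoint_diffs A B" by (rule tiling_disjoint_diffs)
  obtain a a' where a: "a \<in> A" "a' \<in> A" "a mod 2 = a' mod 2" "a mod 4 \<noteq> a' mod 4" "a mod 3 = a' mod 3" "a mod 9 \<noteq> a' mod 9"
    using double_36_not_Cyc(2)[OF assms(1)] by blast
  obtain b b' where b: "b \<in> B" "b' \<in> B" "b mod 2 = b' mod 2" "b mod 4 \<noteq> b' mod 4" "b mod 3 = b' mod 3" "b mod 9 \<noteq> b' mod 9"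
    using split_36_not_Cyc(2)[OF assms(2)] by blast
  have "a mod 8 \<noteq> a' mod 8" "a mod 16 \<noteq> a' mod 16" "b mod 8 \<noteq> b' mod 8" "b mod 16 \<noteq> b' mod 16"
    using a(4) b(4) mod_chain(1,2) by blast+
  then have "sim a a' b b'" unfolding sim_iff using a b by simp
  then have "a = a'" using disjoint_diffsD[OF D a(1,2) b(1,2)] by blast
  then show False using a by simp
qed

theorem mainTheorem4:
  shows "\<exists>T1 T2 T1' T2' T1'' T2'' T1''' T2''' S1 S2 :: nat set set set.
    \<comment> \<open>(I)\<close>
    collection T1 36 24 {{2,8,9,16,18,24,72,144}, {2,8,9,16,18,72,144}} \<and>
    collection T2 6 6 {{3,4,6,12,24,36,48}} \<and>
    tclass {0,17,20,23,28,29,40,48,53,59,65,68,76,88,89,95,96,101,116,124,125,131,136,137} \<in> T1 \<and>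
    tclass {0,32,58,90,112,122} \<in> T2 \<and>
    \<comment> \<open>(II)\<close>
    collection T1' 6 12 {{4,9,16,18,36,144}} \<and>
    collection T2' 324 12 {{2,3,6,8,12,18,24,48,72}, {2,3,6,8,12,24,48,72}} \<and>
    tclass {0,34,40,46,48,58,88,96,106,118,130,136} \<in> T1' \<and>
    tclass {0,16,29,44,57,73,80,93,108,109,124,137} \<in> T2' \<and>
    \<comment> \<open>(III)\<close>
    collection T1'' 8640 24
      {{2,4,9,12,16,18,36,144}, {2,4,6,9,16,18,36,144}, {2,4,9,16,18,36,144}} \<and>
    collection T2'' 3 6 {{3,6,8,12,24,48,72}} \<and>
    tclass {0,9,17,26,27,34,39,40,48,51,57,65,74,82,88,96,99,105,111,113,122,123,130,136} \<in> T1'' \<and>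
    tclass {0,36,64,80,100,116} \<in> T2'' \<and>
    \<comment> \<open>(IV)\<close>
    collection T1''' 6 12 {{3,4,6,8,12,24,36,48,72}} \<and>
    collection S1 156 12 {{3,4,6,8,12,24,48,72}} \<and>
    collection T2''' 12 12 {{2,9,16,18,36,144}} \<and>
    collection S2 48 12 {{2,9,16,18,144}} \<and>
    tclass {0,18,28,44,54,64,80,82,98,108,118,134} \<in> T1''' \<and>
    tclass {0,16,30,44,58,74,80,94,108,110,124,138} \<in> S1 \<and>
    tclass {0,33,40,45,48,57,88,96,105,117,129,136} \<in> T2''' \<and>
    tclass {0,27,30,35,60,72,75,83,102,123,131,132} \<in> S2 \<and>
    (\<forall>C\<in>S1. \<forall>D\<in>S2. \<forall>A\<in>C. \<forall>B\<in>D. \<not> tiling A B) \<and>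
    \<comment> \<open>the classification\<close>
    (let listed = (\<lambda>A B.
        tclass A \<in> T1 \<and> tclass B \<in> T2 \<or>
        tclass A \<in> T1' \<and> tclass B \<in> T2' \<or>
        tclass A \<in> T1'' \<and> tclass B \<in> T2'' \<or>
        tclass A \<in> T1''' \<and> tclass B \<in> T2''' \<union> S2 \<or>
        tclass A \<in> S1 \<and> tclass B \<in> T2''')
     in \<forall>A B. A \<subseteq> Z144 \<longrightarrow> B \<subseteq> Z144 \<longrightarrow>
          (nonperiodic_tiling A B \<longleftrightarrow> listed A B \<or> listed B A))"
proof -
  let ?D = "family 12 R_double - family 12 (RG 2 4)" and ?S = "family 12 (RC 2 4) - family 12 R_split"
  note cD = classwise_Diff[OF classwise_families(8) classwise_families(3)]
  note cS = classwise_Diff[OF classwise_families(6) classwise_families(10)]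
  have none: "\<forall>C\<in>tclass ` ?D. \<forall>D\<in>tclass ` ?S. \<forall>A\<in>C. \<forall>B\<in>D. \<not> tiling A B"
  proof (intro ballI)
    fix C D A B assume h: "C \<in> tclass ` ?D" "D \<in> tclass ` ?S" "A \<in> C" "B \<in> D"
    obtain A' where A': "A' \<in> ?D" "C = tclass A'" using h(1) by (rule imageE)
    obtain B' where B': "B' \<in> ?S" "D = tclass B'" using h(2) by (rule imageE)
    have "A \<in> ?D" by (rule subsetD[OF classwiseD[OF cD A'(1)]]) (use h(3) A'(2) in simp)
    moreover have "B \<in> ?S" by (rule subsetD[OF classwiseD[OF cS B'(1)]]) (use h(4) B'(2) in simp)
    ultimately show "\<not> tiling A B" by (rule diffs_not_tiling)
  qed
  note mem = samples_22[THEN imageI, of tclass, unfolded list.set] samples_even_half[THEN imageI, of tclass, unfolded list.set]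
    samples_42[THEN imageI, of tclass, unfolded list.set] samples_24[THEN imageI, of tclass, unfolded list.set]
    samples_diff[THEN imageI, of tclass, unfolded list.set]
  show ?thesis
    unfolding Let_def
  proof (rule exI[of _ "tclass ` family 24 (RC 2 2)"], rule exI[of _ "tclass ` family 6 (RG 2 2)"],
      rule exI[of _ "tclass ` family 12 R_even"], rule exI[of _ "tclass ` family 12 R_half"],
      rule exI[of _ "tclass ` family 24 (RC 4 2)"], rule exI[of _ "tclass ` family 6 (RG 4 2)"],
      rule exI[of _ "tclass ` family 12 (RG 2 4)"], rule exI[of _ "tclass ` family 12 R_split"],
      rule exI[of _ "tclass ` ?D"], rule exI[of _ "tclass ` ?S"], intro conjI allI impI)
    fix A B assume Z: "A \<subseteq> Z144" "B \<subseteq> Z144"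
    show "nonperiodic_tiling A B \<longleftrightarrow>
      (tclass A \<in> tclass ` family 24 (RC 2 2) \<and> tclass B \<in> tclass ` family 6 (RG 2 2) \<or>
       tclass A \<in> tclass ` family 12 R_even \<and> tclass B \<in> tclass ` family 12 R_half \<or>
       tclass A \<in> tclass ` family 24 (RC 4 2) \<and> tclass B \<in> tclass ` family 6 (RG 4 2) \<or>
       tclass A \<in> tclass ` family 12 (RG 2 4) \<and> tclass B \<in> tclass ` family 12 R_split \<union> tclass ` ?S \<or>
       tclass A \<in> tclass ` ?D \<and> tclass B \<in> tclass ` family 12 R_split) \<or>
      (tclass B \<in> tclass ` family 24 (RC 2 2) \<and> tclass A \<in> tclass ` family 6 (RG 2 2) \<or>
       tclass B \<in> tclass ` family 12 R_even \<and> tclass A \<in> tclass ` family 12 R_half \<or>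
       tclass B \<in> tclass ` family 24 (RC 4 2) \<and> tclass A \<in> tclass ` family 6 (RG 4 2) \<or>
       tclass B \<in> tclass ` family 12 (RG 2 4) \<and> tclass A \<in> tclass ` family 12 R_split \<union> tclass ` ?S \<or>
       tclass B \<in> tclass ` ?D \<and> tclass A \<in> tclass ` family 12 R_split)"
      \<comment> \<open>The families are unions of whole translation classes, so a class belongs to
        the collection exactly when the set belongs to the family.\<close>
      unfolding nonperiodic_tiling_iff pairing_def Un_iff classwise_families[THEN tclass_image_iff, OF Z(1)]
        classwise_families[THEN tclass_image_iff, OF Z(2)] tclass_image_iff[OF cD Z(1)] tclass_image_iff[OF cD Z(2)]
        tclass_image_iff[OF cS Z(1)] tclass_image_iff[OF cS Z(2)] ..
  qed (fact collection_22 collection_even_half collection_42 collection_24 mem none)+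
qed

end
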